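(* Let $n\ge2$, let $\Omega\subset\mathbb{R}^n$ be a bounded domain with $C^3$ boundary and outward unit normal $\vec{\mathbf n}$, let $\alpha\in(0,1)$, and let $c,f\in C^{1,\alpha}(\overline\Omega\times\mathbb{R})$ satisfy, for some constant $C$, $|c|\le C$, $|D_xc|\le C$, $c_z\le 0$, $|f|\le C$, $|D_xf|\le C$, $f_z\ge 0$ at all $(x,z)\in\overline\Omega\times\mathbb{R}$. Let $\phi\in C^3(\overline\Omega)$, $T\in(0,\infty)$, and let $(\eta,q)$ satisfy either $\eta=1$ and $q>0$, or $\eta\in(0,1]$ and $q=1$. Let $u_0\in C^{2,\alpha}(\overline\Omega)$ satisfy $\frac{\partial u_0}{\partial\vec{\mathbf n}}=\phi(\sqrt{\eta^2+|Du_0|^2})^{1-q}$ on $\partial\Omega$. Suppose that there exists $\delta>0$ such that $$\frac{1}{n-1}c(x,z)^2-|Dc(x,z)|-\delta>\max\Big\{0,\ C_0|c(x,z)|+\frac{(n-1)C_0}{K_0}+(1+q)\,\mathrm{sgn}(C_0)\,C_0^2\Big\}$$ for all $(x,z)\in\overline\Omega\times\mathbb{R}$, with $C_0,K_0$ as defined in the context. Suppose that a solution $u^\eta\in C^{2,\sigma}(\overline\Omega\times[0,T])\cap C^{3,\sigma}(\Omega\times(0,T])$, for some $\sigma\in(0,1)$, exists for the problem $$u_t=\sqrt{\eta^2+|Du|^2}\,\mathrm{div}\Big(\tfrac{Du}{\sqrt{\eta^2+|Du|^2}}\Big)+c(x,u)\sqrt{\eta^2+|Du|^2}-f(x,u)\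 \text{ in }\Omega\times(0,T),$$ $$\tfrac{\partial u}{\partial\vec{\mathbf n}}=\phi(x)(\sqrt{\eta^2+|Du|^2})^{1-q}\ \text{ on }\partial\Omega\times[0,T),\qquad u(x,0)=u_0(x)\ \text{ on }\overline\Omega.$$ Then $$\|Du^\eta\|_{L^\infty(\overline\Omega\times[0,T])}\le R,$$ where $R>1$ is a constant depending only on $\Omega,c,f,\phi,q,u_0$ (in particular not on $T$ or $\eta$).
   Context: $Dc$ denotes the gradient of $c$ in the spatial variable $x$; $\mathrm{sgn}(C_0)$ is the sign of $C_0$. For $y\in\partial\Omega$: $K_0(y)=\sup\{r>0: B(y-r\vec{\mathbf n}(y),r)\subseteq\Omega\}$, where $B(x,r)$ is the open ball of center $x$ and radius $r$, and $K_0=\inf_{y\in\partial\Omega}K_0(y)$; $C_0(y)$ is the largest eigenvalue of $-\kappa$, where $\kappa$ is the $(n-1)\times(n-1)$ curvature matrix of $\partial\Omega$ at $y$, with the sign convention that if coordinates are chosen so that $y=0$, $\vec{\mathbf n}(y)=(0,\dots,0,-1)$ and $\Omega$ is locally $\{x_n>\varphi(x')\}$, then $\kappa=D^2\varphi(0)$ (so $\kappa\ge0$ when $\Omega$ is convex); $C_0=\sup_{y\in\partial\Omega}C_0(y)$. *)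

theory Defs
  imports "HOL-Analysis.Analysis"
begin

(* Euclidean n-space as R^(n-1) x R with n = CARD('m) + 1; a point is (x', x_n).  The product
   norm is the Euclidean one.  As 'm ranges over all finite (nonempty) types, n ranges over all
   integers >= 2. *)
type_synonym 'm space = "(real ^ 'm) \<times> real"

section \<open>Derivatives and function spaces\<close>

(* Derivatives are taken within the set S on which f lives, so that for S = closure Omega they
   are also defined on the boundary.  For Omega with C^1 boundary (and for products of its
   closure with R) they are unique there, and a C^1 function in this sense is exactly one whose
   interior derivatives extend continuously to the closure. *)
definition grad :: "'a::euclidean_space set \<Rightarrow> ('a \<Rightarrow> real) \<Rightarrow> 'a \<Rightarrow> 'a" where
  "grad S f x = (\<Sum>b\<in>Basis. frechet_derivative f (at x within S) b *\<^sub>R b)"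

definition divergence :: "('a::euclidean_space \<Rightarrow> 'a) \<Rightarrow> 'a \<Rightarrow> real" where
  "divergence F x = (\<Sum>b\<in>Basis. frechet_derivative F (at x) b \<bullet> b)"

definition hessian :: "(real ^ 'm \<Rightarrow> real) \<Rightarrow> real ^ 'm \<Rightarrow> real ^ 'm ^ 'm" where
  "hessian f x = (\<chi> i j. grad UNIV (\<lambda>y. grad UNIV f y $ i) x $ j)"

(* f is k times differentiable on S and its k-th order partial derivatives satisfy P S. *)
primrec diff_class ::
  "('a::euclidean_space set \<Rightarrow> ('a \<Rightarrow> real) \<Rightarrow> bool) \<Rightarrow> nat \<Rightarrow> 'a set \<Rightarrow> ('a \<Rightarrow> real) \<Rightarrow> bool" where
  "diff_class P 0 S f \<longleftrightarrow> P S f"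
| "diff_class P (Suc k) S f \<longleftrightarrow>
     (\<exists>g. (\<forall>x\<in>S. (f has_derivative (\<lambda>h. g x \<bullet> h)) (at x within S)) \<and>
          (\<forall>b\<in>Basis. diff_class P k S (\<lambda>x. g x \<bullet> b)))"

(* For compact S this is the usual (global) Hoelder condition; for S = closure Omega x R it is
   Hoelder continuity that is uniform on bounded subsets. *)
definition hoelder_on :: "real \<Rightarrow> 'a::metric_space set \<Rightarrow> ('a \<Rightarrow> real) \<Rightarrow> bool" where
  "hoelder_on \<alpha> S f \<longleftrightarrow>
     (\<forall>K. compact K \<and> K \<subseteq> S \<longrightarrow>
        (\<exists>L. \<forall>x\<in>K. \<forall>y\<in>K. \<bar>f x - f y\<bar> \<le> L * dist x y powr \<alpha>))"

definition C_on :: "nat \<Rightarrow> 'a::euclidean_space set \<Rightarrow> ('a \<Rightarrow> real) \<Rightarrow> bool" where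
  "C_on k S f \<longleftrightarrow> diff_class continuous_on k S f"

definition C_hoelder_on :: "nat \<Rightarrow> real \<Rightarrow> 'a::euclidean_space set \<Rightarrow> ('a \<Rightarrow> real) \<Rightarrow> bool" where
  "C_hoelder_on k \<alpha> S f \<longleftrightarrow> diff_class (hoelder_on \<alpha>) k S f"

(* Parabolic Hoelder spaces on S x I: parabolic distance |x - y| + |t - s|^(1/2), one time
   derivative counting as two space derivatives.  The space of order k + \<sigma> requires all
   D_x^\<beta> D_t^j v with |\<beta>| + 2j \<le> k, those with |\<beta>| + 2j = k being \<sigma>-Hoelder for the parabolic
   distance and those with |\<beta>| + 2j = k - 1 being (1 + \<sigma>)/2-Hoelder in time, on compact subsets. *)
definition parabolic_hoelder ::
  "real \<Rightarrow> 'a::euclidean_space set \<Rightarrow> real set \<Rightarrow> ('a \<Rightarrow> real \<Rightarrow> real) \<Rightarrow> bool" where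
  "parabolic_hoelder \<sigma> S I v \<longleftrightarrow>
     (\<forall>K. compact K \<and> K \<subseteq> S \<times> I \<longrightarrow>
        (\<exists>L. \<forall>(x, t)\<in>K. \<forall>(y, s)\<in>K.
           \<bar>v x t - v y s\<bar> \<le> L * (dist x y + sqrt \<bar>t - s\<bar>) powr \<sigma>))"

definition time_hoelder ::
  "real \<Rightarrow> 'a::euclidean_space set \<Rightarrow> real set \<Rightarrow> ('a \<Rightarrow> real \<Rightarrow> real) \<Rightarrow> bool" where
  "time_hoelder \<beta> S I v \<longleftrightarrow>
     (\<forall>K. compact K \<and> K \<subseteq> S \<times> I \<longrightarrow>
        (\<exists>L. \<forall>x t s. (x, t) \<in> K \<and> (x, s) \<in> K \<longrightarrow> \<bar>v x t - v x s\<bar> \<le> L * \<bar>t - s\<bar> powr \<beta>))"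

fun C_parabolic_on ::
  "nat \<Rightarrow> real \<Rightarrow> 'a::euclidean_space set \<Rightarrow> real set \<Rightarrow> ('a \<Rightarrow> real \<Rightarrow> real) \<Rightarrow> bool" where
  "C_parabolic_on 0 \<sigma> S I v \<longleftrightarrow> parabolic_hoelder \<sigma> S I v"
| "C_parabolic_on (Suc 0) \<sigma> S I v \<longleftrightarrow>
     time_hoelder ((1 + \<sigma>) / 2) S I v \<and>
     (\<exists>g. (\<forall>x\<in>S. \<forall>t\<in>I. ((\<lambda>y. v y t) has_derivative (\<lambda>h. g x t \<bullet> h)) (at x within S)) \<and>
          (\<forall>b\<in>Basis. C_parabolic_on 0 \<sigma> S I (\<lambda>x t. g x t \<bullet> b)))"
| "C_parabolic_on (Suc (Suc k)) \<sigma> S I v \<longleftrightarrow>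
     (\<exists>g. (\<forall>x\<in>S. \<forall>t\<in>I. ((\<lambda>y. v y t) has_derivative (\<lambda>h. g x t \<bullet> h)) (at x within S)) \<and>
          (\<forall>b\<in>Basis. C_parabolic_on (Suc k) \<sigma> S I (\<lambda>x t. g x t \<bullet> b))) \<and>
     (\<exists>w. (\<forall>x\<in>S. \<forall>t\<in>I. ((\<lambda>s. v x s) has_real_derivative w x t) (at t within I)) \<and>
          C_parabolic_on k \<sigma> S I w)"

section \<open>Domains with smooth boundary\<close>

(* In the coordinates z = A (x - y), with A orthogonal, Omega is near y the set z_n > \<psi> z'. *)
definition graph_chart ::
  "nat \<Rightarrow> 'm::finite space set \<Rightarrow> 'm space \<Rightarrow> ('m space \<Rightarrow> 'm space) \<Rightarrow> (real ^ 'm \<Rightarrow> real)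
     \<Rightarrow> bool" where
  "graph_chart k \<Omega> y A \<psi> \<longleftrightarrow>
     orthogonal_transformation A \<and> C_on k UNIV \<psi> \<and> \<psi> 0 = 0 \<and>
     (\<exists>r>0. \<Omega> \<inter> ball y r = {x \<in> ball y r. snd (A (x - y)) > \<psi> (fst (A (x - y)))})"

definition C_boundary :: "nat \<Rightarrow> 'm::finite space set \<Rightarrow> bool" where
  "C_boundary k \<Omega> \<longleftrightarrow> (\<forall>y\<in>frontier \<Omega>. \<exists>A \<psi>. graph_chart k \<Omega> y A \<psi>)"

(* The outward normal of z_n > \<psi> z' at 0 is (D\<psi>(0), -1) normalised; the value of \<nu> does not
   depend on the chart. *)
definition outward_normal :: "'m::finite space set \<Rightarrow> 'm space \<Rightarrow> 'm space" where
  "outward_normal \<Omega> y =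
     (THE \<nu>. \<exists>A \<psi>. graph_chart 1 \<Omega> y A \<psi> \<and>
        A \<nu> = (1 / sqrt (1 + (norm (grad UNIV \<psi> 0))\<^sup>2)) *\<^sub>R (grad UNIV \<psi> 0, - 1))"

(* Determined only up to conjugation by an orthogonal matrix, which does not affect the
   eigenvalues; positive semidefinite when Omega is convex. *)
definition curvature_matrix :: "'m::finite space set \<Rightarrow> 'm space \<Rightarrow> real ^ 'm ^ 'm" where
  "curvature_matrix \<Omega> y =
     (SOME \<kappa>. \<exists>A \<psi>. graph_chart 2 \<Omega> y A \<psi> \<and> A (outward_normal \<Omega> y) = (0, - 1) \<and>
        \<kappa> = hessian \<psi> 0)"

definition is_eigenvalue :: "real ^ 'm ^ 'm \<Rightarrow> real \<Rightarrow> bool" where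
  "is_eigenvalue M l \<longleftrightarrow> (\<exists>v. v \<noteq> 0 \<and> M *v v = l *\<^sub>R v)"

definition C0_at :: "'m::finite space set \<Rightarrow> 'm space \<Rightarrow> real" where
  "C0_at \<Omega> y = Max {l. is_eigenvalue (- curvature_matrix \<Omega> y) l}"

definition C0 :: "'m::finite space set \<Rightarrow> real" where
  "C0 \<Omega> = (SUP y\<in>frontier \<Omega>. C0_at \<Omega> y)"

definition K0_at :: "'m::finite space set \<Rightarrow> 'm space \<Rightarrow> real" where
  "K0_at \<Omega> y = Sup {r. r > 0 \<and> ball (y - r *\<^sub>R outward_normal \<Omega> y) r \<subseteq> \<Omega>}"

definition K0 :: "'m::finite space set \<Rightarrow> real" where
  "K0 \<Omega> = (INF y\<in>frontier \<Omega>. K0_at \<Omega> y)"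

section \<open>The initial-boundary value problem\<close>

definition W :: "real \<Rightarrow> 'a::real_normed_vector \<Rightarrow> real" where
  "W \<eta> p = sqrt (\<eta>\<^sup>2 + (norm p)\<^sup>2)"

definition neumann_condition ::
  "'m::finite space set \<Rightarrow> ('m space \<Rightarrow> real) \<Rightarrow> real \<Rightarrow> real \<Rightarrow> ('m space \<Rightarrow> real) \<Rightarrow> bool" where
  "neumann_condition \<Omega> \<phi> q \<eta> v \<longleftrightarrow>
     (\<forall>y\<in>frontier \<Omega>. grad (closure \<Omega>) v y \<bullet> outward_normal \<Omega> y
        = \<phi> y * W \<eta> (grad (closure \<Omega>) v y) powr (1 - q))"

definition mcf_solution ::
  "'m::finite space set \<Rightarrow> ('m space \<Rightarrow> real \<Rightarrow> real) \<Rightarrow> ('m space \<Rightarrow> real \<Rightarrow> real) \<Rightarrow>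
     ('m space \<Rightarrow> real) \<Rightarrow> real \<Rightarrow> real \<Rightarrow> ('m space \<Rightarrow> real) \<Rightarrow> real \<Rightarrow>
     ('m space \<Rightarrow> real \<Rightarrow> real) \<Rightarrow> bool" where
  "mcf_solution \<Omega> c f \<phi> q \<eta> u0 T u \<longleftrightarrow>
     (\<forall>x\<in>\<Omega>. \<forall>t\<in>{0<..<T}.
        let Du = (\<lambda>y. grad (closure \<Omega>) (\<lambda>z. u z t) y) in
        deriv (\<lambda>s. u x s) t
          = W \<eta> (Du x) * divergence (\<lambda>y. (1 / W \<eta> (Du y)) *\<^sub>R Du y) x
            + c x (u x t) * W \<eta> (Du x) - f x (u x t)) \<and>
     (\<forall>t\<in>{0..<T}. neumann_condition \<Omega> \<phi> q \<eta> (\<lambda>x. u x t)) \<and>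
     (\<forall>x\<in>closure \<Omega>. u x 0 = u0 x)"

end

theory Submission
 imports Defs
begin

text \<open>
 The gradient is controlled by the auxiliary function
  \<open>\<Psi> = W powr (1 + q) - (1 + q) V \<bullet> Du\<close>, with \<open>W = sqrt (\<eta>\<^sup>2 + |Du|\<^sup>2)\<close>,
 where \<open>V\<close> extends the field \<open>\<phi> n\<close> from the boundary to the closed domain. Where \<open>W\<close> is large, \<open>\<Psi>\<close> is comparable with
 \<open>W powr (1 + q)\<close>, so it suffices to bound \<open>\<Psi>\<close> at its maximum over the closed domain and \<open>[0, t]\<close>; suppose that it
 is large there.

 \<^emph>\<open>The speed.\<close> Since \<open>c\<close> decreases and \<open>f\<close> increases in the solution, two time shifts of the solution satisfy a comparison
 principle (\<open>time_shift_comparison\<close>), so \<open>u\<^sub>t\<close> is bounded by its initial values for all times (\<open>speed_bound\<close>). For large \<open>W\<close> the equation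
 divided by \<open>W\<close> therefore says that the operator applied to \<open>D\<^sup>2u / W\<close> is nearly \<open>- c\<close>.

 \<^emph>\<open>Interior maxima.\<close> The first and second order conditions, together with the differentiated equation, give
 \<open>c\<^sup>2 / (n - 1) <= |Dc| + small\<close>. The left-hand side is the Cauchy-Schwarz lower bound for the squared norm of the tangential Hessian in terms of its
 trace. This contradicts the forcing condition. If \<open>\<Psi>\<close> is multiplied by \<open>exp ((1 + q) \<gamma>)\<close>, the terms \<open>|c| |D\<gamma>|\<close> and the contraction of
 \<open>D\<^sup>2\<gamma>\<close> with the coefficients are added on the right, whereas the terms quadratic in \<open>D\<gamma>\<close> have a favourable sign (\<open>interior_maximum_algebra\<close>,
 \<open>interior_maximum_yields_data\<close>).

 \<^emph>\<open>Boundary maxima.\<close> The choice of \<open>V\<close> eliminates the second normal derivative of \<open>u\<close> from the normal derivative of \<open>\<Psi>\<close>, and the boundary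
 condition differentiated along the boundary expresses the rest by the second fundamental form. The result is that the normal
 derivative of \<open>\<Psi>\<close> is less than \<open>(1 + q) k \<Psi>\<close> for any \<open>k > max C0 0\<close> (\<open>boundary_maximum_algebra\<close>,
 \<open>boundary_maximum_normal_derivative\<close>). Take a ball of radius \<open>r < K0\<close> inside the domain touching at the maximum point, and
 \<open>\<gamma>\<close> quadratic, zero on the sphere, with inward slope \<open>k\<close> there. Then \<open>\<Psi> exp ((1 + q) \<gamma>)\<close> increases
 into the ball, so its maximum over the closed ball is an interior one with \<open>\<gamma> > 0\<close>. There \<open>|D\<gamma>| <= k\<close> and the contraction of \<open>D\<^sup>2\<gamma>\<close>
 is at most about \<open>(n - 1) k / r\<close>; these are the terms \<open>C0 |c|\<close> and \<open>(n - 1) C0 / K0\<close> of the forcing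
 condition, whose margin \<open>\<delta>\<close> pays for \<open>k\<close> and \<open>r\<close> in place of \<open>C0\<close> and \<open>K0\<close> (\<open>forcing_condition_robust\<close>). The contradiction bounds \<open>\<Psi>\<close> by data
 that involve neither the final time nor \<open>\<eta>\<close> (\<open>uniform_gradient_bound\<close>).

 \<^emph>\<open>Geometry.\<close> A defining function \<open>h\<close> for the domain, of class \<open>C\<^sup>3\<close> on the whole space, is assembled from the charts
 (\<open>defining_function\<close>). It extends the normal field, yields interior balls of uniform radius (\<open>K0_properties\<close>), and identifies the curvature
 matrix in charts adapted to the normal, which exist by an implicit function theorem (\<open>curvature_chart_exists\<close>,
 \<open>curvature_bound\<close>).
\<close>

section \<open>Calculus of functions of class C^k on a set\<close>

lemma C_on_0: "C_on 0 S f \<longleftrightarrow> continuous_on S f"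
 by (simp add: C_on_def)

lemma C_on_Suc:
 "C_on (Suc k) S f \<longleftrightarrow>
   (\<exists>g. (\<forall>x\<in>S. (f has_derivative (%h. g x \<bullet> h)) (at x within S)) \<and>
     (\<forall>b\<in>Basis. C_on k S (%x. g x \<bullet> b)))"
 by (simp add: C_on_def)

lemma C_on_continuous: "C_on k S f ==> continuous_on S f"
proof (cases k)
 case (Suc j)
 assume "C_on k S f"
 then obtain g where "\<forall>x\<in>S. (f has_derivative (%h. g x \<bullet> h)) (at x within S)"
  unfolding Suc C_on_Suc by blast
 then have "\<forall>x\<in>S. continuous (at x within S) f" using has_derivative_continuous by blast
 then show ?thesis by (simp add: continuous_on_eq_continuous_within)
qed (simp add: C_on_0)

lemma C_on_SucD: "C_on (Suc k) S f ==> C_on k S f"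
proof (induction k arbitrary: f)
 case 0
 then show ?case by (simp add: C_on_0 C_on_continuous)
next
 case (Suc k)
 from Suc.prems obtain g where "\<forall>x\<in>S. (f has_derivative (%h. g x \<bullet> h)) (at x within S)"
   "\<forall>b\<in>Basis. C_on (Suc k) S (%x. g x \<bullet> b)" unfolding C_on_Suc[of "Suc k"] by blast
 moreover from this have "\<forall>b\<in>Basis. C_on k S (%x. g x \<bullet> b)" using Suc.IH by blast
 ultimately show ?case using C_on_Suc[of k S f] by blast
qed

lemma C_on_le: "C_on k S f ==> j <= k ==> C_on j S f"
 by (induction k) (auto simp: le_Suc_eq dest: C_on_SucD)

lemma C_on_subset: "C_on k S f ==> T \<subseteq> S ==> C_on k T f"
proof (induction k arbitrary: f)
 case 0
 then show ?case using continuous_on_subset C_on_0 by blast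
next
 case (Suc k)
 then obtain g where "\<forall>x\<in>S. (f has_derivative (%h. g x \<bullet> h)) (at x within S)"
   "\<forall>b\<in>Basis. C_on k S (%x. g x \<bullet> b)" unfolding C_on_Suc by blast
 then show ?case unfolding C_on_Suc using Suc.IH Suc.prems(2) has_derivative_subset
  by (intro exI[of _ g]) blast
qed

lemma C_on_const: "C_on k S (%x. a)"
proof (induction k arbitrary: a)
 case (Suc k)
 show ?case unfolding C_on_Suc
  by (rule exI[of _ "%x. 0"]) (auto intro!: derivative_eq_intros Suc)
qed (simp add: C_on_0)

lemma C_on_linear:
 fixes f :: "'a::euclidean_space => real"
 assumes "linear f" shows "C_on k S f"
proof -
 have eq: "f h = (\<Sum>b\<in>Basis. f b *\<^sub>R b) \<bullet> h" for h
 proof -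
  have "f h = f (\<Sum>b\<in>Basis. (h \<bullet> b) *\<^sub>R b)" by (simp add: euclidean_representation)
  also have "... = (\<Sum>b\<in>Basis. (h \<bullet> b) * f b)"
   using assms by (simp add: linear_sum linear_cmul)
  also have "... = (\<Sum>b\<in>Basis. f b *\<^sub>R b) \<bullet> h" by (simp add: inner_sum_left inner_sum_right inner_commute mult.commute)
  finally show ?thesis .
 qed
 have bl: "bounded_linear f" using assms linear_conv_bounded_linear by blast
 show ?thesis
 proof (cases k)
  case 0
  then show ?thesis using bl by (simp add: C_on_0 linear_continuous_on)
 next
  case (Suc j)
  have "(f has_derivative (%h. (\<Sum>b\<in>Basis. f b *\<^sub>R b) \<bullet> h)) (at x within S)" for x
   using bounded_linear_imp_has_derivative[OF bl] eq by (metis (no_types, lifting) ext)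
  then show ?thesis unfolding Suc C_on_Suc
   by (intro exI[of _ "%_. \<Sum>b\<in>Basis. f b *\<^sub>R b"]) (auto intro!: C_on_const)
 qed
qed

lemma C_on_add: "C_on k S f ==> C_on k S g ==> C_on k S (%x. f x + g x)"
proof (induction k arbitrary: f g)
 case 0
 then show ?case by (simp add: C_on_0 continuous_on_add)
next
 case (Suc k)
 then obtain f' g' where
  "\<forall>x\<in>S. (f has_derivative (%h. f' x \<bullet> h)) (at x within S)" "\<forall>b\<in>Basis. C_on k S (%x. f' x \<bullet> b)"
  "\<forall>x\<in>S. (g has_derivative (%h. g' x \<bullet> h)) (at x within S)" "\<forall>b\<in>Basis. C_on k S (%x. g' x \<bullet> b)"
  unfolding C_on_Suc by blast
 note * = this
 have "((%x. f x + g x) has_derivative (%h. (f' x + g' x) \<bullet> h)) (at x within S)" if "x \<in> S" for x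
  using has_derivative_add[of f "%h. f' x \<bullet> h" "at x within S" g "%h. g' x \<bullet> h"] *(1,3) that
  by (simp add: inner_add_left)
 moreover have "C_on k S (%x. (f' x + g' x) \<bullet> b)" if "b \<in> Basis" for b
  using *(2,4) that by (auto simp: inner_add_left intro!: Suc.IH)
 ultimately show ?case unfolding C_on_Suc by (intro exI[of _ "%x. f' x + g' x"]) auto
qed

lemma C_on_mult: "C_on k S f ==> C_on k S g ==> C_on k S (%x. f x * g x)"
proof (induction k arbitrary: f g)
 case 0
 then show ?case by (simp add: C_on_0 continuous_on_mult)
next
 case (Suc k)
 then obtain f' g' where *:
  "\<forall>x\<in>S. (f has_derivative (%h. f' x \<bullet> h)) (at x within S)" "\<forall>b\<in>Basis. C_on k S (%x. f' x \<bullet> b)"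
  "\<forall>x\<in>S. (g has_derivative (%h. g' x \<bullet> h)) (at x within S)" "\<forall>b\<in>Basis. C_on k S (%x. g' x \<bullet> b)"
  unfolding C_on_Suc by blast
 have "((%x. f x * g x) has_derivative (%h. (f x *\<^sub>R g' x + g x *\<^sub>R f' x) \<bullet> h)) (at x within S)"
  if "x \<in> S" for x
  using *(1,3) that by (auto intro!: derivative_eq_intros simp: inner_add_left algebra_simps)
 moreover have "C_on k S (%x. (f x *\<^sub>R g' x + g x *\<^sub>R f' x) \<bullet> b)" if "b \<in> Basis" for b
  using *(2,4) that Suc.prems by (auto simp: inner_add_left intro!: C_on_add Suc.IH dest: C_on_SucD)
 ultimately show ?case unfolding C_on_Suc
  by (intro exI[of _ "%x. f x *\<^sub>R g' x + g x *\<^sub>R f' x"]) auto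
qed

lemma C_on_cmult: "C_on k S f ==> C_on k S (%x. a * f x)"
 by (rule C_on_mult[OF C_on_const])

lemma C_on_uminus: "C_on k S f ==> C_on k S (%x. - f x)"
 using C_on_cmult[of k S f "-1"] by simp

lemma C_on_diff: "C_on k S f ==> C_on k S g ==> C_on k S (%x. f x - g x)"
 using C_on_add[OF _ C_on_uminus] by fastforce

lemma C_on_sum: "(\<And>i. i \<in> I ==> C_on k S (f i)) ==> C_on k S (%x. \<Sum>i\<in>I. f i x)"
proof (induction I rule: infinite_finite_induct)
 case (insert i I)
 then show ?case by (auto intro!: C_on_add)
qed (auto intro: C_on_const)

text \<open>A vector-valued map is treated by its coordinates, because the classes of differentiable functions are
 classes of real functions.\<close>

lemma has_derivative_from_components:
 fixes f :: "'a::real_normed_vector => 'b::euclidean_space"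
 assumes "\<And>b. b \<in> Basis ==> ((%x. f x \<bullet> b) has_derivative (%h. f' b h)) F"
 shows "(f has_derivative (%h. \<Sum>b\<in>Basis. f' b h *\<^sub>R b)) F"
proof -
 have "((%x. \<Sum>b\<in>Basis. (f x \<bullet> b) *\<^sub>R b) has_derivative (%h. \<Sum>b\<in>Basis. f' b h *\<^sub>R b)) F"
  using assms by (intro has_derivative_sum has_derivative_scaleR_left) auto
 then show ?thesis by (simp add: euclidean_representation)
qed

lemma C_on_gradient_field:
 fixes f :: "'a::euclidean_space => real"
 assumes "C_on (Suc (Suc k)) S f"
 obtains g L where "\<And>x. x \<in> S ==> (f has_derivative (%h. g x \<bullet> h)) (at x within S)"
  "\<And>x. x \<in> S ==> (g has_derivative L x) (at x within S)"
  "\<And>v w. continuous_on S (%x. L x v \<bullet> w)" "\<And>b. b \<in> Basis ==> C_on (Suc k) S (%x. g x \<bullet> b)"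
proof -
 obtain g where g: "\<forall>x\<in>S. (f has_derivative (%h. g x \<bullet> h)) (at x within S)"
  "\<forall>b\<in>Basis. C_on (Suc k) S (%x. g x \<bullet> b)" using assms unfolding C_on_Suc[of "Suc k"] by blast
 have "\<forall>b\<in>Basis. \<exists>G. (\<forall>x\<in>S. ((%x. g x \<bullet> b) has_derivative (%h. G x \<bullet> h)) (at x within S)) \<and>
     (\<forall>c\<in>Basis. C_on k S (%x. G x \<bullet> c))"
  using g(2) unfolding C_on_Suc by blast
 then obtain G where G: "\<And>b x. b \<in> Basis ==> x \<in> S ==> ((%x. g x \<bullet> b) has_derivative (%h. G b x \<bullet> h)) (at x within S)"
  "\<And>b c. b \<in> Basis ==> c \<in> Basis ==> C_on k S (%x. G b x \<bullet> c)" by metis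
 define L where "L x v = (\<Sum>b\<in>Basis. (G b x \<bullet> v) *\<^sub>R b)" for x v
 have "(g has_derivative L x) (at x within S)" if "x \<in> S" for x
  unfolding L_def[abs_def] using G(1)[OF _ that] by (rule has_derivative_from_components)
 moreover have "continuous_on S (%x. L x v \<bullet> w)" for v w
 proof -
  have "continuous_on S (G b)" if "b \<in> Basis" for b
   using G(2)[OF that] C_on_continuous by (subst continuous_on_componentwise) blast
  then show ?thesis unfolding L_def by (intro continuous_intros) auto
 qed
 ultimately show ?thesis using that[of g L] g by blast
qed

lemma C_on_compose:
 fixes f :: "'b::euclidean_space => real" and G :: "'a::euclidean_space => 'b"
 assumes "C_on k T f" and "\<And>b. b \<in> Basis ==> C_on k S (%x. G x \<bullet> b)" and "G ` S \<subseteq> T"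
 shows "C_on k S (%x. f (G x))"
 using assms
proof (induction k arbitrary: f)
 case 0
 have "continuous_on S G"
  using 0 by (subst continuous_on_componentwise) (auto simp: C_on_0)
 with 0 show ?case
  by (auto simp: C_on_0 intro: continuous_on_compose2)
next
 case (Suc k)
 from Suc.prems(1) obtain f' where f': "\<forall>x\<in>T. (f has_derivative (%h. f' x \<bullet> h)) (at x within T)"
  "\<forall>b\<in>Basis. C_on k T (%x. f' x \<bullet> b)" unfolding C_on_Suc by blast
 have "\<forall>b\<in>Basis. \<exists>g. (\<forall>x\<in>S. ((%x. G x \<bullet> b) has_derivative (%h. g x \<bullet> h)) (at x within S)) \<and>
     (\<forall>c\<in>Basis. C_on k S (%x. g x \<bullet> c))"
  using Suc.prems(2) unfolding C_on_Suc by blast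
 then obtain g where g: "\<And>b x. b \<in> Basis ==> x \<in> S ==>
    ((%x. G x \<bullet> b) has_derivative (%h. g b x \<bullet> h)) (at x within S)"
   "\<And>b c. b \<in> Basis ==> c \<in> Basis ==> C_on k S (%x. g b x \<bullet> c)" by metis
 define F where "F x = (\<Sum>b\<in>Basis. (f' (G x) \<bullet> b) *\<^sub>R g b x)" for x
 have "((%x. f (G x)) has_derivative (%h. F x \<bullet> h)) (at x within S)" if x: "x \<in> S" for x
 proof -
  have 1: "(G has_derivative (%h. \<Sum>b\<in>Basis. (g b x \<bullet> h) *\<^sub>R b)) (at x within S)"
   using g(1) x by (intro has_derivative_from_components) auto
  have "(f has_derivative (%h. f' (G x) \<bullet> h)) (at (G x) within G ` S)"
   using f'(1) x Suc.prems(3) has_derivative_subset by blast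
  from diff_chain_within[OF 1 this]
  have "((%x. f (G x)) has_derivative (%h. f' (G x) \<bullet> (\<Sum>b\<in>Basis. (g b x \<bullet> h) *\<^sub>R b))) (at x within S)"
   by (simp add: o_def)
  moreover have "(%h. f' (G x) \<bullet> (\<Sum>b\<in>Basis. (g b x \<bullet> h) *\<^sub>R b)) = (%h. F x \<bullet> h)"
   by (auto simp: F_def inner_sum_right inner_sum_left mult.commute)
  ultimately show ?thesis by simp
 qed
 moreover have "C_on k S (%x. F x \<bullet> c)" if c: "c \<in> Basis" for c
 proof -
  have "C_on k S (%x. f' (G x) \<bullet> b)" if "b \<in> Basis" for b
   using Suc.IH[of "%x. f' x \<bullet> b"] f'(2) that Suc.prems C_on_SucD by blast
  then show ?thesis using c g(2)
   by (auto simp: F_def inner_sum_left intro!: C_on_sum C_on_mult)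
 qed
 ultimately show ?case unfolding C_on_Suc by blast
qed

lemma C_on_powr:
 assumes "C_on k S f" and "\<And>x. x \<in> S ==> 0 < f x"
 shows "C_on k S (%x. f x powr a)"
 using assms
proof (induction k arbitrary: a)
 case 0
 then show ?case
  by (fastforce simp: C_on_0 intro!: continuous_on_powr continuous_on_const)
next
 case (Suc k)
 from Suc.prems(1) obtain f' where f': "\<forall>x\<in>S. (f has_derivative (%h. f' x \<bullet> h)) (at x within S)"
  "\<forall>b\<in>Basis. C_on k S (%x. f' x \<bullet> b)" unfolding C_on_Suc by blast
 have "((%x. f x powr a) has_derivative (%h. (a * f x powr (a - 1)) *\<^sub>R f' x \<bullet> h)) (at x within S)"
  if x: "x \<in> S" for x
 proof -
  have "((%y. y powr a) has_real_derivative a * f x powr (a - 1)) (at (f x))"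
   using Suc.prems(2)[OF x] by (auto intro!: derivative_eq_intros)
  from DERIV_compose_FDERIV[where g = f and g' = "%h. f' x \<bullet> h", OF this] show ?thesis
   using f'(1) x by (simp add: mult.commute)
 qed
 moreover have "C_on k S (%x. (a * f x powr (a - 1)) *\<^sub>R f' x \<bullet> b)" if "b \<in> Basis" for b
  using Suc.IH[of "a - 1"] Suc.prems C_on_SucD f'(2) that
  by (auto intro!: C_on_mult C_on_const)
 ultimately show ?case unfolding C_on_Suc
  by (intro exI[of _ "%x. (a * f x powr (a - 1)) *\<^sub>R f' x"]) blast
qed

lemma has_derivative_pos_part_power:
 "((%t::real. max 0 t ^ Suc (Suc j)) has_real_derivative real (Suc (Suc j)) * max 0 t ^ Suc j) (at t)"
proof -
 consider "t > 0" | "t < 0" | "t = 0" by linarith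
 then show ?thesis
 proof cases
  case 1
  have "((%t::real. t ^ Suc (Suc j)) has_real_derivative real (Suc (Suc j)) * t ^ Suc j) (at t)"
   using DERIV_pow[of "Suc (Suc j)" t UNIV] by simp
  then have "((%t::real. max 0 t ^ Suc (Suc j)) has_real_derivative real (Suc (Suc j)) * t ^ Suc j) (at t)"
   by (rule DERIV_cong_ev[THEN iffD1, rotated -1])
     (use 1 in \<open>auto simp: eventually_nhds_metric dist_real_def intro!: exI[of _ t]\<close>)
  then show ?thesis using 1 by simp
 next
  case 2
  have "((%t::real. 0) has_real_derivative 0) (at t)" by simp
  then have "((%t::real. max 0 t ^ Suc (Suc j)) has_real_derivative 0) (at t)"
   by (rule DERIV_cong_ev[THEN iffD1, rotated -1])
     (use 2 in \<open>auto simp: eventually_nhds_metric dist_real_def intro!: exI[of _ "-t"]\<close>)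
  then show ?thesis using 2 by simp
 next
  case 3
  have "((%h. (max 0 (t + h) ^ Suc (Suc j) - max 0 t ^ Suc (Suc j)) / h) \<longlongrightarrow> 0) (at 0)"
  proof (rule Lim_null_comparison)
   show "\<forall>\<^sub>F h in at 0. norm ((max 0 (t + h) ^ Suc (Suc j) - max 0 t ^ Suc (Suc j)) / h) <= \<bar>h\<bar> ^ Suc j"
   proof (rule always_eventually, rule allI)
    fix h :: real
    have "max 0 h ^ Suc (Suc j) <= \<bar>h\<bar> ^ Suc (Suc j)" by (intro power_mono) auto
    then show "norm ((max 0 (t + h) ^ Suc (Suc j) - max 0 t ^ Suc (Suc j)) / h) <= \<bar>h\<bar> ^ Suc j"
     using 3 by (cases "h = 0") (auto simp: abs_mult power_abs field_simps)
   qed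
   have "((%h::real. \<bar>h\<bar> ^ Suc j) \<longlongrightarrow> \<bar>0\<bar> ^ Suc j) (at 0)" by (intro tendsto_intros)
   then show "((%h::real. \<bar>h\<bar> ^ Suc j) \<longlongrightarrow> 0) (at 0)" by simp
  qed
  then show ?thesis using 3 by (simp add: DERIV_def)
 qed
qed

lemma C_on_pos_part_power:
 assumes "C_on k S f" and "k < j"
 shows "C_on k S (%x. max 0 (f x) ^ j)"
 using assms
proof (induction k arbitrary: j)
 case 0
 then show ?case by (auto simp: C_on_0 intro!: continuous_intros)
next
 case (Suc k)
 then obtain i where j: "j = Suc (Suc i)" by (auto elim!: less_natE)
 from Suc.prems(1) obtain f' where f': "\<forall>x\<in>S. (f has_derivative (%h. f' x \<bullet> h)) (at x within S)"
  "\<forall>b\<in>Basis. C_on k S (%x. f' x \<bullet> b)" unfolding C_on_Suc by blast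
 have "((%x. max 0 (f x) ^ j) has_derivative (%h. (real j * max 0 (f x) ^ Suc i) *\<^sub>R f' x \<bullet> h)) (at x within S)"
  if x: "x \<in> S" for x
  using DERIV_compose_FDERIV[where g = f and x = x and g' = "%h. f' x \<bullet> h" and s = S
    and f = "%t. max 0 t ^ Suc (Suc i)", OF has_derivative_pos_part_power[of i "f x"]] f'(1) x
  by (simp add: j mult.commute del: power_Suc)
 moreover have "C_on k S (%x. (real j * max 0 (f x) ^ Suc i) *\<^sub>R f' x \<bullet> b)" if "b \<in> Basis" for b
  using Suc.IH[of "Suc i"] Suc.prems C_on_SucD f'(2) that j
  by (auto intro!: C_on_mult C_on_const simp del: power_Suc)
 ultimately show ?case unfolding C_on_Suc
  by (intro exI[of _ "%x. (real j * max 0 (f x) ^ Suc i) *\<^sub>R f' x"]) blast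
qed

text \<open>Schwarz's theorem by two mean values, with continuity of one mixed derivative only. In this form it also
 exchanges a space derivative with the time derivative: \<open>Du\<close> has a continuous time derivative near the point, and the space
 derivative of \<open>u\<^sub>t\<close> is compared with it at the point.\<close>

lemma mixed_partials_commute:
 fixes f fs ft fst' :: "real => real => real"
 assumes e: "e > 0"
  and fs: "\<And>s t. \<bar>s\<bar> < e ==> \<bar>t\<bar> < e ==> ((%s. f s t) has_real_derivative fs s t) (at s)"
  and fst: "\<And>s t. \<bar>s\<bar> < e ==> \<bar>t\<bar> < e ==> ((%t. fs s t) has_real_derivative fst' s t) (at t)"
  and ft: "\<And>s. \<bar>s\<bar> < e ==> ((%t. f s t) has_real_derivative ft s 0) (at 0)"
  and fts: "((%s. ft s 0) has_real_derivative l) (at 0)"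
  and cont: "isCont (%(s, t). fst' s t) (0, 0)"
 shows "l = fst' 0 0"
proof -
 have bound: "\<bar>l - fst' 0 0\<bar> <= d" if d: "d > 0" for d
 proof -
  from cont d obtain r where r: "r > 0"
   "\<And>s t. dist (s, t) (0, 0) < r ==> \<bar>fst' s t - fst' 0 0\<bar> < d"
   unfolding continuous_at_eps_delta by (fastforce simp: dist_real_def)
  define k where "k = min e (r/2)"
  have k: "k > 0" "k <= e" "k <= r/2" using e r by (auto simp: k_def)
  have near: "\<bar>fst' s t - fst' 0 0\<bar> < d" if "\<bar>s\<bar> < k" "\<bar>t\<bar> < k" for s t
  proof (rule r(2))
   have "dist (s, t) (0, 0) <= \<bar>s\<bar> + \<bar>t\<bar>"
    using norm_Pair_le[of s t] by (simp add: dist_norm)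
   then show "dist (s, t) (0, 0) < r" using that k by linarith
  qed
  have quot: "\<bar>(ft s 0 - ft 0 0) / s - fst' 0 0\<bar> <= d" if s: "0 < s" "s < k" for s
  proof -
   have lim: "((%t. ((f s t - f 0 t) - (f s 0 - f 0 0)) / t) \<longlongrightarrow> ft s 0 - ft 0 0) (at_right 0)"
   proof -
    have "((%t. f s t - f 0 t) has_real_derivative ft s 0 - ft 0 0) (at 0)"
     using ft[of s] ft[of 0] s k e by (intro DERIV_diff) auto
    then have "((%t. ((f s t - f 0 t) - (f s 0 - f 0 0)) / t) \<longlongrightarrow> ft s 0 - ft 0 0) (at 0)"
     by (simp add: has_field_derivative_iff)
    then show ?thesis by (rule filterlim_mono) (auto simp: at_le)
   qed
   have ev: "\<forall>\<^sub>F t in at_right 0. \<bar>(((f s t - f 0 t) - (f s 0 - f 0 0)) / t) / s - fst' 0 0\<bar> <= d"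
   proof -
    have "\<bar>(((f s t - f 0 t) - (f s 0 - f 0 0)) / t) / s - fst' 0 0\<bar> <= d" if t: "0 < t" "t < k" for t
    proof -
     have "\<exists>\<sigma>. 0 < \<sigma> \<and> \<sigma> < s \<and> (f s t - f s 0) - (f 0 t - f 0 0) = (s - 0) * (fs \<sigma> t - fs \<sigma> 0)"
      using s t k by (intro MVT2) (auto intro!: DERIV_diff fs)
     then obtain \<sigma> where \<sigma>: "0 < \<sigma>" "\<sigma> < s" "(f s t - f s 0) - (f 0 t - f 0 0) = s * (fs \<sigma> t - fs \<sigma> 0)"
      by auto
     have "\<exists>\<tau>. 0 < \<tau> \<and> \<tau> < t \<and> fs \<sigma> t - fs \<sigma> 0 = (t - 0) * fst' \<sigma> \<tau>"
      using s t k \<sigma> by (intro MVT2) (auto intro!: fst)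
     then obtain \<tau> where \<tau>: "0 < \<tau>" "\<tau> < t" "fs \<sigma> t - fs \<sigma> 0 = t * fst' \<sigma> \<tau>" by auto
     have "(f s t - f 0 t) - (f s 0 - f 0 0) = s * (t * fst' \<sigma> \<tau>)" using \<sigma> \<tau> by simp
     then have "(((f s t - f 0 t) - (f s 0 - f 0 0)) / t) / s = fst' \<sigma> \<tau>" using s t by simp
     then show ?thesis using near[of \<sigma> \<tau>] \<sigma> \<tau> s t by fastforce
    qed
    then show ?thesis using k(1) by (auto simp: eventually_at_right_field)
   qed
   have "((%t. \<bar>(((f s t - f 0 t) - (f s 0 - f 0 0)) / t) / s - fst' 0 0\<bar>) \<longlongrightarrow> \<bar>(ft s 0 - ft 0 0) / s - fst' 0 0\<bar>) (at_right 0)"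
    using lim s by (intro tendsto_intros) auto
   then show ?thesis by (rule tendsto_upperbound[OF _ ev]) simp
  qed
  have "((%s. (ft s 0 - ft 0 0) / s) \<longlongrightarrow> l) (at 0)"
   using fts by (simp add: has_field_derivative_iff)
  then have "((%s. (ft s 0 - ft 0 0) / s) \<longlongrightarrow> l) (at_right 0)"
   by (rule filterlim_mono) (auto simp: at_le)
  then have "((%s. \<bar>(ft s 0 - ft 0 0) / s - fst' 0 0\<bar>) \<longlongrightarrow> \<bar>l - fst' 0 0\<bar>) (at_right 0)"
   by (intro tendsto_intros)
  moreover have "\<forall>\<^sub>F s in at_right 0. \<bar>(ft s 0 - ft 0 0) / s - fst' 0 0\<bar> <= d"
   using quot k(1) by (auto simp: eventually_at_right_field)
  ultimately show ?thesis by (rule tendsto_upperbound) simp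
 qed
 then have "\<bar>l - fst' 0 0\<bar> <= 0" by (rule field_le_epsilon[of _ 0, simplified]) auto
 then show ?thesis by simp
qed

section \<open>The boundary: normal, defining function, interior balls\<close>

lemma grad_eqI:
 fixes f :: "'a::euclidean_space => real"
 assumes "(f has_derivative (%h. g \<bullet> h)) (at x)"
 shows "grad UNIV f x = g"
proof -
 have "frechet_derivative f (at x) = (%h. g \<bullet> h)"
  using frechet_derivative_at[OF assms] by simp
 then show ?thesis by (simp add: grad_def euclidean_representation)
qed

lemma has_vector_derivative_along_line:
 assumes F: "(F has_derivative D) (at (y + s *\<^sub>R v))"
 shows "((%s. F (y + s *\<^sub>R v)) has_vector_derivative D v) (at s)"
proof -
 have "((%s. y + s *\<^sub>R v) has_derivative (%h. h *\<^sub>R v)) (at s)"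
  by (auto intro!: derivative_eq_intros)
 from diff_chain_at[OF this F] show ?thesis
  using linear_cmul[OF has_derivative_linear[OF F]] by (simp add: o_def has_vector_derivative_def)
qed

lemma DERIV_along_line:
 assumes "(F has_derivative D) (at (y + s *\<^sub>R v))"
 shows "((%s. F (y + s *\<^sub>R v)) has_real_derivative D v) (at s)"
 using has_vector_derivative_along_line[OF assms] by (simp add: has_real_derivative_iff_has_vector_derivative)

lemma segment_in_open:
 fixes x v :: "'a::real_normed_vector"
 assumes "open S" "x \<in> S"
 obtains e :: real where "e > 0" "\<And>s. \<bar>s\<bar> < e ==> x + s *\<^sub>R v \<in> S"
proof -
 have "open ((%s::real. x + s *\<^sub>R v) -` S)" by (intro open_vimage assms continuous_intros)
 moreover have "0 \<in> (%s::real. x + s *\<^sub>R v) -` S" using assms by simp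
 ultimately obtain e where "e > 0" "ball 0 e \<subseteq> (%s::real. x + s *\<^sub>R v) -` S" using open_contains_ball by blast
 then show ?thesis by (intro that[of e]) (auto simp: subset_iff)
qed

text \<open>The normal is characterised through membership in the domain alone: rays that make an acute angle with it
 leave the domain at once, rays with an obtuse angle enter it. No chart occurs, so its uniqueness is elementary
 and shows that the normal read off from a chart does not depend on the chart.\<close>

definition is_outer_normal :: "'a::euclidean_space set => 'a => 'a => bool" where
 "is_outer_normal \<Omega> y \<nu> \<longleftrightarrow> norm \<nu> = 1 \<and>
   (\<forall>v. v \<bullet> \<nu> < 0 --> (\<exists>e>0. \<forall>s. 0 < s \<and> s < e --> y + s *\<^sub>R v \<in> \<Omega>)) \<and>
   (\<forall>v. v \<bullet> \<nu> > 0 --> (\<exists>e>0. \<forall>s. 0 < s \<and> s < e --> y + s *\<^sub>R v \<notin> \<Omega>))"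

text \<open>If two normals differ, the direction \<open>b - a\<close> enters the domain according to one and leaves it
 according to the other.\<close>

lemma is_outer_normal_unique:
 assumes a: "is_outer_normal \<Omega> y a" and b: "is_outer_normal \<Omega> y b"
 shows "a = b"
proof (rule ccontr)
 assume "a \<noteq> b"
 have n: "norm a = 1" "norm b = 1" using a b by (auto simp: is_outer_normal_def)
 then have aa: "a \<bullet> a = 1" "b \<bullet> b = 1" by (auto simp: norm_eq_1)
 have "(a - b) \<bullet> (a - b) > 0" using \<open>a \<noteq> b\<close> by simp
 then have lt: "a \<bullet> b < 1" using aa by (simp add: inner_diff_left inner_diff_right inner_commute)
 define v where "v = b - a"
 have "v \<bullet> a < 0" "v \<bullet> b > 0" using lt aa by (auto simp: v_def inner_diff_left inner_diff_right inner_commute)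
 have "\<exists>e>0. \<forall>s. 0 < s \<and> s < e --> y + s *\<^sub>R v \<in> \<Omega>"
  using a \<open>v \<bullet> a < 0\<close> unfolding is_outer_normal_def by blast
 moreover have "\<exists>e>0. \<forall>s. 0 < s \<and> s < e --> y + s *\<^sub>R v \<notin> \<Omega>"
  using b \<open>v \<bullet> b > 0\<close> unfolding is_outer_normal_def by blast
 ultimately obtain e1 e2 where "e1 > 0" "\<forall>s. 0 < s \<and> s < e1 --> y + s *\<^sub>R v \<in> \<Omega>"
  "e2 > 0" "\<forall>s. 0 < s \<and> s < e2 --> y + s *\<^sub>R v \<notin> \<Omega>" by blast
 moreover define s where "s = min e1 e2 / 2"
 ultimately have "0 < s \<and> s < e1" "0 < s \<and> s < e2" by (auto simp: s_def)
 then show False using \<open>\<forall>s. 0 < s \<and> s < e1 --> y + s *\<^sub>R v \<in> \<Omega>\<close> \<open>\<forall>s. 0 < s \<and> s < e2 --> y + s *\<^sub>R v \<notin> \<Omega>\<close> by blast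
qed

lemma is_outer_normal_defining:
 assumes F: "(F has_derivative (%h. D \<bullet> h)) (at y)" and "D \<noteq> 0" and "F y = 0"
  and r: "r > 0" "\<And>x. x \<in> ball y r ==> x \<in> \<Omega> \<longleftrightarrow> F x < (0::real)"
 shows "is_outer_normal \<Omega> y ((1 / norm D) *\<^sub>R D)"
proof -
 have der: "((%s. F (y + s *\<^sub>R v)) has_real_derivative D \<bullet> v) (at 0)" for v
  using DERIV_along_line[of F "%h. D \<bullet> h" y 0 v] F by simp
 have inball: "\<exists>e>0. \<forall>s. 0 < s \<and> s < e --> y + s *\<^sub>R v \<in> ball y r" for v
 proof -
  obtain e where "e > 0" "\<And>s. \<bar>s\<bar> < e ==> y + s *\<^sub>R v \<in> ball y r"
   using segment_in_open[OF open_ball, of y y r v] r(1) by auto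
  then show ?thesis by (intro exI[of _ e]) auto
 qed
 show ?thesis unfolding is_outer_normal_def
 proof (intro conjI allI impI)
  show "norm ((1 / norm D) *\<^sub>R D) = 1" using \<open>D \<noteq> 0\<close> by simp
  fix v
  show "\<exists>e>0. \<forall>s. 0 < s \<and> s < e --> y + s *\<^sub>R v \<in> \<Omega>" if "v \<bullet> (1 / norm D) *\<^sub>R D < 0"
  proof -
   have "D \<bullet> v < 0" using that \<open>D \<noteq> 0\<close> by (simp add: inner_commute divide_less_0_iff)
   from DERIV_neg_dec_right[OF der this] obtain d where "d > 0"
    "\<forall>h>0. h < d --> F (y + h *\<^sub>R v) < 0" using \<open>F y = 0\<close> by auto
   moreover obtain e where "e > 0" "\<forall>s. 0 < s \<and> s < e --> y + s *\<^sub>R v \<in> ball y r" using inball by blast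
   ultimately show ?thesis using r(2) by (intro exI[of _ "min d e"]) auto
  qed
  show "\<exists>e>0. \<forall>s. 0 < s \<and> s < e --> y + s *\<^sub>R v \<notin> \<Omega>" if "v \<bullet> (1 / norm D) *\<^sub>R D > 0"
  proof -
   have "D \<bullet> v > 0" using that \<open>D \<noteq> 0\<close> by (simp add: inner_commute zero_less_divide_iff)
   from DERIV_pos_inc_right[OF der this] obtain d where d: "d > 0"
    "\<forall>h>0. h < d --> F (y + h *\<^sub>R v) > 0" using \<open>F y = 0\<close> by auto
   obtain e where "e > 0" "\<forall>s. 0 < s \<and> s < e --> y + s *\<^sub>R v \<in> ball y r" using inball by blast
   then show ?thesis using r(2) d by (intro exI[of _ "min d e"]) (auto simp: not_less less_imp_le)
  qed
 qed
qed

definition chart_fun :: "'m::finite space => ('m space => 'm space) => (real ^ 'm => real) => 'm space => real"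
 where "chart_fun y A \<psi> x = \<psi> (fst (A (x - y))) - snd (A (x - y))"

lemma graph_chartE:
 assumes "graph_chart k \<Omega> y A \<psi>"
 obtains r where "orthogonal_transformation A" "C_on k UNIV \<psi>" "\<psi> 0 = 0" "r > 0"
  "\<And>x. x \<in> ball y r ==> x \<in> \<Omega> \<longleftrightarrow> chart_fun y A \<psi> x < 0"
proof -
 obtain r where r: "r > 0" "\<Omega> \<inter> ball y r = {x \<in> ball y r. snd (A (x - y)) > \<psi> (fst (A (x - y)))}"
  using assms by (auto simp: graph_chart_def)
 have "x \<in> \<Omega> \<longleftrightarrow> chart_fun y A \<psi> x < 0" if "x \<in> ball y r" for x
 proof -
  have "x \<in> \<Omega> \<longleftrightarrow> x \<in> {x \<in> ball y r. snd (A (x - y)) > \<psi> (fst (A (x - y)))}" using r(2) that by blast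
  then show ?thesis using that by (simp add: chart_fun_def)
 qed
 then show ?thesis using that r(1) assms by (auto simp: graph_chart_def)
qed

lemma orthogonal_transformation_Pair_linear:
 fixes A :: "'m::finite space => 'm space"
 assumes "orthogonal_transformation A"
 shows "linear A" "linear (%v. fst (A v))" "linear (%v. snd (A v))"
proof -
 show A: "linear A" using assms orthogonal_transformation_linear by blast
 show "linear (%v. fst (A v))" "linear (%v. snd (A v))"
  using linear_compose[OF A linear_fst] linear_compose[OF A linear_snd] by (simp_all add: o_def)
qed

lemma linear_inner_comp: "linear f ==> linear (%v. f v \<bullet> b)"
 by (rule linearI) (auto simp: linear_add linear_cmul inner_add_left)

lemma C_on_affine:
 assumes "linear f" shows "C_on k S (%x. f (x - y) :: real)"
proof -
 have "C_on k S (%x. f x + (- f y))" by (intro C_on_add C_on_linear assms C_on_const)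
 then show ?thesis using assms by (simp add: linear_diff)
qed

lemma C_on_chart_fun:
 assumes "orthogonal_transformation A" "C_on k UNIV \<psi>"
 shows "C_on k UNIV (chart_fun y A \<psi>)"
proof -
 note lin = orthogonal_transformation_Pair_linear[OF assms(1)]
 have "C_on k UNIV (%x. fst (A (x - y)) \<bullet> b)" for b
  using C_on_affine[OF linear_inner_comp[OF lin(2)]] .
 then have "C_on k UNIV (%x. \<psi> (fst (A (x - y))))" by (rule C_on_compose[OF assms(2)]) simp
 from C_on_diff[OF this C_on_affine[OF lin(3)]] show ?thesis unfolding chart_fun_def[abs_def] .
qed

lemma chart_fun_derivative:
 assumes A: "orthogonal_transformation A"
  and \<psi>: "(\<psi> has_derivative (%h. g \<bullet> h)) (at (fst (A (x - y))))"
 shows "(chart_fun y A \<psi> has_derivative (%v. (g, -1) \<bullet> A v)) (at x)"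
proof -
 note lin = orthogonal_transformation_Pair_linear[OF A]
 have 1: "((%x. fst (A (x - y))) has_derivative (%v. fst (A v))) (at x)"
  using linear_imp_has_derivative[OF lin(2), of "at x"]
   has_derivative_diff[OF linear_imp_has_derivative[OF lin(2), of "at x"] has_derivative_const[of "fst (A y)"]]
  by (simp add: linear_diff[OF lin(1)])
 have 2: "((%x. snd (A (x - y))) has_derivative (%v. snd (A v))) (at x)"
  using has_derivative_diff[OF linear_imp_has_derivative[OF lin(3), of "at x"] has_derivative_const[of "snd (A y)"]]
  by (simp add: linear_diff[OF lin(1)])
 from diff_chain_at[OF 1 \<psi>] have "((%x. \<psi> (fst (A (x - y)))) has_derivative (%v. g \<bullet> fst (A v))) (at x)"
  by (simp add: o_def)
 from has_derivative_diff[OF this 2] show ?thesis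
  by (simp add: chart_fun_def[abs_def] inner_prod_def)
qed

lemma orthogonal_transformation_inner_inv:
 fixes A :: "'a::euclidean_space => 'a"
 assumes A: "orthogonal_transformation A"
 shows "w \<bullet> A v = inv A w \<bullet> v" "A (inv A w) = w" "inv A (A v) = v" "orthogonal_transformation (inv A)"
proof -
 show 1: "A (inv A w) = w"
  by (simp add: A orthogonal_transformation_surj surj_f_inv_f)
 show "inv A (A v) = v" by (simp add: A orthogonal_transformation_inj inv_f_f)
 show "w \<bullet> A v = inv A w \<bullet> v"
  using A 1 by (metis orthogonal_transformation_def)
 show "orthogonal_transformation (inv A)" using A by (rule orthogonal_transformation_inv)
qed

text \<open>Every chart yields a vector satisfying \<^const>\<open>is_outer_normal\<close>, hence the same one; this turns the definite
 description behind \<^const>\<open>outward_normal\<close> into a usable equation.\<close>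

lemma chart_normal:
 fixes \<Omega> :: "'m::finite space set"
 assumes ch: "graph_chart k \<Omega> y A \<psi>" and k: "k \<ge> 1"
 shows "is_outer_normal \<Omega> y (outward_normal \<Omega> y)"
  and "A (outward_normal \<Omega> y) = (1 / sqrt (1 + (norm (grad UNIV \<psi> 0))\<^sup>2)) *\<^sub>R (grad UNIV \<psi> 0, - 1)"
proof -
 define nu where "nu A \<psi> = inv A ((1 / sqrt (1 + (norm (grad UNIV \<psi> 0))\<^sup>2)) *\<^sub>R (grad UNIV \<psi> 0, - 1))"
  for A :: "'m space => 'm space" and \<psi>
 have key: "is_outer_normal \<Omega> y (nu A \<psi>)" if ch: "graph_chart 1 \<Omega> y A \<psi>" for A \<psi>
 proof -
  obtain r where A: "orthogonal_transformation A" and \<psi>: "C_on 1 UNIV \<psi>" "\<psi> 0 = 0"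
   and r: "r > 0" and c4: "\<And>x. x \<in> ball y r ==> x \<in> \<Omega> \<longleftrightarrow> chart_fun y A \<psi> x < 0" by (rule graph_chartE[OF ch]) blast
  note inv = orthogonal_transformation_inner_inv[OF A]
  from \<psi>(1) obtain g where "\<forall>x. (\<psi> has_derivative (%h. g x \<bullet> h)) (at x)"
   unfolding One_nat_def C_on_Suc by auto
  then have g: "(\<psi> has_derivative (%h. grad UNIV \<psi> 0 \<bullet> h)) (at 0)" using grad_eqI by metis
  let ?D = "inv A (grad UNIV \<psi> 0, - 1)"
  have A0: "A 0 = 0" using A orthogonal_transformation_linear linear_0 by blast
  have c1: "(chart_fun y A \<psi> has_derivative (%v. ?D \<bullet> v)) (at y)"
   using chart_fun_derivative[OF A, of \<psi> _ y y] g A0 by (simp add: inv(1))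
  have nD: "norm ?D = sqrt (1 + (norm (grad UNIV \<psi> 0))\<^sup>2)"
   using inv(4) by (simp add: orthogonal_transformation_norm norm_Pair add.commute)
  have "sqrt (1 + (norm (grad UNIV \<psi> 0))\<^sup>2) > 0" by (simp add: add_pos_nonneg)
  then have c2: "?D \<noteq> 0" using nD by (metis less_irrefl norm_zero)
  have c3: "chart_fun y A \<psi> y = 0" using \<psi>(2) A0 by (simp add: chart_fun_def)
  have "is_outer_normal \<Omega> y ((1 / norm ?D) *\<^sub>R ?D)"
   by (rule is_outer_normal_defining[OF c1 c2 c3 r c4])
  moreover have "nu A \<psi> = (1 / norm ?D) *\<^sub>R ?D"
   unfolding nu_def nD by (rule linear_cmul[OF orthogonal_transformation_linear[OF inv(4)]])
  ultimately show ?thesis by simp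
 qed
 have ch1: "graph_chart 1 \<Omega> y A \<psi>" using ch k C_on_le by (auto simp: graph_chart_def)
 have A: "orthogonal_transformation A" using ch by (auto simp: graph_chart_def)
 have nuA: "A \<nu> = (1 / sqrt (1 + (norm (grad UNIV \<psi> 0))\<^sup>2)) *\<^sub>R (grad UNIV \<psi> 0, - 1) \<longleftrightarrow> \<nu> = nu A \<psi>"
  if "orthogonal_transformation A" for A \<psi> \<nu>
  unfolding nu_def using orthogonal_transformation_inner_inv[OF that] by metis
 have "outward_normal \<Omega> y = nu A \<psi>" unfolding outward_normal_def
 proof (rule the_equality)
  show "\<exists>A' \<psi>'. graph_chart 1 \<Omega> y A' \<psi>' \<and> A' (nu A \<psi>) = (1 / sqrt (1 + (norm (grad UNIV \<psi>' 0))\<^sup>2)) *\<^sub>R (grad UNIV \<psi>' 0, - 1)"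
   using ch1 nuA[OF A] by blast
  fix \<nu> assume "\<exists>A' \<psi>'. graph_chart 1 \<Omega> y A' \<psi>' \<and> A' \<nu> = (1 / sqrt (1 + (norm (grad UNIV \<psi>' 0))\<^sup>2)) *\<^sub>R (grad UNIV \<psi>' 0, - 1)"
  then obtain A' \<psi>' where *: "graph_chart 1 \<Omega> y A' \<psi>'"
    "A' \<nu> = (1 / sqrt (1 + (norm (grad UNIV \<psi>' 0))\<^sup>2)) *\<^sub>R (grad UNIV \<psi>' 0, - 1)" by blast
  then have "\<nu> = nu A' \<psi>'" using nuA graph_chart_def by blast
  then show "\<nu> = nu A \<psi>" using key[OF *(1)] key[OF ch1] is_outer_normal_unique by metis
 qed
 then show "is_outer_normal \<Omega> y (outward_normal \<Omega> y)" using key[OF ch1] by simp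
 from \<open>outward_normal \<Omega> y = nu A \<psi>\<close>
 show "A (outward_normal \<Omega> y) = (1 / sqrt (1 + (norm (grad UNIV \<psi> 0))\<^sup>2)) *\<^sub>R (grad UNIV \<psi> 0, - 1)"
  using nuA[OF A] by simp
qed

lemma outward_normal:
 assumes "C_boundary k \<Omega>" "k \<ge> 1" "y \<in> frontier \<Omega>"
 shows "is_outer_normal \<Omega> y (outward_normal \<Omega> y)"
 using assms chart_normal(1) unfolding C_boundary_def by blast

text \<open>The fourth power matches the regularity \<open>C\<^sup>3\<close> of the boundary.\<close>

definition bump :: "real => 'a::euclidean_space => 'a => real" where
 "bump r y x = max 0 (r\<^sup>2 - (x - y) \<bullet> (x - y)) ^ 4"

lemma C_on_norm_sq: "C_on k S (%x. (x - y) \<bullet> (x - y))"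
proof -
 have "C_on k S (%x. (x - y) \<bullet> b)" for b
  by (rule C_on_affine[OF linear_inner_comp[OF linear_id[unfolded id_def]]])
 then have "C_on k S (%x. \<Sum>b\<in>Basis. ((x - y) \<bullet> b) * ((x - y) \<bullet> b))" by (intro C_on_sum C_on_mult)
 then show ?thesis by (subst (asm) euclidean_inner[symmetric])
qed

lemma C_on_bump: "k <= 3 ==> C_on k S (bump r y)"
 unfolding bump_def[abs_def]
 by (intro C_on_pos_part_power C_on_diff C_on_const C_on_norm_sq) auto

lemma bump_pos: "r > 0 ==> bump r y x > 0 \<longleftrightarrow> x \<in> ball y r" and bump_nonneg: "bump r y x \<ge> 0"
proof -
 assume r: "r > 0"
 have "(x - y) \<bullet> (x - y) < r\<^sup>2 \<longleftrightarrow> norm (x - y) < r"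
  using r by (metis norm_ge_zero power2_norm_eq_inner power_mono_iff less_imp_le not_less zero_less_numeral)
 then show "bump r y x > 0 \<longleftrightarrow> x \<in> ball y r"
  by (auto simp: bump_def dist_norm norm_minus_commute zero_less_power_eq)
qed (simp add: bump_def)

lemma bump_derivative:
 "(bump r y has_derivative (%h. ((- 8 * max 0 (r\<^sup>2 - (x - y) \<bullet> (x - y)) ^ 3) *\<^sub>R (x - y)) \<bullet> h)) (at x)"
proof -
 have 1: "((%x. r\<^sup>2 - (x - y) \<bullet> (x - y)) has_derivative (%h. (-2 *\<^sub>R (x - y)) \<bullet> h)) (at x)"
  by (auto intro!: derivative_eq_intros simp: inner_commute)
 let ?m = "max 0 (r\<^sup>2 - (x - y) \<bullet> (x - y))"
 have "(bump r y has_derivative (%h. ((-2 *\<^sub>R (x - y)) \<bullet> h) * (4 * ?m ^ 3))) (at x)"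
  using DERIV_compose_FDERIV[where f = "%t::real. max 0 t ^ 4" and g = "%x. r\<^sup>2 - (x - y) \<bullet> (x - y)", OF _ 1, of "4 * ?m ^ 3"]
   has_derivative_pos_part_power[of 2 "r\<^sup>2 - (x - y) \<bullet> (x - y)"]
  by (simp add: bump_def[abs_def] eval_nat_numeral del: power_Suc)
 moreover have "((-2 *\<^sub>R (x - y)) \<bullet> h) * (4 * ?m ^ 3) = ((- 8 * ?m ^ 3) *\<^sub>R (x - y)) \<bullet> h" for h
  by simp
 ultimately show ?thesis by (simp add: mult_ac)
qed

text \<open>Local defining functions, and the constant \<open>-1\<close> inside the domain, are multiplied by bumps and added over a finite
 cover of the closure. At every point all summands have the same sign, and at a boundary point all gradients are
 nonnegative multiples of the normal, so nothing cancels and the gradient of the sum does not vanish.\<close>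

lemma defining_function_from_local:
 fixes \<Omega> :: "'a::euclidean_space set"
 assumes op: "open \<Omega>" and bdd: "bounded \<Omega>"
  and loc: "\<And>y. y \<in> frontier \<Omega> ==> \<exists>F F' r. r > 0 \<and> C_on 3 UNIV F \<and>
    (\<forall>x. (F has_derivative (%v. F' x \<bullet> v)) (at x) \<and> F' x \<noteq> 0) \<and> (\<forall>x\<in>ball y r. x \<in> \<Omega> \<longleftrightarrow> F x < (0::real))"
 obtains h h' L where "C_on 3 UNIV h" "\<And>x. (h has_derivative (%v. h' x \<bullet> v)) (at x)"
  "\<And>x. (h' has_derivative L x) (at x)" "\<And>v w. continuous_on UNIV (%x. L x v \<bullet> w)"
  "\<And>b. b \<in> Basis ==> C_on 2 UNIV (%x. h' x \<bullet> b)"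
  "\<And>x. h x < 0 \<longleftrightarrow> x \<in> \<Omega>" "\<And>x. x \<in> frontier \<Omega> ==> h x = 0"
  "\<And>x. x \<in> frontier \<Omega> ==> \<exists>s>0. \<exists>\<nu>. is_outer_normal \<Omega> x \<nu> \<and> h' x = s *\<^sub>R \<nu>"
proof -
 define Q where "Q y F F' r \<longleftrightarrow> r > 0 \<and> C_on 3 UNIV F \<and>
    (\<forall>x. (F has_derivative (%v. F' x \<bullet> v)) (at x) \<and> F' x \<noteq> 0) \<and> (\<forall>x\<in>ball y r. x \<in> \<Omega> \<longleftrightarrow> F x < (0::real))"
  for y r F and F' :: "'a => 'a"
 have "\<forall>y. \<exists>F F' r. y \<in> frontier \<Omega> --> Q y F F' r" using loc unfolding Q_def by blast
 then obtain f f' r1 where Q: "\<And>y. y \<in> frontier \<Omega> ==> Q y (f y) (f' y) (r1 y)" by metis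
 have ch: "\<And>y. y \<in> frontier \<Omega> ==> r1 y > 0"
  "\<And>y. y \<in> frontier \<Omega> ==> C_on 3 UNIV (f y)"
  "\<And>x y. y \<in> frontier \<Omega> ==> (f y has_derivative (%v. f' y x \<bullet> v)) (at x)"
  "\<And>x y. y \<in> frontier \<Omega> ==> f' y x \<noteq> 0"
  "\<And>x y. y \<in> frontier \<Omega> ==> x \<in> ball y (r1 y) ==> x \<in> \<Omega> \<longleftrightarrow> f y x < 0"
  using Q unfolding Q_def by blast+
 have "\<forall>y\<in>\<Omega>. \<exists>r>0. ball y r \<subseteq> \<Omega>" using op open_contains_ball by blast
 then obtain r2 where r2: "\<And>y. y \<in> \<Omega> ==> r2 y > 0" "\<And>y. y \<in> \<Omega> ==> ball y (r2 y) \<subseteq> \<Omega>" by metis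
 define r where "r y = (if y \<in> \<Omega> then r2 y else r1 y)" for y
 have notin: "y \<notin> \<Omega>" if "y \<in> frontier \<Omega>" for y using that op by (simp add: frontier_def interior_open)
 have clO: "closure \<Omega> = \<Omega> \<union> frontier \<Omega>" using op by (auto simp: frontier_def interior_open closure_subset[THEN subsetD])
 have rpos: "r y > 0" if "y \<in> closure \<Omega>" for y using that ch(1) r2 notin by (auto simp: clO r_def)
 have comp: "compact (closure \<Omega>)" using bdd by simp
 have "closure \<Omega> \<subseteq> (\<Union>y\<in>closure \<Omega>. ball y (r y))" using rpos by auto
 then obtain F where F: "F \<subseteq> closure \<Omega>" "finite F" "closure \<Omega> \<subseteq> (\<Union>y\<in>F. ball y (r y))"
  using compactE_image[OF comp, of "closure \<Omega>" "%y. ball y (r y)"] by auto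
 define e where "e y = (if y \<in> \<Omega> then (%_. -1) else f y)" for y
 define h where "h x = (\<Sum>y\<in>F. bump (r y) y x * e y x)" for x
 have Fcl: "y \<in> \<Omega> \<or> y \<in> frontier \<Omega>" if "y \<in> F" for y using that F(1) clO by blast
 have Ce: "C_on 3 UNIV (e y)" if "y \<in> F" for y
  using Fcl[OF that] ch(2) by (auto simp: e_def intro!: C_on_const)
 have Ch: "C_on 3 UNIV h" unfolding h_def[abs_def]
  using Ce by (intro C_on_sum C_on_mult C_on_bump) auto
 obtain h' L where h': "\<And>x. (h has_derivative (%v. h' x \<bullet> v)) (at x)"
  "\<And>x. (h' has_derivative L x) (at x)" "\<And>v w. continuous_on UNIV (%x. L x v \<bullet> w)"
  "\<And>b. b \<in> Basis ==> C_on 2 UNIV (%x. h' x \<bullet> b)"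
  using C_on_gradient_field[OF Ch[unfolded numeral_3_eq_3]] unfolding numeral_2_eq_2 by (metis UNIV_I)
 have inball: "x \<in> ball y (r y)" if "y \<in> F" "bump (r y) y x \<noteq> 0" for x y
  using bump_pos[of "r y" y x] bump_nonneg[of "r y" y x] rpos that F(1) by fastforce
 have sign_in: "bump (r y) y x * e y x <= 0" if "y \<in> F" "x \<in> \<Omega>" for x y
 proof (cases "bump (r y) y x = 0")
  case False
  with inball that have "x \<in> ball y (r y)" by blast
  then have "e y x < 0" using that Fcl[of y] ch(5)[of y x] by (auto simp: e_def r_def)
  then show ?thesis using bump_nonneg[of "r y" y x] by (simp add: mult_nonneg_nonpos)
 qed simp
 have in2: "y \<in> frontier \<Omega> \<and> y \<notin> \<Omega> \<and> x \<in> ball y (r1 y)" if "y \<in> F" "x \<notin> \<Omega>" "bump (r y) y x \<noteq> 0" for x y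
 proof -
  have x: "x \<in> ball y (r y)" using inball that by blast
  have "x \<in> \<Omega>" if "y \<in> \<Omega>" using r2(2)[OF that] x that unfolding r_def by auto
  then have "y \<notin> \<Omega>" using that(2) by blast
  then show ?thesis using Fcl[OF that(1)] x by (auto simp: r_def)
 qed
 have sign_out: "bump (r y) y x * e y x \<ge> 0" if "y \<in> F" "x \<notin> \<Omega>" for x y
 proof (cases "bump (r y) y x = 0")
  case False
  with in2 that have "y \<in> frontier \<Omega>" "y \<notin> \<Omega>" "x \<in> ball y (r1 y)" by blast+
  then have "e y x \<ge> 0" using ch(5)[of y x] that(2) by (simp add: e_def not_less)
  then show ?thesis using bump_nonneg[of "r y" y x] by simp
 qed simp
 have hneg: "h x < 0" if x: "x \<in> \<Omega>" for x
 proof -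
  have "x \<in> closure \<Omega>" using x clO by blast
  with F(3) obtain y where y: "y \<in> F" "x \<in> ball y (r y)" by blast
  then have "bump (r y) y x > 0" using bump_pos[of "r y"] rpos F(1) by blast
  moreover have "e y x < 0" using x y Fcl[of y] ch(5)[of y x] by (auto simp: e_def r_def)
  ultimately have "bump (r y) y x * e y x < 0" by (simp add: mult_pos_neg)
  then have "(\<Sum>y\<in>F. bump (r y) y x * e y x) < (\<Sum>y\<in>F. 0)"
   using F(2) y(1) sign_in[OF _ x] by (intro sum_strict_mono_ex1) auto
  then show ?thesis by (simp add: h_def)
 qed
 have hnonneg: "h x \<ge> 0" if "x \<notin> \<Omega>" for x unfolding h_def using sign_out[OF _ that] by (rule sum_nonneg)
 have bdzero: "e y x = 0" if "y \<in> F" "x \<in> frontier \<Omega>" "bump (r y) y x \<noteq> 0" for x y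
 proof -
  from in2[OF that(1) notin[OF that(2)] that(3)]
  have yf: "y \<in> frontier \<Omega>" and yn: "y \<notin> \<Omega>" and xb: "x \<in> ball y (r1 y)" by auto
  have ge: "f y x \<ge> 0" using ch(5)[OF yf xb] notin[OF that(2)] by simp
  have "f y x <= 0"
  proof (rule ccontr)
   assume "\<not> f y x <= 0"
   then have "0 < f y x" by simp
   have "continuous_on UNIV (f y)" using ch(2)[OF yf] C_on_continuous by blast
   then have "open {z. 0 < f y z}" by (simp add: open_Collect_less continuous_on_const)
   then have op': "open ({z. 0 < f y z} \<inter> ball y (r1 y))" by auto
   have "x \<in> {z. 0 < f y z} \<inter> ball y (r1 y)" using xb \<open>0 < f y x\<close> by auto
   moreover have "x \<in> closure \<Omega>" using that(2) by (simp add: frontier_def)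
   ultimately have "({z. 0 < f y z} \<inter> ball y (r1 y)) \<inter> \<Omega> \<noteq> {}"
    using op' open_Int_closure_eq_empty by blast
   then obtain z where "0 < f y z" "z \<in> ball y (r1 y)" "z \<in> \<Omega>" by blast
   then show False using ch(5)[OF yf, of z] by simp
  qed
  then show "e y x = 0" using ge yn by (simp add: e_def)
 qed
 have hzero: "h x = 0" if "x \<in> frontier \<Omega>" for x
  unfolding h_def using bdzero[OF _ that] by (intro sum.neutral) auto
 have local_normal: "\<exists>\<nu>. is_outer_normal \<Omega> x \<nu> \<and> f' y x = norm (f' y x) *\<^sub>R \<nu>"
  if y: "y \<in> F" and x: "x \<in> frontier \<Omega>" and b: "bump (r y) y x \<noteq> 0" for x y
 proof -
  from in2[OF y notin[OF x] b]
  have yf: "y \<in> frontier \<Omega>" and yn: "y \<notin> \<Omega>" and xb: "x \<in> ball y (r1 y)" by auto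
  have f0: "f y x = 0" using bdzero[OF y x b] yn by (simp add: e_def)
  obtain d where d: "d > 0" "ball x d \<subseteq> ball y (r1 y)"
   using xb open_ball[of y "r1 y"] unfolding open_contains_ball by blast
  have "is_outer_normal \<Omega> x ((1 / norm (f' y x)) *\<^sub>R f' y x)"
   by (rule is_outer_normal_defining[OF ch(3)[OF yf] ch(4)[OF yf] f0 d(1)])
     (use d(2) ch(5)[OF yf] in blast)
  then show ?thesis using ch(4)[OF yf, of x] by (intro exI[of _ "(1 / norm (f' y x)) *\<^sub>R f' y x"]) auto
 qed
 have grad: "\<exists>s>0. \<exists>\<nu>. is_outer_normal \<Omega> x \<nu> \<and> h' x = s *\<^sub>R \<nu>" if x: "x \<in> frontier \<Omega>" for x
 proof -
  have "x \<in> closure \<Omega>" using x by (simp add: frontier_def)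
  then obtain y0 where y0: "y0 \<in> F" "x \<in> ball y0 (r y0)" using F(3) by blast
  then have b0: "bump (r y0) y0 x > 0" using bump_pos[of "r y0"] rpos F(1) by blast
  then obtain n where n: "is_outer_normal \<Omega> x n" using local_normal[OF y0(1) x] by auto
  have "\<exists>s\<ge>0. ((%z. bump (r y) y z * e y z) has_derivative (%v. (s *\<^sub>R n) \<bullet> v)) (at x) \<and> (bump (r y) y x \<noteq> 0 --> s > 0)"
   if y: "y \<in> F" for y
  proof -
   obtain g where g: "(bump (r y) y has_derivative (%h. g \<bullet> h)) (at x)"
     "bump (r y) y x = 0 --> g = 0"
    using bump_derivative[of "r y" y x] that by (fastforce simp: bump_def)
   define e' where "e' = (if y \<in> \<Omega> then 0 else f' y x)"
   have e': "(e y has_derivative (%v. e' \<bullet> v)) (at x)"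
    using Fcl[OF y] ch(3) by (auto simp: e_def e'_def)
   have der: "((%z. bump (r y) y z * e y z) has_derivative (%v. (bump (r y) y x *\<^sub>R e' + e y x *\<^sub>R g) \<bullet> v)) (at x)"
    using has_derivative_mult[OF g(1) e'] by (simp add: inner_add_left mult.commute)
   show ?thesis
   proof (cases "bump (r y) y x = 0")
    case True
    then show ?thesis using der g(2) by (intro exI[of _ 0]) auto
   next
    case False
    have yn: "y \<notin> \<Omega>" and yf: "y \<in> frontier \<Omega>" using in2[OF y notin[OF x] False] by auto
    have ez: "e y x = 0" using bdzero[OF y x False] .
    obtain \<nu> where "is_outer_normal \<Omega> x \<nu>" "f' y x = norm (f' y x) *\<^sub>R \<nu>" using local_normal[OF y x False] by blast
    then have e'eq: "e' = norm (f' y x) *\<^sub>R n" using yn n is_outer_normal_unique e'_def by metis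
    have "bump (r y) y x * norm (f' y x) > 0"
     using False bump_nonneg[of "r y" y x] ch(4)[OF yf, of x] by simp
    moreover have "bump (r y) y x *\<^sub>R e' + e y x *\<^sub>R g = (bump (r y) y x * norm (f' y x)) *\<^sub>R n"
     using ez e'eq by simp
    ultimately show ?thesis using der by (metis less_imp_le)
   qed
  qed
  then obtain s where s: "\<And>y. y \<in> F ==> s y \<ge> 0"
   "\<And>y. y \<in> F ==> ((%z. bump (r y) y z * e y z) has_derivative (%v. (s y *\<^sub>R n) \<bullet> v)) (at x)"
   "\<And>y. y \<in> F ==> bump (r y) y x \<noteq> 0 ==> s y > 0" by metis
  have "(h has_derivative (%v. \<Sum>y\<in>F. (s y *\<^sub>R n) \<bullet> v)) (at x)"
   unfolding h_def[abs_def] using s(2) by (rule has_derivative_sum)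
  from has_derivative_unique[OF h'(1)[of x] this]
  have "h' x \<bullet> v = (\<Sum>y\<in>F. (s y *\<^sub>R n) \<bullet> v)" for v by metis
  then have "h' x \<bullet> v = (sum s F *\<^sub>R n) \<bullet> v" for v
   by (simp add: sum_distrib_right)
  then have "h' x = sum s F *\<^sub>R n" using vector_eq_rdot by blast
  moreover have "sum s F > 0"
  proof -
   have "s y0 > 0" using s(3)[OF y0(1)] b0 by auto
   then show ?thesis using s(1) y0 F(2) by (meson sum_pos2)
  qed
  ultimately show ?thesis using n by blast
 qed
 have neg: "h x < 0 \<longleftrightarrow> x \<in> \<Omega>" for x using hneg hnonneg by (meson not_le)
 show ?thesis by (rule that[OF Ch h' neg hzero grad])
qed

lemma defining_function:
 fixes \<Omega> :: "'m::finite space set"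
 assumes bd: "C_boundary 3 \<Omega>" and op: "open \<Omega>" and bdd: "bounded \<Omega>"
 obtains h h' L where "C_on 3 UNIV h" "\<And>x. (h has_derivative (%v. h' x \<bullet> v)) (at x)"
  "\<And>x. (h' has_derivative L x) (at x)" "\<And>v w. continuous_on UNIV (%x. L x v \<bullet> w)"
  "\<And>b. b \<in> Basis ==> C_on 2 UNIV (%x. h' x \<bullet> b)"
  "\<And>x. h x < 0 \<longleftrightarrow> x \<in> \<Omega>" "\<And>x. x \<in> frontier \<Omega> ==> h x = 0"
  "\<And>x. x \<in> frontier \<Omega> ==> \<exists>s>0. h' x = s *\<^sub>R outward_normal \<Omega> x"
proof -
 have loc: "\<exists>F F' r. r > 0 \<and> C_on 3 UNIV F \<and> (\<forall>x. (F has_derivative (%v. F' x \<bullet> v)) (at x) \<and> F' x \<noteq> 0) \<and>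
   (\<forall>x\<in>ball y r. x \<in> \<Omega> \<longleftrightarrow> F x < (0::real))" if "y \<in> frontier \<Omega>" for y
 proof -
  from bd that obtain A \<psi> where ch: "graph_chart 3 \<Omega> y A \<psi>" unfolding C_boundary_def by blast
  obtain r where A: "orthogonal_transformation A" and \<psi>: "C_on 3 UNIV \<psi>" and r: "r > 0"
   and ball: "\<And>x. x \<in> ball y r ==> x \<in> \<Omega> \<longleftrightarrow> chart_fun y A \<psi> x < 0" by (rule graph_chartE[OF ch]) blast
  note inv = orthogonal_transformation_inner_inv[OF A]
  obtain g where g: "\<And>x. (\<psi> has_derivative (%h. g x \<bullet> h)) (at x)"
   using \<psi> unfolding numeral_3_eq_3 C_on_Suc[of "Suc (Suc 0)"] by auto
  define F' where "F' x = inv A (g (fst (A (x - y))), - 1)" for x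
  have "(chart_fun y A \<psi> has_derivative (%v. F' x \<bullet> v)) (at x)" for x
   using chart_fun_derivative[OF A g, of y x] by (simp add: F'_def inv(1))
  moreover have "F' x \<noteq> 0" for x
  proof
   assume "F' x = 0"
   then have "A (F' x) = 0" using A orthogonal_transformation_linear linear_0 by fastforce
   then show False by (simp add: F'_def inv(2) zero_prod_def)
  qed
  ultimately show ?thesis using r ball C_on_chart_fun[OF A \<psi>] by blast
 qed
 obtain h h' L where h: "C_on 3 UNIV h" "\<And>x. (h has_derivative (%v. h' x \<bullet> v)) (at x)"
  "\<And>x. (h' has_derivative L x) (at x)" "\<And>v w. continuous_on UNIV (%x. L x v \<bullet> w)"
  "\<And>b. b \<in> Basis ==> C_on 2 UNIV (%x. h' x \<bullet> b)"
  "\<And>x. h x < 0 \<longleftrightarrow> x \<in> \<Omega>" "\<And>x. x \<in> frontier \<Omega> ==> h x = 0"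
  and grad: "\<And>x. x \<in> frontier \<Omega> ==> \<exists>s>0. \<exists>\<nu>. is_outer_normal \<Omega> x \<nu> \<and> h' x = s *\<^sub>R \<nu>"
  by (rule defining_function_from_local[OF op bdd loc]) blast+
 have nrm: "\<exists>s>0. h' x = s *\<^sub>R outward_normal \<Omega> x" if x: "x \<in> frontier \<Omega>" for x
  using grad[OF x] outward_normal[OF bd _ x] is_outer_normal_unique by (metis one_le_numeral)
 show ?thesis by (rule that[OF h nrm])
qed

lemma frontier_nonempty:
 fixes \<Omega> :: "'m::finite space set"
 assumes "\<Omega> \<noteq> {}" "bounded \<Omega>" shows "frontier \<Omega> \<noteq> {}"
 using assms frontier_eq_empty[of \<Omega>] not_bounded_UNIV by metis

lemma compact_continuous_bounded:
 fixes f :: "'x::topological_space => 'b::real_normed_vector"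
 assumes "compact S" "continuous_on S f"
 obtains B where "B > 0" "\<And>x. x \<in> S ==> norm (f x) <= B"
proof -
 have "bounded (f ` S)" using compact_continuous_image[OF assms(2,1)] compact_imp_bounded by blast
 then obtain B where "B > 0" "\<forall>y\<in>f ` S. norm y <= B" unfolding bounded_pos by blast
 then show ?thesis using that[of B] by blast
qed

lemma linear_family_bounded:
 fixes L :: "'x::t2_space => 'a::euclidean_space => 'b::euclidean_space"
 assumes K: "compact K" and L: "\<And>x. x \<in> K ==> linear (L x)"
  and c: "\<And>v w. continuous_on K (%x. L x v \<bullet> w)"
 obtains M where "M > 0" "\<And>x v. x \<in> K ==> norm (L x v) <= M * norm v"
proof -
 have "continuous_on K (%x. L x b)" for b by (subst continuous_on_componentwise) (use c in blast)
 then have "continuous_on K (%x. \<Sum>b\<in>Basis. norm (L x b))" by (intro continuous_intros)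
 from compact_continuous_bounded[OF K this] obtain M where M: "M > 0"
  "\<And>x. x \<in> K ==> norm (\<Sum>b\<in>Basis. norm (L x b)) <= M" by blast
 have "norm (L x v) <= M * norm v" if x: "x \<in> K" for x v
 proof -
  have "L x v = L x (\<Sum>b\<in>Basis. (v \<bullet> b) *\<^sub>R b)" by (simp add: euclidean_representation)
  also have "... = (\<Sum>b\<in>Basis. (v \<bullet> b) *\<^sub>R L x b)" using L[OF x] by (simp add: linear_sum linear_cmul)
  also have "norm ... <= (\<Sum>b\<in>Basis. norm v * norm (L x b))"
   by (rule sum_norm_le) (auto intro!: mult_right_mono simp: Basis_le_norm)
  also have "... <= norm v * M" using M(2)[OF x] by (simp add: sum_distrib_left[symmetric] mult_left_mono abs_le_iff)
  finally show ?thesis by (simp add: mult.commute)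
 qed
 then show ?thesis using that M(1) by blast
qed

lemma C1_Lipschitz:
 fixes g :: "'a::euclidean_space => 'b::euclidean_space"
 assumes g: "\<And>x. (g has_derivative L x) (at x)" and c: "\<And>v w. continuous_on UNIV (%x. L x v \<bullet> w)"
 obtains M where "M > 0" "\<And>x y. x \<in> cball 0 R ==> y \<in> cball 0 R ==> norm (g x - g y) <= M * norm (x - y)"
proof -
 have lin: "linear (L x)" for x using g has_derivative_linear by blast
 obtain M where M: "M > 0" "\<And>x v. x \<in> cball 0 R ==> norm (L x v) <= M * norm v"
  by (rule linear_family_bounded[OF compact_cball lin continuous_on_subset[OF c subset_UNIV]]) blast
 have "norm (g x - g y) <= M * norm (x - y)" if "x \<in> cball 0 R" "y \<in> cball 0 R" for x y
 proof (rule differentiable_bound[of "cball 0 R" g L])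
  show "onorm (L z) <= M" if "z \<in> cball 0 R" for z using M(2)[OF that] by (rule onorm_le)
 qed (use that has_derivative_at_withinI[OF g] in auto)
 then show ?thesis using that M(1) by blast
qed

text \<open>Taylor's formula of second order as a one-sided bound, which is the form used for interior balls.\<close>

lemma C1_Lipschitz_gradient:
 fixes h :: "'a::euclidean_space => real"
 assumes h: "\<And>x. (h has_derivative (%v. h' x \<bullet> v)) (at x)"
  and L: "\<And>x. (h' has_derivative L x) (at x)" "\<And>v w. continuous_on UNIV (%x. L x v \<bullet> w)"
 shows "\<exists>M>0. \<forall>x\<in>cball 0 R. \<forall>y\<in>cball 0 R. h x <= h y + h' y \<bullet> (x - y) + M * (norm (x - y))\<^sup>2"
proof -
 obtain K where K: "K > 0"
  and lip: "\<And>x y. x \<in> cball 0 R ==> y \<in> cball 0 R ==> norm (h' x - h' y) <= K * norm (x - y)"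
  by (rule C1_Lipschitz[OF L, of R]) blast
 have "h x <= h y + h' y \<bullet> (x - y) + K * (norm (x - y))\<^sup>2" if xy: "x \<in> cball 0 R" "y \<in> cball 0 R" for x y
 proof -
  have der: "((%s. h (y + s *\<^sub>R (x - y))) has_real_derivative h' (y + s *\<^sub>R (x - y)) \<bullet> (x - y)) (at s)" for s
   by (rule DERIV_along_line[OF h])
  obtain s where s: "0 < s" "s < 1" "h (y + 1 *\<^sub>R (x - y)) - h (y + 0 *\<^sub>R (x - y)) = (1 - 0) * (h' (y + s *\<^sub>R (x - y)) \<bullet> (x - y))"
   using MVT2[of 0 1 "%s. h (y + s *\<^sub>R (x - y))" "%s. h' (y + s *\<^sub>R (x - y)) \<bullet> (x - y)"] der by auto
  let ?z = "y + s *\<^sub>R (x - y)"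
  have z: "?z \<in> cball 0 R"
  proof -
   have "?z = (1 - s) *\<^sub>R y + s *\<^sub>R x" by (simp add: algebra_simps)
   then show ?thesis using convexD_alt[OF convex_cball xy(2,1), of s] s by simp
  qed
  have "norm (h' ?z - h' y) <= K * norm (?z - y)" by (rule lip[OF z xy(2)])
  also have "... <= K * norm (x - y)"
   using s K by (intro mult_left_mono) (auto intro: mult_left_le_one_le)
  finally have "(h' ?z - h' y) \<bullet> (x - y) <= K * norm (x - y) * norm (x - y)"
   using norm_cauchy_schwarz[of "h' ?z - h' y" "x - y"] by (meson mult_right_mono norm_ge_zero order_trans)
  then show ?thesis using s(3) by (simp add: inner_diff_left power2_eq_square)
 qed
 then show ?thesis using K by blast
qed

text \<open>By the second order expansion of a defining function, balls of one fixed small radius touch the boundary from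
 inside at every point. This makes the infimum over the boundary positive, and since touching balls of
 smaller radius lie in touching balls of larger radius, every radius below the infimum is admissible.\<close>

lemma K0_properties:
 fixes \<Omega> :: "'m::finite space set"
 assumes bd: "C_boundary 3 \<Omega>" and op: "open \<Omega>" and bdd: "bounded \<Omega>" and ne: "\<Omega> \<noteq> {}"
 shows "K0 \<Omega> > 0"
  and "y \<in> frontier \<Omega> ==> 0 < r ==> r < K0 \<Omega> ==> ball (y - r *\<^sub>R outward_normal \<Omega> y) r \<subseteq> \<Omega>"
proof -
 let ?n = "outward_normal \<Omega>"
 obtain h h' L where h: "C_on 3 UNIV h" "\<And>x. (h has_derivative (%v. h' x \<bullet> v)) (at x)"
  "\<And>x. (h' has_derivative L x) (at x)" "\<And>v w. continuous_on UNIV (%x. L x v \<bullet> w)"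
  "\<And>b. b \<in> Basis ==> C_on 2 UNIV (%x. h' x \<bullet> b)"
  "\<And>x. h x < 0 \<longleftrightarrow> x \<in> \<Omega>" "\<And>x. x \<in> frontier \<Omega> ==> h x = 0"
  "\<And>x. x \<in> frontier \<Omega> ==> \<exists>s>0. h' x = s *\<^sub>R ?n x"
  by (rule defining_function[OF bd op bdd]) (rule that)
 have n1: "norm (?n y) = 1" if "y \<in> frontier \<Omega>" for y
  using outward_normal[OF bd _ that] by (simp add: is_outer_normal_def)
 have fne: "frontier \<Omega> \<noteq> {}" using frontier_nonempty ne bdd by blast
 have fcomp: "compact (frontier \<Omega>)" using bdd by (rule compact_frontier_bounded)
 have h'c: "continuous_on UNIV h'"
  using h(3) has_derivative_continuous by (metis continuous_at_imp_continuous_on)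
 have nh': "h' y = norm (h' y) *\<^sub>R ?n y" "norm (h' y) > 0" if "y \<in> frontier \<Omega>" for y
  using h(8)[OF that] n1[OF that] by auto
 obtain y0 where y0: "y0 \<in> frontier \<Omega>" "\<And>y. y \<in> frontier \<Omega> ==> norm (h' y0) <= norm (h' y)"
  using continuous_attains_inf[OF fcomp fne, of "%y. norm (h' y)"] h'c
  by (metis continuous_on_norm continuous_on_subset top_greatest)
 define s0 where "s0 = norm (h' y0)"
 have s0: "s0 > 0" using nh' y0 by (auto simp: s0_def)
 have "compact (closure \<Omega>)" using bdd by simp
 from compact_continuous_bounded[OF this continuous_on_id] obtain R where R: "R > 0" "closure \<Omega> \<subseteq> cball 0 R"
  by (auto simp: subset_iff)
 from C1_Lipschitz_gradient[OF h(2-4), of "R + 2"] obtain M where M: "M > 0"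
  "\<And>x y. x \<in> cball 0 (R + 2) ==> y \<in> cball 0 (R + 2) ==> h x <= h y + h' y \<bullet> (x - y) + M * (norm (x - y))\<^sup>2" by blast
 define r0 where "r0 = min 1 (s0 / (2 * M))"
 have r0: "r0 > 0" using s0 M by (auto simp: r0_def)
 have ball0: "ball (y - r0 *\<^sub>R ?n y) r0 \<subseteq> \<Omega>" if y: "y \<in> frontier \<Omega>" for y
 proof
  fix x assume "x \<in> ball (y - r0 *\<^sub>R ?n y) r0"
  then have "norm ((x - y) + r0 *\<^sub>R ?n y) < r0" by (simp add: dist_norm norm_minus_commute algebra_simps)
  then have "(norm ((x - y) + r0 *\<^sub>R ?n y))\<^sup>2 < r0\<^sup>2" by (intro power_strict_mono) auto
  moreover have "?n y \<bullet> ?n y = 1" using n1[OF y] by (simp add: norm_eq_1)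
  ultimately have lt: "(norm (x - y))\<^sup>2 + 2 * r0 * (?n y \<bullet> (x - y)) < 0"
   unfolding power2_norm_eq_inner
   by (simp add: inner_add_left inner_add_right inner_commute power2_eq_square algebra_simps)
  have yR: "norm y <= R" using R y by (auto simp: frontier_def)
  have "norm (x - y) <= norm ((x - y) + r0 *\<^sub>R ?n y) + norm (r0 *\<^sub>R ?n y)"
   by (metis add_diff_cancel norm_triangle_ineq4)
  moreover have "norm (r0 *\<^sub>R ?n y) = r0" using n1[OF y] r0 by simp
  moreover have "r0 <= 1" by (simp add: r0_def)
  ultimately have "norm (x - y) <= 2" using \<open>norm ((x - y) + r0 *\<^sub>R ?n y) < r0\<close> by linarith
  then have "norm x <= R + 2" using yR norm_triangle_ineq2[of x y] by linarith
  then have "h x <= h y + h' y \<bullet> (x - y) + M * (norm (x - y))\<^sup>2" using yR by (intro M(2)) auto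
  also have "... = norm (h' y) * (?n y \<bullet> (x - y)) + M * (norm (x - y))\<^sup>2"
   using nh'(1)[OF y] h(7)[OF y] by (metis add_0 inner_scaleR_left)
  also have "... < 0"
  proof -
   have neg: "?n y \<bullet> (x - y) < 0"
    using lt r0 zero_le_power2[of "norm (x - y)"] by (smt (verit) mult_nonneg_nonneg)
   have "norm (h' y) * (?n y \<bullet> (x - y)) <= s0 * (?n y \<bullet> (x - y))"
    using neg y0(2)[OF y] by (intro mult_right_mono_neg) (auto simp: s0_def)
   moreover have "2 * r0 * M <= s0" using M(1) by (simp add: r0_def min_def field_simps)
   then have "2 * r0 * M * (?n y \<bullet> (x - y)) \<ge> s0 * (?n y \<bullet> (x - y))"
    using neg by (intro mult_right_mono_neg) auto
   moreover have "M * ((norm (x - y))\<^sup>2 + 2 * r0 * (?n y \<bullet> (x - y))) < 0" using M(1) lt by (simp add: mult_pos_neg)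
   ultimately show ?thesis by (simp add: algebra_simps)
  qed
  finally show "x \<in> \<Omega>" using h(6) by blast
 qed
 define B where "B y = {r. r > 0 \<and> ball (y - r *\<^sub>R ?n y) r \<subseteq> \<Omega>}" for y
 have bB: "bdd_above (B y)" for y
 proof (rule bdd_aboveI)
  fix r assume "r \<in> B y"
  then have r: "r > 0" "ball (y - r *\<^sub>R ?n y) r \<subseteq> \<Omega>" by (auto simp: B_def)
  have "ball (y - r *\<^sub>R ?n y) r \<subseteq> cball 0 R" using r(2) R(2) closure_subset[of \<Omega>] by blast
  then have "dist (y - r *\<^sub>R ?n y) 0 + r <= R" using r(1) by (simp add: ball_subset_cball_iff)
  then show "r <= R + 1" using zero_le_dist[of "y - r *\<^sub>R ?n y" 0] by linarith
 qed
 have r0B: "r0 \<in> B y" if "y \<in> frontier \<Omega>" for y using r0 ball0[OF that] by (simp add: B_def)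
 have K0at: "K0_at \<Omega> y = Sup (B y)" for y by (simp add: K0_at_def B_def)
 have K0at_ge: "K0_at \<Omega> y \<ge> r0" if "y \<in> frontier \<Omega>" for y
  unfolding K0at using r0B[OF that] bB by (rule cSup_upper)
 have "K0 \<Omega> \<ge> r0" unfolding K0_def using fne K0at_ge by (rule cINF_greatest)
 then show "K0 \<Omega> > 0" using r0 by linarith
 show "ball (y - r *\<^sub>R ?n y) r \<subseteq> \<Omega>" if y: "y \<in> frontier \<Omega>" and r: "0 < r" "r < K0 \<Omega>"
 proof -
  have "K0 \<Omega> <= K0_at \<Omega> y" unfolding K0_def
  proof (rule cINF_lower[OF _ y])
   show "bdd_below (K0_at \<Omega> ` frontier \<Omega>)" using K0at_ge by (rule bdd_belowI2)
  qed
  then have "r < Sup (B y)" using r by (simp add: K0at)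
  then obtain r' where r': "r' \<in> B y" "r < r'" using less_cSupD[of "B y" r] r0B[OF y] by auto
  have "dist (y - r *\<^sub>R ?n y) (y - r' *\<^sub>R ?n y) = r' - r"
  proof -
   have "(y - r *\<^sub>R ?n y) - (y - r' *\<^sub>R ?n y) = (r' - r) *\<^sub>R ?n y" by (simp add: algebra_simps)
   then show ?thesis using r' n1[OF y] by (simp add: dist_norm)
  qed
  then have "ball (y - r *\<^sub>R ?n y) r \<subseteq> ball (y - r' *\<^sub>R ?n y) r'"
   using r r' by (subst ball_subset_ball_iff) auto
  then show ?thesis using r' by (auto simp: B_def)
 qed
qed

section \<open>Curvature of the boundary\<close>

lemma second_derivative_symmetric:
 fixes f :: "'a::euclidean_space => real"
 assumes S: "open S" "x0 \<in> S"
  and g: "\<And>x. x \<in> S ==> (f has_derivative (%h. g x \<bullet> h)) (at x)"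
  and L: "\<And>x. x \<in> S ==> (g has_derivative L x) (at x)"
  and c: "continuous_on S (%x. L x b \<bullet> a)"
 shows "L x0 a \<bullet> b = L x0 b \<bullet> a"
proof -
 define Z where "Z z = x0 + fst z *\<^sub>R a + snd z *\<^sub>R b" for z :: "real \<times> real"
 have "open (Z -` S)" unfolding Z_def[abs_def] by (intro open_vimage S continuous_intros)
 moreover have "(0, 0) \<in> Z -` S" using S by (simp add: Z_def)
 ultimately obtain r where r: "r > 0" "ball (0, 0) r \<subseteq> Z -` S" using open_contains_ball by blast
 define e where "e = r / 2"
 have e: "e > 0" using r by (simp add: e_def)
 have inS: "x0 + s *\<^sub>R a + t *\<^sub>R b \<in> S" if "\<bar>s\<bar> < e" "\<bar>t\<bar> < e" for s t
 proof -
  have "norm (s, t) < r" using norm_Pair_le[of s t] that by (simp add: e_def)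
  then have "(s, t) \<in> ball (0, 0) r" by (simp add: dist_norm norm_Pair)
  then have "(s, t) \<in> Z -` S" using r(2) by blast
  then show ?thesis by (simp add: Z_def)
 qed
 have dg: "((%x. g x \<bullet> w) has_derivative (%v. L x v \<bullet> w)) (at x)" if "x \<in> S" for x w
  using L[OF that] by (rule has_derivative_inner_left)
 have lineb: "((%t. x0 + s *\<^sub>R a + t *\<^sub>R b) has_derivative (%h. h *\<^sub>R b)) (at t)"
  and linea: "((%s. x0 + s *\<^sub>R a + t *\<^sub>R b) has_derivative (%h. h *\<^sub>R a)) (at s)" for s t
  by (auto intro!: derivative_eq_intros)
 have lin: "linear (L x)" if "x \<in> S" for x
  using L[OF that] has_derivative_linear by blast
 show ?thesis
 proof (rule mixed_partials_commute[of e "%s t. f (x0 + s *\<^sub>R a + t *\<^sub>R b)" "%s t. g (x0 + s *\<^sub>R a + t *\<^sub>R b) \<bullet> a"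
   "%s t. L (x0 + s *\<^sub>R a + t *\<^sub>R b) b \<bullet> a" "%s t. g (x0 + s *\<^sub>R a + t *\<^sub>R b) \<bullet> b" "L x0 a \<bullet> b", simplified])
  show "0 < e" by (rule e)
  fix s t :: real assume st: "\<bar>s\<bar> < e" "\<bar>t\<bar> < e"
  let ?x = "x0 + s *\<^sub>R a + t *\<^sub>R b"
  show "((%s. f (x0 + s *\<^sub>R a + t *\<^sub>R b)) has_real_derivative g ?x \<bullet> a) (at s)"
   using diff_chain_at[OF linea g[OF inS[OF st]]]
   by (simp add: o_def has_field_derivative_def mult.commute[of _ "g ?x \<bullet> a"])
  show "((%t. g (x0 + s *\<^sub>R a + t *\<^sub>R b) \<bullet> a) has_real_derivative L ?x b \<bullet> a) (at t)"
   using diff_chain_at[OF lineb dg[OF inS[OF st], of a]] lin[OF inS[OF st]]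
   by (simp add: o_def has_field_derivative_def mult.commute[of _ "L ?x b \<bullet> a"] linear_cmul)
 next
  fix s :: real assume s: "\<bar>s\<bar> < e"
  have x: "x0 + s *\<^sub>R a + 0 *\<^sub>R b \<in> S" using inS[OF s, of 0] e by simp
  show "((%t. f (x0 + s *\<^sub>R a + t *\<^sub>R b)) has_real_derivative g (x0 + s *\<^sub>R a) \<bullet> b) (at 0)"
   using diff_chain_at[OF lineb g[OF x]]
   by (simp add: o_def has_field_derivative_def mult.commute[of _ "g (x0 + s *\<^sub>R a) \<bullet> b"])
 next
  have x: "x0 + 0 *\<^sub>R a + 0 *\<^sub>R b \<in> S" using S by simp
  show "((%s. g (x0 + s *\<^sub>R a) \<bullet> b) has_real_derivative L x0 a \<bullet> b) (at 0)"
   using diff_chain_at[OF linea dg[OF x, of b]] lin[OF S(2)]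
   by (simp add: o_def has_field_derivative_def mult.commute[of _ "L x0 a \<bullet> b"] linear_cmul)
 next
  have "continuous (at x0) (%x. L x b \<bullet> a)" using c S continuous_on_eq_continuous_at by blast
  moreover have "isCont Z (0, 0)" unfolding Z_def[abs_def] by (intro continuous_intros)
  ultimately have "isCont (%z. L (Z z) b \<bullet> a) (0, 0)"
   using isCont_o2[of "(0, 0)" Z "%x. L x b \<bullet> a"] by (simp add: Z_def)
  then have "isCont (%z::real\<times>real. L (x0 + fst z *\<^sub>R a + snd z *\<^sub>R b) b \<bullet> a) (0, 0)"
   by (simp add: Z_def)
  then show "isCont (%(s, t). L (x0 + s *\<^sub>R a + t *\<^sub>R b) b \<bullet> a) (0, 0)"
   by (simp add: case_prod_beta')
 qed
qed

text \<open>The reflection in the hyperplane orthogonal to \<open>a - b\<close> moves \<open>a\<close> to \<open>b\<close>.\<close>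

lemma reflection_exists:
 fixes a b :: "'a::euclidean_space"
 assumes "norm a = norm b"
 shows "\<exists>A. orthogonal_transformation A \<and> A a = b"
proof (cases "a = b")
 case True
 then show ?thesis by (intro exI[of _ "%x. x"]) (simp add: orthogonal_transformation_id)
next
 case False
 define v where "v = a - b"
 have v: "v \<bullet> v \<noteq> 0" using False by (simp add: v_def)
 define A where "A x = x - (2 * (x \<bullet> v) / (v \<bullet> v)) *\<^sub>R v" for x
 have "linear A"
 proof (rule linearI)
  show "A (x + y) = A x + A y" for x y
   by (simp add: A_def inner_add_left distrib_left add_divide_distrib scaleR_left_distrib)
  show "A (c *\<^sub>R x) = c *\<^sub>R A x" for c x
   by (simp add: A_def scaleR_diff_right mult.left_commute)
 qed
 moreover have "A x \<bullet> A y = x \<bullet> y" for x y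
 proof -
  define c where "c x = 2 * (x \<bullet> v) / (v \<bullet> v)" for x
  have cv: "c y * (v \<bullet> v) = 2 * (y \<bullet> v)" using v by (simp add: c_def)
  have "(x - a *\<^sub>R v) \<bullet> (y - b *\<^sub>R v) = x \<bullet> y - b * (x \<bullet> v) - a * (y \<bullet> v) + a * (b * (v \<bullet> v))" for a b :: real
   by (simp add: inner_diff_left inner_diff_right inner_commute algebra_simps)
  then have "A x \<bullet> A y = x \<bullet> y - c y * (x \<bullet> v) - c x * (y \<bullet> v) + c x * (c y * (v \<bullet> v))"
   by (simp only: A_def c_def)
  moreover have "c y * (x \<bullet> v) = c x * (y \<bullet> v)" by (simp add: c_def)
  ultimately show ?thesis by (simp add: cv)
 qed
 moreover have "A a = b"
 proof -
  have "a \<bullet> a = b \<bullet> b" using assms by (simp add: norm_eq)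
  then have "v \<bullet> v = 2 * (a \<bullet> v)" by (simp add: v_def inner_diff_left inner_diff_right inner_commute)
  then have "2 * (a \<bullet> v) / (v \<bullet> v) = (v \<bullet> v) / (v \<bullet> v)" by (rule arg_cong[OF sym])
  also have "... = 1" using v by simp
  finally have "2 * (a \<bullet> v) / (v \<bullet> v) = 1" .
  then have "A a = a - v" by (simp only: A_def scaleR_one)
  then show ?thesis by (simp add: v_def)
 qed
 ultimately show ?thesis unfolding orthogonal_transformation_def by blast
qed

text \<open>Strict decrease in the last variable, with slope at least \<open>a\<close>, gives exactly one zero on each vertical line; the
 bound on the horizontal gradient makes the zero Lipschitz, and then first order expansion of \<open>F\<close> differentiates
 it. The uniform bounds replace the usual localisation, as a chart must be a graph over the whole space.\<close>

lemma global_implicit_function: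
 fixes F :: "'m::finite space => real"
 assumes F: "\<And>w. (F has_derivative (%v. F' w \<bullet> v)) (at w)"
  and F': "\<And>b. b \<in> Basis ==> C_on k UNIV (%w. F' w \<bullet> b)"
  and a: "a > 0" "\<And>w. snd (F' w) <= - a" and B: "\<And>w. norm (fst (F' w)) <= B"
 obtains \<psi> where "\<And>x t. F (x, t) < 0 \<longleftrightarrow> \<psi> x < t" "\<And>x t. F (x, t) = 0 \<longleftrightarrow> \<psi> x = t" "C_on (Suc k) UNIV \<psi>"
proof -
 have der: "((%t. F (x, t)) has_real_derivative snd (F' (x, t))) (at t)" for x t
  using DERIV_along_line[of F "%v. F' (x, t) \<bullet> v" "(x, 0)" t "(0, 1)"] F[of "(x,t)"] by (simp add: inner_prod_def)
 have decr: "F (x, t2) <= F (x, t1) - a * (t2 - t1)" if "t1 <= t2" for x t1 t2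
 proof (cases "t1 = t2")
  case False
  with that have "t1 < t2" by simp
  from MVT2[OF this der, of x] obtain z where "F (x, t2) - F (x, t1) = (t2 - t1) * snd (F' (x, z))" by blast
  moreover have "(t2 - t1) * snd (F' (x, z)) <= (t2 - t1) * (- a)" using that a(2) by (intro mult_left_mono) auto
  ultimately show ?thesis by (simp add: algebra_simps)
 qed simp
 have B0: "B \<ge> 0" using B[of 0] norm_ge_zero order_trans by blast
 have "\<exists>t. F (x, t) = 0" for x
 proof -
  define T where "T = \<bar>F (x, 0)\<bar> / a"
  have T: "T \<ge> 0" "a * T = \<bar>F (x, 0)\<bar>" using a(1) by (auto simp: T_def)
  have "F (x, T) <= 0" using decr[of 0 T x] T by simp
  moreover have "F (x, - T) \<ge> 0" using decr[of "-T" 0 x] T by simp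
  moreover have "continuous_on {-T..T} (%t. F (x, t))"
   using der DERIV_isCont by (metis continuous_at_imp_continuous_on)
  ultimately show ?thesis using IVT2'[of "%t. F (x, t)" T 0 "-T"] T(1) by auto
 qed
 then obtain \<psi> where \<psi>: "\<And>x. F (x, \<psi> x) = 0" by metis
 have sgn: "F (x, t) < 0 \<longleftrightarrow> \<psi> x < t" for x t
 proof (cases "\<psi> x < t")
  case True
  then have "a * (t - \<psi> x) > 0" using a by simp
  then show ?thesis using decr[of "\<psi> x" t x] \<psi>[of x] True by simp
 next
  case False
  then have "a * (\<psi> x - t) \<ge> 0" using a by simp
  then show ?thesis using decr[of t "\<psi> x" x] \<psi>[of x] False by simp
 qed
 define L where "L = B / a"
 have L0: "L \<ge> 0" using B0 a by (simp add: L_def)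
 have lip: "\<bar>\<psi> x - \<psi> y\<bar> <= L * norm (x - y)" for x y
 proof -
  have "norm (F (x, \<psi> y) - F (y, \<psi> y)) <= B * norm (x - y)"
  proof (rule differentiable_bound[of UNIV "%x. F (x, \<psi> y)" "%z v. fst (F' (z, \<psi> y)) \<bullet> v"])
   show "((%x. F (x, \<psi> y)) has_derivative (%v. fst (F' (z, \<psi> y)) \<bullet> v)) (at z within UNIV)" for z
   proof -
    have "((%x. (x, \<psi> y)) has_derivative (%v. (v, 0))) (at z)" by (auto intro!: derivative_eq_intros)
    from diff_chain_at[OF this F] show ?thesis by (simp add: o_def inner_prod_def)
   qed
   show "onorm (%v. fst (F' (z, \<psi> y)) \<bullet> v) <= B" for z
    using B[of "(z, \<psi> y)"] Cauchy_Schwarz_ineq2[of "fst (F' (z, \<psi> y))"]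
    by (intro onorm_le) (metis mult_right_mono norm_ge_zero order_trans real_norm_def)
  qed auto
  then have 1: "\<bar>F (x, \<psi> y)\<bar> <= B * norm (x - y)" using \<psi> by simp
  have "a * \<bar>\<psi> x - \<psi> y\<bar> <= \<bar>F (x, \<psi> y)\<bar>"
   using decr[of "\<psi> x" "\<psi> y" x] decr[of "\<psi> y" "\<psi> x" x] \<psi>[of x] by (cases "\<psi> x <= \<psi> y") auto
  then show ?thesis using 1 a(1) by (simp add: L_def field_simps)
 qed
 define g where "g x = (1 / (- snd (F' (x, \<psi> x)))) *\<^sub>R fst (F' (x, \<psi> x))" for x
 have der\<psi>: "(\<psi> has_derivative (%v. g x \<bullet> v)) (at x)" for x
  unfolding has_derivative_at_alt
 proof (intro conjI allI impI)
  show "bounded_linear (%v. g x \<bullet> v)" by (rule bounded_linear_inner_right)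
  fix e :: real assume e: "e > 0"
  let ?p = "(x, \<psi> x)"
  have "e * a / (1 + L) > 0" using e a L0 by simp
  then obtain d where d: "d > 0"
   "\<And>q. norm (q - ?p) < d ==> norm (F q - F ?p - F' ?p \<bullet> (q - ?p)) <= e * a / (1 + L) * norm (q - ?p)"
   using F[of ?p] unfolding has_derivative_at_alt by blast
  show "\<exists>d>0. \<forall>y. norm (y - x) < d --> norm (\<psi> y - \<psi> x - g x \<bullet> (y - x)) <= e * norm (y - x)"
  proof (intro exI[of _ "d / (1 + L)"] conjI allI impI)
   show "d / (1 + L) > 0" using d L0 by simp
   fix y assume y: "norm (y - x) < d / (1 + L)"
   let ?q = "(y, \<psi> y)"
   have nq: "norm (?q - ?p) <= (1 + L) * norm (y - x)"
    using norm_Pair_le[of "y - x" "\<psi> y - \<psi> x"] lip[of y x] by (simp add: algebra_simps)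
   also have "... < d" using y L0 by (simp add: field_simps)
   finally have "norm (F ?q - F ?p - F' ?p \<bullet> (?q - ?p)) <= e * a / (1 + L) * norm (?q - ?p)" by (rule d(2))
   also have "... <= e * a / (1 + L) * ((1 + L) * norm (y - x))" using nq e a L0 by (intro mult_left_mono) auto
   also have "... = e * a * norm (y - x)" using L0 by simp
   finally have 1: "\<bar>F' ?p \<bullet> (?q - ?p)\<bar> <= e * a * norm (y - x)" using \<psi> by simp
   have sn: "snd (F' ?p) < 0" using a(2)[of ?p] a(1) by linarith
   have "\<psi> y - \<psi> x - g x \<bullet> (y - x) = (F' ?p \<bullet> (?q - ?p)) / snd (F' ?p)"
    using sn by (simp add: g_def inner_prod_def field_simps)
   then have "norm (\<psi> y - \<psi> x - g x \<bullet> (y - x)) = \<bar>F' ?p \<bullet> (?q - ?p)\<bar> / \<bar>snd (F' ?p)\<bar>" by (simp add: abs_divide)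
   also have "... <= \<bar>F' ?p \<bullet> (?q - ?p)\<bar> / a" using sn a by (intro divide_left_mono) (auto intro: mult_neg_pos, smt (verit))
   also have "... <= e * norm (y - x)" using 1 a(1) by (simp add: field_simps)
   finally show "norm (\<psi> y - \<psi> x - g x \<bullet> (y - x)) <= e * norm (y - x)" .
  qed
 qed
 have "j <= Suc k ==> C_on j UNIV \<psi>" for j
 proof (induction j)
  case 0
  have "continuous_on UNIV \<psi>" using der\<psi> has_derivative_continuous by (metis continuous_at_imp_continuous_on)
  then show ?case by (simp add: C_on_0)
 next
  case (Suc j)
  then have IH: "C_on j UNIV \<psi>" by simp
  have comp: "C_on j UNIV (%x. F' (x, \<psi> x) \<bullet> b)" if b: "b \<in> Basis" for b
  proof (rule C_on_compose[of j UNIV "%w. F' w \<bullet> b"])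
   show "C_on j UNIV (%w. F' w \<bullet> b)" using F'[OF b] Suc.prems C_on_le by blast
   fix c :: "'m space"
   have "C_on j UNIV (%x. x \<bullet> fst c + snd c * \<psi> x)"
    using IH by (rule C_on_add[OF C_on_linear[OF linear_inner_comp[OF linear_id[unfolded id_def]]] C_on_mult[OF C_on_const]])
   then show "C_on j UNIV (%x. (x, \<psi> x) \<bullet> c)" by (simp add: inner_prod_def mult.commute)
  qed auto
  have "C_on j UNIV (%x. g x \<bullet> b)" if b: "b \<in> Basis" for b
  proof -
   have "(b, 0::real) \<in> Basis" "(0 :: real ^ 'm, 1::real) \<in> Basis" using b by (auto simp: Basis_prod_def)
   from comp[OF this(1)] comp[OF this(2)]
   have c: "C_on j UNIV (%x. fst (F' (x, \<psi> x)) \<bullet> b)" "C_on j UNIV (%x. snd (F' (x, \<psi> x)))"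
    by (simp_all add: inner_prod_def)
   have pos: "0 < - snd (F' w)" for w using a(2)[of w] a(1) by linarith
   have "C_on j UNIV (%x. (- snd (F' (x, \<psi> x))) powr (-1) * (fst (F' (x, \<psi> x)) \<bullet> b))"
    using c pos by (intro C_on_mult C_on_powr C_on_uminus) auto
   moreover have "(- snd (F' (x, \<psi> x))) powr (-1) * (fst (F' (x, \<psi> x)) \<bullet> b) = g x \<bullet> b" for x
    using pos[of "(x, \<psi> x)"] by (simp add: powr_minus_divide g_def abs_of_neg)
   ultimately show ?thesis by (simp only:)
  qed
  then show ?case unfolding C_on_Suc using der\<psi> by blast
 qed
 moreover have "F (x, t) = 0 \<longleftrightarrow> \<psi> x = t" for x t
 proof
  assume 0: "F (x, t) = 0"
  then have "\<not> \<psi> x < t" using sgn[of x t] by simp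
  moreover have "\<not> t < \<psi> x"
  proof
   assume "t < \<psi> x"
   then have "a * (\<psi> x - t) > 0" using a by simp
   then show False using decr[of t "\<psi> x" x] \<psi>[of x] 0 \<open>t < \<psi> x\<close> by simp
  qed
  ultimately show "\<psi> x = t" by simp
 qed (use \<psi> in auto)
 ultimately show ?thesis using that[of \<psi>] sgn by blast
qed

text \<open>A function that vanishes to second order at the origin keeps a small gradient when it is cut off on a small ball:
 near the origin it is bounded by \<open>M |w|\<^sup>2\<close> and its gradient by \<open>M |w|\<close>, whereas the cutoff has a gradient of
 size \<open>1 / \<epsilon>\<close>.\<close>

lemma cutoff_extension:
 fixes E :: "'a::euclidean_space => real"
 assumes E: "C_on 3 UNIV E" "(E has_derivative (%v. 0)) (at 0)" "E 0 = 0" and c: "c > 0"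
 obtains G G' \<rho> where "\<rho> > 0" "\<And>w. w \<in> ball 0 \<rho> ==> G w = E w"
  "\<And>w. (G has_derivative (%v. G' w \<bullet> v)) (at w)" "\<And>b. b \<in> Basis ==> C_on 2 UNIV (%w. G' w \<bullet> b)"
  "\<And>w. norm (G' w) <= c"
proof -
 obtain E' L where E': "\<And>w. (E has_derivative (%v. E' w \<bullet> v)) (at w)" "\<And>w. (E' has_derivative L w) (at w)"
  "\<And>v w. continuous_on UNIV (%x. L x v \<bullet> w)" "\<And>b. b \<in> Basis ==> C_on 2 UNIV (%w. E' w \<bullet> b)"
  using C_on_gradient_field[OF E(1)[unfolded numeral_3_eq_3]] unfolding numeral_2_eq_2 by (metis UNIV_I)
 have E'0: "E' 0 = 0"
 proof -
  have "(%v. E' 0 \<bullet> v) = (%v. 0)" using has_derivative_unique[OF E'(1)[of 0] E(2)] .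
  then have "E' 0 \<bullet> E' 0 = 0" by metis
  then show ?thesis by simp
 qed
 obtain M where M: "M > 0" "\<And>x y. x \<in> cball 0 1 ==> y \<in> cball 0 1 ==> norm (E' x - E' y) <= M * norm (x - y)"
  by (rule C1_Lipschitz[OF E'(2,3), of 1]) blast
 have bE': "norm (E' w) <= M * norm w" if "norm w <= 1" for w using M(2)[of w 0] that E'0 by simp
 have bE: "\<bar>E w\<bar> <= M * norm w * norm w" if w: "norm w <= 1" for w
 proof -
  have "norm (E w - E 0) <= (M * norm w) * norm (w - 0)"
  proof (rule differentiable_bound[of "cball 0 (norm w)" _ "%z v. E' z \<bullet> v"])
   show "(E has_derivative (%v. E' z \<bullet> v)) (at z within cball 0 (norm w))" for z
    using E'(1) has_derivative_at_withinI by blast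
   show "onorm (%v. E' z \<bullet> v) <= M * norm w" if "z \<in> cball 0 (norm w)" for z
   proof (rule onorm_le)
    fix v
    have "norm (E' z) <= M * norm z" using bE'[of z] that w by simp
    also have "... <= M * norm w" using M(1) that by simp
    finally show "norm (E' z \<bullet> v) <= M * norm w * norm v"
     using Cauchy_Schwarz_ineq2[of "E' z" v] by (metis mult_right_mono norm_ge_zero order_trans real_norm_def)
   qed
  qed auto
  then show ?thesis using E(3) by simp
 qed
 \<comment> \<open>The cutoff \<open>\<beta>\<close> below has gradient at most \<open>64 / \<epsilon>\<close>; with \<open>|E| <= M \<epsilon>\<^sup>2\<close> and
  \<open>|DE| <= M \<epsilon>\<close> the gradient of \<open>\<beta> E\<close> is at most \<open>65 M \<epsilon>\<close>.\<close>
 define \<epsilon> where "\<epsilon> = min 1 (c / (65 * M))"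
 have \<epsilon>: "\<epsilon> > 0" "\<epsilon> <= 1" "65 * M * \<epsilon> <= c" using c M(1) by (auto simp: \<epsilon>_def min_def field_simps)
 \<comment> \<open>Near the origin \<open>m\<close> is negative, so \<open>\<beta>\<close> equals 1 there; outside the ball of radius \<open>\<epsilon>\<close> it equals 1, so \<open>\<beta>\<close> vanishes.\<close>
 define m where "m w = 1 - 2 / \<epsilon> ^ 8 * bump \<epsilon> 0 w" for w :: 'a
 define \<beta> where "\<beta> w = 1 - max 0 (m w) ^ 4" for w :: 'a
 define M3 where "M3 w = max 0 (\<epsilon>\<^sup>2 - w \<bullet> w) ^ 3" for w :: 'a
 define \<beta>' where "\<beta>' w = (4 * max 0 (m w) ^ 3 * (2 / \<epsilon> ^ 8) * (- 8 * M3 w)) *\<^sub>R w" for w :: 'a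
 have Cm: "C_on 3 UNIV m" unfolding m_def[abs_def]
  by (intro C_on_diff C_on_const C_on_mult C_on_bump) auto
 have C\<beta>: "C_on 3 UNIV \<beta>" unfolding \<beta>_def[abs_def]
  by (intro C_on_diff C_on_const C_on_pos_part_power Cm) auto
 have d\<beta>: "(\<beta> has_derivative (%v. \<beta>' w \<bullet> v)) (at w)" for w
 proof -
  have "(m has_derivative (%v. - (2 / \<epsilon> ^ 8 * (((- 8 * M3 w) *\<^sub>R w) \<bullet> v)))) (at w)"
   using has_derivative_diff[OF has_derivative_const[of 1] has_derivative_mult_right[OF bump_derivative[of \<epsilon> 0 w], of "2 / \<epsilon> ^ 8"]]
   by (simp add: M3_def m_def[abs_def])
  from DERIV_compose_FDERIV[where f = "%t::real. max 0 t ^ 4" and g = m, OF _ this, of "4 * max 0 (m w) ^ 3"]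
  have "((%w. max 0 (m w) ^ 4) has_derivative (%v. - (2 / \<epsilon> ^ 8 * (((- 8 * M3 w) *\<^sub>R w) \<bullet> v)) * (4 * max 0 (m w) ^ 3))) (at w)"
   using has_derivative_pos_part_power[of 2 "m w"] by (simp add: eval_nat_numeral del: power_Suc)
  from has_derivative_diff[OF has_derivative_const[of 1] this] show ?thesis
   unfolding \<beta>_def[abs_def] \<beta>'_def by (simp add: mult.assoc mult.left_commute mult.commute)
 qed
 have m1: "m w <= 1" for w using \<epsilon> bump_nonneg[of \<epsilon> 0 w] by (simp add: m_def)
 have \<beta>01: "\<bar>\<beta> w\<bar> <= 1" for w
 proof -
  have "max 0 (m w) ^ 4 <= 1" using m1 by (intro power_le_one) auto
  moreover have "max 0 (m w) ^ 4 \<ge> 0" by simp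
  ultimately show ?thesis by (simp add: \<beta>_def)
 qed
 have out: "\<beta> w = 0" "\<beta>' w = 0" if "norm w \<ge> \<epsilon>" for w
 proof -
  have "\<epsilon>\<^sup>2 <= w \<bullet> w" using that \<epsilon> by (metis power2_norm_eq_inner power_mono less_imp_le)
  then show "\<beta> w = 0" "\<beta>' w = 0" by (auto simp: \<beta>_def m_def bump_def \<beta>'_def M3_def)
 qed
 have b\<beta>': "norm (\<beta>' w) <= 64 * norm w / \<epsilon>\<^sup>2" for w
 proof -
  have "M3 w <= (\<epsilon>\<^sup>2) ^ 3" unfolding M3_def by (intro power_mono) auto
  then have "M3 w <= \<epsilon> ^ 6" by (simp flip: power_mult)
  moreover have "max 0 (m w) ^ 3 <= 1" using m1 by (intro power_le_one) auto
  ultimately have "4 * max 0 (m w) ^ 3 * (2 / \<epsilon> ^ 8) * (8 * M3 w) <= 4 * 1 * (2 / \<epsilon> ^ 8) * (8 * \<epsilon> ^ 6)"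
   using \<epsilon> by (intro mult_mono) (auto simp: M3_def)
  also have "... = 64 / \<epsilon>\<^sup>2" using \<epsilon> by (simp add: field_simps eval_nat_numeral)
  finally have le: "4 * max 0 (m w) ^ 3 * (2 / \<epsilon> ^ 8) * (8 * M3 w) <= 64 / \<epsilon>\<^sup>2" .
  have "norm (\<beta>' w) = 4 * max 0 (m w) ^ 3 * (2 / \<epsilon> ^ 8) * (8 * M3 w) * norm w"
   using \<epsilon> by (simp add: \<beta>'_def abs_mult M3_def)
  then show ?thesis using mult_right_mono[OF le norm_ge_zero[of w]] by simp
 qed
 define G' where "G' w = \<beta> w *\<^sub>R E' w + E w *\<^sub>R \<beta>' w" for w
 have dG: "((%w. \<beta> w * E w) has_derivative (%v. G' w \<bullet> v)) (at w)" for w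
  using has_derivative_mult[OF d\<beta>[of w] E'(1)[of w]]
  by (simp add: G'_def inner_add_left algebra_simps)
 have bG: "norm (G' w) <= c" for w
 proof (cases "norm w \<ge> \<epsilon>")
  case True
  then show ?thesis using out c by (simp add: G'_def)
 next
  case False
  then have w: "norm w <= \<epsilon>" "norm w <= 1" using \<epsilon> by auto
  have "norm (G' w) <= \<bar>\<beta> w\<bar> * norm (E' w) + \<bar>E w\<bar> * norm (\<beta>' w)"
   unfolding G'_def by (metis norm_scaleR norm_triangle_ineq)
  also have "... <= 1 * (M * norm w) + (M * norm w * norm w) * (64 * norm w / \<epsilon>\<^sup>2)"
   using \<beta>01 bE'[OF w(2)] bE[OF w(2)] b\<beta>'[of w] M(1) by (intro add_mono mult_mono) auto
  also have "... <= 1 * (M * \<epsilon>) + (M * \<epsilon> * \<epsilon>) * (64 * \<epsilon> / \<epsilon>\<^sup>2)"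
   using w M(1) \<epsilon> by (intro add_mono mult_mono divide_right_mono) auto
  also have "... = 65 * M * \<epsilon>" using \<epsilon> by (simp add: field_simps power2_eq_square)
  finally show ?thesis using \<epsilon>(3) by linarith
 qed
 have CG': "C_on 2 UNIV (%w. G' w \<bullet> b)" if "b \<in> Basis" for b
 proof -
  have "C_on 3 UNIV (%w. \<beta> w * E w)" using C\<beta> E(1) by (rule C_on_mult)
  then obtain G2 where G2: "\<And>w. ((%w. \<beta> w * E w) has_derivative (%v. G2 w \<bullet> v)) (at w)"
    "\<And>b. b \<in> Basis ==> C_on 2 UNIV (%w. G2 w \<bullet> b)"
   unfolding numeral_3_eq_3 numeral_2_eq_2 C_on_Suc[of "Suc (Suc 0)"] by auto
  have "G2 w = G' w" for w
   using has_derivative_unique[OF G2(1)[of w] dG[of w]] by (metis vector_eq_rdot)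
  then show ?thesis using G2(2)[OF that] by simp
 qed
 have "\<beta> w = 1" if "w \<in> ball 0 (\<epsilon> / 4)" for w
 proof -
  have "(norm w)\<^sup>2 <= (\<epsilon> / 4)\<^sup>2" using that by (intro power_mono) auto
  then have "w \<bullet> w <= \<epsilon>\<^sup>2 / 16" by (simp add: power2_norm_eq_inner power_divide)
  moreover have "\<epsilon>\<^sup>2 - w \<bullet> w <= max 0 (\<epsilon>\<^sup>2 - w \<bullet> w)" by simp
  ultimately have "15 / 16 * \<epsilon>\<^sup>2 <= max 0 (\<epsilon>\<^sup>2 - w \<bullet> w)" by linarith
  then have "(15 / 16 * \<epsilon>\<^sup>2) ^ 4 <= bump \<epsilon> 0 w" unfolding bump_def using \<epsilon> by (intro power_mono) auto
  moreover have "(15 / 16 * \<epsilon>\<^sup>2) ^ 4 = 50625 / 65536 * \<epsilon> ^ 8"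
   by (simp only: power_mult_distrib power_mult[symmetric]) (simp add: power_divide)
  moreover have "\<epsilon> ^ 8 > 0" using \<epsilon> by simp
  ultimately have "1 / 2 * \<epsilon> ^ 8 <= bump \<epsilon> 0 w" by linarith
  then have "m w <= 0" using \<epsilon> by (simp add: m_def field_simps)
  then show ?thesis by (simp add: \<beta>_def)
 qed
 then show ?thesis using \<epsilon> by (intro that[of "\<epsilon>/4" "%w. \<beta> w * E w" G', OF _ _ dG CG' bG]) auto
qed

text \<open>The charts that define the boundary need not be adapted to the normal, while the curvature matrix is chosen among
 adapted ones; existence makes the choice meaningful. After a rotation the defining function is \<open>- s z\<^sub>n\<close> plus a
 remainder that vanishes to second order; cutting the remainder off keeps the function strictly decreasing
 in \<open>z\<^sub>n\<close> everywhere, so its zero set is a global graph that agrees with the boundary near the point.\<close>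

lemma curvature_chart_exists:
 fixes \<Omega> :: "'m::finite space set"
 assumes bd: "C_boundary 3 \<Omega>" and op: "open \<Omega>" and bdd: "bounded \<Omega>" and y: "y \<in> frontier \<Omega>"
 shows "\<exists>A \<psi>. graph_chart 2 \<Omega> y A \<psi> \<and> A (outward_normal \<Omega> y) = (0, - 1)"
proof -
 let ?n = "outward_normal \<Omega> y"
 obtain h h' where h: "C_on 3 UNIV h" "\<And>x. (h has_derivative (%v. h' x \<bullet> v)) (at x)"
  "\<And>x. h x < 0 \<longleftrightarrow> x \<in> \<Omega>" "\<And>x. x \<in> frontier \<Omega> ==> h x = 0"
  "\<And>x. x \<in> frontier \<Omega> ==> \<exists>s>0. h' x = s *\<^sub>R outward_normal \<Omega> x"
  by (rule defining_function[OF bd op bdd]) (rule that)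
 obtain s where s: "s > 0" "h' y = s *\<^sub>R ?n" using h(5)[OF y] by blast
 have "norm ?n = 1" using outward_normal[OF bd _ y] by (simp add: is_outer_normal_def)
 then have "norm ?n = norm (0 :: real ^ 'm, - 1 :: real)" by (simp add: norm_Pair)
 from reflection_exists[OF this] obtain A :: "'m space => 'm space" where A: "orthogonal_transformation A" "A ?n = (0, - 1)" by blast
 note inv = orthogonal_transformation_inner_inv[OF A(1)]
 note lin = orthogonal_transformation_linear[OF inv(4)]
 define E where "E w = h (y + inv A w) + s * snd w" for w
 have "C_on 3 UNIV (%w. h (y + inv A w))"
 proof (rule C_on_compose[OF h(1)])
  fix b
  have "C_on 3 UNIV (%w. y \<bullet> b + inv A w \<bullet> b)"
   by (intro C_on_add C_on_const C_on_linear linear_inner_comp lin)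
  then show "C_on 3 UNIV (%w. (y + inv A w) \<bullet> b)" by (simp add: inner_add_left)
 qed simp
 from C_on_add[OF this C_on_mult[OF C_on_const C_on_linear[OF linear_snd]]]
 have CE: "C_on 3 UNIV E" unfolding E_def[abs_def] .
 have i0: "inv A 0 = 0" using lin by (rule linear_0)
 have E0: "E 0 = 0" using h(4)[OF y] by (simp add: E_def i0)
 have dE: "(E has_derivative (%v. 0)) (at 0)"
 proof -
  have "((%w. y + inv A w) has_derivative inv A) (at 0)"
   using has_derivative_add[OF has_derivative_const[of y] linear_imp_has_derivative[OF lin, of "at 0"]] by simp
  from diff_chain_at[OF this h(2)] have "((%w. h (y + inv A w)) has_derivative (%v. h' y \<bullet> inv A v)) (at 0)"
   by (simp add: o_def i0)
  moreover have "((%w::'m space. s * snd w) has_derivative (%v. s * snd v)) (at 0)"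
   by (auto intro!: derivative_eq_intros)
  ultimately have "(E has_derivative (%v. h' y \<bullet> inv A v + s * snd v)) (at 0)"
   unfolding E_def[abs_def] by (rule has_derivative_add)
  moreover have "h' y \<bullet> inv A v + s * snd v = 0" for v
  proof -
   have "?n \<bullet> inv A v = A ?n \<bullet> v" by (metis inv(1) inner_commute)
   then have "?n \<bullet> inv A v = - snd v" using A(2) by (simp add: inner_prod_def)
   moreover have "h' y \<bullet> inv A v = s * (?n \<bullet> inv A v)" by (simp only: s inner_scaleR_left)
   ultimately show ?thesis by simp
  qed
  ultimately show ?thesis by simp
 qed
 obtain G G' \<rho> where G: "\<rho> > 0" "\<And>w. w \<in> ball 0 \<rho> ==> G w = E w"
  "\<And>w. (G has_derivative (%v. G' w \<bullet> v)) (at w)" "\<And>b. b \<in> Basis ==> C_on 2 UNIV (%w. G' w \<bullet> b)"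
  "\<And>w. norm (G' w) <= s / 2"
  using cutoff_extension[OF CE dE E0, of "s / 2"] s(1) by (metis half_gt_zero)
 define F where "F w = G w - s * snd w" for w
 define F' where "F' w = G' w - (0, s)" for w
 have F1: "(F has_derivative (%v. F' w \<bullet> v)) (at w)" for w
 proof -
  have "((%w::'m space. s * snd w) has_derivative (%v. s * snd v)) (at w)"
   by (auto intro!: derivative_eq_intros)
  from has_derivative_diff[OF G(3)[of w] this] have "(F has_derivative (%v. G' w \<bullet> v - s * snd v)) (at w)"
   unfolding F_def[abs_def] .
  moreover have "G' w \<bullet> v - s * snd v = F' w \<bullet> v" for v by (simp add: F'_def inner_diff_left inner_prod_def algebra_simps)
  ultimately show ?thesis by simp
 qed
 have F2: "\<And>b. b \<in> Basis ==> C_on 1 UNIV (%w. F' w \<bullet> b)"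
  unfolding F'_def inner_diff_left using C_on_le[OF G(4), of _ 1] by (intro C_on_diff C_on_const) auto
 have F3: "s / 2 > 0" using s by simp
 have F4: "snd (F' w) <= - (s / 2)" for w
  using G(5)[of w] norm_snd_le[of "snd (G' w)" "fst (G' w)"] by (simp add: F'_def)
 have F5: "norm (fst (F' w)) <= s / 2" for w
  using G(5)[of w] norm_fst_le[of "fst (G' w)" "snd (G' w)"] by (simp add: F'_def)
 obtain \<psi> where \<psi>: "\<And>x t. F (x, t) < 0 \<longleftrightarrow> \<psi> x < t" "\<And>x t. F (x, t) = 0 \<longleftrightarrow> \<psi> x = t" "C_on (Suc 1) UNIV \<psi>"
  by (rule global_implicit_function[OF F1 F2 F3 F4 F5]) (assumption, rule that)
 have "F (0, 0) = 0" using G(1) G(2)[of 0] E0 by (simp add: F_def zero_prod_def)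
 then have "\<psi> 0 = 0" using \<psi>(2) by blast
 moreover have "\<Omega> \<inter> ball y \<rho> = {x \<in> ball y \<rho>. snd (A (x - y)) > \<psi> (fst (A (x - y)))}"
 proof -
  have "x \<in> \<Omega> \<longleftrightarrow> snd (A (x - y)) > \<psi> (fst (A (x - y)))" if x: "x \<in> ball y \<rho>" for x
  proof -
   have "norm (A (x - y)) = norm (x - y)" using A(1) orthogonal_transformation_norm by blast
   then have "A (x - y) \<in> ball 0 \<rho>" using x by (simp add: dist_norm norm_minus_commute)
   then have "F (A (x - y)) = h x" using G(2) by (simp add: F_def E_def inv(3))
   then show ?thesis using \<psi>(1)[of "fst (A (x - y))" "snd (A (x - y))"] h(3)[of x] by simp
  qed
  then show ?thesis by auto
 qed
 ultimately have "graph_chart 2 \<Omega> y A \<psi>" unfolding graph_chart_def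
  using A(1) \<psi>(3) G(1) by (auto simp: numeral_2_eq_2)
 then show ?thesis using A(2) by blast
qed

text \<open>The maximum of the Rayleigh quotient on the sphere is an eigenvalue. Eigenvectors for different eigenvalues are
 orthogonal, which makes the set of eigenvalues finite and its maximum meaningful.\<close>

lemma symmetric_matrix_eigenvalues:
 fixes M :: "real ^ 'n ^ 'n"
 assumes sym: "\<And>a b. (M *v a) \<bullet> b = (M *v b) \<bullet> a"
 shows "finite {l. is_eigenvalue M l}" "{l. is_eigenvalue M l} \<noteq> {}"
  "v \<bullet> (M *v v) <= Max {l. is_eigenvalue M l} * (v \<bullet> v)"
proof -
 define Q where "Q v = v \<bullet> (M *v v)" for v
 have lin: "linear (%v. M *v v)" by (rule matrix_vector_mul_linear)
 have cQ: "continuous_on (sphere 0 1) Q"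
  unfolding Q_def by (intro continuous_intros linear_continuous_on) (simp add: lin linear_conv_bounded_linear[symmetric])
 obtain k :: 'n where True by simp
 have "axis k 1 \<in> sphere (0 :: real ^ 'n) 1" by simp
 then have ne: "sphere (0 :: real ^ 'n) 1 \<noteq> {}" by blast
 obtain v0 where v0: "v0 \<in> sphere 0 1" "\<And>v. v \<in> sphere 0 1 ==> Q v <= Q v0"
  using continuous_attains_sup[OF compact_sphere ne cQ] by blast
 define l where "l = Q v0"
 have ray: "Q v <= l * (v \<bullet> v)" for v
 proof (cases "v = 0")
  case False
  have "(1 / norm v) *\<^sub>R v \<in> sphere 0 1" using False by simp
  from v0(2)[OF this] have "Q ((1 / norm v) *\<^sub>R v) <= l" by (simp add: l_def)
  moreover have "Q ((1 / norm v) *\<^sub>R v) = Q v / (v \<bullet> v)"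
   by (simp add: Q_def matrix_vector_mult_scaleR power2_norm_eq_inner[symmetric] power2_eq_square)
  ultimately show ?thesis using False by (simp add: pos_divide_le_eq)
 qed (simp add: Q_def)
 have v01: "v0 \<bullet> v0 = 1" using v0(1) by (simp add: norm_eq_1)
 have "(M *v v0) \<bullet> w = (l *\<^sub>R v0) \<bullet> w" for w
 proof (rule ccontr)
  define a where "a = l * (v0 \<bullet> w) - (M *v v0) \<bullet> w"
  define b where "b = l * (w \<bullet> w) - Q w"
  assume "(M *v v0) \<bullet> w \<noteq> (l *\<^sub>R v0) \<bullet> w"
  then have a: "a \<noteq> 0" by (simp add: a_def)
  define B where "B = \<bar>b\<bar> + 1"
  define t where "t = - a / B"
  have exp: "l * ((v0 + t *\<^sub>R w) \<bullet> (v0 + t *\<^sub>R w)) - Q (v0 + t *\<^sub>R w) = 2 * t * a + t\<^sup>2 * b" for t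
  proof -
   have "Q (v0 + t *\<^sub>R w) = Q v0 + t * (v0 \<bullet> (M *v w)) + t * (w \<bullet> (M *v v0)) + t\<^sup>2 * Q w"
    by (simp add: Q_def matrix_vector_right_distrib matrix_vector_mult_scaleR inner_add_left inner_add_right power2_eq_square algebra_simps)
   moreover have "v0 \<bullet> (M *v w) = (M *v v0) \<bullet> w" "w \<bullet> (M *v v0) = (M *v v0) \<bullet> w"
    using sym[of v0 w] by (simp_all add: inner_commute)
   ultimately have e2: "Q (v0 + t *\<^sub>R w) = l + 2 * t * ((M *v v0) \<bullet> w) + t\<^sup>2 * Q w" by (simp add: l_def)
   have e1: "(v0 + t *\<^sub>R w) \<bullet> (v0 + t *\<^sub>R w) = 1 + 2 * t * (v0 \<bullet> w) + t\<^sup>2 * (w \<bullet> w)"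
    using v01 by (simp add: inner_add_left inner_add_right inner_commute power2_eq_square)
   show ?thesis unfolding e1 e2 a_def b_def by (simp add: algebra_simps)
  qed
  have "2 * t * a + t\<^sup>2 * b \<ge> 0" using exp[of t] ray[of "v0 + t *\<^sub>R w"] by linarith
  moreover have "2 * t * a + t\<^sup>2 * b = (a / B)\<^sup>2 * (b - 2 * B)"
  proof -
   have tB: "t * B = - a" by (simp add: t_def B_def)
   have eq1: "(a / B)\<^sup>2 = t\<^sup>2" by (simp add: t_def power_divide)
   have eq2: "t\<^sup>2 * (2 * B) = 2 * t * (t * B)" by (simp add: power2_eq_square)
   have "t\<^sup>2 * (b - 2 * B) = t\<^sup>2 * b - 2 * t * (- a)" by (simp only: right_diff_distrib eq2 tB)
   then show ?thesis by (simp add: eq1)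
  qed
  moreover have "(a / B)\<^sup>2 > 0" using a by (simp add: B_def)
  moreover have "b - 2 * B < 0" by (simp add: B_def)
  ultimately show False by (metis mult_pos_neg not_le)
 qed
 then have ev: "M *v v0 = l *\<^sub>R v0" using vector_eq_rdot by blast
 have "v0 \<noteq> 0" using v0(1) by auto
 then have evl: "is_eigenvalue M l" unfolding is_eigenvalue_def using ev by blast
 then show "{l. is_eigenvalue M l} \<noteq> {}" by blast
 have "\<forall>l\<in>{l. is_eigenvalue M l}. \<exists>v. v \<noteq> 0 \<and> M *v v = l *\<^sub>R v" by (simp add: is_eigenvalue_def)
 then obtain e where e: "\<And>l. is_eigenvalue M l ==> e l \<noteq> 0" "\<And>l. is_eigenvalue M l ==> M *v e l = l *\<^sub>R e l"
  by (metis mem_Collect_eq)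
 have orth: "e a \<bullet> e b = 0" if "is_eigenvalue M a" "is_eigenvalue M b" "a \<noteq> b" for a b
 proof -
  have "a * (e a \<bullet> e b) = b * (e a \<bullet> e b)"
   using sym[of "e a" "e b"] e(2)[OF that(1)] e(2)[OF that(2)] by (simp add: inner_commute)
  then show ?thesis using that(3) by simp
 qed
 have inj: "inj_on e {l. is_eigenvalue M l}"
 proof (rule inj_onI)
  fix a b assume *: "a \<in> {l. is_eigenvalue M l}" "b \<in> {l. is_eigenvalue M l}" "e a = e b"
  show "a = b"
  proof (rule ccontr)
   assume "a \<noteq> b"
   then have "e a \<bullet> e a = 0" using orth[of a b] * by simp
   then show False using e(1)[of a] * by simp
  qed
 qed
 have "pairwise orthogonal (e ` {l. is_eigenvalue M l})"
  unfolding pairwise_def orthogonal_def using orth by (metis (no_types, lifting) imageE mem_Collect_eq)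
 moreover have "0 \<notin> e ` {l. is_eigenvalue M l}" using e(1) by force
 ultimately have "independent (e ` {l. is_eigenvalue M l})" by (rule pairwise_orthogonal_independent)
 then have "finite (e ` {l. is_eigenvalue M l})" by (rule finiteI_independent)
 then show fin: "finite {l. is_eigenvalue M l}" using inj finite_imageD by blast
 have "l <= Max {l. is_eigenvalue M l}" using fin evl by simp
 then have "l * (v \<bullet> v) <= Max {l. is_eigenvalue M l} * (v \<bullet> v)" by (intro mult_right_mono) auto
 then show "v \<bullet> (M *v v) <= Max {l. is_eigenvalue M l} * (v \<bullet> v)" using ray[of v] by (simp add: Q_def)
qed

lemma hessian_derivative:
 fixes \<psi> :: "real ^ 'm => real"
 assumes "C_on 2 UNIV \<psi>"
 obtains g where "\<And>x. (\<psi> has_derivative (%h. g x \<bullet> h)) (at x)" "g 0 = grad UNIV \<psi> 0"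
  "(g has_derivative (%v. hessian \<psi> 0 *v v)) (at 0)"
  "\<And>a b. (hessian \<psi> 0 *v a) \<bullet> b = (hessian \<psi> 0 *v b) \<bullet> a"
proof -
 obtain g L where g: "\<And>x. (\<psi> has_derivative (%h. g x \<bullet> h)) (at x)"
  "\<And>x. (g has_derivative L x) (at x)" "\<And>v w. continuous_on UNIV (%x. L x v \<bullet> w)"
  using C_on_gradient_field[of 0 UNIV \<psi>] assms[unfolded numeral_2_eq_2] by (metis UNIV_I)
 have gg: "grad UNIV \<psi> x = g x" for x using grad_eqI[OF g(1)] .
 have lin: "linear (L 0)" using g(2) has_derivative_linear by blast
 have hess: "hessian \<psi> 0 *v v = L 0 v" for v
 proof -
  have "(hessian \<psi> 0 *v v) $ i = L 0 v $ i" for i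
  proof -
   define D where "D = (\<Sum>b\<in>Basis. (L 0 b $ i) *\<^sub>R b)"
   have Di: "D \<bullet> h = L 0 h $ i" for h
   proof -
    have "L 0 h = L 0 (\<Sum>b\<in>Basis. (h \<bullet> b) *\<^sub>R b)" by (simp add: euclidean_representation)
    also have "... = (\<Sum>b\<in>Basis. (h \<bullet> b) *\<^sub>R L 0 b)" using lin by (simp add: linear_sum linear_cmul)
    finally show ?thesis by (simp add: D_def inner_sum_left inner_sum_right inner_commute mult.commute)
   qed
   have "((%y. g y \<bullet> axis i 1) has_derivative (%h. L 0 h \<bullet> axis i 1)) (at 0)"
    using g(2) by (rule has_derivative_inner_left)
   then have "((%y. g y $ i) has_derivative (%h. D \<bullet> h)) (at 0)" by (simp add: inner_axis Di)
   then have "grad UNIV (%y. g y $ i) 0 = D" by (rule grad_eqI)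
   then have "(hessian \<psi> 0 *v v) $ i = (\<Sum>j\<in>UNIV. D $ j * v $ j)"
    by (simp add: hessian_def gg matrix_vector_mult_def)
   also have "... = D \<bullet> v" by (simp add: inner_vec_def)
   finally show ?thesis by (simp add: Di)
  qed
  then show ?thesis by (simp add: vec_eq_iff)
 qed
 have "L 0 a \<bullet> b = L 0 b \<bullet> a" for a b
  using second_derivative_symmetric[of UNIV 0 \<psi> g L b a] g by simp
 moreover have "(%v. hessian \<psi> 0 *v v) = L 0" using hess by blast
 ultimately show ?thesis using that[of g] g gg hess by simp
qed

text \<open>Velocities of curves in the boundary. Relations that hold along the boundary are differentiated along such curves.\<close>

definition tangent_to_frontier :: "'a::real_normed_vector set => 'a => 'a => bool" where
 "tangent_to_frontier \<Omega> y \<tau> \<longleftrightarrow> (\<exists>x. x 0 = y \<and> (x has_vector_derivative \<tau>) (at (0::real)) \<and>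
   (\<exists>e>0. \<forall>s. \<bar>s\<bar> < e --> x s \<in> frontier \<Omega>))"

lemma boundary_curve:
 fixes \<Omega> :: "'m::finite space set"
 assumes ch: "graph_chart k \<Omega> y A \<psi>" and g: "\<And>x. (\<psi> has_derivative (%h. g x \<bullet> h)) (at x)"
 defines "x \<equiv> %v s. y + inv A (s *\<^sub>R v, \<psi> (s *\<^sub>R v))"
 shows "\<exists>e>0. \<forall>s. \<bar>s\<bar> < e --> x v s \<in> frontier \<Omega>" and "x v 0 = y"
  and "(x v has_vector_derivative inv A (v, g (s *\<^sub>R v) \<bullet> v)) (at s)"
proof -
 obtain r where A: "orthogonal_transformation A" and \<psi>0: "\<psi> 0 = 0" and r: "r > 0"
  and memb: "\<And>z. z \<in> ball y r ==> z \<in> \<Omega> \<longleftrightarrow> chart_fun y A \<psi> z < 0" by (rule graph_chartE[OF ch]) blast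
 note inv = orthogonal_transformation_inner_inv[OF A]
 note lin = orthogonal_transformation_linear[OF inv(4)]
 have i0: "inv A 0 = 0" using lin by (rule linear_0)
 show x0: "x v 0 = y" using i0 \<psi>0 by (simp add: x_def zero_prod_def)
 have der: "(x v has_vector_derivative inv A (v, g (s *\<^sub>R v) \<bullet> v)) (at s)" for s
 proof -
  have 1: "((%s. s *\<^sub>R v) has_derivative (%h. h *\<^sub>R v)) (at s)" by (auto intro!: derivative_eq_intros)
  have 2: "((%s. \<psi> (s *\<^sub>R v)) has_derivative (%h. g (s *\<^sub>R v) \<bullet> (h *\<^sub>R v))) (at s)"
   using diff_chain_at[OF 1 g] by (simp add: o_def)
  have 3: "((%s. (s *\<^sub>R v, \<psi> (s *\<^sub>R v))) has_derivative (%h. (h *\<^sub>R v, g (s *\<^sub>R v) \<bullet> (h *\<^sub>R v)))) (at s)"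
   using has_derivative_Pair[OF 1 2] .
  have "((%s. inv A (s *\<^sub>R v, \<psi> (s *\<^sub>R v))) has_derivative (%h. inv A (h *\<^sub>R v, g (s *\<^sub>R v) \<bullet> (h *\<^sub>R v)))) (at s)"
   using diff_chain_at[OF 3 linear_imp_has_derivative[OF lin]] by (simp add: o_def)
  from has_derivative_add[OF has_derivative_const[of y] this]
  have "(x v has_derivative (%h. inv A (h *\<^sub>R v, g (s *\<^sub>R v) \<bullet> (h *\<^sub>R v)))) (at s)" by (simp add: x_def)
  moreover have "inv A (h *\<^sub>R v, g (s *\<^sub>R v) \<bullet> (h *\<^sub>R v)) = h *\<^sub>R inv A (v, g (s *\<^sub>R v) \<bullet> v)" for h
   using linear_cmul[OF lin, of h "(v, g (s *\<^sub>R v) \<bullet> v)"] by simp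
  ultimately show ?thesis by (simp add: has_vector_derivative_def)
 qed
 then show "(x v has_vector_derivative inv A (v, g (s *\<^sub>R v) \<bullet> v)) (at s)" .
 have "isCont (x v) 0" using der has_vector_derivative_continuous by blast
 then obtain e where e: "e > 0" "\<And>s. \<bar>s\<bar> < e ==> dist (x v s) y < r"
  unfolding continuous_at_eps_delta x0 using r by (auto simp: dist_real_def)
 have "x v s \<in> frontier \<Omega>" if s: "\<bar>s\<bar> < e" for s
 proof -
  let ?x = "x v s"
  have xb: "?x \<in> ball y r" using e(2)[OF s] by (simp add: dist_commute)
  have Ax: "A (?x - y) = (s *\<^sub>R v, \<psi> (s *\<^sub>R v))" by (simp add: x_def inv(2))
  have notin: "?x \<notin> \<Omega>" using memb[OF xb] Ax by (simp add: chart_fun_def)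
  have "?x \<in> closure \<Omega>" unfolding closure_approachable
  proof (intro allI impI)
   fix d :: real assume d: "d > 0"
   define t where "t = min d (r - dist ?x y) / 2"
   have t: "t > 0" "t < d" "t < r - dist ?x y" using d e(2)[OF s] by (auto simp: t_def)
   define z where "z = ?x + inv A (0, t)"
   have nz: "dist z ?x = t"
    using t inv(4) by (simp add: z_def dist_norm orthogonal_transformation_norm norm_Pair)
   have "dist z y <= dist z ?x + dist ?x y" by (rule dist_triangle)
   then have "z \<in> ball y r" using nz t by (simp add: dist_commute)
   moreover have "A (z - y) = (s *\<^sub>R v, \<psi> (s *\<^sub>R v) + t)"
   proof -
    have "z - y = inv A ((s *\<^sub>R v, \<psi> (s *\<^sub>R v)) + (0, t))"
     unfolding linear_add[OF lin] by (simp add: z_def x_def)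
    then show ?thesis by (simp add: inv(2))
   qed
   ultimately have "z \<in> \<Omega>" using memb[of z] t by (simp add: chart_fun_def)
   then show "\<exists>y\<in>\<Omega>. dist y ?x < d" using nz t by auto
  qed
  then show ?thesis using notin interior_subset[of \<Omega>] unfolding frontier_def by blast
 qed
 then show "\<exists>e>0. \<forall>s. \<bar>s\<bar> < e --> x v s \<in> frontier \<Omega>" using e(1) by blast
qed

text \<open>The defining function vanishes along the curves \<open>s \<mapsto> (s v, \<psi> (s v))\<close>; two derivatives in \<open>s\<close> relate its Hessian in
 tangential directions to the Hessian of the graph function.\<close>

lemma curvature_relation:
 fixes \<Omega> :: "'m::finite space set"
 assumes ch: "graph_chart 2 \<Omega> y A \<psi>" "A (outward_normal \<Omega> y) = (0, - 1)"
  and h: "\<And>x. (h has_derivative (%v. h' x \<bullet> v)) (at x)" "(h' has_derivative L) (at y)"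
   "\<And>x. x \<in> frontier \<Omega> ==> h x = 0" "h' y = s *\<^sub>R outward_normal \<Omega> y"
 shows "L (inv A (v, 0)) \<bullet> inv A (v, 0) = s * (v \<bullet> (hessian \<psi> 0 *v v))"
  and "\<And>a b. (hessian \<psi> 0 *v a) \<bullet> b = (hessian \<psi> 0 *v b) \<bullet> a"
  and "tangent_to_frontier \<Omega> y (inv A (v, 0))"
proof -
 let ?n = "outward_normal \<Omega> y"
 from ch have A: "orthogonal_transformation A" and \<psi>: "C_on 2 UNIV \<psi>" "\<psi> 0 = 0" by (auto simp: graph_chart_def)
 note inv = orthogonal_transformation_inner_inv[OF A]
 note lin = orthogonal_transformation_linear[OF inv(4)]
 obtain g where g: "\<And>x. (\<psi> has_derivative (%h. g x \<bullet> h)) (at x)" "g 0 = grad UNIV \<psi> 0"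
  "(g has_derivative (%v. hessian \<psi> 0 *v v)) (at 0)"
  "\<And>a b. (hessian \<psi> 0 *v a) \<bullet> b = (hessian \<psi> 0 *v b) \<bullet> a"
  by (rule hessian_derivative[OF \<psi>(1)]) blast
 show "\<And>a b. (hessian \<psi> 0 *v a) \<bullet> b = (hessian \<psi> 0 *v b) \<bullet> a" by (rule g(4))
 have g0: "g 0 = 0"
 proof -
  have "(1 / sqrt (1 + (norm (grad UNIV \<psi> 0))\<^sup>2)) *\<^sub>R (grad UNIV \<psi> 0, - 1::real) = (0, -1)"
   using chart_normal(2)[OF ch(1)] ch(2) by simp
  then have "(1 / sqrt (1 + (norm (grad UNIV \<psi> 0))\<^sup>2)) *\<^sub>R grad UNIV \<psi> 0 = 0" by simp
  moreover have "sqrt (1 + (norm (grad UNIV \<psi> 0))\<^sup>2) > 0" by (simp add: add_pos_nonneg)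
  ultimately show ?thesis using g(2) by simp
 qed
 define x where "x = (%s. y + inv A (s *\<^sub>R v, \<psi> (s *\<^sub>R v)))"
 note curve = boundary_curve[OF ch(1) g(1), of v, folded x_def]
 have x0: "x 0 = y" using boundary_curve(2)[OF ch(1) g(1), of v] by (simp only: x_def)
 define x' where "x' s = inv A (v, g (s *\<^sub>R v) \<bullet> v)" for s
 have dx: "(x has_vector_derivative x' s) (at s)" for s using curve(3)[of s] by (simp add: x'_def)
 have x'0: "x' 0 = inv A (v, 0)" by (simp add: x'_def g0)
 have "\<exists>e>0. \<forall>s. \<bar>s\<bar> < e --> x s \<in> frontier \<Omega>"
  using boundary_curve(1)[OF ch(1) g(1), of v] by (simp only: x_def)
 then obtain e where e: "e > 0" "\<And>s. \<bar>s\<bar> < e ==> x s \<in> frontier \<Omega>" by metis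
 show "tangent_to_frontier \<Omega> y (inv A (v, 0))"
  unfolding tangent_to_frontier_def
 proof (intro exI[of _ x] conjI)
  show "(x has_vector_derivative inv A (v, 0)) (at 0)" using dx[of 0] by (simp only: x'0)
  show "\<exists>e>0. \<forall>s. \<bar>s\<bar> < e --> x s \<in> frontier \<Omega>" using e by blast
 qed (rule x0)
 have k0: "h' (x s) \<bullet> x' s = 0" if s: "\<bar>s\<bar> < e" for s
 proof -
  have "((%s. h (x s)) has_real_derivative h' (x s) \<bullet> x' s) (at s)"
   using diff_chain_at[OF dx[of s, unfolded has_vector_derivative_def] h(1)]
   by (simp add: o_def has_field_derivative_def mult.commute[of _ "h' (x s) \<bullet> x' s"])
  moreover have "\<forall>t. \<bar>s - t\<bar> < e - \<bar>s\<bar> --> h (x s) = h (x t)"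
  proof (intro allI impI)
   fix t assume "\<bar>s - t\<bar> < e - \<bar>s\<bar>"
   then have "\<bar>t\<bar> < e" by linarith
   then show "h (x s) = h (x t)" using e(2) h(3) s by simp
  qed
  ultimately show ?thesis using DERIV_local_const[of "%s. h (x s)" _ s "e - \<bar>s\<bar>"] s by simp
 qed
 have lL: "linear L" using h(2) has_derivative_linear by blast
 have dx': "(x' has_vector_derivative inv A (0, (hessian \<psi> 0 *v v) \<bullet> v)) (at 0)"
 proof -
  have 1: "((%s. s *\<^sub>R v) has_derivative (%h. h *\<^sub>R v)) (at (0::real))" by (auto intro!: derivative_eq_intros)
  have 2: "((%s. g (s *\<^sub>R v)) has_derivative (%h. hessian \<psi> 0 *v (h *\<^sub>R v))) (at 0)"
   using diff_chain_at[OF 1, of g "%v. hessian \<psi> 0 *v v"] g(3) by (simp add: o_def)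
  from has_derivative_Pair[OF has_derivative_const[of v] has_derivative_inner_left[OF this, of v]]
  have 3: "((%s. (v, g (s *\<^sub>R v) \<bullet> v)) has_derivative (%h. (0, (hessian \<psi> 0 *v (h *\<^sub>R v)) \<bullet> v))) (at 0)" by simp
  have "(x' has_derivative (%h. inv A (0, (hessian \<psi> 0 *v (h *\<^sub>R v)) \<bullet> v))) (at 0)"
   using diff_chain_at[OF 3 linear_imp_has_derivative[OF lin]] by (simp add: o_def x'_def[abs_def])
  moreover have "inv A (0, (hessian \<psi> 0 *v (h *\<^sub>R v)) \<bullet> v) = h *\<^sub>R inv A (0, (hessian \<psi> 0 *v v) \<bullet> v)" for h
   using linear_cmul[OF lin, of h "(0, (hessian \<psi> 0 *v v) \<bullet> v)"] by (simp add: matrix_vector_mult_scaleR)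
  ultimately show ?thesis by (simp add: has_vector_derivative_def)
 qed
 have dh': "((%s. h' (x s)) has_derivative (%t. L (t *\<^sub>R x' 0))) (at 0)"
  using diff_chain_at[OF dx[of 0, unfolded has_vector_derivative_def], of h' L] h(2) x0 by (simp add: o_def)
 have "((%s. h' (x s) \<bullet> x' s) has_derivative (%t. h' (x 0) \<bullet> (t *\<^sub>R inv A (0, (hessian \<psi> 0 *v v) \<bullet> v)) + L (t *\<^sub>R x' 0) \<bullet> x' 0)) (at 0)"
  by (rule has_derivative_inner[OF dh' dx'[unfolded has_vector_derivative_def]])
 moreover have "h' (x 0) \<bullet> (t *\<^sub>R inv A (0, (hessian \<psi> 0 *v v) \<bullet> v)) + L (t *\<^sub>R x' 0) \<bullet> x' 0
   = (h' y \<bullet> inv A (0, (hessian \<psi> 0 *v v) \<bullet> v) + L (x' 0) \<bullet> x' 0) * t" for t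
  by (simp only: x0 linear_cmul[OF lL] inner_scaleR_left inner_scaleR_right) (simp add: algebra_simps)
 ultimately have "((%s. h' (x s) \<bullet> x' s) has_real_derivative (h' y \<bullet> inv A (0, (hessian \<psi> 0 *v v) \<bullet> v) + L (x' 0) \<bullet> x' 0)) (at 0)"
  by (simp only: has_field_derivative_def)
 then have "h' y \<bullet> inv A (0, (hessian \<psi> 0 *v v) \<bullet> v) + L (x' 0) \<bullet> x' 0 = 0"
  using DERIV_local_const[of _ _ 0 e] k0 e(1) by simp
 moreover have "h' y \<bullet> inv A (0, (hessian \<psi> 0 *v v) \<bullet> v) = - s * (v \<bullet> (hessian \<psi> 0 *v v))"
 proof -
  have "?n \<bullet> inv A w = A ?n \<bullet> w" for w by (metis inv(1) inner_commute)
  then have "?n \<bullet> inv A (0, (hessian \<psi> 0 *v v) \<bullet> v) = - (v \<bullet> (hessian \<psi> 0 *v v))"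
   using ch(2) by (simp add: inner_prod_def inner_commute)
  moreover have "h' y \<bullet> w = s * (?n \<bullet> w)" for w by (simp only: h(4) inner_scaleR_left)
  ultimately show ?thesis by simp
 qed
 ultimately show "L (inv A (v, 0)) \<bullet> inv A (v, 0) = s * (v \<bullet> (hessian \<psi> 0 *v v))" using x'0 by simp
qed

lemma has_derivative_ray:
 assumes "(f has_derivative A) (at y within S)" and "\<And>s. 0 <= s ==> s < e ==> y + s *\<^sub>R v \<in> S"
 shows "((%s. f (y + s *\<^sub>R v)) has_vector_derivative A v) (at 0 within {0..<e})"
proof -
 have "((%s. y + s *\<^sub>R v) has_derivative (%h. h *\<^sub>R v)) (at 0 within {0..<e})"
  by (auto intro!: derivative_eq_intros)
 moreover have "(f has_derivative A) (at (y + 0 *\<^sub>R v) within (%s. y + s *\<^sub>R v) ` {0..<e})"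
  using has_derivative_subset[OF assms(1)] assms(2) by (simp add: image_subset_iff)
 ultimately have "((%s. f (y + s *\<^sub>R v)) has_derivative (%h. A (h *\<^sub>R v))) (at 0 within {0..<e})"
  using diff_chain_within[of "%s. y + s *\<^sub>R v" "%h. h *\<^sub>R v" 0 "{0..<e}" f A] by (simp add: o_def)
 then show ?thesis
  using has_derivative_linear[OF assms(1)] by (simp add: has_vector_derivative_def linear_cmul)
qed

lemma inward_ray_closure:
 assumes "is_outer_normal \<Omega> y \<nu>" "y \<in> frontier \<Omega>" "v \<bullet> \<nu> < 0"
 obtains e where "e > 0" "\<And>s. 0 <= s ==> s < e ==> y + s *\<^sub>R v \<in> closure \<Omega>"
proof -
 obtain e where "e > 0" "\<forall>s. 0 < s \<and> s < e --> y + s *\<^sub>R v \<in> \<Omega>"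
  using assms unfolding is_outer_normal_def by meson
 moreover have "y \<in> closure \<Omega>" using assms(2) by (simp add: frontier_def)
 ultimately show ?thesis using that[of e] closure_subset[of \<Omega>] by (metis add_0_right less_eq_real_def scaleR_zero_left subsetD)
qed

text \<open>A half space spans the whole space. This is why derivatives within the closure are determined at boundary points.\<close>

lemma linear_eq_on_halfspace:
 assumes "linear A" "linear B" and \<nu>: "\<nu> \<bullet> \<nu> = 1" and eq: "\<And>v. v \<bullet> \<nu> < 0 ==> A v = B v"
 shows "A = B"
proof
 fix w
 have n: "A (- \<nu>) = B (- \<nu>)" using \<nu> by (intro eq) simp
 define t where "t = \<bar>w \<bullet> \<nu>\<bar> + 1"
 have "A (w + t *\<^sub>R (- \<nu>)) = B (w + t *\<^sub>R (- \<nu>))"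
  using \<nu> by (intro eq) (simp add: inner_diff_left t_def)
 then show "A w = B w"
  unfolding linear_add[OF assms(1)] linear_add[OF assms(2)] linear_cmul[OF assms(1)] linear_cmul[OF assms(2)] n by simp
qed

lemma has_derivative_unique_boundary:
 assumes n: "is_outer_normal \<Omega> y \<nu>" "y \<in> frontier \<Omega>"
  and A: "(f has_derivative A) (at y within closure \<Omega>)" and B: "(f has_derivative B) (at y within closure \<Omega>)"
 shows "A = B"
proof (rule linear_eq_on_halfspace[where \<nu> = \<nu>])
 show "linear A" "linear B" using A B has_derivative_linear by blast+
 show "\<nu> \<bullet> \<nu> = 1" using n(1) by (simp add: is_outer_normal_def norm_eq_1)
 fix v assume "v \<bullet> \<nu> < 0"
 from inward_ray_closure[OF n this] obtain e where e: "e > 0" "\<And>s. 0 <= s ==> s < e ==> y + s *\<^sub>R v \<in> closure \<Omega>" by blast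
 have "at (0::real) within {0..<e} \<noteq> bot"
  using e(1) by (simp add: trivial_limit_within islimpt_Ico)
 with has_derivative_ray[OF A e(2)] has_derivative_ray[OF B e(2)] show "A v = B v"
  by (rule vector_derivative_unique_within[rotated 1])
qed

lemma grad_within_eqI:
 fixes f :: "'a::euclidean_space => real"
 assumes "(f has_derivative (%h. g \<bullet> h)) (at x within S)"
  and "\<And>A B. (f has_derivative A) (at x within S) ==> (f has_derivative B) (at x within S) ==> A = B"
 shows "grad S f x = g"
proof -
 have "(f has_derivative frechet_derivative f (at x within S)) (at x within S)"
  using assms(1) differentiableI frechet_derivative_works by blast
 then have "frechet_derivative f (at x within S) = (%h. g \<bullet> h)" using assms by blast
 then show ?thesis by (simp add: grad_def euclidean_representation)
qed

lemma grad_closure_eqI: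
 fixes f :: "'a::euclidean_space => real"
 assumes "open \<Omega>" and "\<And>y. y \<in> frontier \<Omega> ==> is_outer_normal \<Omega> y (n y)"
  and "x \<in> closure \<Omega>" and "(f has_derivative (%h. g \<bullet> h)) (at x within closure \<Omega>)"
 shows "grad (closure \<Omega>) f x = g"
proof (rule grad_within_eqI[OF assms(4)])
 fix A B assume AB: "(f has_derivative A) (at x within closure \<Omega>)" "(f has_derivative B) (at x within closure \<Omega>)"
 show "A = B"
 proof (cases "x \<in> \<Omega>")
  case True
  then have "at x within closure \<Omega> = at x"
   using assms(1) closure_subset by (metis at_within_open_subset)
  then show ?thesis using AB has_derivative_unique by metis
 next
  case False
  then have "x \<in> frontier \<Omega>" using assms(1,3) by (simp add: frontier_def interior_open)
  then show ?thesis using has_derivative_unique_boundary AB assms(2) by metis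
 qed
qed

locale flow_domain =
 fixes \<Omega> :: "'a::euclidean_space set" and n :: "'a => 'a"
 assumes open_domain: "open \<Omega>" and bounded_domain: "bounded \<Omega>"
  and normal: "y \<in> frontier \<Omega> ==> is_outer_normal \<Omega> y (n y)"
begin

lemma normal_unit: "y \<in> frontier \<Omega> ==> n y \<bullet> n y = 1"
 using normal by (simp add: is_outer_normal_def norm_eq_1)

lemma compact_closure_domain: "compact (closure \<Omega>)"
 using bounded_domain by simp

lemma at_within_interior_point: "x \<in> \<Omega> ==> at x within closure \<Omega> = at x"
 using open_domain closure_subset by (metis at_within_open_subset)

lemma closure_cases: "x \<in> closure \<Omega> \<longleftrightarrow> x \<in> \<Omega> \<or> x \<in> frontier \<Omega>"
 using open_domain closure_subset[of \<Omega>] by (auto simp: frontier_def interior_open)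

end

text \<open>In an adapted chart the left-hand side is the quadratic form of the negative curvature matrix, which is bounded by
 its largest eigenvalue. The supremum over the boundary bounds it only because these eigenvalues are
 bounded above, by compactness of the boundary.\<close>

lemma curvature_bound:
 fixes \<Omega> :: "'m::finite space set"
 assumes bd: "C_boundary 3 \<Omega>" and op: "open \<Omega>" and bdd: "bounded \<Omega>"
  and h: "\<And>x. (h has_derivative (%v. h' x \<bullet> v)) (at x)" "\<And>x. (h' has_derivative L x) (at x)"
   "\<And>v w. continuous_on UNIV (%x. L x v \<bullet> w)"
   "\<And>x. x \<in> frontier \<Omega> ==> h x = 0" "\<And>x. x \<in> frontier \<Omega> ==> \<exists>s>0. h' x = s *\<^sub>R outward_normal \<Omega> x"
  and y: "y \<in> frontier \<Omega>" and \<tau>: "\<tau> \<bullet> outward_normal \<Omega> y = 0"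
 shows "- (L y \<tau> \<bullet> \<tau>) <= norm (h' y) * (C0 \<Omega> * (\<tau> \<bullet> \<tau>))"
  and "tangent_to_frontier \<Omega> y \<tau>"
proof -
 let ?n = "outward_normal \<Omega>"
 have n1: "norm (?n y) = 1" if "y \<in> frontier \<Omega>" for y
  using outward_normal[OF bd _ that] by (simp add: is_outer_normal_def)
 have s: "norm (h' y) > 0" "h' y = norm (h' y) *\<^sub>R ?n y" if "y \<in> frontier \<Omega>" for y
  using h(5)[OF that] n1[OF that] by auto
 have chart: "\<exists>A \<psi>. graph_chart 2 \<Omega> y A \<psi> \<and> A (?n y) = (0, - 1) \<and> curvature_matrix \<Omega> y = hessian \<psi> 0"
  if "y \<in> frontier \<Omega>" for y
 proof -
  have "\<exists>\<kappa>. \<exists>A \<psi>. graph_chart 2 \<Omega> y A \<psi> \<and> A (?n y) = (0, - 1) \<and> \<kappa> = hessian \<psi> 0"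
   using curvature_chart_exists[OF bd op bdd that] by blast
  then show ?thesis unfolding curvature_matrix_def by (rule someI_ex)
 qed
 define \<kappa> where "\<kappa> = curvature_matrix \<Omega>"
 have neg: "(- \<kappa> y) *v v = - (\<kappa> y *v v)" for y v
  by (simp add: matrix_vector_mult_def vec_eq_iff sum_negf)
 have rel: "\<exists>A :: 'm space => 'm space. orthogonal_transformation A \<and> A (?n y) = (0, -1) \<and>
   (\<forall>v. L y (inv A (v, 0)) \<bullet> inv A (v, 0) = norm (h' y) * (v \<bullet> (\<kappa> y *v v)) \<and>
    (tangent_to_frontier \<Omega> y (inv A (v, 0)))) \<and>
   (\<forall>a b. ((- \<kappa> y) *v a) \<bullet> b = ((- \<kappa> y) *v b) \<bullet> a)" if y: "y \<in> frontier \<Omega>" for y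
 proof -
  obtain A \<psi> where ch: "graph_chart 2 \<Omega> y A \<psi>" "A (?n y) = (0, - 1)" and k: "\<kappa> y = hessian \<psi> 0"
   using chart[OF y] unfolding \<kappa>_def by blast
  have cr1: "L y (inv A (v, 0)) \<bullet> inv A (v, 0) = norm (h' y) * (v \<bullet> (\<kappa> y *v v))" for v
   unfolding k by (rule curvature_relation(1)[OF ch h(1) h(2) _ s(2)[OF y]]) (rule h(4))
  have cr2: "(hessian \<psi> 0 *v a) \<bullet> b = (hessian \<psi> 0 *v b) \<bullet> a" for a b
   by (rule curvature_relation(2)[OF ch h(1) h(2) _ s(2)[OF y]]) (rule h(4))
  have cr3: "tangent_to_frontier \<Omega> y (inv A (v, 0))" for v
   by (rule curvature_relation(3)[OF ch h(1) h(2) _ s(2)[OF y]]) (rule h(4))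
  have "orthogonal_transformation A" using ch(1) by (auto simp: graph_chart_def)
  moreover have "((- \<kappa> y) *v a) \<bullet> b = ((- \<kappa> y) *v b) \<bullet> a" for a b
   unfolding neg using cr2[of a b] k by (simp only: inner_minus_left)
  ultimately show ?thesis using ch(2) cr1 cr3 by (intro exI[of _ A] conjI allI)
 qed
 have fcomp: "compact (frontier \<Omega>)" using bdd by (rule compact_frontier_bounded)
 have fne: "frontier \<Omega> \<noteq> {}" using y by blast
 have h'c: "continuous_on (frontier \<Omega>) h'"
  using h(2) has_derivative_continuous by (metis continuous_at_imp_continuous_on)
 obtain y0 where y0: "y0 \<in> frontier \<Omega>" "\<And>y. y \<in> frontier \<Omega> ==> norm (h' y0) <= norm (h' y)"
  using continuous_attains_inf[OF fcomp fne, of "%y. norm (h' y)"] h'c continuous_on_norm by blast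
 define s0 where "s0 = norm (h' y0)"
 have s0: "s0 > 0" using s(1) y0(1) by (simp add: s0_def)
 have "linear (L x)" for x using h(2) has_derivative_linear by blast
 from linear_family_bounded[OF fcomp this continuous_on_subset[OF h(3) subset_UNIV]]
 obtain M where M: "M > 0" "\<And>x v. x \<in> frontier \<Omega> ==> norm (L x v) <= M * norm v" by blast
 have LM: "\<bar>L x v \<bullet> v\<bar> <= M * (v \<bullet> v)" if "x \<in> frontier \<Omega>" for x v
 proof -
  have "\<bar>L x v \<bullet> v\<bar> <= norm (L x v) * norm v" by (rule Cauchy_Schwarz_ineq2)
  also have "... <= (M * norm v) * norm v" using M(2)[OF that] by (intro mult_right_mono) auto
  finally show ?thesis by (simp add: power2_norm_eq_inner[symmetric] power2_eq_square mult.assoc)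
 qed
 have C0at: "C0_at \<Omega> y = Max {l. is_eigenvalue (- \<kappa> y) l}" for y by (simp add: C0_at_def \<kappa>_def)
 have bound: "C0_at \<Omega> y <= M / s0" if y: "y \<in> frontier \<Omega>" for y
 proof -
  obtain A :: "'m space => 'm space" where A: "orthogonal_transformation A"
   and r: "\<And>v. L y (inv A (v, 0)) \<bullet> inv A (v, 0) = norm (h' y) * (v \<bullet> (\<kappa> y *v v))"
   and sym: "\<And>a b. ((- \<kappa> y) *v a) \<bullet> b = ((- \<kappa> y) *v b) \<bullet> a" using rel[OF y] by blast
  note ev = symmetric_matrix_eigenvalues[OF sym]
  have "C0_at \<Omega> y \<in> {l. is_eigenvalue (- \<kappa> y) l}" unfolding C0at using ev(1,2) by (rule Max_in)
  then obtain v where v: "v \<noteq> 0" "(- \<kappa> y) *v v = C0_at \<Omega> y *\<^sub>R v" by (auto simp: is_eigenvalue_def)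
  define t where "t = inv A (v, 0)"
  have "norm t = norm (v, 0::real)" using A orthogonal_transformation_inner_inv(4) orthogonal_transformation_norm unfolding t_def by blast
  then have tt: "t \<bullet> t = v \<bullet> v" by (simp add: norm_Pair power2_norm_eq_inner[symmetric])
  have vk: "v \<bullet> (\<kappa> y *v v) = - (C0_at \<Omega> y * (v \<bullet> v))"
  proof -
   have "\<kappa> y *v v = - (C0_at \<Omega> y *\<^sub>R v)" using v(2) unfolding neg by (metis minus_minus)
   then show ?thesis by simp
  qed
  have "norm (h' y) * (C0_at \<Omega> y * (v \<bullet> v)) <= M * (v \<bullet> v)"
   using LM[OF y, of t] r[of v] vk tt unfolding t_def by (simp add: abs_le_iff)
  then have le: "norm (h' y) * C0_at \<Omega> y <= M" using v(1) by (simp add: mult.assoc[symmetric])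
  show ?thesis
  proof (cases "C0_at \<Omega> y \<ge> 0")
   case True
   then have "s0 * C0_at \<Omega> y <= norm (h' y) * C0_at \<Omega> y" using y0(2)[OF y] by (intro mult_right_mono) (auto simp: s0_def)
   then show ?thesis using le s0 by (simp add: pos_le_divide_eq mult.commute)
  next
   case False
   moreover have "M / s0 > 0" using M(1) s0 by simp
   ultimately show ?thesis by linarith
  qed
 qed
 have C0ge: "C0_at \<Omega> y <= C0 \<Omega>" unfolding C0_def
 proof (rule cSUP_upper[OF y])
  show "bdd_above (C0_at \<Omega> ` frontier \<Omega>)" using bound by (rule bdd_aboveI2)
 qed
 obtain A :: "'m space => 'm space" where A: "orthogonal_transformation A" "A (?n y) = (0, -1)"
  and r: "\<And>v. L y (inv A (v, 0)) \<bullet> inv A (v, 0) = norm (h' y) * (v \<bullet> (\<kappa> y *v v))"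
  and cu: "\<And>v. tangent_to_frontier \<Omega> y (inv A (v, 0))"
  and sym: "\<And>a b. ((- \<kappa> y) *v a) \<bullet> b = ((- \<kappa> y) *v b) \<bullet> a" using rel[OF y] by blast
 note inv = orthogonal_transformation_inner_inv[OF A(1)]
 define v where "v = fst (A \<tau>)"
 have "A \<tau> \<bullet> A (?n y) = \<tau> \<bullet> ?n y" using A(1) unfolding orthogonal_transformation_def by blast
 then have "snd (A \<tau>) = 0" using A(2) \<tau> by (simp add: inner_prod_def)
 then have Av: "A \<tau> = (v, 0)" by (simp add: v_def prod_eq_iff)
 then have tv: "\<tau> = inv A (v, 0)" using inv(3) by metis
 show "tangent_to_frontier \<Omega> y \<tau>"
  unfolding tv by (rule cu)
 have "A \<tau> \<bullet> A \<tau> = \<tau> \<bullet> \<tau>" using A(1) unfolding orthogonal_transformation_def by blast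
 then have tt: "\<tau> \<bullet> \<tau> = v \<bullet> v" by (simp add: Av inner_prod_def)
 have "- (L y \<tau> \<bullet> \<tau>) = norm (h' y) * (v \<bullet> ((- \<kappa> y) *v v))"
  unfolding neg using r[of v] tv by simp
 also have "... <= norm (h' y) * (C0_at \<Omega> y * (v \<bullet> v))"
  unfolding C0at using symmetric_matrix_eigenvalues(3)[OF sym] by (intro mult_left_mono) auto
 also have "... <= norm (h' y) * (C0 \<Omega> * (\<tau> \<bullet> \<tau>))"
  unfolding tt using C0ge by (intro mult_left_mono mult_right_mono) auto
 finally show "- (L y \<tau> \<bullet> \<tau>) <= norm (h' y) * (C0 \<Omega> * (\<tau> \<bullet> \<tau>))" .
qed

text \<open>The field \<open>N\<close> extends the normal to the closure; its derivative along the boundary is the Weingarten map, bounded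
 below by \<open>- \<kappa>0\<close> and tangential since \<open>N\<close> has unit length on the boundary. The function \<open>h\<close> serves as a barrier: its
 gradient on the boundary is a positive multiple of the normal.\<close>

locale curved_domain = flow_domain \<Omega> n for \<Omega> :: "'a::euclidean_space set" and n +
 fixes h :: "'a => real" and h' :: "'a => 'a" and Lh :: "'a => 'a => 'a" and N :: "'a => 'a" and \<kappa>0 :: real
 assumes h: "\<And>x. (h has_derivative (%v. h' x \<bullet> v)) (at x)" "\<And>x. (h' has_derivative Lh x) (at x)"
   "\<And>v w. continuous_on UNIV (%x. Lh x v \<bullet> w)"
  and h_normal: "\<And>y. y \<in> frontier \<Omega> ==> \<exists>s>0. h' y = s *\<^sub>R n y"
  and N_smooth: "\<And>b. b \<in> Basis ==> C_on 2 (closure \<Omega>) (%x. N x \<bullet> b)"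
  and N_normal: "\<And>y. y \<in> frontier \<Omega> ==> N y = n y"
  and N_derivative: "\<And>y L \<tau>. y \<in> frontier \<Omega> ==> (N has_derivative L) (at y within closure \<Omega>) ==> \<tau> \<bullet> n y = 0 ==>
    - (L \<tau> \<bullet> \<tau>) <= \<kappa>0 * (\<tau> \<bullet> \<tau>) \<and> L \<tau> \<bullet> n y = 0"
  and tangent_curve: "\<And>y \<tau>. y \<in> frontier \<Omega> ==> \<tau> \<bullet> n y = 0 ==>
    tangent_to_frontier \<Omega> y \<tau>"

text \<open>The extension is \<open>N = Dh / sqrt (|Dh|\<^sup>2 + h\<^sup>2)\<close>: the gradient of a defining function may vanish inside the domain, but
 not where \<open>h\<close> vanishes, and on the boundary the formula gives the unit normal.\<close>

lemma curved_domain_exists: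
 fixes \<Omega> :: "'m::finite space set"
 assumes bd: "C_boundary 3 \<Omega>" and op: "open \<Omega>" and bdd: "bounded \<Omega>"
 obtains h h' Lh N where "curved_domain \<Omega> (outward_normal \<Omega>) h h' Lh N (C0 \<Omega>)"
proof -
 let ?n = "outward_normal \<Omega>"
 have dom: "flow_domain \<Omega> ?n"
  by unfold_locales (use op bdd outward_normal[OF bd] in auto)
 interpret flow_domain \<Omega> ?n by (rule dom)
 obtain h h' L where h0: "C_on 3 UNIV h" and h': "\<And>x. (h has_derivative (%v. h' x \<bullet> v)) (at x)"
  "\<And>x. (h' has_derivative L x) (at x)" "\<And>v w. continuous_on UNIV (%x. L x v \<bullet> w)"
  "\<And>b. b \<in> Basis ==> C_on 2 UNIV (%x. h' x \<bullet> b)"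
  and neg: "\<And>x. h x < 0 \<longleftrightarrow> x \<in> \<Omega>" and zero: "\<And>x. x \<in> frontier \<Omega> ==> h x = 0"
  and hn: "\<And>x. x \<in> frontier \<Omega> ==> \<exists>s>0. h' x = s *\<^sub>R ?n x"
  by (rule defining_function[OF bd op bdd]) (rule that)
 define m where "m x = h' x \<bullet> h' x + h x * h x" for x
 have mpos: "m x > 0" if "x \<in> closure \<Omega>" for x
 proof (cases "x \<in> \<Omega>")
  case True
  then have "h x * h x > 0" using neg[of x] by (simp add: mult_neg_neg)
  then show ?thesis by (simp add: m_def add_nonneg_pos)
 next
  case False
  then have "x \<in> frontier \<Omega>" using that closure_cases by blast
  then obtain s where "s > 0" "h' x = s *\<^sub>R ?n x" using hn by blast
  then show ?thesis using normal_unit[OF \<open>x \<in> frontier \<Omega>\<close>] by (simp add: m_def add_pos_nonneg)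
 qed
 define N where "N x = (m x powr (-1/2)) *\<^sub>R h' x" for x
 have Cm: "C_on 2 (closure \<Omega>) m"
 proof -
  have "C_on 2 UNIV (%x. (\<Sum>b\<in>Basis. (h' x \<bullet> b) * (h' x \<bullet> b)) + h x * h x)"
   using h'(4) C_on_le[OF h0, of 2] by (intro C_on_add C_on_sum C_on_mult) auto
  moreover have "m = (%x. (\<Sum>b\<in>Basis. (h' x \<bullet> b) * (h' x \<bullet> b)) + h x * h x)"
   unfolding m_def[abs_def] by (subst euclidean_inner) (rule refl)
  ultimately show ?thesis using C_on_subset by (metis subset_UNIV)
 qed
 have CN: "C_on 2 (closure \<Omega>) (%x. N x \<bullet> b)" if "b \<in> Basis" for b
  unfolding N_def inner_scaleR_left using C_on_powr[OF Cm mpos] C_on_subset[OF h'(4)[OF that]] by (intro C_on_mult) auto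
 have Nn: "N y = ?n y" "norm (h' y) > 0" "m y powr (-1/2) = 1 / norm (h' y)" "h' y = norm (h' y) *\<^sub>R ?n y" if y: "y \<in> frontier \<Omega>" for y
 proof -
  obtain s where s: "s > 0" "h' y = s *\<^sub>R ?n y" using hn[OF y] by blast
  have "norm (?n y) = 1" using normal_unit[OF y] by (simp add: norm_eq_1)
  then have ns: "norm (h' y) = s" using s by simp
  have "m y = s\<^sup>2" using zero[OF y] normal_unit[OF y] s(2) by (simp add: m_def power2_eq_square)
  then have "m y powr (-1/2) = 1 / s"
   using s(1) by (simp add: powr_minus_divide powr_half_sqrt)
  then show "N y = ?n y" "norm (h' y) > 0" "m y powr (-1/2) = 1 / norm (h' y)" "h' y = norm (h' y) *\<^sub>R ?n y"
   using s ns by (auto simp: N_def)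
 qed
 have dN: "\<exists>\<mu>'. (N has_derivative (%v. (1 / norm (h' y)) *\<^sub>R L y v + \<mu>' v *\<^sub>R h' y)) (at y)" if y: "y \<in> frontier \<Omega>" for y
 proof -
  have "y \<in> closure \<Omega>" using y closure_cases by blast
  have "\<exists>m'. (m has_derivative m') (at y)" unfolding m_def[abs_def]
   using has_derivative_add[OF has_derivative_inner[OF h'(2)[of y] h'(2)[of y]] has_derivative_mult[OF h'(1)[of y] h'(1)[of y]]] by blast
  then obtain m' where m': "(m has_derivative m') (at y)" by blast
  have "((%t. t powr (-1/2)) has_real_derivative (-1/2) * m y powr (-1/2 - 1)) (at (m y))"
   using mpos[OF \<open>y \<in> closure \<Omega>\<close>] by (auto intro!: derivative_eq_intros)
  from DERIV_compose_FDERIV[where f = "%t. t powr (-1/2)" and g = m, OF this m']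
  obtain \<mu>' where \<mu>': "((%x. m x powr (-1/2)) has_derivative \<mu>') (at y)" by blast
  have "(N has_derivative (%v. m y powr (-1/2) *\<^sub>R L y v + \<mu>' v *\<^sub>R h' y)) (at y)"
   unfolding N_def[abs_def] by (rule has_derivative_scaleR[OF \<mu>' h'(2)])
  then show ?thesis using Nn(3)[OF y] by auto
 qed
 have "curved_domain \<Omega> ?n h h' L N (C0 \<Omega>)"
 proof (unfold_locales)
  fix y Ly \<tau> assume y: "y \<in> frontier \<Omega>" and Ly: "(N has_derivative Ly) (at y within closure \<Omega>)" and \<tau>: "\<tau> \<bullet> ?n y = 0"
  obtain \<mu>' where \<mu>': "(N has_derivative (%v. (1 / norm (h' y)) *\<^sub>R L y v + \<mu>' v *\<^sub>R h' y)) (at y)"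
   using dN[OF y] by blast
  have "Ly = (%v. (1 / norm (h' y)) *\<^sub>R L y v + \<mu>' v *\<^sub>R h' y)"
   using has_derivative_unique_boundary[OF normal[OF y] y Ly has_derivative_at_withinI[OF \<mu>']] .
  then have Lyt: "Ly \<tau> = (1 / norm (h' y)) *\<^sub>R L y \<tau> + \<mu>' \<tau> *\<^sub>R h' y" by simp
  have dNy: "(N has_derivative Ly) (at y)" using \<mu>' \<open>Ly = _\<close> by simp
  have "h' y \<bullet> \<tau> = norm (h' y) * (\<tau> \<bullet> ?n y)" 
   using arg_cong[OF Nn(4)[OF y], of "%z. z \<bullet> \<tau>"] by (simp only: inner_scaleR_left inner_commute[of "?n y"])
  then have "h' y \<bullet> \<tau> = 0" using \<tau> by simp
  then have eq: "Ly \<tau> \<bullet> \<tau> = (1 / norm (h' y)) * (L y \<tau> \<bullet> \<tau>)" by (simp add: Lyt inner_add_left)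
  note cb = curvature_bound[OF bd op bdd h'(1-3) zero hn y \<tau>]
  have "- (Ly \<tau> \<bullet> \<tau>) = (- (L y \<tau> \<bullet> \<tau>)) / norm (h' y)" unfolding eq by simp
  also have "... <= (norm (h' y) * (C0 \<Omega> * (\<tau> \<bullet> \<tau>))) / norm (h' y)" using cb(1) by (intro divide_right_mono) auto
  also have "... = C0 \<Omega> * (\<tau> \<bullet> \<tau>)" using Nn(2)[OF y] by simp
  finally have 1: "- (Ly \<tau> \<bullet> \<tau>) <= C0 \<Omega> * (\<tau> \<bullet> \<tau>)" .
  obtain x e where x: "x 0 = y" "(x has_vector_derivative \<tau>) (at 0)" "e > 0" "\<And>s. \<bar>s\<bar> < e ==> x s \<in> frontier \<Omega>"
   using cb(2) unfolding tangent_to_frontier_def by blast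
  have "(N has_derivative Ly) (at (x 0))" using dNy x(1) by simp
  from diff_chain_at[OF x(2)[unfolded has_vector_derivative_def] this]
  have "((%s. N (x s)) has_derivative (%t. Ly (t *\<^sub>R \<tau>))) (at 0)" by (simp add: o_def)
  from has_derivative_inner[OF this this]
  have "((%s. N (x s) \<bullet> N (x s)) has_derivative (%t. N y \<bullet> Ly (t *\<^sub>R \<tau>) + Ly (t *\<^sub>R \<tau>) \<bullet> N y)) (at 0)" by (simp add: x(1))
  moreover have "N y \<bullet> Ly (t *\<^sub>R \<tau>) + Ly (t *\<^sub>R \<tau>) \<bullet> N y = (2 * (Ly \<tau> \<bullet> ?n y)) * t" for t
   using linear_cmul[OF has_derivative_linear[OF dNy], of t \<tau>] Nn(1)[OF y] by (simp add: inner_commute)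
  ultimately have "((%s. N (x s) \<bullet> N (x s)) has_real_derivative (2 * (Ly \<tau> \<bullet> ?n y))) (at 0)"
   by (simp only: has_field_derivative_def)
  moreover have "\<forall>s. \<bar>0 - s\<bar> < e --> N (x 0) \<bullet> N (x 0) = N (x s) \<bullet> N (x s)"
  proof (intro allI impI)
   fix s assume "\<bar>0 - s\<bar> < e"
   then have "x s \<in> frontier \<Omega>" using x(4) by simp
   then show "N (x 0) \<bullet> N (x 0) = N (x s) \<bullet> N (x s)" using Nn(1) normal_unit y x(1) by simp
  qed
  ultimately have "2 * (Ly \<tau> \<bullet> ?n y) = 0" using DERIV_local_const x(3) by blast
  then show "- (Ly \<tau> \<bullet> \<tau>) <= C0 \<Omega> * (\<tau> \<bullet> \<tau>) \<and> Ly \<tau> \<bullet> ?n y = 0" using 1 by simp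
 next
  fix y \<tau> assume y: "y \<in> frontier \<Omega>" and \<tau>: "\<tau> \<bullet> ?n y = 0"
  show "tangent_to_frontier \<Omega> y \<tau>"
   by (rule curvature_bound(2)[OF bd op bdd h'(1-3) zero hn y \<tau>])
 qed (use h' hn CN Nn(1) in blast)+
 then show ?thesis by (rule that)
qed

section \<open>Parabolic regularity\<close>

text \<open>A Hoelder modulus of continuity, stated once for the parabolic distance, for time alone and for space alone.\<close>

lemma tendsto_powr_modulus:
 fixes f :: "'a::topological_space => 'b::real_normed_vector"
 assumes \<sigma>: "\<sigma> > 0" and \<rho>: "(\<rho> \<longlongrightarrow> 0) (at p within K)" "\<And>z. 0 <= \<rho> z"
  and f: "\<And>z. z \<in> K ==> norm (f z) <= L * \<rho> z powr \<sigma>"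
 shows "(f \<longlongrightarrow> 0) (at p within K)"
proof (rule Lim_null_comparison)
 have "((%z. \<rho> z powr \<sigma>) \<longlongrightarrow> 0 powr \<sigma>) (at p within K)"
  by (rule tendsto_powr'[OF \<rho>(1) tendsto_const]) (use \<sigma> \<rho>(2) in auto)
 then show "((%z. L * \<rho> z powr \<sigma>) \<longlongrightarrow> 0) (at p within K)" using tendsto_mult_right_zero by simp
 show "\<forall>\<^sub>F z in at p within K. norm (f z) <= L * \<rho> z powr \<sigma>"
  unfolding eventually_at_filter by (intro always_eventually) (use f in blast)
qed

lemma parabolic_hoelder_continuous:
 assumes v: "parabolic_hoelder \<sigma> S I v" and \<sigma>: "\<sigma> > 0" and K: "compact K" "K \<subseteq> S \<times> I"
 shows "continuous_on K (%z. v (fst z) (snd z))"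
proof -
 obtain L where L: "\<And>x t y s. (x, t) \<in> K ==> (y, s) \<in> K ==> \<bar>v x t - v y s\<bar> <= L * (dist x y + sqrt \<bar>t - s\<bar>) powr \<sigma>"
 proof -
  obtain L where L: "\<forall>(x, t)\<in>K. \<forall>(y, s)\<in>K. \<bar>v x t - v y s\<bar> <= L * (dist x y + sqrt \<bar>t - s\<bar>) powr \<sigma>"
   using v K unfolding parabolic_hoelder_def by meson
  show ?thesis by (rule that[of L]) (use L in fastforce)
 qed
 show ?thesis unfolding continuous_on
 proof
  fix p assume p: "p \<in> K"
  define \<rho> where "\<rho> z = dist (fst z) (fst p) + sqrt \<bar>snd z - snd p\<bar>" for z
  have "(\<rho> \<longlongrightarrow> dist (fst p) (fst p) + sqrt \<bar>snd p - snd p\<bar>) (at p within K)"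
   unfolding \<rho>_def by (intro tendsto_intros)
  then have "(\<rho> \<longlongrightarrow> 0) (at p within K)" by simp
  note lim = tendsto_powr_modulus[OF \<sigma> this]
  have "((%z. v (fst z) (snd z) - v (fst p) (snd p)) \<longlongrightarrow> 0) (at p within K)"
  proof (rule lim)
   show "norm (v (fst z) (snd z) - v (fst p) (snd p)) <= L * \<rho> z powr \<sigma>" if "z \<in> K" for z
    using L[of "fst z" "snd z" "fst p" "snd p"] that p by (simp add: \<rho>_def)
  qed (simp_all add: \<rho>_def)
  then show "((%z. v (fst z) (snd z)) \<longlongrightarrow> v (fst p) (snd p)) (at p within K)"
   by (rule LIM_zero_cancel)
 qed
qed

text \<open>Continuity in space at each time and uniform Hoelder continuity in time give joint continuity.\<close>

lemma time_hoelder_continuous: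
 assumes v: "time_hoelder \<beta> S I v" and \<beta>: "\<beta> > 0"
  and x: "\<And>t. t \<in> I ==> continuous_on S (%x. v x t)"
  and AB: "compact A" "A \<subseteq> S" "compact B" "B \<subseteq> I"
 shows "continuous_on (A \<times> B) (%z. v (fst z) (snd z))"
proof -
 have "compact (A \<times> B)" "A \<times> B \<subseteq> S \<times> I" using AB by (auto intro: compact_Times)
 then obtain L where L: "\<And>x t s. x \<in> A ==> t \<in> B ==> s \<in> B ==> \<bar>v x t - v x s\<bar> <= L * \<bar>t - s\<bar> powr \<beta>"
  using v unfolding time_hoelder_def by (metis mem_Times_iff fst_conv snd_conv)
 show ?thesis unfolding continuous_on
 proof
  fix p assume p: "p \<in> A \<times> B"
  let ?F = "at p within A \<times> B"
  have "((%z. \<bar>snd z - snd p\<bar>) \<longlongrightarrow> \<bar>snd p - snd p\<bar>) ?F" by (intro tendsto_intros)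
  then have "((%z. \<bar>snd z - snd p\<bar>) \<longlongrightarrow> 0) ?F" by simp
  note lim = tendsto_powr_modulus[OF \<beta> this]
  have lim1: "((%z. v (fst z) (snd z) - v (fst z) (snd p)) \<longlongrightarrow> 0) ?F"
  proof (rule lim)
   show "norm (v (fst z) (snd z) - v (fst z) (snd p)) <= L * \<bar>snd z - snd p\<bar> powr \<beta>" if "z \<in> A \<times> B" for z
    using L[of "fst z" "snd z" "snd p"] that p by auto
  qed simp_all
  have "continuous_on (A \<times> B) (%z. v (fst z) (snd p))"
   using continuous_on_compose2[OF x[of "snd p"] continuous_on_fst[OF continuous_on_id], of "A \<times> B"] AB p by auto
  then have "((%z. v (fst z) (snd p)) \<longlongrightarrow> v (fst p) (snd p)) ?F"
   using p unfolding continuous_on by blast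
  then have lim2: "((%z. v (fst z) (snd p) - v (fst p) (snd p)) \<longlongrightarrow> 0) ?F" by (rule LIM_zero)
  from tendsto_add[OF lim1 lim2] have "((%z. v (fst z) (snd z) - v (fst p) (snd p)) \<longlongrightarrow> 0) ?F" by simp
  then show "((%z. v (fst z) (snd z)) \<longlongrightarrow> v (fst p) (snd p)) ?F" by (rule LIM_zero_cancel)
 qed
qed

lemma continuous_on_open_Times:
 fixes F :: "'a::euclidean_space \<times> real => 'b::topological_space"
 assumes "open S" "open J"
  and c: "\<And>A B. compact A ==> A \<subseteq> S ==> compact B ==> B \<subseteq> J ==> continuous_on (A \<times> B) F"
 shows "continuous_on (S \<times> J) F"
proof -
 have "continuous (at z) F" if z: "z \<in> S \<times> J" for z
 proof -
  obtain r where r: "r > 0" "cball (fst z) r \<subseteq> S" using assms(1) z open_contains_cball by (metis mem_Times_iff)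
  obtain s where s: "s > 0" "cball (snd z) s \<subseteq> J" using assms(2) z open_contains_cball by (metis mem_Times_iff)
  have "continuous_on (cball (fst z) r \<times> cball (snd z) s) F" using r s by (intro c) auto
  then have "continuous_on (ball (fst z) r \<times> ball (snd z) s) F"
   by (rule continuous_on_subset) (auto intro: Sigma_mono)
  moreover have "open (ball (fst z) r \<times> ball (snd z) s)" by (intro open_Times) auto
  moreover have "z \<in> ball (fst z) r \<times> ball (snd z) s" using r s by (auto simp: mem_Times_iff)
  ultimately show ?thesis using continuous_on_eq_continuous_at by blast
 qed
 then show ?thesis by (intro continuous_at_imp_continuous_on) auto
qed

lemma continuous_on_slice:
 assumes c: "continuous_on (S \<times> J) (%z. F (fst z) (snd z))" and t: "t \<in> J"
 shows "continuous_on S (%x. F x t)"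
proof -
 have "continuous_on S ((%z. F (fst z) (snd z)) \<circ> (%x. (x, t)))"
 proof (rule continuous_on_compose)
  show "continuous_on S (%x. (x, t))" by (intro continuous_intros)
  show "continuous_on ((%x. (x, t)) ` S) (%z. F (fst z) (snd z))"
   by (rule continuous_on_subset[OF c]) (use t in auto)
 qed
 then show ?thesis by (simp add: o_def)
qed

lemma C_parabolic_2_derivatives:
 fixes u :: "'a::euclidean_space => real => real"
 assumes u: "C_parabolic_on (Suc (Suc 0)) \<sigma> S I u" and \<sigma>: "\<sigma> > 0"
 obtains g L w where
  "\<And>x t. x \<in> S ==> t \<in> I ==> ((%y. u y t) has_derivative (%h. g x t \<bullet> h)) (at x within S)"
  "\<And>x t. x \<in> S ==> t \<in> I ==> ((%y. g y t) has_derivative L x t) (at x within S)"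
  "\<And>x t. x \<in> S ==> t \<in> I ==> ((%s. u x s) has_real_derivative w x t) (at t within I)"
  "\<And>A B. compact A ==> A \<subseteq> S ==> compact B ==> B \<subseteq> I ==> continuous_on (A \<times> B) (%z. g (fst z) (snd z))"
  "\<And>A B v. compact A ==> A \<subseteq> S ==> compact B ==> B \<subseteq> I ==> continuous_on (A \<times> B) (%z. L (fst z) (snd z) v)"
  "\<And>A B. compact A ==> A \<subseteq> S ==> compact B ==> B \<subseteq> I ==> continuous_on (A \<times> B) (%z. w (fst z) (snd z))"
proof -
 from u obtain g w where g: "\<forall>x\<in>S. \<forall>t\<in>I. ((%y. u y t) has_derivative (%h. g x t \<bullet> h)) (at x within S)"
  "\<forall>b\<in>Basis. C_parabolic_on (Suc 0) \<sigma> S I (%x t. g x t \<bullet> b)"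
  and w: "\<forall>x\<in>S. \<forall>t\<in>I. ((%s. u x s) has_real_derivative w x t) (at t within I)" "C_parabolic_on 0 \<sigma> S I w"
  unfolding C_parabolic_on.simps(3) by blast
 have "\<forall>b\<in>Basis. \<exists>G. (\<forall>x\<in>S. \<forall>t\<in>I. ((%y. g y t \<bullet> b) has_derivative (%h. G x t \<bullet> h)) (at x within S)) \<and>
     (\<forall>c\<in>Basis. parabolic_hoelder \<sigma> S I (%x t. G x t \<bullet> c))"
  using g(2) unfolding C_parabolic_on.simps(1,2) by blast
 then obtain G where G: "\<And>b x t. b \<in> Basis ==> x \<in> S ==> t \<in> I ==> ((%y. g y t \<bullet> b) has_derivative (%h. G b x t \<bullet> h)) (at x within S)"
  "\<And>b c. b \<in> Basis ==> c \<in> Basis ==> parabolic_hoelder \<sigma> S I (%x t. G b x t \<bullet> c)" by metis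
 define L where "L x t v = (\<Sum>b\<in>Basis. (G b x t \<bullet> v) *\<^sub>R b)" for x t v
 show ?thesis
 proof (rule that[of g L w])
  show "((%y. g y t) has_derivative L x t) (at x within S)" if "x \<in> S" "t \<in> I" for x t
   unfolding L_def[abs_def] using G(1)[OF _ that] by (rule has_derivative_from_components)
  fix A :: "'a set" and B :: "real set" assume AB: "compact A" "A \<subseteq> S" "compact B" "B \<subseteq> I"
  have cAB: "compact (A \<times> B)" "A \<times> B \<subseteq> S \<times> I" using AB by (auto intro: compact_Times)
  show "continuous_on (A \<times> B) (%z. w (fst z) (snd z))"
   using w(2) by (intro parabolic_hoelder_continuous[OF _ \<sigma> cAB]) simp
  have Gc: "continuous_on (A \<times> B) (%z. G b (fst z) (snd z))" if "b \<in> Basis" for b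
   using parabolic_hoelder_continuous[OF G(2)[OF that] \<sigma> cAB]
   by (subst continuous_on_componentwise) blast
  then show "continuous_on (A \<times> B) (%z. L (fst z) (snd z) v)" for v
   unfolding L_def by (intro continuous_intros) auto
  have "continuous_on (A \<times> B) (%z. g (fst z) (snd z) \<bullet> b)" if b: "b \<in> Basis" for b
  proof (rule time_hoelder_continuous[OF _ _ _ AB, of "(1 + \<sigma>) / 2" "%x t. g x t \<bullet> b"])
   show "time_hoelder ((1 + \<sigma>) / 2) S I (%x t. g x t \<bullet> b)" using g(2) b by simp
   show "continuous_on S (%x. g x t \<bullet> b)" if "t \<in> I" for t
    unfolding continuous_on_eq_continuous_within
    using G(1)[OF b _ that] has_derivative_continuous by blast
  qed (use \<sigma> in auto)
  then show "continuous_on (A \<times> B) (%z. g (fst z) (snd z))"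
   by (subst continuous_on_componentwise) blast
 qed (use g(1) w(1) in auto)
qed

text \<open>The derivatives of a solution that occur in the estimates, as functions of their own. Those up to second order in
 space and first order in time are continuous up to the boundary and the initial time; third space derivatives and
 mixed derivatives exist at interior points and interior times only, which suffices at interior maxima.\<close>

locale smooth_evolution = flow_domain \<Omega> n for \<Omega> :: "'a::euclidean_space set" and n +
 fixes T :: real and u :: "'a => real => real" and Du :: "'a => real => 'a"
  and H :: "'a => real => 'a => 'a" and ut :: "'a => real => real"
  and D3 :: "'a => real => 'a => 'a => 'a" and Dut :: "'a => real => 'a"
 assumes T: "T > 0"
  and Du: "\<And>x t. x \<in> closure \<Omega> ==> t \<in> {0..T} ==> ((%y. u y t) has_derivative (%h. Du x t \<bullet> h)) (at x within closure \<Omega>)"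
  and H: "\<And>x t. x \<in> closure \<Omega> ==> t \<in> {0..T} ==> ((%y. Du y t) has_derivative H x t) (at x within closure \<Omega>)"
  and ut: "\<And>x t. x \<in> closure \<Omega> ==> t \<in> {0..T} ==> ((%s. u x s) has_real_derivative ut x t) (at t within {0..T})"
  and Du_continuous: "continuous_on (closure \<Omega> \<times> {0..T}) (%z. Du (fst z) (snd z))"
  and H_continuous: "\<And>v. continuous_on (closure \<Omega> \<times> {0..T}) (%z. H (fst z) (snd z) v)"
  and ut_continuous: "continuous_on (closure \<Omega> \<times> {0..T}) (%z. ut (fst z) (snd z))"
  and H_symmetric: "\<And>x t v w. x \<in> closure \<Omega> ==> t \<in> {0..T} ==> H x t v \<bullet> w = H x t w \<bullet> v"
  and D3: "\<And>x t v. x \<in> \<Omega> ==> t \<in> {0<..<T} ==> ((%y. H y t v) has_derivative D3 x t v) (at x)"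
  and D3_symmetric: "\<And>x t v w. x \<in> \<Omega> ==> t \<in> {0<..<T} ==> D3 x t v w = D3 x t w v"
   "\<And>x t v w z. x \<in> \<Omega> ==> t \<in> {0<..<T} ==> D3 x t v w \<bullet> z = D3 x t z w \<bullet> v"
  and Dut: "\<And>x t. x \<in> \<Omega> ==> t \<in> {0<..<T} ==> ((%s. Du x s) has_vector_derivative Dut x t) (at t)"
   "\<And>x t. x \<in> \<Omega> ==> t \<in> {0<..<T} ==> ((%y. ut y t) has_derivative (%v. Dut x t \<bullet> v)) (at x)"
begin

lemma H_linear: "x \<in> closure \<Omega> ==> t \<in> {0..T} ==> linear (H x t)"
 using H has_derivative_linear by blast

end

text \<open>The regularity classes provide derivatives on two different sets, the closed cylinder and the interior one; they
 agree on the overlap by uniqueness of derivatives. The symmetries come from Schwarz's theorem inside and by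
 continuity on the boundary.\<close>

lemma smooth_evolution_exists:
 fixes u :: "'a::euclidean_space => real => real"
 assumes dom: "flow_domain \<Omega> n" and T: "T > 0" and \<sigma>: "0 < \<sigma>"
  and u2: "C_parabolic_on 2 \<sigma> (closure \<Omega>) {0..T} u" and u3: "C_parabolic_on 3 \<sigma> \<Omega> {0<..T} u"
 obtains Du H ut D3 Dut where "smooth_evolution \<Omega> n T u Du H ut D3 Dut"
proof -
 interpret flow_domain \<Omega> n by (rule dom)
 obtain Du H ut where d: "\<And>x t. x \<in> closure \<Omega> ==> t \<in> {0..T} ==> ((%y. u y t) has_derivative (%h. Du x t \<bullet> h)) (at x within closure \<Omega>)"
  "\<And>x t. x \<in> closure \<Omega> ==> t \<in> {0..T} ==> ((%y. Du y t) has_derivative H x t) (at x within closure \<Omega>)"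
  "\<And>x t. x \<in> closure \<Omega> ==> t \<in> {0..T} ==> ((%s. u x s) has_real_derivative ut x t) (at t within {0..T})"
  and c: "\<And>A B. compact A ==> A \<subseteq> closure \<Omega> ==> compact B ==> B \<subseteq> {0..T} ==> continuous_on (A \<times> B) (%z. Du (fst z) (snd z))"
  "\<And>A B v. compact A ==> A \<subseteq> closure \<Omega> ==> compact B ==> B \<subseteq> {0..T} ==> continuous_on (A \<times> B) (%z. H (fst z) (snd z) v)"
  "\<And>A B. compact A ==> A \<subseteq> closure \<Omega> ==> compact B ==> B \<subseteq> {0..T} ==> continuous_on (A \<times> B) (%z. ut (fst z) (snd z))"
  by (rule C_parabolic_2_derivatives[OF u2[unfolded numeral_2_eq_2] \<sigma>]) (rule that)
 note cc = c(1)[OF compact_closure_domain order_refl compact_Icc order_refl]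
  c(2)[OF compact_closure_domain order_refl compact_Icc order_refl]
  c(3)[OF compact_closure_domain order_refl compact_Icc order_refl]
 have sub: "\<Omega> \<subseteq> closure \<Omega>" by (rule closure_subset)
 have atin: "at x within \<Omega> = at x" if "x \<in> \<Omega>" for x using that open_domain at_within_open by blast
 have att: "at t within {0<..T} = at t" "at t within {0..T} = at t" if "t \<in> {0<..<T}" for t
  using that by (auto intro!: at_within_interior)
 from u3 obtain g3 w3 where g3: "\<forall>x\<in>\<Omega>. \<forall>t\<in>{0<..T}. ((%y. u y t) has_derivative (%h. g3 x t \<bullet> h)) (at x within \<Omega>)"
  "\<forall>b\<in>Basis. C_parabolic_on (Suc (Suc 0)) \<sigma> \<Omega> {0<..T} (%x t. g3 x t \<bullet> b)"
  and w3: "\<forall>x\<in>\<Omega>. \<forall>t\<in>{0<..T}. ((%s. u x s) has_real_derivative w3 x t) (at t within {0<..T})" "C_parabolic_on (Suc 0) \<sigma> \<Omega> {0<..T} w3"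
  unfolding numeral_3_eq_3 C_parabolic_on.simps(3)[of "Suc 0"] by blast
 have gDu: "g3 x t = Du x t" if "x \<in> \<Omega>" "t \<in> {0<..T}" for x t
 proof -
  have "((%y. u y t) has_derivative (%h. g3 x t \<bullet> h)) (at x)" using g3(1) that atin by metis
  moreover have "((%y. u y t) has_derivative (%h. Du x t \<bullet> h)) (at x)"
   using d(1)[of x t] that sub at_within_interior_point by auto
  ultimately have "(%h. g3 x t \<bullet> h) = (%h. Du x t \<bullet> h)" by (rule has_derivative_unique)
  then show ?thesis by (metis vector_eq_rdot)
 qed
 define Good where "Good b G L w \<longleftrightarrow>
  (\<forall>x\<in>\<Omega>. \<forall>t\<in>{0<..T}. ((%y. g3 y t \<bullet> b) has_derivative (%h. G x t \<bullet> h)) (at x)) \<and>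
  (\<forall>x\<in>\<Omega>. \<forall>t\<in>{0<..T}. ((%y. G y t) has_derivative L x t) (at x)) \<and>
  (\<forall>x\<in>\<Omega>. \<forall>t\<in>{0<..<T}. ((%s. g3 x s \<bullet> b) has_real_derivative w x t) (at t)) \<and>
  (\<forall>v. continuous_on (\<Omega> \<times> {0<..<T}) (%z. L (fst z) (snd z) v)) \<and>
  continuous_on (\<Omega> \<times> {0<..<T}) (%z. w (fst z) (snd z))"
  for b :: 'a and G and L :: "'a => real => 'a => 'a" and w :: "'a => real => real"
 have "\<exists>G L w. Good b G L w" if b: "b \<in> Basis" for b
 proof -
  obtain G L w where *: "\<And>x t. x \<in> \<Omega> ==> t \<in> {0<..T} ==> ((%y. g3 y t \<bullet> b) has_derivative (%h. G x t \<bullet> h)) (at x within \<Omega>)"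
  "\<And>x t. x \<in> \<Omega> ==> t \<in> {0<..T} ==> ((%y. G y t) has_derivative L x t) (at x within \<Omega>)"
  "\<And>x t. x \<in> \<Omega> ==> t \<in> {0<..T} ==> ((%s. g3 x s \<bullet> b) has_real_derivative w x t) (at t within {0<..T})"
  and cL: "\<And>A B v. compact A ==> A \<subseteq> \<Omega> ==> compact B ==> B \<subseteq> {0<..T} ==> continuous_on (A \<times> B) (%z. L (fst z) (snd z) v)"
  and cw: "\<And>A B. compact A ==> A \<subseteq> \<Omega> ==> compact B ==> B \<subseteq> {0<..T} ==> continuous_on (A \<times> B) (%z. w (fst z) (snd z))"
   by (rule C_parabolic_2_derivatives[OF bspec[OF g3(2) b] \<sigma>]) (rule that)
  have J: "B \<subseteq> {0<..T}" if "B \<subseteq> {0<..<T}" for B :: "real set" using that by auto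
  have 1: "continuous_on (\<Omega> \<times> {0<..<T}) (%z. L (fst z) (snd z) v)" for v
   by (rule continuous_on_open_Times[OF open_domain open_greaterThanLessThan]) (intro cL J)
  have 2: "continuous_on (\<Omega> \<times> {0<..<T}) (%z. w (fst z) (snd z))"
   by (rule continuous_on_open_Times[OF open_domain open_greaterThanLessThan]) (intro cw J)
  have "Good b G L w" unfolding Good_def
  proof (intro conjI ballI allI 1 2)
   fix x t assume x: "x \<in> \<Omega>"
   show "((%y. g3 y t \<bullet> b) has_derivative (%h. G x t \<bullet> h)) (at x)" if "t \<in> {0<..T}" using *(1)[OF x that] atin[OF x] by simp
   show "((%y. G y t) has_derivative L x t) (at x)" if "t \<in> {0<..T}" using *(2)[OF x that] atin[OF x] by simp
   show "((%s. g3 x s \<bullet> b) has_real_derivative w x t) (at t)" if t: "t \<in> {0<..<T}" using *(3)[OF x, of t] t att(1)[OF t] by simp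
  qed
  then show ?thesis by blast
 qed
 then have "\<forall>b. \<exists>G L w. b \<in> Basis --> Good b G L w" by blast
 then obtain G L w where Good: "\<And>b. b \<in> Basis ==> Good b (G b) (L b) (w b)" by metis
 have G: "\<And>b x t. b \<in> Basis ==> x \<in> \<Omega> ==> t \<in> {0<..T} ==> ((%y. g3 y t \<bullet> b) has_derivative (%h. G b x t \<bullet> h)) (at x)"
  "\<And>b x t. b \<in> Basis ==> x \<in> \<Omega> ==> t \<in> {0<..T} ==> ((%y. G b y t) has_derivative L b x t) (at x)"
  "\<And>b x t. b \<in> Basis ==> x \<in> \<Omega> ==> t \<in> {0<..<T} ==> ((%s. g3 x s \<bullet> b) has_real_derivative w b x t) (at t)"
  and cL: "\<And>b v. b \<in> Basis ==> continuous_on (\<Omega> \<times> {0<..<T}) (%z. L b (fst z) (snd z) v)"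
  and cw: "\<And>b. b \<in> Basis ==> continuous_on (\<Omega> \<times> {0<..<T}) (%z. w b (fst z) (snd z))"
  using Good unfolding Good_def by blast+
 have Hin: "((%y. Du y t) has_derivative H x t) (at x)" if "x \<in> \<Omega>" "t \<in> {0..T}" for x t
  using d(2)[of x t] that sub at_within_interior_point by auto
 have HG: "H x t v \<bullet> b = G b x t \<bullet> v" if x: "x \<in> \<Omega>" and t: "t \<in> {0<..T}" and b: "b \<in> Basis" for x t v b
 proof -
  have "((%y. Du y t \<bullet> b) has_derivative (%h. H x t h \<bullet> b)) (at x)"
   using has_derivative_inner_left[OF Hin[OF x]] t by simp
  then have "((%y. g3 y t \<bullet> b) has_derivative (%h. H x t h \<bullet> b)) (at x)"
   by (rule has_derivative_transform_within_open[OF _ open_domain x]) (use gDu t in simp)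
  from has_derivative_unique[OF this G(1)[OF b x t]] show ?thesis by metis
 qed
 define D3 where "D3 x t v z = (\<Sum>b\<in>Basis. (L b x t z \<bullet> v) *\<^sub>R b)" for x t v z
 define Dut where "Dut x t = (\<Sum>b\<in>Basis. w b x t *\<^sub>R b)" for x t
 have dD3: "((%y. H y t v) has_derivative D3 x t v) (at x)" if x: "x \<in> \<Omega>" and t: "t \<in> {0<..<T}" for x t v
  unfolding D3_def[abs_def]
 proof (rule has_derivative_from_components)
  fix b :: 'a assume b: "b \<in> Basis"
  have t': "t \<in> {0<..T}" using t by auto
  have "((%y. G b y t \<bullet> v) has_derivative (%h. L b x t h \<bullet> v)) (at x)"
   by (rule has_derivative_inner_left[OF G(2)[OF b x t']])
  then show "((%y. H y t v \<bullet> b) has_derivative (%h. L b x t h \<bullet> v)) (at x)"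
   by (rule has_derivative_transform_within_open[OF _ open_domain x]) (use HG[OF _ t' b] in simp)
 qed
 have contx: "continuous_on \<Omega> (%x. F x t)" if "continuous_on (\<Omega> \<times> {0<..<T}) (%z. F (fst z) (snd z))" "t \<in> {0<..<T}"
  for F :: "'a => real => 'a" and t
  using that by (rule continuous_on_slice)
 have symH_in: "H x t v \<bullet> b = H x t b \<bullet> v" if x: "x \<in> \<Omega>" and t: "t \<in> {0..T}" for x t v b
 proof (rule second_derivative_symmetric[of \<Omega> x "%y. u y t" "%y. Du y t" "%y. H y t" b v])
  show "((%y. u y t) has_derivative (%h. Du y t \<bullet> h)) (at y)" if "y \<in> \<Omega>" for y
   using d(1)[of y t] that t sub at_within_interior_point by auto
  have "continuous_on \<Omega> (%x. H x t b)"
   using continuous_on_subset[OF continuous_on_slice[OF cc(2) t] sub] .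
  then show "continuous_on \<Omega> (%x. H x t b \<bullet> v)" by (intro continuous_intros)
 qed (use x t Hin open_domain in auto)
 have symH: "H x t v \<bullet> b = H x t b \<bullet> v" if x: "x \<in> closure \<Omega>" and t: "t \<in> {0..T}" for x t v b
 proof -
  have "continuous_on (closure \<Omega>) (%x. H x t v)" for v
   using continuous_on_slice[OF cc(2) t] .
  then have "continuous_on (closure \<Omega>) (%x. H x t v \<bullet> b - H x t b \<bullet> v)" by (intro continuous_intros)
  then have "H x t v \<bullet> b - H x t b \<bullet> v = 0"
   using continuous_constant_on_closure[of \<Omega> "%x. H x t v \<bullet> b - H x t b \<bullet> v" 0 x] symH_in t x by simp
  then show ?thesis by simp
 qed
 have symL: "L b x t v \<bullet> z = L b x t z \<bullet> v" if x: "x \<in> \<Omega>" and t: "t \<in> {0<..<T}" and b: "b \<in> Basis" for x t b v z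
 proof (rule second_derivative_symmetric[of \<Omega> x "%y. g3 y t \<bullet> b" "%y. G b y t" "%y. L b y t" z v])
  show "continuous_on \<Omega> (%x. L b x t z \<bullet> v)" using contx[OF cL[OF b, of z] t] by (intro continuous_intros)
 qed (use x t G(1,2)[OF b] open_domain in auto)
 have sym1: "D3 x t v z = D3 x t z v" if x: "x \<in> \<Omega>" and t: "t \<in> {0<..<T}" for x t v z
  unfolding D3_def using symL[OF x t] by (intro sum.cong) auto
 have sym2: "D3 x t v z \<bullet> y = D3 x t y z \<bullet> v" if x: "x \<in> \<Omega>" and t: "t \<in> {0<..<T}" for x t v z y
 proof -
  have "((%x. H x t v \<bullet> y) has_derivative (%h. D3 x t v h \<bullet> y)) (at x)"
   by (rule has_derivative_inner_left[OF dD3[OF x t]])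
  moreover have "((%x. H x t y \<bullet> v) has_derivative (%h. D3 x t y h \<bullet> v)) (at x)"
   by (rule has_derivative_inner_left[OF dD3[OF x t]])
  then have "((%x. H x t v \<bullet> y) has_derivative (%h. D3 x t y h \<bullet> v)) (at x)"
   by (rule has_derivative_transform_within_open[OF _ open_domain x]) (use symH_in t in auto)
  ultimately show ?thesis using has_derivative_unique by metis
 qed
 have dDut: "((%s. Du x s) has_vector_derivative Dut x t) (at t)" if x: "x \<in> \<Omega>" and t: "t \<in> {0<..<T}" for x t
 proof -
  have "((%s. Du x s) has_derivative (%h. \<Sum>b\<in>Basis. (w b x t * h) *\<^sub>R b)) (at t)"
  proof (rule has_derivative_from_components)
   fix b :: 'a assume b: "b \<in> Basis"
   have "((%s. g3 x s \<bullet> b) has_derivative (%h. w b x t * h)) (at t)"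
    using G(3)[OF b x t] by (simp add: has_field_derivative_def)
   then show "((%s. Du x s \<bullet> b) has_derivative (%h. w b x t * h)) (at t)"
    by (rule has_derivative_transform_within_open[of _ _ _ _ "{0<..<T}"]) (use gDu[OF x] t in auto)
  qed
  moreover have "(\<Sum>b\<in>Basis. (w b x t * h) *\<^sub>R b) = h *\<^sub>R Dut x t" for h
   by (simp add: Dut_def scaleR_sum_right mult.commute)
  ultimately show ?thesis by (simp add: has_vector_derivative_def)
 qed
 from w3(2) obtain p where p: "\<forall>x\<in>\<Omega>. \<forall>t\<in>{0<..T}. ((%y. w3 y t) has_derivative (%h. p x t \<bullet> h)) (at x within \<Omega>)"
  unfolding C_parabolic_on.simps(2) by blast
 have w3ut: "w3 x t = ut x t" if x: "x \<in> \<Omega>" and t: "t \<in> {0<..<T}" for x t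
 proof -
  have "((%s. u x s) has_real_derivative w3 x t) (at t)" using bspec[OF bspec[OF w3(1) x], of t] t att(1)[OF t] by simp
  moreover have "((%s. u x s) has_real_derivative ut x t) (at t)" using d(3)[of x t] x t sub att(2)[OF t] by auto
  ultimately show ?thesis by (rule DERIV_unique)
 qed
 have dut: "((%y. ut y t) has_derivative (%v. p x t \<bullet> v)) (at x)" if x: "x \<in> \<Omega>" and t: "t \<in> {0<..<T}" for x t
 proof -
  have "((%y. w3 y t) has_derivative (%v. p x t \<bullet> v)) (at x)" using bspec[OF bspec[OF p x], of t] t atin[OF x] by simp
  then show ?thesis by (rule has_derivative_transform_within_open[OF _ open_domain x]) (use w3ut t in auto)
 qed
 have pDut: "p x t \<bullet> v = Dut x t \<bullet> v" if x: "x \<in> \<Omega>" and t: "t \<in> {0<..<T}" for x t v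
 proof -
  obtain e0 where e0: "e0 > 0" "\<And>s. \<bar>s\<bar> < e0 ==> x + s *\<^sub>R v \<in> \<Omega>" using segment_in_open[OF open_domain x] by blast
  define e where "e = min e0 (min t (T - t))"
  have e: "e > 0" using e0 t by (auto simp: e_def)
  have inO: "x + s *\<^sub>R v \<in> \<Omega>" if "\<bar>s\<bar> < e" for s using e0(2)[of s] that by (simp add: e_def)
  have int: "t + s \<in> {0<..<T}" if "\<bar>s\<bar> < e" for s using that by (auto simp: e_def)
  have "p x t \<bullet> v = Dut (x + 0 *\<^sub>R v) (t + 0) \<bullet> v"
  proof (rule mixed_partials_commute[OF e, of "%s \<tau>. u (x + s *\<^sub>R v) (t + \<tau>)" "%s \<tau>. Du (x + s *\<^sub>R v) (t + \<tau>) \<bullet> v"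
    "%s \<tau>. Dut (x + s *\<^sub>R v) (t + \<tau>) \<bullet> v" "%s \<tau>. ut (x + s *\<^sub>R v) (t + \<tau>)"])
   fix s \<tau> :: real assume s: "\<bar>s\<bar> < e" and \<tau>: "\<bar>\<tau>\<bar> < e"
   show "((%s. u (x + s *\<^sub>R v) (t + \<tau>)) has_real_derivative Du (x + s *\<^sub>R v) (t + \<tau>) \<bullet> v) (at s)"
   proof (rule DERIV_along_line[where D = "%h. Du (x + s *\<^sub>R v) (t + \<tau>) \<bullet> h"])
    show "((%y. u y (t + \<tau>)) has_derivative (%h. Du (x + s *\<^sub>R v) (t + \<tau>) \<bullet> h)) (at (x + s *\<^sub>R v))"
     using d(1)[of "x + s *\<^sub>R v" "t + \<tau>"] inO[OF s] int[OF \<tau>] sub at_within_interior_point[OF inO[OF s]] by auto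
   qed
   have sh: "((%\<tau>. t + \<tau>) has_vector_derivative 1) (at \<tau>)"
    by (auto intro!: derivative_eq_intros)
   have "((%\<tau>. Du (x + s *\<^sub>R v) (t + \<tau>)) has_vector_derivative Dut (x + s *\<^sub>R v) (t + \<tau>)) (at \<tau>)"
    using vector_diff_chain_at[OF sh dDut[OF inO[OF s] int[OF \<tau>]]] by (simp add: o_def)
   then have "((%\<tau>. Du (x + s *\<^sub>R v) (t + \<tau>)) has_derivative (%h. h *\<^sub>R Dut (x + s *\<^sub>R v) (t + \<tau>))) (at \<tau>)"
    by (simp add: has_vector_derivative_def)
   from has_derivative_inner_left[OF this, of v]
   show "((%\<tau>. Du (x + s *\<^sub>R v) (t + \<tau>) \<bullet> v) has_real_derivative Dut (x + s *\<^sub>R v) (t + \<tau>) \<bullet> v) (at \<tau>)"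
    by (simp add: has_field_derivative_def mult.commute[of _ "Dut (x + s *\<^sub>R v) (t + \<tau>) \<bullet> v"])
  next
   fix s :: real assume s: "\<bar>s\<bar> < e"
   have "((%\<tau>. u (x + s *\<^sub>R v) \<tau>) has_real_derivative ut (x + s *\<^sub>R v) (t + 0)) (at (t + 0))"
    using d(3)[of "x + s *\<^sub>R v" t] inO[OF s] t sub att(2)[OF t] by auto
   then show "((%\<tau>. u (x + s *\<^sub>R v) (t + \<tau>)) has_real_derivative ut (x + s *\<^sub>R v) (t + 0)) (at 0)"
    using DERIV_shift[of "u (x + s *\<^sub>R v)" "ut (x + s *\<^sub>R v) t" 0 t] by (simp add: add.commute)
  next
   have "((%y. ut y t) has_derivative (%v. p x t \<bullet> v)) (at (x + 0 *\<^sub>R v))" using dut[OF x t] by simp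
   from DERIV_along_line[OF this]
   show "((%s. ut (x + s *\<^sub>R v) (t + 0)) has_real_derivative p x t \<bullet> v) (at 0)" by simp
  next
   have "continuous_on (\<Omega> \<times> {0<..<T}) (%z. Dut (fst z) (snd z))"
    unfolding Dut_def using cw by (intro continuous_intros) auto
   then have "continuous_on (\<Omega> \<times> {0<..<T}) (%z. Dut (fst z) (snd z) \<bullet> v)" by (intro continuous_intros)
   then have c1: "isCont (%z. Dut (fst z) (snd z) \<bullet> v) (x, t)"
    by (rule continuous_on_eq_continuous_at[OF open_Times[OF open_domain open_greaterThanLessThan], THEN iffD1, THEN bspec])
      (use x t in simp)
   define Z where "Z z = (x + fst z *\<^sub>R v, t + snd z)" for z :: "real \<times> real"
   have "isCont Z (0, 0)" unfolding Z_def[abs_def] by (intro continuous_intros)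
   moreover have "Z (0, 0) = (x, t)" by (simp add: Z_def)
   ultimately have "isCont (%z. Dut (fst (Z z)) (snd (Z z)) \<bullet> v) (0, 0)"
    using isCont_o2[of "(0, 0)" Z "%z. Dut (fst z) (snd z) \<bullet> v"] c1 by simp
   then show "isCont (%(s, \<tau>). Dut (x + s *\<^sub>R v) (t + \<tau>) \<bullet> v) (0, 0)"
    by (simp add: Z_def case_prod_beta')
  qed
  then show ?thesis by simp
 qed
 have dut': "((%y. ut y t) has_derivative (%v. Dut x t \<bullet> v)) (at x)" if x: "x \<in> \<Omega>" and t: "t \<in> {0<..<T}" for x t
 proof -
  have "(%v. p x t \<bullet> v) = (%v. Dut x t \<bullet> v)" using pDut[OF x t] by blast
  then show ?thesis using dut[OF x t] by simp
 qed
 have "smooth_evolution \<Omega> n T u Du H ut D3 Dut"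
  by (intro smooth_evolution.intro smooth_evolution_axioms.intro dom) (fact T d cc symH dD3 sym1 sym2 dDut dut')+
 then show ?thesis by (rule that)
qed

section \<open>The equation and the bound on the speed\<close>

lemma W_pos: "\<eta> > 0 ==> W \<eta> p > 0"
 by (simp add: W_def add_pos_nonneg)

lemma W_sq: "(W \<eta> p)\<^sup>2 = \<eta>\<^sup>2 + p \<bullet> p"
 by (simp add: W_def power2_norm_eq_inner)

lemma norm_le_W: "norm p <= W \<eta> p"
 unfolding W_def by (rule real_le_rsqrt) simp

lemma W_le: "\<eta> \<ge> 0 ==> W \<eta> p <= \<eta> + norm p"
 unfolding W_def by (rule real_le_lsqrt) (auto simp: power2_sum)

lemma W_derivative:
 fixes p :: "'b::real_normed_vector => 'a::real_inner"
 assumes "\<eta> > 0" and "(p has_derivative p') (at x within S)"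
 shows "((%x. W \<eta> (p x)) has_derivative (%v. (p x \<bullet> p' v) / W \<eta> (p x))) (at x within S)"
proof -
 have pp: "((%x. \<eta>\<^sup>2 + p x \<bullet> p x) has_derivative (%v. 2 * (p x \<bullet> p' v))) (at x within S)"
 proof -
  have "((%x. \<eta>\<^sup>2 + p x \<bullet> p x) has_derivative (%v. 0 + (p x \<bullet> p' v + p' v \<bullet> p x))) (at x within S)"
   by (rule has_derivative_add[OF has_derivative_const has_derivative_inner[OF assms(2) assms(2)]])
  moreover have "(%v. 0 + (p x \<bullet> p' v + p' v \<bullet> p x)) = (%v. 2 * (p x \<bullet> p' v))"
  proof
   fix v show "0 + (p x \<bullet> p' v + p' v \<bullet> p x) = 2 * (p x \<bullet> p' v)"
    using inner_commute[of "p x" "p' v"] by linarith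
  qed
  ultimately show ?thesis by (rule has_derivative_eq_rhs)
 qed
 have pos: "\<eta>\<^sup>2 + p x \<bullet> p x > 0" using assms(1) by (simp add: add_pos_nonneg)
 have D: "((%x. sqrt (\<eta>\<^sup>2 + p x \<bullet> p x)) has_derivative (%v. 2 * (p x \<bullet> p' v) * (inverse (sqrt (\<eta>\<^sup>2 + p x \<bullet> p x)) / 2))) (at x within S)"
  using DERIV_compose_FDERIV[where f = sqrt and g = "%x. \<eta>\<^sup>2 + p x \<bullet> p x", OF DERIV_real_sqrt[OF pos] pp] .
 have W_eq: "W \<eta> = (%p::'a. sqrt (\<eta>\<^sup>2 + p \<bullet> p))"
  by (rule ext) (simp only: W_def power2_norm_eq_inner)
 show ?thesis unfolding W_eq
 proof (rule has_derivative_eq_rhs[OF D], rule ext)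
  fix v
  have "2 * a * (inverse b / 2) = a / b" for a b :: real by (simp add: inverse_eq_divide)
  then show "2 * (p x \<bullet> p' v) * (inverse (sqrt (\<eta>\<^sup>2 + p x \<bullet> p x)) / 2) = p x \<bullet> p' v / sqrt (\<eta>\<^sup>2 + p x \<bullet> p x)" .
 qed
qed

text \<open>The quotient rule removes the divergence form: the operator is \<open>tr ((I - p \<otimes> p / W\<^sup>2) D\<^sup>2u)\<close>.\<close>

lemma divergence_normalised_gradient:
 fixes p :: "'a::euclidean_space => 'a"
 assumes \<eta>: "\<eta> > 0" and p: "(p has_derivative p') (at x)"
 shows "W \<eta> (p x) * divergence (%y. (1 / W \<eta> (p y)) *\<^sub>R p y) x
  = (\<Sum>b\<in>Basis. p' b \<bullet> b) - p x \<bullet> p' (p x) / (W \<eta> (p x))\<^sup>2"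
proof -
 let ?w = "W \<eta> (p x)"
 have w: "?w > 0" using W_pos[OF \<eta>] .
 have lin: "linear p'" using p has_derivative_linear by blast
 have dW: "((%x. W \<eta> (p x)) has_derivative (%v. (p x \<bullet> p' v) / ?w)) (at x)"
  by (rule W_derivative[OF \<eta> p])
 have "((%t. 1 / t) has_real_derivative - (1 / ?w\<^sup>2)) (at ?w)"
  using w by (auto intro!: derivative_eq_intros simp: power2_eq_square)
 from DERIV_compose_FDERIV[where f = "%t. 1 / t" and g = "%x. W \<eta> (p x)", OF this dW]
 have "((%x. 1 / W \<eta> (p x)) has_derivative (%v. (p x \<bullet> p' v) / ?w * - (1 / ?w\<^sup>2))) (at x)" .
 from has_derivative_scaleR[OF this p]
 have "((%y. (1 / W \<eta> (p y)) *\<^sub>R p y) has_derivative (%v. (1 / ?w) *\<^sub>R p' v + ((p x \<bullet> p' v) / ?w * - (1 / ?w\<^sup>2)) *\<^sub>R p x)) (at x)" .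
 from frechet_derivative_at[OF this, symmetric]
 have "divergence (%y. (1 / W \<eta> (p y)) *\<^sub>R p y) x
   = (\<Sum>b\<in>Basis. ((1 / ?w) *\<^sub>R p' b + ((p x \<bullet> p' b) / ?w * - (1 / ?w\<^sup>2)) *\<^sub>R p x) \<bullet> b)"
  unfolding divergence_def by (simp only:)
 also have "... = (\<Sum>b\<in>Basis. (1 / ?w) * (p' b \<bullet> b) - (1 / ?w) * ((p x \<bullet> p' b) * (p x \<bullet> b) / ?w\<^sup>2))"
  by (intro sum.cong refl, simp only: inner_add_left inner_scaleR_left) (simp add: mult_ac)
 also have "... = (1 / ?w) * ((\<Sum>b\<in>Basis. p' b \<bullet> b) - (\<Sum>b\<in>Basis. (p x \<bullet> p' b) * (p x \<bullet> b)) / ?w\<^sup>2)"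
  by (simp add: sum_subtractf right_diff_distrib sum_distrib_left sum_divide_distrib)
 also have "(\<Sum>b\<in>Basis. (p x \<bullet> p' b) * (p x \<bullet> b)) = p x \<bullet> p' (p x)"
 proof -
  have "p' (p x) = p' (\<Sum>b\<in>Basis. (p x \<bullet> b) *\<^sub>R b)" by (simp add: euclidean_representation)
  also have "... = (\<Sum>b\<in>Basis. (p x \<bullet> b) *\<^sub>R p' b)" by (simp add: linear_sum[OF lin] linear_cmul[OF lin])
  finally show ?thesis by (simp add: inner_sum_right mult.commute)
 qed
 finally show ?thesis using w by simp
qed

text \<open>The contraction of the coefficient matrix \<open>I - p \<otimes> p / W\<^sup>2\<close> with a Hessian \<open>A\<close>, given as a linear map.\<close>

definition curv :: "real => 'a::euclidean_space => ('a => 'a) => real" where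
 "curv \<eta> p A = (\<Sum>b\<in>Basis. A b \<bullet> b) - p \<bullet> A p / (W \<eta> p)\<^sup>2"

locale forced_flow = smooth_evolution \<Omega> n T u Du H ut D3 Dut + curved_domain \<Omega> n h h' Lh N \<kappa>0
 for \<Omega> :: "'a::euclidean_space set" and n T u Du H ut D3 Dut h h' Lh N \<kappa>0 +
 fixes c f :: "'a => real => real" and cx fx :: "'a => real => 'a" and cz fz :: "'a => real => real"
  and \<phi> :: "'a => real" and q \<eta> C :: real
 assumes \<eta>: "0 < \<eta>" "\<eta> <= 1" and q: "q > 0"
  and pde: "\<And>x t. x \<in> \<Omega> ==> t \<in> {0<..<T} ==>
    ut x t = curv \<eta> (Du x t) (H x t) + c x (u x t) * W \<eta> (Du x t) - f x (u x t)"
  and neumann: "\<And>y t. y \<in> frontier \<Omega> ==> t \<in> {0..<T} ==> Du y t \<bullet> n y = \<phi> y * W \<eta> (Du y t) powr (1 - q)"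
  and c_deriv: "\<And>x z. x \<in> \<Omega> ==> ((%p. c (fst p) (snd p)) has_derivative (%v. cx x z \<bullet> fst v + cz x z * snd v)) (at (x, z))"
  and f_deriv: "\<And>x z. x \<in> \<Omega> ==> ((%p. f (fst p) (snd p)) has_derivative (%v. fx x z \<bullet> fst v + fz x z * snd v)) (at (x, z))"
  and c_bounds: "\<And>x z. x \<in> \<Omega> ==> \<bar>c x z\<bar> <= C" "\<And>x z. x \<in> \<Omega> ==> norm (cx x z) <= C" "\<And>x z. x \<in> \<Omega> ==> cz x z <= 0"
  and f_bounds: "\<And>x z. x \<in> \<Omega> ==> \<bar>f x z\<bar> <= C" "\<And>x z. x \<in> \<Omega> ==> norm (fx x z) <= C" "\<And>x z. x \<in> \<Omega> ==> fz x z \<ge> 0"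
begin

lemma c_antimono: assumes x: "x \<in> \<Omega>" and "z <= z'" shows "c x z' <= c x z"
proof -
 have "((%z. c x z) has_real_derivative cz x z) (at z)" for z
 proof -
  have "((%z. (x, z)) has_derivative (%h. (0, h))) (at z)" by (auto intro!: derivative_eq_intros)
  from diff_chain_at[OF this c_deriv[OF x]] show ?thesis by (simp add: o_def has_field_derivative_def)
 qed
 then show ?thesis using c_bounds(3)[OF x] \<open>z <= z'\<close> DERIV_nonpos_imp_nonincreasing[of z z' "c x"] by blast
qed

lemma f_mono: assumes x: "x \<in> \<Omega>" and "z <= z'" shows "f x z <= f x z'"
proof -
 have "((%z. f x z) has_real_derivative fz x z) (at z)" for z
 proof -
  have "((%z. (x, z)) has_derivative (%h. (0, h))) (at z)" by (auto intro!: derivative_eq_intros)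
  from diff_chain_at[OF this f_deriv[OF x]] show ?thesis by (simp add: o_def has_field_derivative_def)
 qed
 then show ?thesis using f_bounds(3)[OF x] \<open>z <= z'\<close> DERIV_nonneg_imp_nondecreasing[of z z' "f x"] by blast
qed

lemma Du_interior: "x \<in> \<Omega> ==> t \<in> {0..T} ==> ((%y. u y t) has_derivative (%h. Du x t \<bullet> h)) (at x)"
 using Du[of x t] at_within_interior_point closure_cases by simp

lemma H_interior: "x \<in> \<Omega> ==> t \<in> {0..T} ==> ((%y. Du y t) has_derivative H x t) (at x)"
 using H[of x t] at_within_interior_point closure_cases by simp

lemma Lh_linear: "linear (Lh x)"
 using h(2) has_derivative_linear by blast

end

lemma second_derivative_test:
 fixes \<psi> :: "real => real"
 assumes e: "e > 0" and d1: "\<And>s. \<bar>s\<bar> < e ==> (\<psi> has_real_derivative \<psi>' s) (at s)"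
  and d2: "(\<psi>' has_real_derivative l) (at 0)" and mx: "\<And>s. \<bar>s\<bar> < e ==> \<psi> s <= \<psi> 0"
 shows "\<psi>' 0 = 0" and "l <= 0"
proof -
 show z: "\<psi>' 0 = 0" using DERIV_local_max[OF d1[of 0] e] mx e by simp
 show "l <= 0"
 proof (rule ccontr)
  assume "\<not> l <= 0"
  then have "l > 0" by simp
  from DERIV_pos_inc_right[OF d2 this] obtain d where d: "d > 0" "\<And>h. 0 < h ==> h < d ==> \<psi>' h > 0" using z by auto
  define s where "s = min d e / 2"
  have s: "0 < s" "s < d" "s < e" using d(1) e by (auto simp: s_def)
  obtain x where "0 < x" "x < s" "\<psi> s - \<psi> 0 = (s - 0) * \<psi>' x"
   using MVT2[OF s(1), of \<psi> \<psi>'] d1 s by auto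
  moreover from this have "s * \<psi>' x > 0" using d(2)[of x] s by simp
  ultimately have "\<psi> s > \<psi> 0" by simp
  then show False using mx[of s] s by simp
 qed
qed

text \<open>The square root of the coefficient matrix \<open>I - P \<otimes> P\<close> is again of the form \<open>I - \<mu> P \<otimes> P\<close>, so the contraction is the sum
 of \<open>m\<close> over the diagonal at the images of the basis vectors.\<close>

lemma coefficient_trace_nonpos:
 fixes m :: "'a::euclidean_space => 'a => real" and P :: 'a
 assumes lin: "\<And>w. linear (%v. m v w)" "\<And>v. linear (%w. m v w)" and np: "\<And>v. m v v <= 0" and P: "P \<bullet> P <= 1"
 shows "(\<Sum>b\<in>Basis. m b b) - m P P <= 0"
proof -
 \<comment> \<open>A root of \<open>2 \<mu> - \<mu>\<^sup>2 |P|\<^sup>2 = 1\<close>, chosen so that it stays finite for \<open>P = 0\<close>.\<close>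
 define \<mu> where "\<mu> = 1 / (1 + sqrt (1 - P \<bullet> P))"
 define s where "s = sqrt (1 - P \<bullet> P)"
 have s: "s \<ge> 0" "s\<^sup>2 = 1 - P \<bullet> P" using P by (auto simp: s_def)
 have \<mu>: "2 * \<mu> - \<mu>\<^sup>2 * (P \<bullet> P) = 1"
 proof -
  have "P \<bullet> P = (1 - s) * (1 + s)" using s(2) by (simp add: power2_eq_square algebra_simps)
  moreover have "\<mu> * (1 + s) = 1" using s(1) by (simp add: \<mu>_def s_def[symmetric])
  ultimately have "\<mu>\<^sup>2 * (P \<bullet> P) = \<mu> * (1 - s)" by (simp add: power2_eq_square)
  then show ?thesis using \<open>\<mu> * (1 + s) = 1\<close> by (simp add: algebra_simps)
 qed
 have exp: "m (b - (\<mu> * (P \<bullet> b)) *\<^sub>R P) (b - (\<mu> * (P \<bullet> b)) *\<^sub>R P)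
   = m b b - \<mu> * ((P \<bullet> b) * m b P) - \<mu> * ((P \<bullet> b) * m P b) + \<mu>\<^sup>2 * m P P * ((P \<bullet> b) * (P \<bullet> b))" for b
  by (simp add: linear_diff[OF lin(1)] linear_diff[OF lin(2)] linear_cmul[OF lin(1)] linear_cmul[OF lin(2)] power2_eq_square algebra_simps)
 have repr: "(\<Sum>b\<in>Basis. (P \<bullet> b) *\<^sub>R b) = P" by (rule euclidean_representation)
 have 1: "(\<Sum>b\<in>Basis. (P \<bullet> b) * m b P) = m P P"
  using linear_sum[OF lin(1)[of P], of "%b. (P \<bullet> b) *\<^sub>R b" Basis] by (simp add: repr linear_cmul[OF lin(1)])
 have 2: "(\<Sum>b\<in>Basis. (P \<bullet> b) * m P b) = m P P"
  using linear_sum[OF lin(2)[of P], of "%b. (P \<bullet> b) *\<^sub>R b" Basis] by (simp add: repr linear_cmul[OF lin(2)])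
 have 3: "(\<Sum>b\<in>Basis. (P \<bullet> b) * (P \<bullet> b)) = P \<bullet> P" by (rule euclidean_inner[symmetric])
 have "0 \<ge> (\<Sum>b\<in>Basis. m (b - (\<mu> * (P \<bullet> b)) *\<^sub>R P) (b - (\<mu> * (P \<bullet> b)) *\<^sub>R P))"
  using np by (intro sum_nonpos) auto
 also have "(\<Sum>b\<in>Basis. m (b - (\<mu> * (P \<bullet> b)) *\<^sub>R P) (b - (\<mu> * (P \<bullet> b)) *\<^sub>R P))
  = (\<Sum>b\<in>Basis. m b b) - \<mu> * m P P - \<mu> * m P P + \<mu>\<^sup>2 * m P P * (P \<bullet> P)"
  unfolding exp by (simp only: sum.distrib sum_subtractf sum_distrib_left[symmetric] 1 2 3)
 also have "... = (\<Sum>b\<in>Basis. m b b) - (2 * \<mu> - \<mu>\<^sup>2 * (P \<bullet> P)) * m P P" by (simp add: algebra_simps)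
 finally show ?thesis unfolding \<mu> by simp
qed

lemma curv_nonpos:
 assumes \<eta>: "\<eta> > 0" and "linear A" and "\<And>v. A v \<bullet> v <= 0"
 shows "curv \<eta> p A <= 0"
proof -
 define P where "P = (1 / W \<eta> p) *\<^sub>R p"
 have w: "W \<eta> p > 0" using W_pos[OF \<eta>] .
 have "p \<bullet> p <= (W \<eta> p)\<^sup>2" by (simp add: W_sq)
 then have "P \<bullet> P <= 1" using w by (simp add: P_def power2_eq_square field_simps)
 moreover have "linear (%v. A v \<bullet> w)" "linear (%w. A v \<bullet> w)" for v w
  using assms(2) by (auto intro!: linearI simp: linear_add linear_cmul inner_add_left inner_add_right)
 ultimately have "(\<Sum>b\<in>Basis. A b \<bullet> b) - A P \<bullet> P <= 0"
  using assms(3) by (intro coefficient_trace_nonpos) auto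
 moreover have "A P \<bullet> P = p \<bullet> A p / (W \<eta> p)\<^sup>2"
  using linear_cmul[OF assms(2)] by (simp add: P_def inner_commute power2_eq_square)
 ultimately show ?thesis by (simp add: curv_def)
qed

lemma curv_diff: "linear A ==> linear B ==> curv \<eta> p (%v. A v - B v) = curv \<eta> p A - curv \<eta> p B"
 by (simp add: curv_def inner_diff_left inner_diff_right sum_subtractf diff_divide_distrib)

lemma curv_cmult: "curv \<eta> p (%v. a *\<^sub>R A v) = a * curv \<eta> p A"
 by (simp add: curv_def sum_distrib_left right_diff_distrib)

lemma unit_gradient_bound: "\<eta> > 0 ==> norm ((1 / W \<eta> p) *\<^sub>R p) <= 1"
 using norm_le_W[of p \<eta>] W_pos[of \<eta> p] by (simp add: divide_le_eq_1)

lemma curv_bound: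
 fixes A :: "'a::euclidean_space => 'a"
 assumes \<eta>: "\<eta> > 0" and "linear A" and M: "\<And>v. norm (A v) <= M * norm v"
 shows "\<bar>curv \<eta> p A\<bar> <= (real DIM('a) + 1) * M"
proof -
 define P where "P = (1 / W \<eta> p) *\<^sub>R p"
 have P: "norm P <= 1" unfolding P_def by (rule unit_gradient_bound[OF \<eta>])
 have "M \<ge> 0" using M[of "SOME b. b \<in> Basis"] norm_Basis[OF someI_ex[OF nonempty_Basis[unfolded ex_in_conv[symmetric]]]] norm_ge_zero order_trans
  by (metis mult.right_neutral)
 have one: "\<bar>A v \<bullet> v\<bar> <= M" if "norm v <= 1" for v
 proof -
  have "\<bar>A v \<bullet> v\<bar> <= norm (A v) * norm v" by (rule Cauchy_Schwarz_ineq2)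
  also have "... <= (M * norm v) * norm v" using M by (intro mult_right_mono) auto
  also have "... <= (M * 1) * 1" using that \<open>M \<ge> 0\<close> by (intro mult_mono) auto
  finally show ?thesis by simp
 qed
 have "p \<bullet> A p / (W \<eta> p)\<^sup>2 = A P \<bullet> P"
  using linear_cmul[OF assms(2)] by (simp add: P_def inner_commute power2_eq_square)
 then have "curv \<eta> p A = (\<Sum>b\<in>Basis. A b \<bullet> b) - A P \<bullet> P" by (simp add: curv_def)
 moreover have "\<bar>\<Sum>b\<in>Basis. A b \<bullet> b\<bar> <= real DIM('a) * M"
 proof -
  have "\<bar>\<Sum>b\<in>Basis. A b \<bullet> b\<bar> <= (\<Sum>b\<in>Basis. \<bar>A b \<bullet> b\<bar>)" by (rule sum_abs)
  also have "... <= (\<Sum>b\<in>(Basis::'a set). M)" using one by (intro sum_mono) simp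
  finally show ?thesis by simp
 qed
 ultimately show ?thesis using one[OF P] by (simp add: algebra_simps)
qed

lemma interior_maximum:
 fixes F :: "'a::euclidean_space => real"
 assumes S: "open S" "x0 \<in> S" and G: "\<And>x. x \<in> S ==> (F has_derivative (%v. G x \<bullet> v)) (at x)"
  and L: "(G has_derivative L) (at x0)" and mx: "\<And>x. x \<in> S ==> F x <= F x0"
 shows "G x0 = 0" and "L v \<bullet> v <= 0"
proof -
 have key: "G x0 \<bullet> v = 0 \<and> L v \<bullet> v <= 0" for v
 proof -
  obtain e where e: "e > 0" and inS: "\<And>s. \<bar>s\<bar> < e ==> x0 + s *\<^sub>R v \<in> S" using segment_in_open[OF S] by blast
  have d1: "((%s. F (x0 + s *\<^sub>R v)) has_real_derivative G (x0 + s *\<^sub>R v) \<bullet> v) (at s)" if "\<bar>s\<bar> < e" for s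
   using G[OF inS[OF that]] by (rule DERIV_along_line)
  have d2: "((%s. G (x0 + s *\<^sub>R v) \<bullet> v) has_real_derivative L v \<bullet> v) (at 0)"
   using DERIV_along_line[OF has_derivative_inner_left, of G L x0 0 v v] L by simp
  have "F (x0 + s *\<^sub>R v) <= F (x0 + 0 *\<^sub>R v)" if "\<bar>s\<bar> < e" for s using mx[OF inS[OF that]] by simp
  from second_derivative_test[OF e d1 d2 this] show ?thesis by simp
 qed
 then show "L v \<bullet> v <= 0" by blast
 have "G x0 \<bullet> G x0 = 0" using key by blast
 then show "G x0 = 0" by simp
qed

text \<open>One-sided, since a maximum over a time interval may sit at its end.\<close>

lemma left_maximum_derivative:
 fixes \<psi> :: "real => real"
 assumes "(\<psi> has_real_derivative l) (at t within {0..b})" and "0 < t" "t <= b" and "\<And>s. s \<in> {0..b} ==> \<psi> s <= \<psi> t"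
 shows "l \<ge> 0"
proof (rule ccontr)
 assume "\<not> l \<ge> 0"
 then have "l < 0" by simp
 from has_real_derivative_neg_dec_left[OF assms(1) this] obtain d where d: "d > 0"
  "\<And>h. 0 < h ==> t - h \<in> {0..b} ==> h < d ==> \<psi> t < \<psi> (t - h)" by blast
 define h where "h = min d t / 2"
 have "0 < h" "h < d" "t - h \<in> {0..b}" using d(1) assms(2,3) by (auto simp: h_def)
 then show False using d(2)[of h] assms(4)[of "t - h"] by fastforce
qed

context flow_domain begin

text \<open>Moving into the domain along any direction with \<open>v \<bullet> n < 0\<close> cannot increase \<open>F\<close>, and these directions determine the
 gradient up to a nonnegative factor.\<close>

lemma boundary_maximum:
 fixes F :: "'a => real"
 assumes y: "y \<in> frontier \<Omega>" and F: "(F has_derivative (%v. z \<bullet> v)) (at y within closure \<Omega>)"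
  and mx: "\<And>x. x \<in> closure \<Omega> ==> F x <= F y"
 shows "\<exists>l\<ge>0. z = l *\<^sub>R n y"
proof -
 have dir: "z \<bullet> v <= 0" if vn: "v \<bullet> n y < 0" for v
 proof (rule ccontr)
  assume "\<not> z \<bullet> v <= 0"
  then have zv: "z \<bullet> v > 0" by simp
  obtain e where e: "e > 0" "\<And>s. 0 <= s ==> s < e ==> y + s *\<^sub>R v \<in> closure \<Omega>"
   by (rule inward_ray_closure[OF normal[OF y] y vn]) blast
  have "((%s. F (y + s *\<^sub>R v)) has_real_derivative z \<bullet> v) (at 0 within {0..<e})"
   using has_derivative_ray[OF F e(2)] by (simp add: has_real_derivative_iff_has_vector_derivative)
  from has_real_derivative_pos_inc_right[OF this zv] obtain d where d: "d > 0"
   "\<And>h. 0 < h ==> 0 + h \<in> {0..<e} ==> h < d ==> F (y + 0 *\<^sub>R v) < F (y + (0 + h) *\<^sub>R v)" by blast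
  define s where "s = min d e / 2"
  have s: "0 < s" "s < d" "s < e" using d(1) e(1) by (auto simp: s_def)
  then have "F y < F (y + s *\<^sub>R v)" using d(2)[of s] by simp
  moreover have "y + s *\<^sub>R v \<in> closure \<Omega>" using e(2)[of s] s by simp
  ultimately show False using mx[of "y + s *\<^sub>R v"] by simp
 qed
 define l where "l = z \<bullet> n y"
 have n1: "n y \<bullet> n y = 1" using normal_unit[OF y] .
 have le: "z \<bullet> v <= 0" if "v \<bullet> n y = 0" for v
 proof (rule field_le_epsilon)
  fix e :: real assume e: "e > 0"
  define t where "t = e / (\<bar>l\<bar> + 1)"
  have t: "t > 0" "t * \<bar>l\<bar> <= e" using e by (auto simp: t_def field_simps)
  have "z \<bullet> (v - t *\<^sub>R n y) <= 0" using that n1 t by (intro dir) (simp add: inner_diff_left)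
  then have "z \<bullet> v <= t * l" by (simp add: inner_diff_right l_def)
  also have "... <= t * \<bar>l\<bar>" using t by (intro mult_left_mono) auto
  finally show "z \<bullet> v <= 0 + e" using t by simp
 qed
 define w where "w = z - l *\<^sub>R n y"
 have wn: "w \<bullet> n y = 0" using n1 by (simp add: w_def l_def inner_diff_left)
 have "w \<bullet> w = z \<bullet> w" using wn by (simp add: w_def inner_diff_left inner_commute)
 then have "w \<bullet> w <= 0" using le[OF wn] by simp
 then have "w = 0" using inner_ge_zero[of w] by (metis inner_eq_zero_iff order_antisym)
 then have "z = l *\<^sub>R n y" by (simp add: w_def)
 moreover have "z \<bullet> (- n y) <= 0" using n1 by (intro dir) simp
 then have "l \<ge> 0" by (simp add: l_def)
 ultimately show ?thesis by blast
qed

end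

text \<open>With tangential part fixed, \<open>b W^(q-1)\<close> has derivative \<open>W^(q-3) (A + q b\<^sup>2)\<close> in the normal derivative \<open>b\<close>, which is positive. Hence
 the nonlinear boundary condition determines the normal derivative from the tangential gradient.\<close>

lemma neumann_relation_strict_mono:
 assumes A: "A > (0::real)" and q: "q > 0" and b: "b1 < b2"
 shows "b1 * (A + b1\<^sup>2) powr ((q - 1) / 2) < b2 * (A + b2\<^sup>2) powr ((q - 1) / 2)"
proof (rule DERIV_pos_imp_increasing[OF b])
 fix x :: real
 have pos: "A + x\<^sup>2 > 0" using A by (simp add: add_pos_nonneg)
 let ?B = "A + x\<^sup>2"
 have D1: "((%b. A + b\<^sup>2) has_real_derivative 2 * x) (at x)" by (auto intro!: derivative_eq_intros)
 have D2: "((%y. y powr ((q - 1) / 2)) has_real_derivative ((q - 1) / 2) * ?B powr ((q - 1) / 2 - 1)) (at ?B)"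
  using pos by (auto intro!: derivative_eq_intros)
 have "((%b. (A + b\<^sup>2) powr ((q - 1) / 2)) has_real_derivative ((q - 1) / 2) * ?B powr ((q - 1) / 2 - 1) * (2 * x)) (at x)"
  by (rule DERIV_chain2[where g = "%b. A + b\<^sup>2" and x = x, OF D2 D1])
 from DERIV_mult[OF DERIV_ident this]
 have "((%b. b * (A + b\<^sup>2) powr ((q - 1) / 2)) has_real_derivative
   1 * ?B powr ((q - 1) / 2) + ((q - 1) / 2) * ?B powr ((q - 1) / 2 - 1) * (2 * x) * x) (at x)" .
 moreover have "1 * ?B powr ((q - 1) / 2) + ((q - 1) / 2) * ?B powr ((q - 1) / 2 - 1) * (2 * x) * x
   = ?B powr ((q - 1) / 2 - 1) * (A + q * x\<^sup>2)"
 proof -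
  have "?B powr ((q - 1) / 2) = ?B powr ((q - 1) / 2 - 1) * ?B powr 1"
   using powr_add[of ?B "(q - 1) / 2 - 1" 1] by (simp only: diff_add_cancel)
  moreover have "?B powr 1 = ?B" using pos by simp
  ultimately have e: "?B powr ((q - 1) / 2) = ?B powr ((q - 1) / 2 - 1) * ?B" by (simp only:)
  show ?thesis unfolding e by (simp add: power2_eq_square field_simps)
 qed
 ultimately have "((%b. b * (A + b\<^sup>2) powr ((q - 1) / 2)) has_real_derivative ?B powr ((q - 1) / 2 - 1) * (A + q * x\<^sup>2)) (at x)"
  by (simp only:)
 moreover have "?B powr ((q - 1) / 2 - 1) * (A + q * x\<^sup>2) > 0"
  using pos A q by (intro mult_pos_pos add_pos_nonneg) auto
 ultimately show "\<exists>y. ((%b. b * (A + b\<^sup>2) powr ((q - 1) / 2)) has_real_derivative y) (at x) \<and> y > 0" by blast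
qed

lemma neumann_condition_rigid:
 fixes p1 p2 n :: "'a::euclidean_space"
 assumes \<eta>: "\<eta> > 0" and q: "q > 0" and n: "n \<bullet> n = 1" and p: "p1 = p2 + k *\<^sub>R n"
  and e1: "p1 \<bullet> n = a * W \<eta> p1 powr (1 - q)" and e2: "p2 \<bullet> n = a * W \<eta> p2 powr (1 - q)"
 shows "\<not> k > 0"
proof
 assume k: "k > 0"
 define t where "t = p2 - (p2 \<bullet> n) *\<^sub>R n"
 define A where "A = \<eta>\<^sup>2 + t \<bullet> t"
 have tn: "t \<bullet> n = 0" using n by (simp add: t_def inner_diff_left)
 have A: "A > 0" using \<eta> by (simp add: A_def add_pos_nonneg)
 have rel: "b * (A + b\<^sup>2) powr ((q - 1) / 2) = a" if b: "b = a * W \<eta> (t + b *\<^sub>R n) powr (1 - q)" for b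
 proof -
  have "(t + b *\<^sub>R n) \<bullet> (t + b *\<^sub>R n) = t \<bullet> t + b\<^sup>2"
   using tn n by (simp add: inner_add_left inner_add_right inner_commute power2_eq_square)
  then have W2: "(W \<eta> (t + b *\<^sub>R n))\<^sup>2 = A + b\<^sup>2" by (simp add: W_sq A_def)
  have w: "W \<eta> (t + b *\<^sub>R n) > 0" by (rule W_pos[OF \<eta>])
  have "(A + b\<^sup>2) powr ((q - 1) / 2) = (W \<eta> (t + b *\<^sub>R n) powr 2) powr ((q - 1) / 2)"
   using w by (simp add: W2[symmetric] powr_numeral)
  also have "... = W \<eta> (t + b *\<^sub>R n) powr (q - 1)"
  proof -
   have "2 * ((q - 1) / 2) = q - 1" by simp
   then show ?thesis by (simp only: powr_powr)
  qed
  finally have "b * (A + b\<^sup>2) powr ((q - 1) / 2) = a * (W \<eta> (t + b *\<^sub>R n) powr (1 - q) * W \<eta> (t + b *\<^sub>R n) powr (q - 1))"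
   using b by (metis mult.assoc)
  also have "W \<eta> (t + b *\<^sub>R n) powr (1 - q) * W \<eta> (t + b *\<^sub>R n) powr (q - 1) = 1"
   using w by (simp flip: powr_add)
  finally show ?thesis by simp
 qed
 have p2: "p2 = t + (p2 \<bullet> n) *\<^sub>R n" by (simp add: t_def)
 have p1n: "p1 \<bullet> n = p2 \<bullet> n + k" using n by (simp add: p inner_add_left)
 have p1: "p1 = t + (p1 \<bullet> n) *\<^sub>R n" unfolding p1n by (simp add: t_def p algebra_simps)
 have "(p2 \<bullet> n) * (A + (p2 \<bullet> n)\<^sup>2) powr ((q - 1) / 2) = a" using rel[of "p2 \<bullet> n"] e2 p2 by metis
 moreover have "(p1 \<bullet> n) * (A + (p1 \<bullet> n)\<^sup>2) powr ((q - 1) / 2) = a" using rel[of "p1 \<bullet> n"] e1 p1 by metis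
 moreover have "p2 \<bullet> n < p1 \<bullet> n" using p1n k by simp
 ultimately show False using neumann_relation_strict_mono[OF A q, of "p2 \<bullet> n" "p1 \<bullet> n"] by simp
qed

lemma W_Lipschitz: "\<bar>W \<eta> p - W \<eta> p'\<bar> <= norm (p - p')"
proof -
 have W: "W \<eta> p = norm (\<eta>, p)" for p by (simp add: W_def norm_Pair)
 have "\<bar>norm (\<eta>, p) - norm (\<eta>, p')\<bar> <= norm ((\<eta>, p) - (\<eta>, p'))" by (rule norm_triangle_ineq3)
 also have "... = norm (p - p')" by (simp add: norm_Pair)
 finally show ?thesis by (simp add: W)
qed

lemma unit_gradient_Lipschitz:
 assumes \<eta>: "\<eta> > 0"
 shows "norm ((1 / W \<eta> p) *\<^sub>R p - (1 / W \<eta> p') *\<^sub>R p') <= 2 / \<eta> * norm (p - p')"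
proof -
 have w: "W \<eta> p > 0" "W \<eta> p' > 0" using W_pos[OF \<eta>] by auto
 have ge: "W \<eta> p \<ge> \<eta>" unfolding W_def using \<eta> by (intro real_le_rsqrt) simp
 have "(1 / W \<eta> p) *\<^sub>R p - (1 / W \<eta> p') *\<^sub>R p' = (1 / W \<eta> p) *\<^sub>R (p - p') + ((W \<eta> p' - W \<eta> p) / W \<eta> p) *\<^sub>R ((1 / W \<eta> p') *\<^sub>R p')"
  using w by (simp add: algebra_simps diff_divide_distrib)
 then have "norm ((1 / W \<eta> p) *\<^sub>R p - (1 / W \<eta> p') *\<^sub>R p')
   <= norm ((1 / W \<eta> p) *\<^sub>R (p - p')) + norm (((W \<eta> p' - W \<eta> p) / W \<eta> p) *\<^sub>R ((1 / W \<eta> p') *\<^sub>R p'))"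
  by (metis norm_triangle_ineq)
 also have "norm (((W \<eta> p' - W \<eta> p) / W \<eta> p) *\<^sub>R ((1 / W \<eta> p') *\<^sub>R p')) = \<bar>W \<eta> p' - W \<eta> p\<bar> / W \<eta> p * norm ((1 / W \<eta> p') *\<^sub>R p')"
  using w by (simp add: abs_divide)
 also have "... <= (norm (p - p') / W \<eta> p) * 1"
  using W_Lipschitz[of \<eta> p' p] unit_gradient_bound[OF \<eta>, of p'] w
  by (intro mult_mono divide_right_mono) (auto simp: norm_minus_commute)
 finally have "norm ((1 / W \<eta> p) *\<^sub>R p - (1 / W \<eta> p') *\<^sub>R p') <= 2 * (norm (p - p') / W \<eta> p)" using w by simp
 also have "... <= 2 * (norm (p - p') / \<eta>)" using ge \<eta> by (intro mult_left_mono divide_left_mono) auto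
 finally show ?thesis by simp
qed

lemma curv_gradient_Lipschitz:
 assumes \<eta>: "\<eta> > 0" and A: "linear A" and M: "\<And>v. norm (A v) <= M * norm v" "M \<ge> 0"
 shows "\<bar>curv \<eta> p A - curv \<eta> p' A\<bar> <= 4 * M / \<eta> * norm (p - p')"
proof -
 define P where "P p = (1 / W \<eta> p) *\<^sub>R p" for p :: 'a
 have P1: "norm (P p) <= 1" for p unfolding P_def by (rule unit_gradient_bound[OF \<eta>])
 have q: "p \<bullet> A p / (W \<eta> p)\<^sup>2 = A (P p) \<bullet> P p" for p
  using linear_cmul[OF A] by (simp add: P_def inner_commute power2_eq_square)
 have "curv \<eta> p A - curv \<eta> p' A = A (P p') \<bullet> P p' - A (P p) \<bullet> P p" by (simp add: curv_def q)
 also have "... = A (P p' - P p) \<bullet> P p' + A (P p) \<bullet> (P p' - P p)"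
  by (simp add: linear_diff[OF A] inner_diff_left inner_diff_right)
 finally have "\<bar>curv \<eta> p A - curv \<eta> p' A\<bar> <= \<bar>A (P p' - P p) \<bullet> P p'\<bar> + \<bar>A (P p) \<bullet> (P p' - P p)\<bar>" by simp
 also have "... <= (M * norm (P p' - P p)) * 1 + (M * 1) * norm (P p' - P p)"
 proof (intro add_mono)
  have "\<bar>A (P p' - P p) \<bullet> P p'\<bar> <= norm (A (P p' - P p)) * norm (P p')" by (rule Cauchy_Schwarz_ineq2)
  also have "... <= (M * norm (P p' - P p)) * 1" using M P1 by (intro mult_mono) auto
  finally show "\<bar>A (P p' - P p) \<bullet> P p'\<bar> <= (M * norm (P p' - P p)) * 1" .
  have "norm (A (P p)) <= M * 1" using M(1)[of "P p"] M(2) P1[of p] by (meson mult_left_mono order_trans)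
  moreover have "\<bar>A (P p) \<bullet> (P p' - P p)\<bar> <= norm (A (P p)) * norm (P p' - P p)" by (rule Cauchy_Schwarz_ineq2)
  ultimately show "\<bar>A (P p) \<bullet> (P p' - P p)\<bar> <= (M * 1) * norm (P p' - P p)"
   by (meson mult_right_mono norm_ge_zero order_trans)
 qed
 also have "... = 2 * M * norm (P p - P p')" by (simp add: norm_minus_commute)
 also have "... <= 2 * M * (2 / \<eta> * norm (p - p'))"
  using unit_gradient_Lipschitz[OF \<eta>, of p p'] M(2) unfolding P_def by (intro mult_left_mono) auto
 finally show ?thesis by simp
qed

context forced_flow begin

lemma hessian_bounded:
 obtains M where "M > 0" "\<And>x t v. x \<in> closure \<Omega> ==> t \<in> {0..T} ==> norm (H x t v) <= M * norm v"
proof -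
 have "compact (closure \<Omega> \<times> {0..T})" by (intro compact_Times compact_closure_domain compact_Icc)
 moreover have "linear (H (fst z) (snd z))" if "z \<in> closure \<Omega> \<times> {0..T}" for z using H_linear that by auto
 moreover have "continuous_on (closure \<Omega> \<times> {0..T}) (%z. H (fst z) (snd z) v \<bullet> w)" for v w
  by (intro continuous_intros H_continuous)
 ultimately obtain M where M: "M > 0" "\<And>z v. z \<in> closure \<Omega> \<times> {0..T} ==> norm (H (fst z) (snd z) v) <= M * norm v"
  by (rule linear_family_bounded) (assumption, rule that)
 show ?thesis using that[OF M(1)] M(2)[of "(x, t)" for x t] by simp
qed

lemma u_continuous: "continuous_on (closure \<Omega> \<times> {0..T}) (%z. u (fst z) (snd z))"
proof -
 have "compact ((%z. ut (fst z) (snd z)) ` (closure \<Omega> \<times> {0..T}))"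
  by (intro compact_continuous_image ut_continuous compact_Times compact_closure_domain compact_Icc)
 then obtain M where M: "M > 0" "\<forall>r\<in>(%z. ut (fst z) (snd z)) ` (closure \<Omega> \<times> {0..T}). norm r <= M"
  using compact_imp_bounded bounded_pos by metis
 have "time_hoelder 1 (closure \<Omega>) {0..T} u" unfolding time_hoelder_def
 proof (intro allI impI)
  fix K assume K: "compact K \<and> K \<subseteq> closure \<Omega> \<times> {0..T}"
  have "\<bar>u x t - u x s\<bar> <= M * \<bar>t - s\<bar> powr 1" if "(x, t) \<in> K" "(x, s) \<in> K" for x t s
  proof -
   have x: "x \<in> closure \<Omega>" and ts: "t \<in> {0..T}" "s \<in> {0..T}" using that K by auto
   have "norm (u x t - u x s) <= M * norm (t - s)"
   proof (rule field_differentiable_bound[OF convex_real_interval(5)[of 0 T] _ _ ts])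
    show "(u x has_field_derivative ut x r) (at r within {0..T})" if "r \<in> {0..T}" for r
     using ut[OF x that] .
    show "norm (ut x r) <= M" if "r \<in> {0..T}" for r using M(2) x that by force
   qed
   then show ?thesis by simp
  qed
  then show "\<exists>L. \<forall>x t s. (x, t) \<in> K \<and> (x, s) \<in> K --> \<bar>u x t - u x s\<bar> <= L * \<bar>t - s\<bar> powr 1" by blast
 qed
 then show ?thesis
 proof (rule time_hoelder_continuous)
  show "continuous_on (closure \<Omega>) (%x. u x t)" if "t \<in> {0..T}" for t
   unfolding continuous_on_eq_continuous_within using Du[OF _ that] has_derivative_continuous by blast
 qed (auto simp: compact_closure_domain bounded_domain)
qed

text \<open>The difference of two time shifts of the solution satisfies a maximum principle, because \<open>c\<close> decreases and \<open>f\<close> increases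
 in the solution. The correction \<open>- \<epsilon> h\<close> excludes a maximum on the boundary, where it would force the two gradients to
 differ by a positive multiple of the normal although they satisfy the same boundary condition; the
 correction linear in time absorbs what \<open>- \<epsilon> h\<close> contributes to the equation.\<close>

lemma time_shift_comparison:
 assumes ab: "0 <= a" "0 <= b" "0 <= T'" "T' + a < T" "T' + b < T" and m: "m \<ge> 0"
  and init: "\<And>x. x \<in> closure \<Omega> ==> u x a - u x b <= m"
  and x: "x \<in> closure \<Omega>" and t: "t \<in> {0..T'}"
 shows "u x (t + a) - u x (t + b) <= m"
proof (rule ccontr)
 define D where "D x t = u x (t + a) - u x (t + b)" for x t
 assume "\<not> ?thesis"
 then have d: "D x t - m > 0" by (simp add: D_def)
 obtain MH where MH: "MH > 0" "\<And>x t v. x \<in> closure \<Omega> ==> t \<in> {0..T} ==> norm (H x t v) <= MH * norm v"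
  using hessian_bounded by blast
 have hc: "continuous_on (closure \<Omega>) h" "continuous_on (closure \<Omega>) h'"
  using h(1,2) has_derivative_continuous by (metis continuous_at_imp_continuous_on)+
 obtain Mh where Mh: "Mh > 0" "\<And>x. x \<in> closure \<Omega> ==> \<bar>h x\<bar> <= Mh"
  using compact_continuous_bounded[OF compact_closure_domain hc(1)] by auto
 obtain M1 where M1: "M1 > 0" "\<And>x. x \<in> closure \<Omega> ==> norm (h' x) <= M1"
  using compact_continuous_bounded[OF compact_closure_domain hc(2)] by blast
 obtain M2 where M2: "M2 > 0" "\<And>x v. x \<in> closure \<Omega> ==> norm (Lh x v) <= M2 * norm v"
  using linear_family_bounded[OF compact_closure_domain Lh_linear continuous_on_subset[OF h(3) subset_UNIV]] by blast
 define K1 where "K1 = 4 * MH / \<eta> * M1 + (real DIM('a) + 1) * M2 + \<bar>C\<bar> * M1"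
 have K1: "K1 \<ge> 0" using MH M1 M2 \<eta> by (simp add: K1_def)
 define \<epsilon> where "\<epsilon> = (D x t - m) / (2 * (2 * Mh + (K1 + 1) * T' + 1))"
 have den: "2 * Mh + (K1 + 1) * T' + 1 > 0" using Mh K1 ab by (simp add: add_pos_pos add_nonneg_pos add_pos_nonneg)
 have \<epsilon>: "\<epsilon> > 0" using d den by (simp add: \<epsilon>_def)
 have "\<epsilon> * (2 * (2 * Mh + (K1 + 1) * T' + 1)) = D x t - m" using den by (simp add: \<epsilon>_def)
 then have \<epsilon>d: "\<epsilon> * (2 * Mh) + \<epsilon> * ((K1 + 1) * T') < D x t - m"
 proof -
  have "0 <= \<epsilon> * ((K1 + 1) * T')" using \<epsilon> K1 ab by simp
  moreover have "0 <= \<epsilon> * (2 * Mh)" using \<epsilon> Mh(1) by simp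
  moreover have "\<epsilon> * (2 * (2 * Mh + (K1 + 1) * T' + 1)) = 2 * (\<epsilon> * (2 * Mh)) + 2 * (\<epsilon> * ((K1 + 1) * T')) + 2 * \<epsilon>"
   by (simp add: algebra_simps)
  ultimately show ?thesis using \<open>\<epsilon> * (2 * (2 * Mh + (K1 + 1) * T' + 1)) = D x t - m\<close> \<epsilon> by linarith
 qed
 define Z where "Z z = D (fst z) (snd z) - \<epsilon> * h (fst z) - \<epsilon> * (K1 + 1) * snd z" for z
 have comp: "compact (closure \<Omega> \<times> {0..T'})" by (intro compact_Times compact_closure_domain compact_Icc)
 have ne: "closure \<Omega> \<times> {0..T'} \<noteq> {}" using x t by auto
 have cu: "continuous_on (closure \<Omega> \<times> {0..T'}) (%z. u (fst z) (snd z + a))" if "0 <= a" "T' + a < T" for a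
 proof -
  have c1: "continuous_on (closure \<Omega> \<times> {0..T'}) (%z. (fst z, snd z + a))" by (intro continuous_intros)
  have sub: "(%z. (fst z, snd z + a)) ` (closure \<Omega> \<times> {0..T'}) \<subseteq> closure \<Omega> \<times> {0..T}" using that by auto
  from continuous_on_compose2[OF u_continuous c1 sub] show ?thesis by simp
 qed
 have "continuous_on (closure \<Omega> \<times> {0..T'}) (%z. h (fst z))"
  using continuous_on_compose2[OF hc(1) continuous_on_fst[OF continuous_on_id], of "closure \<Omega> \<times> {0..T'}"] by auto
 then have "continuous_on (closure \<Omega> \<times> {0..T'}) Z"
  unfolding Z_def[abs_def] D_def using cu ab by (intro continuous_intros) auto
 from continuous_attains_sup[OF comp ne this] obtain z0 where z0: "z0 \<in> closure \<Omega> \<times> {0..T'}"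
  "\<And>z. z \<in> closure \<Omega> \<times> {0..T'} ==> Z z <= Z z0" by blast
 define x0 t0 where "x0 = fst z0" and "t0 = snd z0"
 have x0: "x0 \<in> closure \<Omega>" and t0: "t0 \<in> {0..T'}" using z0(1) by (auto simp: x0_def t0_def)
 have mx: "Z (y, s) <= Z (x0, t0)" if "y \<in> closure \<Omega>" "s \<in> {0..T'}" for y s
  using z0(2)[of "(y, s)"] that by (simp add: x0_def t0_def)
 have D0: "D x0 t0 > m"
 proof -
  have "Z (x, t) \<ge> D x t - \<epsilon> * Mh - \<epsilon> * ((K1 + 1) * T')"
  proof -
   have "\<epsilon> * h x <= \<epsilon> * Mh" using Mh(2)[OF x] \<epsilon> by (intro mult_left_mono) auto
   moreover have "\<epsilon> * (K1 + 1) * t <= \<epsilon> * (K1 + 1) * T'" using \<epsilon> K1 t by (intro mult_left_mono) auto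
   ultimately show ?thesis by (simp add: Z_def mult.assoc)
  qed
  moreover have "Z (x0, t0) <= D x0 t0 + \<epsilon> * Mh"
  proof -
   have "- h x0 <= Mh" using Mh(2)[OF x0] by simp
   then have "\<epsilon> * (- h x0) <= \<epsilon> * Mh" using \<epsilon> by (intro mult_left_mono) auto
   moreover have "\<epsilon> * (K1 + 1) * t0 \<ge> 0" using \<epsilon> K1 t0 by simp
   ultimately show ?thesis by (simp add: Z_def)
  qed
  ultimately show ?thesis using mx[OF x t] \<epsilon>d by linarith
 qed
 have t0pos: "t0 > 0"
 proof (rule ccontr)
  assume "\<not> t0 > 0"
  then have "t0 = 0" using t0 by simp
  then show False using D0 init[OF x0] by (simp add: D_def)
 qed
 define t1 t2 where "t1 = t0 + a" and "t2 = t0 + b"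
 have t12: "t1 \<in> {0<..<T}" "t2 \<in> {0<..<T}" using t0 t0pos ab by (auto simp: t1_def t2_def)
 then have t12': "t1 \<in> {0..T}" "t2 \<in> {0..T}" "t1 \<in> {0..<T}" "t2 \<in> {0..<T}" by auto
 have dZx: "((%y. Z (y, t0)) has_derivative (%v. (Du y t1 - Du y t2 - \<epsilon> *\<^sub>R h' y) \<bullet> v)) (at y within closure \<Omega>)"
  if y: "y \<in> closure \<Omega>" for y
 proof -
  have "((%y. D y t0) has_derivative (%v. Du y t1 \<bullet> v - Du y t2 \<bullet> v)) (at y within closure \<Omega>)"
   unfolding D_def t1_def[symmetric] t2_def[symmetric]
   using has_derivative_diff[OF Du[OF y t12'(1)] Du[OF y t12'(2)]] .
  from has_derivative_diff[OF has_derivative_diff[OF this has_derivative_mult_right[OF has_derivative_at_withinI[OF h(1)], of \<epsilon>]] has_derivative_const[of "\<epsilon> * (K1 + 1) * t0"]]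
  show ?thesis unfolding Z_def by (simp add: inner_diff_left)
 qed
 show False
 proof (cases "x0 \<in> \<Omega>")
  case False
  then have fr: "x0 \<in> frontier \<Omega>" using x0 closure_cases by blast
  from boundary_maximum[OF fr dZx[OF x0]] mx t0
  obtain l where l: "l \<ge> 0" "Du x0 t1 - Du x0 t2 - \<epsilon> *\<^sub>R h' x0 = l *\<^sub>R n x0" by auto
  obtain s where s: "s > 0" "h' x0 = s *\<^sub>R n x0" using h_normal[OF fr] by blast
  have "Du x0 t1 = Du x0 t2 + (l + \<epsilon> * s) *\<^sub>R n x0"
   using l(2) unfolding s(2) by (simp add: algebra_simps)
  from neumann_condition_rigid[OF \<eta>(1) q normal_unit[OF fr] this neumann[OF fr t12'(3)] neumann[OF fr t12'(4)]]
  have "\<not> l + \<epsilon> * s > 0" .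
  moreover have "\<epsilon> * s > 0" using \<epsilon> s(1) by simp
  ultimately show False using l(1) by linarith
 next
  case True
  have "((%y. Z (y, t0)) has_derivative (%v. (Du y t1 - Du y t2 - \<epsilon> *\<^sub>R h' y) \<bullet> v)) (at y)" if "y \<in> \<Omega>" for y
   using dZx[of y] that at_within_interior_point closure_cases by simp
  moreover have "((%y. Du y t1 - Du y t2 - \<epsilon> *\<^sub>R h' y) has_derivative (%v. H x0 t1 v - H x0 t2 v - \<epsilon> *\<^sub>R Lh x0 v)) (at x0)"
   by (intro has_derivative_diff has_derivative_scaleR_right H_interior[OF True] t12' h(2))
  moreover have "Z (y, t0) <= Z (x0, t0)" if "y \<in> \<Omega>" for y using mx[of y t0] that closure_cases t0 by blast
  ultimately have im: "Du x0 t1 - Du x0 t2 - \<epsilon> *\<^sub>R h' x0 = 0" "(H x0 t1 v - H x0 t2 v - \<epsilon> *\<^sub>R Lh x0 v) \<bullet> v <= 0" for v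
   using interior_maximum[OF open_domain True, of "%y. Z (y, t0)" "%y. Du y t1 - Du y t2 - \<epsilon> *\<^sub>R h' y"] by blast+
  have att: "at t within {0..T} = at t" if "t \<in> {0<..<T}" for t using that by (auto intro!: at_within_interior)
  have "((%s. Z (x0, s)) has_real_derivative ut x0 t1 - ut x0 t2 - \<epsilon> * (K1 + 1)) (at t0)"
  proof -
   have 1: "((%s. u x0 (s + a)) has_real_derivative ut x0 t1) (at t0)"
    using ut[OF x0 t12'(1)] att[OF t12(1)] by (simp add: t1_def DERIV_shift)
   have 2: "((%s. u x0 (s + b)) has_real_derivative ut x0 t2) (at t0)"
    using ut[OF x0 t12'(2)] att[OF t12(2)] by (simp add: t2_def DERIV_shift)
   show ?thesis unfolding Z_def D_def using 1 2 by (auto intro!: derivative_eq_intros)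
  qed
  then have "((%s. Z (x0, s)) has_real_derivative ut x0 t1 - ut x0 t2 - \<epsilon> * (K1 + 1)) (at t0 within {0..T'})"
   by (rule has_field_derivative_at_within)
  from left_maximum_derivative[OF this t0pos] mx[OF x0] t0
  have time: "ut x0 t1 - ut x0 t2 - \<epsilon> * (K1 + 1) \<ge> 0" by auto
  define p1 p2 where "p1 = Du x0 t1" and "p2 = Du x0 t2"
  have pp: "p1 - p2 = \<epsilon> *\<^sub>R h' x0" using im(1) by (simp add: p1_def p2_def)
  have npp: "norm (p1 - p2) <= \<epsilon> * M1" unfolding pp using \<epsilon> M1(2)[OF x0] by simp
  have l1: "linear (H x0 t1)" "linear (H x0 t2)" using H_linear x0 t12' by auto
  have l2: "linear (%v. \<epsilon> *\<^sub>R Lh x0 v)" using Lh_linear[of x0] by (rule linear_compose_scale_right)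
  have "curv \<eta> p1 (%v. H x0 t1 v - H x0 t2 v - \<epsilon> *\<^sub>R Lh x0 v) <= 0"
   using im(2) l1 l2 by (intro curv_nonpos[OF \<eta>(1)] linear_compose_sub) auto
  then have c1: "curv \<eta> p1 (H x0 t1) <= curv \<eta> p1 (H x0 t2) + \<epsilon> * curv \<eta> p1 (Lh x0)"
   using l1 l2 by (simp add: curv_diff linear_compose_sub curv_cmult)
  have c2: "curv \<eta> p1 (H x0 t2) <= curv \<eta> p2 (H x0 t2) + 4 * MH / \<eta> * (\<epsilon> * M1)"
  proof -
   have "\<bar>curv \<eta> p1 (H x0 t2) - curv \<eta> p2 (H x0 t2)\<bar> <= 4 * MH / \<eta> * norm (p1 - p2)"
    using MH x0 t12' by (intro curv_gradient_Lipschitz[OF \<eta>(1) l1(2)]) auto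
   also have "... <= 4 * MH / \<eta> * (\<epsilon> * M1)" using npp MH(1) \<eta> by (intro mult_left_mono) auto
   finally show ?thesis by linarith
  qed
  have c3: "\<epsilon> * curv \<eta> p1 (Lh x0) <= \<epsilon> * ((real DIM('a) + 1) * M2)"
   using curv_bound[OF \<eta>(1) Lh_linear M2(2)[OF x0], of p1] \<epsilon> by (intro mult_left_mono) auto
  have u12: "u x0 t2 <= u x0 t1" using D0 m by (simp add: D_def t1_def t2_def)
  have c4: "c x0 (u x0 t1) * W \<eta> p1 - c x0 (u x0 t2) * W \<eta> p2 <= \<bar>C\<bar> * (\<epsilon> * M1)"
  proof -
   have "c x0 (u x0 t1) * W \<eta> p1 <= c x0 (u x0 t2) * W \<eta> p1"
    using c_antimono[OF True u12] W_pos[OF \<eta>(1), of p1] by (intro mult_right_mono) auto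
   then have "c x0 (u x0 t1) * W \<eta> p1 - c x0 (u x0 t2) * W \<eta> p2 <= c x0 (u x0 t2) * (W \<eta> p1 - W \<eta> p2)"
    by (simp add: right_diff_distrib)
   also have "... <= \<bar>c x0 (u x0 t2)\<bar> * \<bar>W \<eta> p1 - W \<eta> p2\<bar>" by (metis abs_ge_self abs_mult)
   also have "... <= \<bar>C\<bar> * (\<epsilon> * M1)"
    using c_bounds(1)[OF True, of "u x0 t2"] W_Lipschitz[of \<eta> p1 p2] npp by (intro mult_mono) auto
   finally show ?thesis .
  qed
  have c5: "f x0 (u x0 t2) <= f x0 (u x0 t1)" by (rule f_mono[OF True u12])
  have "ut x0 t1 - ut x0 t2 <= 4 * MH / \<eta> * (\<epsilon> * M1) + \<epsilon> * ((real DIM('a) + 1) * M2) + \<bar>C\<bar> * (\<epsilon> * M1)"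
   using pde[OF True t12(1)] pde[OF True t12(2)] c1 c2 c3 c4 c5 unfolding p1_def p2_def by linarith
  also have "... = \<epsilon> * K1" by (simp add: K1_def algebra_simps)
  finally show False using time \<epsilon> by (simp add: algebra_simps)
 qed
qed

text \<open>For a small shift in time the initial difference is at most \<open>(K + e) \<tau>\<close>; comparison carries this to all times, and
 division by \<open>\<tau>\<close> gives the speed. This is how the gradient bound becomes independent of the final time.\<close>

lemma speed_bound:
 assumes K: "\<And>x. x \<in> closure \<Omega> ==> \<bar>ut x 0\<bar> <= K" and x: "x \<in> closure \<Omega>" and t: "t \<in> {0..<T}"
 shows "\<bar>ut x t\<bar> <= K"
proof (rule field_le_epsilon)
 fix e :: real assume e: "e > 0"
 have "compact (closure \<Omega> \<times> {0..T})" by (intro compact_Times compact_closure_domain compact_Icc)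
 with ut_continuous have "uniformly_continuous_on (closure \<Omega> \<times> {0..T}) (%z. ut (fst z) (snd z))"
  by (rule compact_uniformly_continuous)
 then obtain d where d0: "d > 0" "\<forall>z\<in>closure \<Omega> \<times> {0..T}. \<forall>z'\<in>closure \<Omega> \<times> {0..T}. dist z' z < d -->
    dist (ut (fst z') (snd z')) (ut (fst z) (snd z)) < e"
  using e unfolding uniformly_continuous_on_def by meson
 have d: "d > 0" "\<And>z z'. z \<in> closure \<Omega> \<times> {0..T} ==> z' \<in> closure \<Omega> \<times> {0..T} ==> dist z' z < d ==>
    dist (ut (fst z') (snd z')) (ut (fst z) (snd z)) < e" using d0 by blast+
 have K0: "K \<ge> 0" using K[OF x] by linarith
 have start: "\<bar>u y \<tau> - u y 0\<bar> <= (K + e) * \<tau>" if y: "y \<in> closure \<Omega>" and \<tau>: "0 < \<tau>" "\<tau> < d" "\<tau> < T" for y \<tau>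
 proof -
  have der: "(u y has_real_derivative ut y s) (at s within {0..\<tau>})" if "0 <= s" "s <= \<tau>" for s
   using ut[OF y, of s] that \<tau> by (auto elim: has_field_derivative_subset)
  have "norm (u y \<tau> - u y 0) <= (K + e) * norm (\<tau> - 0)"
  proof (rule field_differentiable_bound[OF convex_real_interval(5)[of 0 \<tau>], where f' = "ut y"])
   show "norm (ut y s) <= K + e" if "s \<in> {0..\<tau>}" for s
   proof -
    have "dist (y, s) (y, 0) < d" using that \<tau> by (simp add: dist_Pair_Pair dist_real_def)
    then have "\<bar>ut y s - ut y 0\<bar> < e" using d(2)[of "(y, 0)" "(y, s)"] y that \<tau> T by (simp add: dist_real_def)
    then show ?thesis using K[OF y] by simp
   qed
  qed (use der \<tau> in auto)
  then show ?thesis using \<tau> by simp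
 qed
 have step: "\<bar>u x (t + \<tau>) - u x t\<bar> <= (K + e) * \<tau>" if \<tau>: "0 < \<tau>" "\<tau> < d" "\<tau> < T" "t + \<tau> < T" for \<tau>
 proof -
  have m: "(K + e) * \<tau> \<ge> 0" using K0 e \<tau> by simp
  have "u x (t + \<tau>) - u x (t + 0) <= (K + e) * \<tau>"
   using start \<tau> t by (intro time_shift_comparison[of \<tau> 0 t _ x t] m x) (auto simp: abs_le_iff)
  moreover have "u x (t + 0) - u x (t + \<tau>) <= (K + e) * \<tau>"
   using start \<tau> t by (intro time_shift_comparison[of 0 \<tau> t _ x t] m x) (auto simp: abs_le_iff)
  ultimately show ?thesis by simp
 qed
 have t': "t \<in> {0..T}" using t by auto
 define r where "r = min d (T - t)"
 have r: "r > 0" "r <= d" "r <= T - t" using d(1) t by (auto simp: r_def)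
 show "\<bar>ut x t\<bar> <= K + e"
 proof (rule ccontr)
  assume "\<not> \<bar>ut x t\<bar> <= K + e"
  then obtain \<sigma> :: real where \<sigma>: "\<sigma> = 1 \<or> \<sigma> = - 1" and pos: "\<sigma> * ut x t - (K + e) > 0"
   by (cases "ut x t \<ge> 0") (auto intro: that[of 1] that[of "- 1"])
  have "((%s. \<sigma> * u x s - (K + e) * s) has_real_derivative \<sigma> * ut x t - (K + e)) (at t within {0..T})"
   using ut[OF x t'] by (auto intro!: derivative_eq_intros)
  from has_real_derivative_pos_inc_right[OF this pos] obtain d' where d': "d' > 0"
   "\<And>h. 0 < h ==> t + h \<in> {0..T} ==> h < d' ==> \<sigma> * u x t - (K + e) * t < \<sigma> * u x (t + h) - (K + e) * (t + h)" by blast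
  define \<tau> where "\<tau> = min d' r / 2"
  have "0 < \<tau>" "\<tau> < d'" "\<tau> < r" using d' r by (auto simp: \<tau>_def)
  then show False using d'(2)[of \<tau>] step[of \<tau>] r t \<sigma> by (auto simp: algebra_simps abs_le_iff)
 qed
qed

end

section \<open>The algebra at a boundary maximum\<close>

context forced_flow begin

text \<open>The boundary condition is differentiated along a curve in the boundary; derivatives of \<open>u\<close> up to second order
 extend to the boundary, so no third derivatives enter.\<close>

lemma neumann_tangential_derivative:
 assumes y: "y \<in> frontier \<Omega>" and t: "t \<in> {0..<T}" and \<tau>: "\<tau> \<bullet> n y = 0"
  and N': "(N has_derivative LN) (at y within closure \<Omega>)"
  and \<phi>': "(\<phi> has_derivative (%v. \<phi>' \<bullet> v)) (at y within closure \<Omega>)"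
 shows "H y t \<tau> \<bullet> n y + Du y t \<bullet> LN \<tau> = (\<phi>' \<bullet> \<tau>) * W \<eta> (Du y t) powr (1 - q)
   + \<phi> y * (1 - q) * W \<eta> (Du y t) powr (- 1 - q) * (Du y t \<bullet> H y t \<tau>)"
proof -
 have t': "t \<in> {0..T}" using t by auto
 have yc: "y \<in> closure \<Omega>" using y closure_cases by blast
 obtain x e where x: "x 0 = y" "(x has_vector_derivative \<tau>) (at 0)" "e > 0" "\<And>s. \<bar>s\<bar> < e ==> x s \<in> frontier \<Omega>"
  using tangent_curve[OF y \<tau>] unfolding tangent_to_frontier_def by blast
 let ?I = "{-e<..<e}"
 have xin: "x ` ?I \<subseteq> closure \<Omega>" using x(4) closure_cases by auto
 have dx: "(x has_derivative (%h. h *\<^sub>R \<tau>)) (at 0 within ?I)"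
  using x(2) has_derivative_at_withinI unfolding has_vector_derivative_def by blast
 have at0: "at (0::real) within ?I = at 0" using x(3) by (intro at_within_open) auto
 have comp: "((%s. F (x s)) has_derivative (%h. F' (h *\<^sub>R \<tau>))) (at 0)"
  if "(F has_derivative F') (at y within closure \<Omega>)" for F :: "'a => 'b::real_normed_vector" and F'
 proof -
  have "(F has_derivative F') (at (x 0) within x ` ?I)"
   using has_derivative_subset[OF that xin] x(1) by simp
  from diff_chain_within[OF dx this] show ?thesis by (simp add: o_def at0)
 qed
 have inn: "((%s. F (x s) \<bullet> G (x s)) has_real_derivative (F y \<bullet> G' \<tau> + F' \<tau> \<bullet> G y)) (at 0)"
  if F: "(F has_derivative F') (at y within closure \<Omega>)" and G: "(G has_derivative G') (at y within closure \<Omega>)"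
  for F G :: "'a => 'a" and F' G'
 proof -
  have "((%s. F (x s) \<bullet> G (x s)) has_derivative (%h. F y \<bullet> G' (h *\<^sub>R \<tau>) + F' (h *\<^sub>R \<tau>) \<bullet> G y)) (at 0)"
   using has_derivative_inner[OF comp[OF F] comp[OF G]] by (simp add: x(1))
  moreover have "(%h. F y \<bullet> G' (h *\<^sub>R \<tau>) + F' (h *\<^sub>R \<tau>) \<bullet> G y) = (%h. (F y \<bullet> G' \<tau> + F' \<tau> \<bullet> G y) * h)"
   using linear_cmul[OF has_derivative_linear[OF F]] linear_cmul[OF has_derivative_linear[OF G]] by (auto simp: algebra_simps)
  ultimately show ?thesis by (simp add: has_field_derivative_def)
 qed
 have lhs: "((%s. Du (x s) t \<bullet> N (x s)) has_real_derivative (Du y t \<bullet> LN \<tau> + H y t \<tau> \<bullet> N y)) (at 0)"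
  by (rule inn[OF H[OF yc t'] N'])
 let ?w = "W \<eta> (Du y t)"
 have w: "?w > 0" by (rule W_pos[OF \<eta>(1)])
 have "((%s. W \<eta> (Du (x s) t)) has_derivative (%h. (Du y t \<bullet> H y t (h *\<^sub>R \<tau>)) / ?w)) (at 0)"
  using W_derivative[OF \<eta>(1) comp[OF H[OF yc t']]] by (simp add: x(1))
 then have dW: "((%s. W \<eta> (Du (x s) t)) has_real_derivative (Du y t \<bullet> H y t \<tau>) / ?w) (at 0)"
 proof -
  assume D: "((%s. W \<eta> (Du (x s) t)) has_derivative (%h. (Du y t \<bullet> H y t (h *\<^sub>R \<tau>)) / ?w)) (at 0)"
  have "(%h. (Du y t \<bullet> H y t (h *\<^sub>R \<tau>)) / ?w) = (%h. (Du y t \<bullet> H y t \<tau>) / ?w * h)"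
   using linear_cmul[OF H_linear[OF yc t']] by (simp add: fun_eq_iff)
  then show ?thesis using D unfolding has_field_derivative_def by (simp only:)
 qed
 have "((%r. r powr (1 - q)) has_real_derivative (1 - q) * ?w powr (1 - q - 1)) (at ?w)"
  using w by (auto intro!: derivative_eq_intros)
 then have dWp: "((%s. W \<eta> (Du (x s) t) powr (1 - q)) has_real_derivative ((1 - q) * ?w powr (1 - q - 1)) * ((Du y t \<bullet> H y t \<tau>) / ?w)) (at 0)"
  using DERIV_chain2[of "%r. r powr (1 - q)" _ "%s. W \<eta> (Du (x s) t)" 0 _ UNIV, OF _ dW] by (simp add: x(1))
 have "((%s. \<phi> (x s)) has_derivative (%h. \<phi>' \<bullet> (h *\<^sub>R \<tau>))) (at 0)" by (rule comp[OF \<phi>'])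
 moreover have "(%h. \<phi>' \<bullet> (h *\<^sub>R \<tau>)) = (%h. (\<phi>' \<bullet> \<tau>) * h)" by (simp add: fun_eq_iff)
 ultimately have d\<phi>: "((%s. \<phi> (x s)) has_real_derivative \<phi>' \<bullet> \<tau>) (at 0)"
  unfolding has_field_derivative_def by (simp only:)
 from DERIV_mult[OF d\<phi> dWp]
 have rhs: "((%s. \<phi> (x s) * W \<eta> (Du (x s) t) powr (1 - q)) has_real_derivative
   (\<phi>' \<bullet> \<tau>) * ?w powr (1 - q) + ((1 - q) * ?w powr (1 - q - 1)) * ((Du y t \<bullet> H y t \<tau>) / ?w) * \<phi> y) (at 0)"
  by (simp add: x(1))
 from DERIV_diff[OF lhs rhs]
 have diff: "((%s. Du (x s) t \<bullet> N (x s) - \<phi> (x s) * W \<eta> (Du (x s) t) powr (1 - q)) has_real_derivative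
   (Du y t \<bullet> LN \<tau> + H y t \<tau> \<bullet> N y) - ((\<phi>' \<bullet> \<tau>) * ?w powr (1 - q) + ((1 - q) * ?w powr (1 - q - 1)) * ((Du y t \<bullet> H y t \<tau>) / ?w) * \<phi> y)) (at 0)" .
 have zero: "Du (x s) t \<bullet> N (x s) - \<phi> (x s) * W \<eta> (Du (x s) t) powr (1 - q) = 0" if "\<bar>s\<bar> < e" for s
  using neumann[OF x(4)[OF that] t] N_normal[OF x(4)[OF that]] by simp
 have "(Du y t \<bullet> LN \<tau> + H y t \<tau> \<bullet> N y) - ((\<phi>' \<bullet> \<tau>) * ?w powr (1 - q) + ((1 - q) * ?w powr (1 - q - 1)) * ((Du y t \<bullet> H y t \<tau>) / ?w) * \<phi> y) = 0"
  by (rule DERIV_local_const[OF diff x(3)]) (use zero x(3) in simp)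
 moreover have ww: "?w powr (1 - q - 1) / ?w = ?w powr (- 1 - q)"
 proof -
  have "?w powr (- 1 - q) * ?w powr 1 = ?w powr (- 1 - q + 1)" by (simp only: powr_add)
  moreover have "- 1 - q + 1 = 1 - q - 1" by simp
  moreover have "?w powr 1 = ?w" using w by simp
  ultimately have "?w powr (- 1 - q) * ?w = ?w powr (1 - q - 1)" by (simp only:)
  then show ?thesis using w by (simp add: field_simps)
 qed
 have "((1 - q) * ?w powr (1 - q - 1)) * ((Du y t \<bullet> H y t \<tau>) / ?w) * \<phi> y = \<phi> y * (1 - q) * ?w powr (- 1 - q) * (Du y t \<bullet> H y t \<tau>)"
  by (simp only: ww[symmetric]) (simp add: mult_ac)
 ultimately have "(Du y t \<bullet> LN \<tau> + H y t \<tau> \<bullet> n y) - ((\<phi>' \<bullet> \<tau>) * ?w powr (1 - q)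
   + \<phi> y * (1 - q) * ?w powr (- 1 - q) * (Du y t \<bullet> H y t \<tau>)) = 0"
  using N_normal[OF y] by (simp only:)
 then show ?thesis by linarith
qed

end

text \<open>The gradient \<open>p\<close>, the Hessian \<open>A\<close> and the boundary data at one boundary point. The two equations are the tangential
 derivative of the boundary condition and the vanishing of the tangential gradient of the auxiliary function.\<close>

definition boundary_maximum_data :: "real => real => real => 'a::euclidean_space => ('a => 'a) => ('a => 'a) =>
  ('a => 'a) => 'a => real => 'a => real => bool" where
 "boundary_maximum_data M q k0 p A LN LV n a g w \<longleftrightarrow>
   p \<bullet> p <= w\<^sup>2 \<and> w\<^sup>2 <= 1 + p \<bullet> p \<and> n \<bullet> n = 1 \<and> \<bar>a\<bar> <= M \<and> norm g <= M \<and>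
   p \<bullet> n = a * w powr (1 - q) \<and> linear A \<and> (\<forall>v x. A v \<bullet> x = A x \<bullet> v) \<and> (\<forall>v. norm (LV v) <= M * norm v) \<and>
   (\<forall>\<tau>. \<tau> \<bullet> n = 0 --> (- (LN \<tau> \<bullet> \<tau>) <= k0 * (\<tau> \<bullet> \<tau>) \<and> LN \<tau> \<bullet> n = 0) \<and>
    A \<tau> \<bullet> n + p \<bullet> LN \<tau> = (g \<bullet> \<tau>) * w powr (1 - q) + a * (1 - q) * w powr (- 1 - q) * (p \<bullet> A \<tau>) \<and>
    (p - w powr (1 - q) *\<^sub>R (a *\<^sub>R n)) \<bullet> A \<tau> = w powr (1 - q) * (LV \<tau> \<bullet> p))"

text \<open>In terms of the auxiliary function \<open>\<Psi>\<close>: its normal derivative is less than \<open>(1 + q) (k0 + \<delta>) \<Psi>\<close>.\<close>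

definition boundary_estimate :: "'a::euclidean_space itself => real => real => real => real => real => bool" where
 "boundary_estimate _ M q k0 \<delta> R \<longleftrightarrow> (\<forall>(p::'a) A LN LV n a g w. R <= w \<and> boundary_maximum_data M q k0 p A LN LV n a g w -->
   (1 + q) * w powr (q - 1) * ((p - w powr (1 - q) *\<^sub>R (a *\<^sub>R n)) \<bullet> A n) - (1 + q) * (LV n \<bullet> p)
      < (1 + q) * (k0 + \<delta>) * (w powr (1 + q) - (1 + q) * (a * (n \<bullet> p))))"

text \<open>The leading part of the normal derivative of \<open>\<Psi>\<close> is the mixed second derivative \<open>Y = A T \<bullet> n\<close>, where \<open>T\<close> is the
 tangential gradient. The differentiated boundary condition in direction \<open>T\<close> gives \<open>Y = - LN T \<bullet> T\<close> up to terms of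
 relative size \<open>\<omega> = w powr (- q)\<close>, because \<open>T \<bullet> A T\<close> is small by the vanishing tangential gradient. The curvature bound
 then gives \<open>Y <= k0 w\<^sup>2\<close> plus lower order, while \<open>\<Psi>\<close> is \<open>w powr (1 + q)\<close> plus lower order.\<close>

lemma boundary_maximum_algebra:
 fixes M q k0 \<delta> :: real
 assumes M: "M \<ge> 1" and q: "q > 0" and k0: "k0 \<ge> 0" and \<delta>: "\<delta> > 0"
 obtains R where "R \<ge> 1" "boundary_estimate TYPE('a::euclidean_space) M q k0 \<delta> R"
proof -
 define Q where "Q = 1 + q"
 define c1 where "c1 = (2 * M + Q * M\<^sup>2) * 2 + k0 * 4 * Q * M\<^sup>2 + M + (k0 + \<delta>) * Q * M\<^sup>2"
 have Q: "Q > 1" using q by (simp add: Q_def)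
 have c1: "c1 > 0" using M Q k0 \<delta> by (simp add: c1_def add_pos_nonneg add_nonneg_pos)
 \<comment> \<open>The first bound keeps the factor \<open>1 - d\<close> in front of \<open>Y\<close> above \<open>1 / 2\<close>, the second lets \<open>\<delta>\<close> absorb all errors.\<close>
 define \<omega>0 where "\<omega>0 = min (1 / (2 * Q * M\<^sup>2 + 1)) (\<delta> / (2 * c1))"
 have \<omega>0: "\<omega>0 > 0" using M Q \<delta> c1 by (simp add: \<omega>0_def add_nonneg_pos)
 define R where "R = max 1 ((1 / \<omega>0) powr (1 / q))"
 have "boundary_estimate TYPE('a) M q k0 \<delta> R" unfolding boundary_estimate_def
 proof (intro allI impI)
  fix p :: 'a and A LN LV n a g w
  assume "R <= w \<and> boundary_maximum_data M q k0 p A LN LV n a g w"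
  then have w: "w \<ge> R" and pw: "p \<bullet> p <= w\<^sup>2" "w\<^sup>2 <= 1 + p \<bullet> p" and n: "n \<bullet> n = 1" and a: "\<bar>a\<bar> <= M" and g: "norm g <= M"
   and pn: "p \<bullet> n = a * w powr (1 - q)" and A: "linear A" "\<And>v x. A v \<bullet> x = A x \<bullet> v"
   and LV: "\<And>v. norm (LV v) <= M * norm v"
   and LN: "\<And>\<tau>. \<tau> \<bullet> n = 0 ==> - (LN \<tau> \<bullet> \<tau>) <= k0 * (\<tau> \<bullet> \<tau>) \<and> LN \<tau> \<bullet> n = 0"
   and e1: "\<And>\<tau>. \<tau> \<bullet> n = 0 ==> A \<tau> \<bullet> n + p \<bullet> LN \<tau> = (g \<bullet> \<tau>) * w powr (1 - q) + a * (1 - q) * w powr (- 1 - q) * (p \<bullet> A \<tau>)"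
   and e2: "\<And>\<tau>. \<tau> \<bullet> n = 0 ==> (p - w powr (1 - q) *\<^sub>R (a *\<^sub>R n)) \<bullet> A \<tau> = w powr (1 - q) * (LV \<tau> \<bullet> p)"
   unfolding boundary_maximum_data_def by blast+
  have w1: "w \<ge> 1" and wpos: "w > 0" using w by (auto simp: R_def)
  define \<omega> where "\<omega> = w powr (- q)"
  have \<omega>: "0 < \<omega>" "\<omega> <= \<omega>0" "\<omega> <= 1"
  proof -
   show "\<omega> > 0" using wpos by (simp add: \<omega>_def)
   have "((1 / \<omega>0) powr (1 / q)) powr q <= w powr q" using w q by (intro powr_mono2) (auto simp: R_def)
   then have "1 / \<omega>0 <= w powr q" using \<omega>0 q by (simp add: powr_powr)
   then show "\<omega> <= \<omega>0" using \<omega>0 wpos by (simp add: \<omega>_def powr_minus_divide field_simps)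
   show "\<omega> <= 1" using w1 q by (simp add: \<omega>_def powr_minus_divide ge_one_powr_ge_zero)
  qed
  have pw1: "w powr (1 - q) = w * \<omega>" "w powr (- 1 - q) = \<omega> / w" "w powr (q - 1) = 1 / (w * \<omega>)" "w powr (1 + q) = w / \<omega>"
  proof -
   show 1: "w powr (1 - q) = w * \<omega>" using wpos by (simp add: \<omega>_def powr_diff powr_minus_divide)
   show "w powr (- 1 - q) = \<omega> / w" using wpos by (simp add: \<omega>_def powr_diff powr_minus_divide)
   have "w powr (q - 1) = 1 / w powr (1 - q)" using powr_minus_divide[of w "1 - q"] by simp
   then show "w powr (q - 1) = 1 / (w * \<omega>)" using 1 by simp
   show "w powr (1 + q) = w / \<omega>" using wpos by (simp add: \<omega>_def powr_add powr_minus_divide)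
  qed
  have np: "norm p <= w" using pw(1) wpos by (simp add: norm_le_square)
  define T where "T = p - (p \<bullet> n) *\<^sub>R n"
  have Tn: "T \<bullet> n = 0" using n by (simp add: T_def inner_diff_left)
  have T: "T = p - w powr (1 - q) *\<^sub>R (a *\<^sub>R n)" by (simp add: T_def pn mult.commute)
  have p: "p = T + (a * (w * \<omega>)) *\<^sub>R n" by (simp add: T_def pn pw1(1))
  have TT: "T \<bullet> T <= w\<^sup>2"
  proof -
   have "p \<bullet> p = T \<bullet> T + (a * (w * \<omega>))\<^sup>2"
    using Tn n by (subst (1 2) p) (simp add: inner_add_left inner_add_right inner_commute[of n T] power2_eq_square)
   then show ?thesis using pw(1) by (smt (verit) zero_le_power2)
  qed
  then have nT: "norm T <= w" using wpos by (simp add: norm_le_square)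
  define Y where "Y = A T \<bullet> n"
  define Z where "Z = LV T \<bullet> p"
  have Zb: "\<bar>Z\<bar> <= M * w\<^sup>2"
  proof -
   have "\<bar>Z\<bar> <= norm (LV T) * norm p" unfolding Z_def by (rule Cauchy_Schwarz_ineq2)
   also have "... <= (M * norm T) * w" using LV[of T] np M by (intro mult_mono) auto
   also have "... <= (M * w) * w" using nT M wpos by (intro mult_right_mono mult_left_mono) auto
   finally show ?thesis by (simp add: power2_eq_square mult.assoc)
  qed
  have AT: "T \<bullet> A T = w * \<omega> * Z" using e2[OF Tn] unfolding T[symmetric] unfolding pw1(1) Z_def .
  have pAT: "p \<bullet> A T = w * \<omega> * Z + a * (w * \<omega>) * Y"
  proof -
   have "p \<bullet> A T = T \<bullet> A T + (a * (w * \<omega>)) * (n \<bullet> A T)"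
    by (metis p inner_add_left inner_scaleR_left)
   then show ?thesis using AT inner_commute[of n "A T"] by (simp add: Y_def)
  qed
  have LNT: "p \<bullet> LN T = T \<bullet> LN T"
   using LN[OF Tn] by (subst p) (simp add: inner_add_left inner_commute[of n])
  define G where "G = g \<bullet> T"
  have Gb: "\<bar>G\<bar> <= M * w"
  proof -
   have "\<bar>G\<bar> <= norm g * norm T" unfolding G_def by (rule Cauchy_Schwarz_ineq2)
   also have "... <= M * w" using g nT M by (intro mult_mono) auto
   finally show ?thesis .
  qed
  have eqY: "Y * (1 - a\<^sup>2 * (1 - q) * \<omega>\<^sup>2) = - (LN T \<bullet> T) + G * (w * \<omega>) + a * (1 - q) * \<omega>\<^sup>2 * Z"
  proof -
   have "Y + T \<bullet> LN T = G * (w * \<omega>) + a * (1 - q) * (\<omega> / w) * (w * \<omega> * Z + a * (w * \<omega>) * Y)"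
    using e1[OF Tn] unfolding pw1 LNT pAT Y_def[symmetric] G_def[symmetric] .
   moreover have "a * (1 - q) * (\<omega> / w) * (w * \<omega> * Z + a * (w * \<omega>) * Y) = a * (1 - q) * \<omega>\<^sup>2 * Z + Y * (a\<^sup>2 * (1 - q) * \<omega>\<^sup>2)"
    using wpos by (simp add: power2_eq_square field_simps)
   ultimately show ?thesis using inner_commute[of T "LN T"] by (simp add: right_diff_distrib)
  qed
  have a2: "a\<^sup>2 <= M\<^sup>2" using a by (metis abs_le_square_iff abs_of_nonneg M order_trans zero_le_one)
  have q1: "\<bar>1 - q\<bar> <= Q" using q by (simp add: Q_def)
  have \<omega>2: "\<omega>\<^sup>2 <= \<omega>" using \<omega> by (simp add: power2_eq_square mult_left_le_one_le)
  define d where "d = a\<^sup>2 * (1 - q) * \<omega>\<^sup>2"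
  have db: "\<bar>d\<bar> <= Q * M\<^sup>2 * \<omega>"
  proof -
   have "\<bar>d\<bar> = a\<^sup>2 * \<bar>1 - q\<bar> * \<omega>\<^sup>2" by (simp add: d_def abs_mult)
   also have "... <= M\<^sup>2 * Q * \<omega>" using a2 q1 \<omega>2 M Q \<omega> by (intro mult_mono) auto
   finally show ?thesis by (simp add: mult_ac)
  qed
  have "\<omega> * (2 * Q * M\<^sup>2 + 1) <= 1"
  proof -
   have "2 * Q * M\<^sup>2 + 1 > 0" using Q M by (simp add: add_nonneg_pos)
   moreover have "\<omega> <= 1 / (2 * Q * M\<^sup>2 + 1)" using \<omega>(2) by (simp add: \<omega>0_def)
   ultimately show ?thesis by (simp add: pos_le_divide_eq)
  qed
  then have dh: "Q * M\<^sup>2 * \<omega> <= 1 / 2" using \<omega> by (simp add: algebra_simps)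
  have d2: "1 - d \<ge> 1 / 2" using db dh by (simp add: abs_le_iff)
  have S: "Y * (1 - d) <= k0 * w\<^sup>2 + \<omega> * w\<^sup>2 * (M + Q * M\<^sup>2)"
  proof -
   have "- (LN T \<bullet> T) <= k0 * w\<^sup>2" using LN[OF Tn] mult_left_mono[OF TT k0] by linarith
   moreover have "G * (w * \<omega>) <= M * w * (w * \<omega>)" using Gb wpos \<omega> by (intro mult_right_mono) (auto simp: abs_le_iff)
   moreover have "a * (1 - q) * \<omega>\<^sup>2 * Z <= M * Q * \<omega> * (M * w\<^sup>2)"
   proof -
    have "a * (1 - q) * \<omega>\<^sup>2 * Z <= \<bar>a\<bar> * \<bar>1 - q\<bar> * \<omega>\<^sup>2 * \<bar>Z\<bar>"
     using abs_ge_self[of "a * (1 - q) * \<omega>\<^sup>2 * Z"] by (simp add: abs_mult)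
    also have "... <= M * Q * \<omega> * (M * w\<^sup>2)" using a q1 \<omega>2 Zb M Q \<omega> by (intro mult_mono) auto
    finally show ?thesis .
   qed
   ultimately show ?thesis using eqY unfolding d_def by (simp add: power2_eq_square algebra_simps)
  qed
  have Yb: "Y <= k0 * w\<^sup>2 + \<omega> * w\<^sup>2 * ((2 * M + Q * M\<^sup>2) * 2 + k0 * 4 * Q * M\<^sup>2)"
  proof (cases "Y <= 0")
   case True
   have "0 <= k0 * w\<^sup>2 + \<omega> * w\<^sup>2 * ((2 * M + Q * M\<^sup>2) * 2 + k0 * 4 * Q * M\<^sup>2)"
    using k0 \<omega> M Q by (intro add_nonneg_nonneg mult_nonneg_nonneg) auto
   then show ?thesis using True by linarith
  next
   case False
   then have Y0: "Y > 0" by simp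
   have le1: "Y * (1 / 2) <= Y * (1 - d)" using Y0 d2 by (intro mult_left_mono) auto
   define B where "B = k0 * w\<^sup>2 + \<omega> * w\<^sup>2 * (M + Q * M\<^sup>2)"
   have YB: "Y <= 2 * B" using le1 S by (simp add: B_def)
   have "Y * d <= Y * (Q * M\<^sup>2 * \<omega>)" using db Y0 by (intro mult_left_mono) (auto simp: abs_le_iff)
   also have "... <= 2 * B * (Q * M\<^sup>2 * \<omega>)" using YB Q \<omega> by (intro mult_right_mono) auto
   finally have "Y <= B + 2 * B * (Q * M\<^sup>2 * \<omega>)" using S by (simp add: B_def algebra_simps)
   also have "... = k0 * w\<^sup>2 + k0 * w\<^sup>2 * 2 * (Q * M\<^sup>2 * \<omega>) + \<omega> * w\<^sup>2 * (M + Q * M\<^sup>2) * (1 + 2 * (Q * M\<^sup>2 * \<omega>))"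
    by (simp add: B_def algebra_simps)
   also have "... <= k0 * w\<^sup>2 + k0 * w\<^sup>2 * 4 * (Q * M\<^sup>2 * \<omega>) + \<omega> * w\<^sup>2 * (2 * M + Q * M\<^sup>2) * 2"
    using dh k0 \<omega> Q M by (intro add_mono mult_mono) auto
   finally show ?thesis by (simp add: algebra_simps)
  qed
  define r where "r = (2 * M + Q * M\<^sup>2) * 2 + k0 * 4 * Q * M\<^sup>2"
  have TAn: "T \<bullet> A n = Y" using A(2)[of n T] by (simp add: Y_def inner_commute)
  have LVn: "- (LV n \<bullet> p) <= M * w"
  proof -
   have "norm n = 1" using n by (simp add: norm_eq_1)
   then have "norm (LV n) * norm p <= M * w" using LV[of n] np M by (intro mult_mono) auto
   then show ?thesis using Cauchy_Schwarz_ineq2[of "LV n" p] by (simp add: abs_le_iff)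
  qed
  have wo: "w * \<omega> > 0" using wpos \<omega> by simp
  have "w powr (q - 1) * (T \<bullet> A n) - LV n \<bullet> p <= (1 / (w * \<omega>)) * (k0 * w\<^sup>2 + \<omega> * w\<^sup>2 * r) + M * w"
  proof -
   have "0 <= 1 / (w * \<omega>)" using wo by simp
   from mult_left_mono[OF Yb this] show ?thesis using LVn unfolding TAn pw1(3) r_def by linarith
  qed
  also have "(1 / (w * \<omega>)) * (k0 * w\<^sup>2 + \<omega> * w\<^sup>2 * r) = k0 * (w / \<omega>) + w * r"
   using wpos \<omega> by (simp add: field_simps power2_eq_square)
  finally have up: "w powr (q - 1) * (T \<bullet> A n) - LV n \<bullet> p <= k0 * (w / \<omega>) + w * (r + M)" by (simp add: algebra_simps)
  have an: "a * (n \<bullet> p) <= M\<^sup>2 * w"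
  proof -
   have "a * (n \<bullet> p) = a\<^sup>2 * (w * \<omega>)" by (simp add: inner_commute[of n] pn pw1(1) power2_eq_square)
   also have "... <= M\<^sup>2 * (w * 1)" using a2 wpos \<omega> by (intro mult_mono) auto
   finally show ?thesis by simp
  qed
  have lo: "(k0 + \<delta>) * (w powr (1 + q) - Q * (a * (n \<bullet> p))) \<ge> (k0 + \<delta>) * (w / \<omega> - Q * (M\<^sup>2 * w))"
   using an Q k0 \<delta> unfolding pw1(4) by (intro mult_left_mono diff_left_mono) auto
  have fin: "k0 * (w / \<omega>) + w * (r + M) < (k0 + \<delta>) * (w / \<omega> - Q * (M\<^sup>2 * w))"
  proof -
   have c1r: "c1 = r + M + (k0 + \<delta>) * Q * M\<^sup>2" by (simp add: c1_def r_def)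
   have "\<omega> * (2 * c1) <= \<delta>" using \<omega>(2) c1 by (simp add: \<omega>0_def pos_le_divide_eq)
   then have "\<omega> * c1 < \<delta>" using mult_pos_pos[OF \<omega>(1) c1] by linarith
   then have "w * c1 < \<delta> * (w / \<omega>)" using wpos \<omega>(1) by (simp add: field_simps)
   moreover have "(k0 + \<delta>) * (w / \<omega> - Q * (M\<^sup>2 * w)) = k0 * (w / \<omega>) + \<delta> * (w / \<omega>) - w * ((k0 + \<delta>) * Q * M\<^sup>2)"
    by (simp only: distrib_right distrib_left right_diff_distrib) (simp add: mult_ac distrib_left)
   moreover have "w * c1 = w * (r + M) + w * ((k0 + \<delta>) * Q * M\<^sup>2)" unfolding c1r by (simp add: distrib_left)
   ultimately show ?thesis by linarith
  qed
  have "w powr (q - 1) * (T \<bullet> A n) - LV n \<bullet> p < (k0 + \<delta>) * (w powr (1 + q) - Q * (a * (n \<bullet> p)))"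
   using up fin lo by linarith
  then have "Q * (w powr (q - 1) * (T \<bullet> A n) - LV n \<bullet> p) < Q * ((k0 + \<delta>) * (w powr (1 + q) - Q * (a * (n \<bullet> p))))"
   using Q by simp
  then show "(1 + q) * w powr (q - 1) * ((p - w powr (1 - q) *\<^sub>R (a *\<^sub>R n)) \<bullet> A n) - (1 + q) * (LV n \<bullet> p)
      < (1 + q) * (k0 + \<delta>) * (w powr (1 + q) - (1 + q) * (a * (n \<bullet> p)))"
   unfolding T[symmetric] Q_def by (simp add: algebra_simps)
 qed
 moreover have "R \<ge> 1" by (simp add: R_def)
 ultimately show ?thesis using that by blast
qed

section \<open>The algebra at an interior maximum\<close>

text \<open>The squared Frobenius norm, in the basis of the space.\<close>

definition frob_sq :: "('a::euclidean_space => 'a) => real" where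
 "frob_sq X = (\<Sum>b\<in>Basis. X b \<bullet> X b)"

lemma frob_sq_nonneg: "frob_sq X \<ge> 0"
 by (simp add: frob_sq_def sum_nonneg)

lemma norm_le_frob:
 assumes "linear X" shows "norm (X v) <= sqrt (frob_sq X) * norm v"
proof -
 have "norm (X v) = norm (\<Sum>b\<in>Basis. (v \<bullet> b) *\<^sub>R X b)"
  by (subst euclidean_representation[of v, symmetric])
    (simp add: linear_sum[OF assms] linear_cmul[OF assms] del: euclidean_representation)
 also have "... <= (\<Sum>b\<in>Basis. \<bar>v \<bullet> b\<bar> * norm (X b))" by (rule order_trans[OF norm_sum]) simp
 also have "... <= L2_set (%b. v \<bullet> b) Basis * L2_set (%b. norm (X b)) Basis"
  using L2_set_mult_ineq[of "%b. v \<bullet> b" "%b. norm (X b)" Basis] by simp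
 also have "... = norm v * sqrt (frob_sq X)"
  by (simp add: L2_set_def frob_sq_def power2_norm_eq_inner norm_eq_sqrt_inner euclidean_inner[of v v] power2_eq_square)
 finally show ?thesis by (simp add: mult.commute)
qed

lemma orthonormal_parseval:
 fixes E :: "'a::euclidean_space set"
 assumes E: "pairwise orthogonal E" "\<And>x. x \<in> E ==> norm x = 1" "span E = UNIV" "finite E"
 shows "v \<bullet> w = (\<Sum>f\<in>E. (v \<bullet> f) * (w \<bullet> f))"
proof -
 have "(\<Sum>f\<in>E. (v \<bullet> f) *\<^sub>R f) = v" using E by (intro orthonormal_basis_expand) auto
 moreover have "(\<Sum>f\<in>E. (v \<bullet> f) *\<^sub>R f) \<bullet> w = (\<Sum>f\<in>E. (v \<bullet> f) * (w \<bullet> f))"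
  by (subst inner_sum_left) (simp add: inner_commute[of _ w])
 ultimately show ?thesis by simp
qed

lemma trace_orthonormal:
 fixes E :: "'a::euclidean_space set"
 assumes E: "pairwise orthogonal E" "\<And>x. x \<in> E ==> norm x = 1" "span E = UNIV" "finite E"
  and L: "linear L"
 shows "(\<Sum>b\<in>Basis. L b \<bullet> b) = (\<Sum>f\<in>E. L f \<bullet> f)"
proof -
 have "(\<Sum>b\<in>Basis. L b \<bullet> b) = (\<Sum>b\<in>Basis. \<Sum>f\<in>E. (L b \<bullet> f) * (b \<bullet> f))"
  by (intro sum.cong refl orthonormal_parseval[OF E])
 also have "... = (\<Sum>f\<in>E. \<Sum>b\<in>Basis. (L b \<bullet> f) * (b \<bullet> f))" by (rule sum.swap)
 also have "... = (\<Sum>f\<in>E. L f \<bullet> f)"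
 proof (rule sum.cong[OF refl])
  fix f assume "f \<in> E"
  have "L f = L (\<Sum>b\<in>Basis. (f \<bullet> b) *\<^sub>R b)" by (simp add: euclidean_representation)
  also have "... = (\<Sum>b\<in>Basis. (f \<bullet> b) *\<^sub>R L b)" by (simp add: linear_sum[OF L] linear_cmul[OF L])
  finally have "L f \<bullet> f = (\<Sum>b\<in>Basis. (f \<bullet> b) * (L b \<bullet> f))" by (simp add: inner_sum_left)
  then show "(\<Sum>b\<in>Basis. (L b \<bullet> f) * (b \<bullet> f)) = L f \<bullet> f" by (simp add: inner_commute mult.commute)
 qed
 finally show ?thesis .
qed

text \<open>In an orthonormal basis containing \<open>e\<close> this is the Cauchy-Schwarz inequality for the diagonal entries of the block of
 \<open>X\<close> orthogonal to \<open>e\<close>. It is the source of the factor \<open>1 / (n - 1)\<close> in the forcing condition.\<close>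

lemma tangential_trace_bound:
 fixes X :: "'a::euclidean_space => 'a"
 assumes X: "linear X" and sym: "\<And>v w. X v \<bullet> w = X w \<bullet> v" and e: "norm e = 1"
 shows "((\<Sum>b\<in>Basis. X b \<bullet> b) - X e \<bullet> e)\<^sup>2
   <= (real DIM('a) - 1) * (frob_sq X - 2 * (X e \<bullet> X e) + (X e \<bullet> e)\<^sup>2)"
proof -
 obtain E where E: "e \<in> E" "pairwise orthogonal E" "\<And>x. x \<in> E ==> norm x = 1" "independent E"
  "card E = DIM('a)" "span E = UNIV" using vector_in_orthonormal_basis[OF e] by metis
 have fin: "finite E" using E(4) by (rule finiteI_independent)
 note on = E(2,3,6) fin
 define E' where "E' = E - {e}"
 have E': "finite E'" "card E' = DIM('a) - 1" using fin E(1,5) by (auto simp: E'_def)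
 have splitE: "(\<Sum>f\<in>E. F f) = F e + (\<Sum>f\<in>E'. F f)" for F :: "'a => real"
  unfolding E'_def using fin E(1) by (rule sum.remove)
 have tr: "(\<Sum>b\<in>Basis. X b \<bullet> b) - X e \<bullet> e = (\<Sum>f\<in>E'. X f \<bullet> f)"
  using trace_orthonormal[OF on X] splitE[of "%f. X f \<bullet> f"] by simp
 have XX: "linear (%v. X (X v))" using linear_compose[OF X X] by (simp add: o_def)
 have "frob_sq X = (\<Sum>b\<in>Basis. X (X b) \<bullet> b)" unfolding frob_sq_def using sym by (intro sum.cong) auto
 also have "... = (\<Sum>f\<in>E. X (X f) \<bullet> f)" by (rule trace_orthonormal[OF on XX])
 also have "... = (\<Sum>f\<in>E. X f \<bullet> X f)" using sym by (intro sum.cong) auto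
 also have "... = X e \<bullet> X e + (\<Sum>f\<in>E'. X f \<bullet> X f)" by (rule splitE)
 finally have fr: "frob_sq X = X e \<bullet> X e + (\<Sum>f\<in>E'. X f \<bullet> X f)" .
 have ge: "X f \<bullet> X f \<ge> (X e \<bullet> f)\<^sup>2 + (X f \<bullet> f)\<^sup>2" if f: "f \<in> E'" for f
 proof -
  have "X f \<bullet> X f = (X f \<bullet> e) * (X f \<bullet> e) + (\<Sum>f'\<in>E'. (X f \<bullet> f') * (X f \<bullet> f'))"
   using orthonormal_parseval[OF on, of "X f" "X f"] splitE by simp
  moreover have "(\<Sum>f'\<in>E'. (X f \<bullet> f') * (X f \<bullet> f')) \<ge> (X f \<bullet> f) * (X f \<bullet> f)"
   using f E'(1) by (intro member_le_sum[of f E' "%f'. (X f \<bullet> f') * (X f \<bullet> f')"]) auto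
  ultimately show ?thesis using sym[of f e] by (simp add: power2_eq_square)
 qed
 have "X e \<bullet> X e = (X e \<bullet> e)\<^sup>2 + (\<Sum>f\<in>E'. (X e \<bullet> f)\<^sup>2)"
  using orthonormal_parseval[OF on, of "X e" "X e"] splitE by (simp add: power2_eq_square)
 moreover have "(\<Sum>f\<in>E'. X f \<bullet> X f) \<ge> (\<Sum>f\<in>E'. (X e \<bullet> f)\<^sup>2 + (X f \<bullet> f)\<^sup>2)" using ge by (rule sum_mono)
 ultimately have 1: "frob_sq X - 2 * (X e \<bullet> X e) + (X e \<bullet> e)\<^sup>2 \<ge> (\<Sum>f\<in>E'. (X f \<bullet> f)\<^sup>2)"
  using fr by (simp add: sum.distrib)
 have "(\<Sum>f\<in>E'. X f \<bullet> f)\<^sup>2 <= real (card E') * (\<Sum>f\<in>E'. (X f \<bullet> f)\<^sup>2)"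
  using sum_squared_le_sum_of_squares[of "%f. X f \<bullet> f" E'] by (simp add: mult.commute)
 moreover have "real (card E') = real DIM('a) - 1"
  using E'(2) DIM_positive[where 'a='a] by (simp add: of_nat_diff Suc_leI)
 ultimately have "(\<Sum>f\<in>E'. X f \<bullet> f)\<^sup>2 <= (real DIM('a) - 1) * (\<Sum>f\<in>E'. (X f \<bullet> f)\<^sup>2)" by simp
 also have "... <= (real DIM('a) - 1) * (frob_sq X - 2 * (X e \<bullet> X e) + (X e \<bullet> e)\<^sup>2)"
  using 1 DIM_positive[where 'a='a] by (intro mult_left_mono) (auto simp: Suc_leI)
 finally show ?thesis using tr by simp
qed

text \<open>The quadratic form of the coefficient matrix \<open>I - P \<otimes> P\<close>.\<close>

definition aform :: "'a::real_inner => 'a => 'a => real" where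
 "aform P v w = v \<bullet> w - (P \<bullet> v) * (P \<bullet> w)"

lemma aform_nonneg: "norm P <= 1 ==> aform P v v \<ge> 0"
proof -
 assume P: "norm P <= 1"
 have "(P \<bullet> v) * (P \<bullet> v) <= (P \<bullet> P) * (v \<bullet> v)" using Cauchy_Schwarz_ineq[of P v] by (simp add: power2_eq_square)
 also have "... <= 1 * (v \<bullet> v)" using P by (intro mult_right_mono) (auto simp: power2_norm_eq_inner[symmetric] power_le_one)
 finally show ?thesis by (simp add: aform_def)
qed

lemma aform_add: "aform P (v + w) (x + y) = aform P v x + aform P v y + aform P w x + aform P w y"
 by (simp add: aform_def inner_add_left inner_add_right algebra_simps)

lemma aform_commute: "aform P v w = aform P w v"
 by (simp add: aform_def inner_commute mult.commute)

lemma aform_scaleR: "aform P (a *\<^sub>R v) w = a * aform P v w" "aform P v (a *\<^sub>R w) = a * aform P v w"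
 by (simp_all add: aform_def algebra_simps)

lemma aform_le: assumes "norm P <= 1" shows "\<bar>aform P v w\<bar> <= norm v * norm w"
proof -
 have self: "aform P v v <= (norm v)\<^sup>2" for v by (simp add: aform_def power2_norm_eq_inner)
 define s t where "s = norm v" and "t = norm w"
 show ?thesis
 proof (cases "s = 0 \<or> t = 0")
  case True
  then show ?thesis by (auto simp: s_def t_def aform_def)
 next
  case False
  then have st: "s > 0" "t > 0" by (auto simp: s_def t_def)
  have "0 <= aform P (t *\<^sub>R v + s *\<^sub>R w) (t *\<^sub>R v + s *\<^sub>R w)" by (rule aform_nonneg[OF assms])
  also have "... = t\<^sup>2 * aform P v v + 2 * s * t * aform P v w + s\<^sup>2 * aform P w w"
   by (simp add: aform_add aform_scaleR aform_commute[of P w v] power2_eq_square algebra_simps)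
  also have "... <= t\<^sup>2 * s\<^sup>2 + 2 * s * t * aform P v w + s\<^sup>2 * t\<^sup>2"
   using self[of v] self[of w] by (intro add_mono mult_left_mono) (auto simp: s_def t_def)
  finally have "0 <= 2 * s * t * (s * t + aform P v w)" by (simp add: power2_eq_square algebra_simps)
  then have 1: "0 <= s * t + aform P v w" using mult_pos_pos[OF st] by (auto simp: zero_le_mult_iff)
  have "0 <= aform P (t *\<^sub>R v + (- s) *\<^sub>R w) (t *\<^sub>R v + (- s) *\<^sub>R w)" by (rule aform_nonneg[OF assms])
  also have "... = t\<^sup>2 * aform P v v - 2 * s * t * aform P v w + s\<^sup>2 * aform P w w"
   unfolding aform_add aform_scaleR by (simp add: aform_commute[of P w v] power2_eq_square algebra_simps)
  also have "... <= t\<^sup>2 * s\<^sup>2 - 2 * s * t * aform P v w + s\<^sup>2 * t\<^sup>2"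
   using self[of v] self[of w] by (intro add_mono diff_mono mult_left_mono) (auto simp: s_def t_def)
  finally have "0 <= 2 * s * t * (s * t - aform P v w)" by (simp add: power2_eq_square algebra_simps)
  then have 2: "0 <= s * t - aform P v w" using mult_pos_pos[OF st] by (auto simp: zero_le_mult_iff)
  show ?thesis using 1 2 by (simp add: s_def t_def abs_le_iff)
 qed
qed

text \<open>The conditions at an interior maximum of \<open>\<Psi> exp \<gamma>\<close>, scaled to be bounded for large gradients: \<open>P = Du / W\<close>,
 \<open>X = D\<^sup>2u / W\<close>, \<open>\<omega> = W powr (- q)\<close>, \<open>\<iota> = 1 / W\<close>; \<open>g\<close> and \<open>G\<close> are the gradient of \<open>\<gamma> / (1 + q)\<close> and its second
 derivative contracted with the coefficients, and \<open>1 - (1 + q) \<omega> (P \<bullet> V)\<close> is \<open>\<Psi> / W powr (1 + q)\<close>. The three relations are the first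
 order condition, the equation, with \<open>\<epsilon>\<close> collecting speed and \<open>f\<close>, and the second order condition combined with the
 equation differentiated in direction \<open>P - \<omega> V\<close>. The parameter \<open>\<nu>\<close> measures smallness and tends to 0 as \<open>W\<close> grows.\<close>

definition interior_maximum_data :: "real => real => real => 'a::euclidean_space => ('a => 'a) => real => real =>
  'a => ('a => 'a) => real => 'a => real => real => 'a => 'a => real => real => bool" where
 "interior_maximum_data M q \<nu> P X \<omega> \<iota> V DV D2 g G c Dc Df z \<epsilon> \<longleftrightarrow>
   0 <= \<omega> \<and> \<omega> <= \<nu> \<and> 0 <= \<iota> \<and> \<iota> <= \<nu> \<and> norm P <= 1 \<and> 1 - P \<bullet> P <= \<nu> \<and>
   linear X \<and> (\<forall>v w. X v \<bullet> w = X w \<bullet> v) \<and> norm V <= M \<and> (\<forall>v. norm (DV v) <= M * norm v) \<and>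
   \<bar>D2\<bar> <= M \<and> norm g <= M \<and> \<bar>G\<bar> <= M \<and> \<bar>c\<bar> <= M \<and> norm Dc <= M \<and> norm Df <= M \<and> z <= 0 \<and> \<bar>\<epsilon>\<bar> <= M * \<nu> \<and>
   (\<forall>v. (P - \<omega> *\<^sub>R V) \<bullet> X v = \<omega> * (DV v \<bullet> P) - (1 - (1 + q) * \<omega> * (P \<bullet> V)) * (g \<bullet> v)) \<and>
   (\<Sum>b\<in>Basis. X b \<bullet> b) - P \<bullet> X P = - c + \<epsilon> \<and>
   (1 - (1 + q) * \<omega> * (P \<bullet> V)) * (G - (1 + q) * aform P g g)
    <= - 2 * aform P (X P) (X (P - \<omega> *\<^sub>R V)) - (frob_sq X - X P \<bullet> X P) - (q - 1) * aform P (X P) (X P)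
     + (P - \<omega> *\<^sub>R V) \<bullet> Dc + z * ((P - \<omega> *\<^sub>R V) \<bullet> P) + c * ((P - \<omega> *\<^sub>R V) \<bullet> X P) - \<iota> * ((P - \<omega> *\<^sub>R V) \<bullet> Df)
     + 2 * \<omega> * ((\<Sum>b\<in>Basis. DV b \<bullet> X b) - DV P \<bullet> X P) + \<omega> * D2"

definition interior_estimate :: "'a::euclidean_space itself => real => real => real => real => bool" where
 "interior_estimate _ M q \<nu>0 K \<longleftrightarrow> (\<forall>\<nu> (P::'a) X \<omega> \<iota> V DV D2 g G c Dc Df z \<epsilon>.
   0 < \<nu> \<and> \<nu> <= \<nu>0 \<and> interior_maximum_data M q \<nu> P X \<omega> \<iota> V DV D2 g G c Dc Df z \<epsilon> -->
   c\<^sup>2 / (real DIM('a) - 1) <= norm Dc + \<bar>c\<bar> * norm g + \<bar>G\<bar> + K * \<nu>)"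

text \<open>In the limit \<open>\<nu> = 0\<close> the first order condition reads \<open>X P = - g\<close> and the equation says that the trace of \<open>X\<close>
 orthogonal to \<open>P\<close> is \<open>- c\<close>. The terms quadratic in \<open>X P\<close> and \<open>g\<close> then add up to a nonpositive multiple of \<open>aform P g g\<close>,
 and what remains of the second order condition bounds the squared norm of the tangential block of \<open>X\<close> by
 \<open>|Dc| + |c| |g| + |G|\<close>; the trace inequality bounds that norm below by \<open>c\<^sup>2 / (n - 1)\<close>. For small \<open>\<nu>\<close> the same computation
 has errors \<open>\<nu> F\<close> with \<open>F\<close> the norm of \<open>X\<close>; they are absorbed because \<open>F\<close> is itself bounded by the norm of the tangential
 block.\<close>

lemma interior_maximum_algebra:
 fixes M q :: real
 assumes M: "M \<ge> 1" and q: "q > 0" and dim: "DIM('a::euclidean_space) \<ge> 2"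
 obtains \<nu>0 K where "\<nu>0 > 0" "K \<ge> 0" "interior_estimate TYPE('a) M q \<nu>0 K"
proof -
 define N where "N = real DIM('a)"
 have N1: "N \<ge> 1" using DIM_positive[where 'a='a] by (simp add: N_def Suc_leI)
 define C1 where "C1 = 4 * (2 + q) * M\<^sup>2 + M\<^sup>2 + (1 + q) * M ^ 3 + M\<^sup>2 + 2 * M + M + (1 + q) * M\<^sup>2"
 define C2 where "C2 = 6 * (1 + q) * M\<^sup>2 + 2 * (N + 1) * M"
 define C3 where "C3 = 2 * (2 * M + M\<^sup>2 + C1 + C2 * (1 + 144 * M\<^sup>2))"
 define C4 where "C4 = 1 + 2 * C3 + 144 * M\<^sup>2"
 define K where "K = C1 + C2 * C4 + 2 * M * (M + C4)"
 define \<nu>0 where "\<nu>0 = 1 / (4 * ((1 + q) * (2 + q) * M + C2 + 4 * M\<^sup>2))"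
 have C1: "C1 \<ge> 0" using M q by (simp add: C1_def)
 have C2: "C2 > 0" using M q N1 by (simp add: C2_def add_pos_pos)
 have C3: "C3 \<ge> 0" using M C1 C2 by (simp add: C3_def)
 have C4: "C4 \<ge> 1" using C3 by (simp add: C4_def)
 have K: "K \<ge> 0" using C1 C2 C4 M by (simp add: K_def)
 have den: "(1 + q) * (2 + q) * M + C2 + 4 * M\<^sup>2 > 0" using M q C2 by (intro add_pos_pos) auto
 have \<nu>0: "\<nu>0 > 0" using den by (simp add: \<nu>0_def)
 have "interior_estimate TYPE('a) M q \<nu>0 K" unfolding interior_estimate_def
 proof (intro allI impI)
  fix \<nu> and P :: 'a and X \<omega> \<iota> V DV D2 g G c Dc Df z \<epsilon>
  assume "0 < \<nu> \<and> \<nu> <= \<nu>0 \<and> interior_maximum_data M q \<nu> P X \<omega> \<iota> V DV D2 g G c Dc Df z \<epsilon>"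
  then have \<nu>: "0 < \<nu>" "\<nu> <= \<nu>0" and \<omega>: "0 <= \<omega>" "\<omega> <= \<nu>" and \<iota>: "0 <= \<iota>" "\<iota> <= \<nu>"
   and P: "norm P <= 1" "1 - P \<bullet> P <= \<nu>" and X: "linear X" "\<And>v w. X v \<bullet> w = X w \<bullet> v"
   and V: "norm V <= M" and DV: "\<And>v. norm (DV v) <= M * norm v" and D2: "\<bar>D2\<bar> <= M"
   and g: "norm g <= M" and G: "\<bar>G\<bar> <= M" and c: "\<bar>c\<bar> <= M" and Dc: "norm Dc <= M" and Df: "norm Df <= M"
   and z: "z <= 0" and \<epsilon>: "\<bar>\<epsilon>\<bar> <= M * \<nu>"
   and first: "\<And>v. (P - \<omega> *\<^sub>R V) \<bullet> X v = \<omega> * (DV v \<bullet> P) - (1 - (1 + q) * \<omega> * (P \<bullet> V)) * (g \<bullet> v)"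
   and tr: "(\<Sum>b\<in>Basis. X b \<bullet> b) - P \<bullet> X P = - c + \<epsilon>"
   and second: "(1 - (1 + q) * \<omega> * (P \<bullet> V)) * (G - (1 + q) * aform P g g)
     <= - 2 * aform P (X P) (X (P - \<omega> *\<^sub>R V)) - (frob_sq X - X P \<bullet> X P) - (q - 1) * aform P (X P) (X P)
      + (P - \<omega> *\<^sub>R V) \<bullet> Dc + z * ((P - \<omega> *\<^sub>R V) \<bullet> P) + c * ((P - \<omega> *\<^sub>R V) \<bullet> X P) - \<iota> * ((P - \<omega> *\<^sub>R V) \<bullet> Df)
      + 2 * \<omega> * ((\<Sum>b\<in>Basis. DV b \<bullet> X b) - DV P \<bullet> X P) + \<omega> * D2"
   unfolding interior_maximum_data_def by blast+
  have "\<nu> * (4 * ((1 + q) * (2 + q) * M + C2 + 4 * M\<^sup>2)) <= 1"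
   using \<nu>(2) den by (simp add: \<nu>0_def pos_le_divide_eq)
  then have small: "4 * (\<nu> * ((1 + q) * (2 + q) * M)) + 4 * (\<nu> * C2) + 16 * (\<nu> * M\<^sup>2) <= 1"
   by (simp add: algebra_simps)
  have s0: "\<nu> * ((1 + q) * (2 + q) * M) \<ge> 0" "\<nu> * C2 \<ge> 0" "\<nu> * M\<^sup>2 \<ge> 0" using \<nu> M q C2 by auto
  have sC2: "2 * \<nu> * C2 <= 1 / 2" and sq: "\<nu> * ((1 + q) * (2 + q) * M) <= 1 / 4" and sM2: "16 * (\<nu> * M\<^sup>2) <= 1"
   using small s0 by (auto simp: mult.assoc)
  have MM: "M <= M\<^sup>2" using M by (simp add: power2_eq_square)
  have sM: "\<nu> * M <= 1 / 16" using mult_left_mono[OF MM, of \<nu>] \<nu> sM2 by linarith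
  have "\<nu> <= \<nu> * M" using \<nu> M by simp
  then have \<nu>1: "\<nu> <= 1 / 16" using sM by linarith
  have s1q: "(1 + q) * (\<nu> * M) <= 1 / 4"
  proof -
   have "(1 + q) * (\<nu> * M) * 1 <= (1 + q) * (\<nu> * M) * (2 + q)" using q \<nu> M by (intro mult_left_mono) auto
   moreover have "(1 + q) * (\<nu> * M) * (2 + q) = \<nu> * ((1 + q) * (2 + q) * M)" by (simp add: mult_ac)
   ultimately show ?thesis using sq by linarith
  qed
  define \<theta> where "\<theta> = 1 - (1 + q) * \<omega> * (P \<bullet> V)"
  define k where "k = X P"
  define \<xi> where "\<xi> = P - \<omega> *\<^sub>R V"
  define E where "E = X \<xi>"
  define F where "F = sqrt (frob_sq X)"
  have F: "F \<ge> 0" "F\<^sup>2 = frob_sq X" using frob_sq_nonneg[of X] by (auto simp: F_def)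
  have XF: "norm (X v) <= F * norm v" for v unfolding F_def by (rule norm_le_frob[OF X(1)])
  have PV: "\<bar>P \<bullet> V\<bar> <= M"
   using Cauchy_Schwarz_ineq2[of P V] mult_mono[OF P(1) V] by simp
  have \<omega>M: "\<omega> * M <= \<nu> * M" using \<omega> M by (intro mult_right_mono) auto
  have \<theta>1: "\<bar>\<theta> - 1\<bar> <= (1 + q) * (\<nu> * M)"
  proof -
   have "\<bar>\<theta> - 1\<bar> = (1 + q) * (\<omega> * \<bar>P \<bullet> V\<bar>)" using \<omega> q by (simp add: \<theta>_def abs_mult)
   also have "... <= (1 + q) * (\<nu> * M)" using PV \<omega> q by (intro mult_left_mono mult_mono) auto
   finally show ?thesis .
  qed
  have \<theta>2: "\<theta> \<ge> 3 / 4" "\<theta> <= 2" using \<theta>1 s1q by (auto simp: abs_le_iff)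
  have \<theta>q: "(1 + q) <= (2 + q) * \<theta>"
  proof -
   have "(2 + q) * (1 - \<theta>) <= (2 + q) * ((1 + q) * (\<nu> * M))" using \<theta>1 q by (intro mult_left_mono) auto
   also have "... = \<nu> * ((1 + q) * (2 + q) * M)" by (simp add: mult_ac)
   also have "... <= 1" using sq by linarith
   finally show ?thesis by (simp add: algebra_simps)
  qed
  have n\<xi>: "norm \<xi> <= 1 + \<nu> * M" "norm (\<xi> - P) <= \<nu> * M"
  proof -
   have "norm (\<xi> - P) = \<omega> * norm V" using \<omega> by (simp add: \<xi>_def)
   also have "... <= \<nu> * M" using \<omega> V by (intro mult_mono) auto
   finally show "norm (\<xi> - P) <= \<nu> * M" .
   then show "norm \<xi> <= 1 + \<nu> * M" using norm_triangle_ineq2[of \<xi> P] P by linarith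
  qed
  have Ev: "E \<bullet> v = \<omega> * (DV v \<bullet> P) - \<theta> * (g \<bullet> v)" for v
   using first[of v] X(2)[of \<xi> v] by (simp add: E_def \<xi>_def \<theta>_def inner_commute)
  define a where "a = E + \<theta> *\<^sub>R g"
  have na: "norm a <= \<nu> * M"
  proof (cases "a = 0")
   case False
   have "a \<bullet> a = \<omega> * (DV a \<bullet> P)" using Ev[of a] by (simp add: a_def inner_add_left)
   also have "... <= \<omega> * (norm (DV a) * norm P)" using norm_cauchy_schwarz[of "DV a" P] \<omega> by (intro mult_left_mono) auto
   also have "... <= \<nu> * (M * norm a * 1)" using \<omega> DV[of a] P M by (intro mult_mono) auto
   finally have "norm a * norm a <= (\<nu> * M) * norm a" by (simp add: power2_norm_eq_inner[symmetric] power2_eq_square)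
   then show ?thesis using False by simp
  qed (use \<nu> M in auto)
  have nE: "norm E <= \<theta> * norm g + \<nu> * M"
  proof -
   have "norm E = norm (a - \<theta> *\<^sub>R g)" by (simp add: a_def)
   also have "... <= norm a + norm (\<theta> *\<^sub>R g)" by (rule norm_triangle_ineq4)
   finally show ?thesis using na \<theta>2 by simp
  qed
  have nE3: "norm E <= 3 * M"
  proof -
   have "\<theta> * norm g <= 2 * M" using \<theta>2 g by (intro mult_mono) auto
   then show ?thesis using nE sM M by linarith
  qed
  define b where "b = k - E"
  have nb: "norm b <= \<nu> * M * F"
  proof -
   have "b = X (P - \<xi>)" by (simp add: b_def k_def E_def linear_diff[OF X(1)])
   then have "norm b <= F * norm (P - \<xi>)" using XF by simp
   also have "... <= F * (\<nu> * M)" using n\<xi>(2) F by (intro mult_left_mono) (auto simp: norm_minus_commute)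
   finally show ?thesis by (simp add: mult_ac)
  qed
  define \<beta> where "\<beta> = 1 - P \<bullet> P"
  have PP: "P \<bullet> P <= 1" using P(1) by (simp add: power2_norm_eq_inner[symmetric] power_le_one)
  have \<beta>: "0 <= \<beta>" "\<beta> <= \<nu>" using PP P(2) by (auto simp: \<beta>_def)
  define l where "l = norm P"
  have l2: "l\<^sup>2 = 1 - \<beta>" by (simp add: l_def \<beta>_def power2_norm_eq_inner)
  have l2h: "l\<^sup>2 \<ge> 1 / 2" using l2 \<beta> \<nu>1 by linarith
  have lpos: "l > 0" using l2h by (metis l_def norm_ge_zero less_eq_real_def power_zero_numeral zero_less_divide_1_iff zero_less_numeral not_le)
  define e where "e = (1 / l) *\<^sub>R P"
  have ne: "norm e = 1" using lpos by (simp add: e_def l_def)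
  have Pe: "P = l *\<^sub>R e" using lpos by (simp add: e_def)
  define y where "y = X e"
  have ky: "k = l *\<^sub>R y" by (simp add: k_def y_def Pe linear_cmul[OF X(1)])
  define S2 where "S2 = frob_sq X - 2 * (y \<bullet> y) + (y \<bullet> e)\<^sup>2"
  have ye: "(y \<bullet> e)\<^sup>2 <= y \<bullet> y" using Cauchy_Schwarz_ineq[of y e] ne by (simp add: norm_eq_1)
  have kk: "k \<bullet> k = l\<^sup>2 * (y \<bullet> y)" by (simp add: ky power2_eq_square)
  have yy: "y \<bullet> y <= 2 * (k \<bullet> k)"
   using mult_right_mono[OF l2h, of "y \<bullet> y"] kk by simp
  have ck: "k \<bullet> k <= 18 * M\<^sup>2 + 2 * (\<nu> * M * F)\<^sup>2"
  proof -
   have "norm k <= norm E + norm b" unfolding b_def by (metis add.commute diff_add_cancel norm_triangle_ineq)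
   then have "norm k <= 3 * M + \<nu> * M * F" using nE3 nb by linarith
   then have "(norm k)\<^sup>2 <= (3 * M + \<nu> * M * F)\<^sup>2" by (intro power_mono) auto
   also have "... <= 2 * (3 * M)\<^sup>2 + 2 * (\<nu> * M * F)\<^sup>2"
    using sum_squares_bound[of "3 * M" "\<nu> * M * F"] by (simp add: power2_sum)
   finally show ?thesis by (simp add: power2_norm_eq_inner power_mult_distrib)
  qed
  have F2: "F\<^sup>2 <= 2 * S2 + 144 * M\<^sup>2"
  proof -
   have "F\<^sup>2 <= S2 + 2 * (y \<bullet> y)" using F(2) by (simp add: S2_def)
   also have "... <= S2 + 72 * M\<^sup>2 + 8 * (\<nu> * M * F)\<^sup>2" using yy ck by linarith
   finally have 1: "F\<^sup>2 <= S2 + 72 * M\<^sup>2 + 8 * ((\<nu> * M)\<^sup>2 * F\<^sup>2)" by (simp add: power_mult_distrib)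
   have "(\<nu> * M)\<^sup>2 <= (1 / 16)\<^sup>2" using sM \<nu> M by (intro power_mono) auto
   then have "(\<nu> * M)\<^sup>2 * F\<^sup>2 <= (1 / 16) * F\<^sup>2" by (intro mult_right_mono) (auto simp: power2_eq_square)
   then show ?thesis using 1 by simp
  qed
  have S2k: "frob_sq X - k \<bullet> k \<ge> S2 + aform P k k"
  proof -
   have "P \<bullet> k = l\<^sup>2 * (y \<bullet> e)" by (simp add: ky Pe power2_eq_square inner_commute)
   then have "frob_sq X - k \<bullet> k - aform P k k - S2 = 2 * (y \<bullet> y) - 2 * (l\<^sup>2 * (y \<bullet> y)) - (y \<bullet> e)\<^sup>2 + (l\<^sup>2)\<^sup>2 * (y \<bullet> e)\<^sup>2"
    by (simp add: aform_def S2_def kk power2_eq_square algebra_simps)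
   also have "... = 2 * \<beta> * (y \<bullet> y) - \<beta> * (2 - \<beta>) * (y \<bullet> e)\<^sup>2"
    unfolding l2 by (simp add: power2_eq_square algebra_simps)
   also have "... \<ge> 0"
   proof -
    have "\<beta> * (2 - \<beta>) * (y \<bullet> e)\<^sup>2 <= \<beta> * 2 * (y \<bullet> y)"
     using \<beta> ye \<nu>1 by (intro mult_mono) auto
    then show ?thesis by simp
   qed
   finally show ?thesis by simp
  qed
  have TD: "(\<Sum>b\<in>Basis. DV b \<bullet> X b) - DV P \<bullet> X P <= (N + 1) * M * F"
  proof -
   have one: "\<bar>DV v \<bullet> X v\<bar> <= M * F" if "norm v <= 1" for v
   proof -
    have "norm (DV v) <= M" using DV[of v] that M by (metis mult.right_neutral mult_left_mono order_trans zero_le_one)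
    moreover have "norm (X v) <= F" using XF[of v] that F by (metis mult.right_neutral mult_left_mono order_trans)
    ultimately show ?thesis using Cauchy_Schwarz_ineq2[of "DV v" "X v"] M
     by (meson mult_mono norm_ge_zero order_trans zero_le_one)
   qed
   have "(\<Sum>b\<in>Basis. DV b \<bullet> X b) <= (\<Sum>b\<in>(Basis::'a set). M * F)"
    using one by (intro sum_mono) (simp add: abs_le_iff)
   also have "... = N * M * F" by (simp add: N_def)
   finally show ?thesis using one[OF P(1)] by (simp add: abs_le_iff algebra_simps)
  qed
  have quad: "- 2 * aform P k E - q * aform P k k + (1 + q) * \<theta> * aform P g g
    <= \<nu> * (4 * (2 + q) * M\<^sup>2) + \<nu> * (6 * (1 + q) * M\<^sup>2) * F"
  proof -
   have kE: "k = E + b" by (simp add: b_def)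
   have A: "aform P k E = aform P E E + aform P b E" "aform P k k = aform P E E + 2 * aform P b E + aform P b b"
    unfolding kE using aform_add[of P E b E b]
    by (simp_all add: aform_commute[of P E b]) (simp add: aform_def inner_add_left inner_add_right algebra_simps)
   have gE: "E = a + (- \<theta>) *\<^sub>R g" by (simp add: a_def)
   have B: "aform P E E = aform P a a - 2 * \<theta> * aform P g a + \<theta>\<^sup>2 * aform P g g"
    unfolding gE aform_add aform_scaleR by (simp add: aform_commute[of P a g] power2_eq_square)
   have n: "aform P b b \<ge> 0" "aform P a a \<ge> 0" "aform P g g \<ge> 0" using aform_nonneg[OF P(1)] by auto
   have ga: "2 * \<theta> * aform P g a <= 4 * M * (\<nu> * M)"
   proof -
    have "aform P g a <= norm g * norm a" using aform_le[OF P(1), of g a] by (simp add: abs_le_iff)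
    also have "... <= M * (\<nu> * M)" using g na M by (intro mult_mono) auto
    finally have "2 * \<theta> * aform P g a <= 2 * \<theta> * (M * (\<nu> * M))" using \<theta>2 by (intro mult_left_mono) auto
    also have "... <= 4 * (M * (\<nu> * M))" using \<theta>2 M \<nu> by (intro mult_right_mono) auto
    finally show ?thesis by simp
   qed
   have bE: "- aform P b E <= \<nu> * M * F * (3 * M)"
   proof -
    have "- aform P b E <= norm b * norm E" using aform_le[OF P(1), of b E] by (simp add: abs_le_iff)
    also have "... <= \<nu> * M * F * (3 * M)" using nb nE3 \<nu> M F by (intro mult_mono) auto
    finally show ?thesis .
   qed
   have "- 2 * aform P k E - q * aform P k k + (1 + q) * \<theta> * aform P g g
     = - (2 + q) * aform P E E + (2 * (1 + q)) * (- aform P b E) - q * aform P b b + (1 + q) * \<theta> * aform P g g"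
    unfolding A by (simp add: algebra_simps)
   also have "... <= - (2 + q) * (\<theta>\<^sup>2 * aform P g g - 4 * M * (\<nu> * M)) + (2 * (1 + q)) * (\<nu> * M * F * (3 * M)) - 0 + (1 + q) * \<theta> * aform P g g"
   proof (intro add_mono diff_mono)
    have "(2 + q) * aform P E E \<ge> (2 + q) * (\<theta>\<^sup>2 * aform P g g - 4 * M * (\<nu> * M))"
     by (intro mult_left_mono) (use B n ga q in linarith)+
    then show "- (2 + q) * aform P E E <= - (2 + q) * (\<theta>\<^sup>2 * aform P g g - 4 * M * (\<nu> * M))" by (simp add: algebra_simps)
    show "2 * (1 + q) * - aform P b E <= 2 * (1 + q) * (\<nu> * M * F * (3 * M))" using bE q by (intro mult_left_mono) auto
   qed (use n q in auto)
   also have "... = \<theta> * ((1 + q) - (2 + q) * \<theta>) * aform P g g + \<nu> * (4 * (2 + q) * M\<^sup>2) + \<nu> * (6 * (1 + q) * M\<^sup>2) * F"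
    by (simp add: power2_eq_square algebra_simps)
   also have "... <= 0 + \<nu> * (4 * (2 + q) * M\<^sup>2) + \<nu> * (6 * (1 + q) * M\<^sup>2) * F"
    using \<theta>q \<theta>2 n by (intro add_mono mult_nonpos_nonneg mult_nonneg_nonpos) auto
   finally show ?thesis by simp
  qed
  have r1: "\<xi> \<bullet> Dc <= norm Dc + \<nu> * M\<^sup>2"
  proof -
   have "\<xi> \<bullet> Dc <= norm \<xi> * norm Dc" by (rule norm_cauchy_schwarz)
   also have "... <= (1 + \<nu> * M) * norm Dc" using n\<xi> by (intro mult_right_mono) auto
   also have "... <= norm Dc + \<nu> * M * M" using Dc \<nu> M by (simp add: distrib_right mult_left_mono)
   finally show ?thesis by (simp add: power2_eq_square mult.assoc)
  qed
  have r2: "z * (\<xi> \<bullet> P) <= 0"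
  proof -
   have "\<xi> \<bullet> P = P \<bullet> P - \<omega> * (P \<bullet> V)" by (simp add: \<xi>_def inner_diff_left inner_commute[of V P])
   moreover have "\<omega> * (P \<bullet> V) <= \<nu> * M" using PV \<omega> M by (meson abs_le_D1 mult_left_mono mult_right_mono order_trans zero_le_one)
   ultimately have "\<xi> \<bullet> P \<ge> 0" using l2h l2 sM by (simp add: \<beta>_def)
   then show ?thesis using z by (simp add: mult_nonpos_nonneg)
  qed
  have r3: "c * (\<xi> \<bullet> X P) <= \<bar>c\<bar> * norm g + \<nu> * ((1 + q) * M ^ 3 + M\<^sup>2)"
  proof -
   have "\<xi> \<bullet> X P = E \<bullet> P" using X(2)[of P \<xi>] by (simp add: E_def inner_commute)
   then have cE: "c * (\<xi> \<bullet> X P) <= \<bar>c\<bar> * \<bar>E \<bullet> P\<bar>" by (metis abs_ge_self abs_mult)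
   have "\<bar>E \<bullet> P\<bar> <= norm E"
    using Cauchy_Schwarz_ineq2[of E P] P(1) by (metis mult.right_neutral mult_left_mono norm_ge_zero order_trans)
   then have "\<bar>c\<bar> * \<bar>E \<bullet> P\<bar> <= \<bar>c\<bar> * (\<theta> * norm g + \<nu> * M)" using nE by (intro mult_left_mono) auto
   also have "... = \<bar>c\<bar> * norm g + \<bar>c\<bar> * ((\<theta> - 1) * norm g) + \<bar>c\<bar> * (\<nu> * M)" by (simp add: algebra_simps)
   also have "... <= \<bar>c\<bar> * norm g + M * (((1 + q) * (\<nu> * M)) * M) + M * (\<nu> * M)"
   proof (intro add_mono order_refl)
    have "\<bar>c\<bar> * ((\<theta> - 1) * norm g) <= \<bar>c\<bar> * (((1 + q) * (\<nu> * M)) * M)"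
    proof (intro mult_left_mono)
     have "(\<theta> - 1) * norm g <= ((1 + q) * (\<nu> * M)) * norm g" using \<theta>1 by (intro mult_right_mono) (auto simp: abs_le_iff)
     also have "... <= ((1 + q) * (\<nu> * M)) * M" using g q \<nu> M by (intro mult_left_mono) auto
     finally show "(\<theta> - 1) * norm g <= (1 + q) * (\<nu> * M) * M" .
    qed simp
    also have "... <= M * (((1 + q) * (\<nu> * M)) * M)" using c q \<nu> M by (intro mult_right_mono) auto
    finally show "\<bar>c\<bar> * ((\<theta> - 1) * norm g) <= M * ((1 + q) * (\<nu> * M) * M)" .
    show "\<bar>c\<bar> * (\<nu> * M) <= M * (\<nu> * M)" using c \<nu> M by (intro mult_right_mono) auto
   qed
   finally show ?thesis using cE by (simp add: power2_eq_square power3_eq_cube algebra_simps)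
  qed
  have r4: "- \<iota> * (\<xi> \<bullet> Df) <= \<nu> * (2 * M)"
  proof -
   have "\<bar>\<xi> \<bullet> Df\<bar> <= norm \<xi> * norm Df" by (rule Cauchy_Schwarz_ineq2)
   also have "... <= 2 * M" using n\<xi>(1) sM Df by (intro mult_mono) auto
   finally have "\<iota> * \<bar>\<xi> \<bullet> Df\<bar> <= \<nu> * (2 * M)" using \<iota> by (intro mult_mono) auto
   moreover have "- \<iota> * (\<xi> \<bullet> Df) <= \<iota> * \<bar>\<xi> \<bullet> Df\<bar>" using \<iota> by (metis abs_ge_minus_self mult_left_mono mult_minus_left mult_minus_right)
   ultimately show ?thesis by linarith
  qed
  have r5: "2 * \<omega> * ((\<Sum>b\<in>Basis. DV b \<bullet> X b) - DV P \<bullet> X P) <= \<nu> * (2 * (N + 1) * M) * F"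
  proof -
   have "2 * \<omega> * ((\<Sum>b\<in>Basis. DV b \<bullet> X b) - DV P \<bullet> X P) <= 2 * \<omega> * ((N + 1) * M * F)"
    using TD \<omega> by (intro mult_left_mono) auto
   also have "... <= 2 * \<nu> * ((N + 1) * M * F)" using \<omega> N1 M F by (intro mult_right_mono) auto
   finally show ?thesis by (simp add: mult_ac)
  qed
  have r6: "\<omega> * D2 <= \<nu> * M" using D2 \<omega> M by (meson abs_le_D1 mult_left_mono mult_right_mono order_trans zero_le_one)
  have r7: "- \<theta> * G <= \<bar>G\<bar> + \<nu> * ((1 + q) * M\<^sup>2)"
  proof -
   have "- \<theta> * G = - G - (\<theta> - 1) * G" by (simp add: algebra_simps)
   also have "... <= \<bar>G\<bar> + \<bar>\<theta> - 1\<bar> * \<bar>G\<bar>" by (metis abs_ge_minus_self abs_mult add_mono diff_conv_add_uminus)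
   also have "... <= \<bar>G\<bar> + (1 + q) * (\<nu> * M) * M" using \<theta>1 G q \<nu> M by (intro add_mono mult_mono) auto
   finally show ?thesis by (simp add: power2_eq_square mult_ac)
  qed
  have main: "S2 <= norm Dc + \<bar>c\<bar> * norm g + \<bar>G\<bar> + \<nu> * (C1 + C2 * F)"
  proof -
   have "\<theta> * (G - (1 + q) * aform P g g) <= - 2 * aform P k E - (S2 + aform P k k) - (q - 1) * aform P k k
     + \<xi> \<bullet> Dc + z * (\<xi> \<bullet> P) + c * (\<xi> \<bullet> X P) - \<iota> * (\<xi> \<bullet> Df)
     + 2 * \<omega> * ((\<Sum>b\<in>Basis. DV b \<bullet> X b) - DV P \<bullet> X P) + \<omega> * D2"
    using second S2k unfolding \<theta>_def k_def E_def \<xi>_def by linarith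
   then have "S2 <= (- 2 * aform P k E - q * aform P k k + (1 + q) * \<theta> * aform P g g) - \<theta> * G
     + \<xi> \<bullet> Dc + z * (\<xi> \<bullet> P) + c * (\<xi> \<bullet> X P) - \<iota> * (\<xi> \<bullet> Df)
     + 2 * \<omega> * ((\<Sum>b\<in>Basis. DV b \<bullet> X b) - DV P \<bullet> X P) + \<omega> * D2"
    by (simp add: algebra_simps)
   also have "... <= (\<nu> * (4 * (2 + q) * M\<^sup>2) + \<nu> * (6 * (1 + q) * M\<^sup>2) * F) + (\<bar>G\<bar> + \<nu> * ((1 + q) * M\<^sup>2))
     + (norm Dc + \<nu> * M\<^sup>2) + 0 + (\<bar>c\<bar> * norm g + \<nu> * ((1 + q) * M ^ 3 + M\<^sup>2)) + \<nu> * (2 * M)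
     + \<nu> * (2 * (N + 1) * M) * F + \<nu> * M"
    using quad r1 r2 r3 r4 r5 r6 r7 by linarith
   also have "... = norm Dc + \<bar>c\<bar> * norm g + \<bar>G\<bar> + \<nu> * (C1 + C2 * F)"
    by (simp add: C1_def C2_def algebra_simps)
   finally show ?thesis .
  qed
  have FC4: "F <= C4"
  proof -
   have F1: "F <= 1 + F\<^sup>2" using sum_squares_bound[of F 1] F(1) by simp
   have "S2 <= M + M\<^sup>2 + M + \<nu> * C1 + \<nu> * C2 * F"
   proof -
    have "\<bar>c\<bar> * norm g <= M\<^sup>2" unfolding power2_eq_square using c g M by (intro mult_mono) auto
    then show ?thesis using main Dc G by (simp add: distrib_left mult.assoc)
   qed
   also have "... <= M + M\<^sup>2 + M + C1 + \<nu> * C2 * (1 + (2 * S2 + 144 * M\<^sup>2))"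
   proof -
    have "\<nu> * C1 <= C1" using \<nu>1 \<nu> C1 by (simp add: mult_left_le_one_le)
    moreover have "\<nu> * C2 * F <= \<nu> * C2 * (1 + (2 * S2 + 144 * M\<^sup>2))" using F1 F2 \<nu> C2 by (intro mult_left_mono) auto
    ultimately show ?thesis by linarith
   qed
   also have "... = M + M\<^sup>2 + M + C1 + \<nu> * (C2 * (1 + 144 * M\<^sup>2)) + (2 * \<nu> * C2) * S2" by (simp add: algebra_simps)
   also have "... <= M + M\<^sup>2 + M + C1 + C2 * (1 + 144 * M\<^sup>2) + (2 * \<nu> * C2) * S2"
    using \<nu>1 \<nu> C2 by (simp add: mult_left_le_one_le)
   finally have st: "S2 <= M + M\<^sup>2 + M + C1 + C2 * (1 + 144 * M\<^sup>2) + (2 * \<nu> * C2) * S2" .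
   have "S2 <= C3"
   proof (cases "S2 \<ge> 0")
    case True
    then have "(2 * \<nu> * C2) * S2 <= 1 / 2 * S2" using sC2 by (intro mult_right_mono)
    then show ?thesis using st by (simp add: C3_def)
   qed (use C3 in linarith)
   then show ?thesis using F1 F2 by (simp add: C4_def)
  qed
  define \<tau> where "\<tau> = (\<Sum>b\<in>Basis. X b \<bullet> b) - y \<bullet> e"
  have \<tau>: "\<bar>\<tau> + c\<bar> <= \<nu> * (M + C4)"
  proof -
   have "P \<bullet> X P = l\<^sup>2 * (y \<bullet> e)" unfolding k_def[symmetric] by (simp add: ky Pe power2_eq_square inner_commute)
   then have "\<tau> + c = \<epsilon> - \<beta> * (y \<bullet> e)" using tr unfolding \<tau>_def l2 by (simp add: algebra_simps)
   then have "\<bar>\<tau> + c\<bar> <= \<bar>\<epsilon>\<bar> + \<beta> * \<bar>y \<bullet> e\<bar>" using \<beta> by (metis abs_mult abs_of_nonneg abs_triangle_ineq4)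
   moreover have "\<bar>y \<bullet> e\<bar> <= F" using Cauchy_Schwarz_ineq2[of y e] XF[of e] ne by (simp add: y_def)
   then have "\<beta> * \<bar>y \<bullet> e\<bar> <= \<nu> * C4" using \<beta> FC4 \<nu> by (intro mult_mono) auto
   ultimately show ?thesis using \<epsilon> by (simp add: algebra_simps)
  qed
  have "\<tau>\<^sup>2 <= (N - 1) * S2"
   using tangential_trace_bound[OF X ne] by (simp add: \<tau>_def N_def S2_def y_def)
  moreover have "c\<^sup>2 <= \<tau>\<^sup>2 + 2 * M * (\<nu> * (M + C4))"
  proof -
   have "\<tau>\<^sup>2 = c\<^sup>2 - 2 * (c * (\<tau> + c)) + (\<tau> + c)\<^sup>2" by (simp add: power2_eq_square algebra_simps)
   moreover have "c * (\<tau> + c) <= M * (\<nu> * (M + C4))"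
   proof -
    have "c * (\<tau> + c) <= \<bar>c\<bar> * \<bar>\<tau> + c\<bar>" by (metis abs_ge_self abs_mult)
    also have "... <= M * (\<nu> * (M + C4))" using c \<tau> M by (intro mult_mono) auto
    finally show ?thesis .
   qed
   ultimately show ?thesis using zero_le_power2[of "\<tau> + c"] by linarith
  qed
  ultimately have c2: "c\<^sup>2 <= (N - 1) * S2 + 2 * M * (\<nu> * (M + C4))" by linarith
  have N2: "N - 1 \<ge> 1" using dim by (simp add: N_def)
  have "2 * M * (\<nu> * (M + C4)) \<ge> 0" using M \<nu> C4 by simp
  from mult_right_mono[OF N2 this] have "2 * M * (\<nu> * (M + C4)) <= (N - 1) * (2 * M * (\<nu> * (M + C4)))" by simp
  then have "c\<^sup>2 <= (N - 1) * (S2 + 2 * M * (\<nu> * (M + C4)))" using c2 by (simp add: distrib_left)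
  then have "c\<^sup>2 / (N - 1) <= S2 + 2 * M * (\<nu> * (M + C4))" using N2 by (simp add: pos_divide_le_eq mult.commute)
  also have "... <= norm Dc + \<bar>c\<bar> * norm g + \<bar>G\<bar> + \<nu> * (C1 + C2 * C4) + 2 * M * (\<nu> * (M + C4))"
  proof -
   have "\<nu> * (C1 + C2 * F) <= \<nu> * (C1 + C2 * C4)" using FC4 \<nu> C2 by (intro mult_left_mono add_left_mono) auto
   then show ?thesis using main by linarith
  qed
  also have "... = norm Dc + \<bar>c\<bar> * norm g + \<bar>G\<bar> + K * \<nu>" by (simp add: K_def algebra_simps)
  finally show "c\<^sup>2 / (real DIM('a) - 1) <= norm Dc + \<bar>c\<bar> * norm g + \<bar>G\<bar> + K * \<nu>" by (simp add: N_def)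
 qed
 then show ?thesis using that \<nu>0 K by blast
qed

section \<open>The auxiliary function and the gradient bound\<close>

text \<open>The field \<open>V\<close> extends \<open>\<phi> n\<close>, so that \<open>V \<bullet> Du\<close> equals \<open>\<phi>\<^sup>2 W powr (1 - q)\<close> on the boundary. The factor \<open>DIM('a) + 1\<close> bounds the contraction
 of second derivatives of \<open>V\<close> with the coefficients of the operator by \<open>M\<close>.\<close>

locale boundary_field = flow_domain \<Omega> n for \<Omega> :: "'a::euclidean_space set" and n +
 fixes \<phi> :: "'a => real" and N V :: "'a => 'a" and DV :: "'a => 'a => 'a" and D2V :: "'a => 'a => 'a => 'a"
  and \<phi>' :: "'a => 'a" and LN :: "'a => 'a => 'a" and M :: real
 assumes V: "\<And>x. x \<in> closure \<Omega> ==> (V has_derivative DV x) (at x within closure \<Omega>)"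
  and V_normal: "\<And>y. y \<in> frontier \<Omega> ==> V y = \<phi> y *\<^sub>R n y"
  and D2V: "\<And>x v. x \<in> \<Omega> ==> ((%y. DV y v) has_derivative D2V x v) (at x)"
  and D2V_linear: "\<And>x w. x \<in> \<Omega> ==> linear (%v. D2V x v w)"
  and V_bounds: "\<And>x. x \<in> closure \<Omega> ==> norm (V x) <= M" "\<And>x v. x \<in> closure \<Omega> ==> norm (DV x v) <= M * norm v"
   "\<And>x v w. x \<in> \<Omega> ==> (real DIM('a) + 1) * norm (D2V x v w) <= M * norm v * norm w"
  and LN: "\<And>y. y \<in> frontier \<Omega> ==> (N has_derivative LN y) (at y within closure \<Omega>)"
  and \<phi>': "\<And>y. y \<in> frontier \<Omega> ==> (\<phi> has_derivative (%v. \<phi>' y \<bullet> v)) (at y within closure \<Omega>)"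
   "\<And>y. y \<in> frontier \<Omega> ==> \<bar>\<phi> y\<bar> <= M" "\<And>y. y \<in> frontier \<Omega> ==> norm (\<phi>' y) <= M"

text \<open>The estimates see the speed bound \<open>K\<close> only through \<open>M\<close>: speed and \<open>f\<close> together form one bounded term of the equation.\<close>

locale capillary_flow = forced_flow \<Omega> n T u Du H ut D3 Dut h h' Lh N \<kappa>0 c f cx fx cz fz \<phi> q \<eta> C +
  boundary_field \<Omega> n \<phi> N V DV D2V \<phi>' LN M
 for \<Omega> :: "'a::euclidean_space set" and n T u Du H ut D3 Dut h h' Lh N \<kappa>0 c f cx fx cz fz \<phi> q \<eta> C V DV D2V \<phi>' LN M +
 fixes K :: real
 assumes ut_bound: "\<And>x t. x \<in> closure \<Omega> ==> t \<in> {0..<T} ==> \<bar>ut x t\<bar> <= K"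
  and M: "M \<ge> 1" "\<bar>C\<bar> <= M" "K + \<bar>C\<bar> <= M"
begin

text \<open>On the boundary the gradient of \<open>w powr (1 + q) / (1 + q) - V \<bullet> p\<close> in \<open>p\<close> is \<open>w powr (q - 1)\<close> times the tangential gradient, by the boundary
 condition. Thus the normal derivative of the auxiliary function contains mixed second derivatives of \<open>u\<close> but no second normal
 derivative, which the boundary condition does not control.\<close>

definition aux :: "'a => real => real" where
 "aux x t = W \<eta> (Du x t) powr (1 + q) - (1 + q) * (V x \<bullet> Du x t)"

definition aux' :: "'a => real => 'a => real" where
 "aux' x t v = (1 + q) * (W \<eta> (Du x t) powr (q - 1) * (Du x t \<bullet> H x t v) - (V x \<bullet> H x t v + DV x v \<bullet> Du x t))"

lemma W_powr_derivative:
 assumes "(p has_derivative p') (at x within S)"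
 shows "((%x. W \<eta> (p x) powr a) has_derivative (%v. a * W \<eta> (p x) powr (a - 2) * (p x \<bullet> p' v))) (at x within S)"
proof -
 let ?w = "W \<eta> (p x)"
 have w: "?w > 0" by (rule W_pos[OF \<eta>(1)])
 have D: "((%r. r powr a) has_real_derivative a * ?w powr (a - 1)) (at ?w)"
  using w by (auto intro!: derivative_eq_intros)
 have "((%x. W \<eta> (p x) powr a) has_derivative (%v. (p x \<bullet> p' v) / ?w * (a * ?w powr (a - 1)))) (at x within S)"
  by (rule DERIV_compose_FDERIV[where f = "%r. r powr a" and g = "%x. W \<eta> (p x)", OF D W_derivative[OF \<eta>(1) assms]])
 moreover have "?w powr (a - 1) = ?w powr (a - 2) * ?w"
 proof -
  have "?w powr (a - 1) = ?w powr (a - 2) * ?w powr 1" using powr_add[of ?w "a - 2" 1] by simp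
  then show ?thesis using w by simp
 qed
 then have "(p x \<bullet> p' v) / ?w * (a * ?w powr (a - 1)) = a * ?w powr (a - 2) * (p x \<bullet> p' v)" for v using w by simp
 ultimately show ?thesis by (simp only:)
qed

lemma aux_derivative:
 assumes x: "x \<in> closure \<Omega>" and t: "t \<in> {0..T}"
 shows "((%y. aux y t) has_derivative aux' x t) (at x within closure \<Omega>)"
proof -
 have 1: "((%y. W \<eta> (Du y t) powr (1 + q)) has_derivative (%v. (1 + q) * W \<eta> (Du x t) powr (1 + q - 2) * (Du x t \<bullet> H x t v))) (at x within closure \<Omega>)"
  by (rule W_powr_derivative[OF H[OF x t]])
 have 2: "((%y. (1 + q) * (V y \<bullet> Du y t)) has_derivative (%v. (1 + q) * (V x \<bullet> H x t v + DV x v \<bullet> Du x t))) (at x within closure \<Omega>)"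
  by (rule has_derivative_mult_right[OF has_derivative_inner[OF V[OF x] H[OF x t]]])
 have "1 + q - 2 = q - 1" by simp
 then have "((%y. aux y t) has_derivative (%v. (1 + q) * W \<eta> (Du x t) powr (q - 1) * (Du x t \<bullet> H x t v)
   - (1 + q) * (V x \<bullet> H x t v + DV x v \<bullet> Du x t))) (at x within closure \<Omega>)"
  using has_derivative_diff[OF 1 2] unfolding aux_def by simp
 moreover have "(%v. (1 + q) * W \<eta> (Du x t) powr (q - 1) * (Du x t \<bullet> H x t v) - (1 + q) * (V x \<bullet> H x t v + DV x v \<bullet> Du x t)) = aux' x t"
  by (simp add: fun_eq_iff aux'_def right_diff_distrib mult.assoc)
 ultimately show ?thesis by simp
qed

lemma aux_continuous: "continuous_on (closure \<Omega> \<times> {0..T}) (%z. aux (fst z) (snd z))"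
proof -
 have Vc: "continuous_on (closure \<Omega>) V"
  unfolding continuous_on_eq_continuous_within using V has_derivative_continuous by blast
 have "continuous_on (closure \<Omega> \<times> {0..T}) (%z. V (fst z))"
  by (rule continuous_on_compose2[OF Vc continuous_on_fst[OF continuous_on_id]]) auto
 moreover have "continuous_on (closure \<Omega> \<times> {0..T}) (%z. W \<eta> (Du (fst z) (snd z)) powr (1 + q))"
  unfolding W_def using Du_continuous \<eta>(1)
  by (intro continuous_intros continuous_on_powr) (auto simp: add_pos_nonneg)
 ultimately show ?thesis unfolding aux_def using Du_continuous
  by (intro continuous_on_diff continuous_on_mult continuous_on_inner continuous_on_const)
qed

text \<open>It vanishes on the sphere of radius \<open>r\<close> around \<open>z\<close> and grows there along the inward normal at the rate
 \<open>(1 + q) k\<close>, the bound for the logarithmic normal derivative of the auxiliary function at a boundary maximum.\<close>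

definition weight :: "real => real => 'a => 'a => real" where
 "weight k r z x = (1 + q) * (k / (2 * r) * (r\<^sup>2 - (x - z) \<bullet> (x - z)))"

lemma weight_derivative:
 assumes "r > 0"
 shows "(weight k r z has_derivative (%v. - ((1 + q) * (k / r) * ((x - z) \<bullet> v)))) (at x within S)"
proof -
 have "((%x. (x - z) \<bullet> (x - z)) has_derivative (%v. (x - z) \<bullet> v + v \<bullet> (x - z))) (at x within S)"
  by (auto intro!: derivative_eq_intros)
 from has_derivative_mult_right[OF has_derivative_mult_right[OF has_derivative_diff[OF has_derivative_const[of "r\<^sup>2"] this], of "k / (2 * r)"], of "1 + q"]
 have "(weight k r z has_derivative (%v. (1 + q) * (k / (2 * r) * (0 - ((x - z) \<bullet> v + v \<bullet> (x - z)))))) (at x within S)"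
  unfolding weight_def[abs_def] .
 moreover have "(1 + q) * (k / (2 * r) * (0 - ((x - z) \<bullet> v + v \<bullet> (x - z)))) = - ((1 + q) * (k / r) * ((x - z) \<bullet> v))" for v
  using assms by (simp add: inner_commute[of v] field_simps)
 ultimately show ?thesis by (simp only:)
qed

text \<open>The ordinary conditions on a line. Dividing by the weight and inserting the first order condition into the second removes the
 weight from the formulas, except for the derivatives of its exponent.\<close>

lemma weighted_maximum_conditions:
 assumes S: "open S" "S \<subseteq> \<Omega>" "x1 \<in> S" and t: "t1 \<in> {0<..<T}" and r: "r > 0"
  and mx: "\<And>x. x \<in> S ==> aux x t1 * exp (weight k r z x) <= aux x1 t1 * exp (weight k r z x1)"
 shows "aux' x1 t1 v = aux x1 t1 * ((1 + q) * (k / r) * ((x1 - z) \<bullet> v))"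
  and "(1 + q) * ((q - 1) * W \<eta> (Du x1 t1) powr (q - 3) * (Du x1 t1 \<bullet> H x1 t1 v) * (Du x1 t1 \<bullet> H x1 t1 v)
    + W \<eta> (Du x1 t1) powr (q - 1) * (H x1 t1 v \<bullet> H x1 t1 v + Du x1 t1 \<bullet> D3 x1 t1 v v)
    - (V x1 \<bullet> D3 x1 t1 v v + DV x1 v \<bullet> H x1 t1 v + DV x1 v \<bullet> H x1 t1 v + D2V x1 v v \<bullet> Du x1 t1))
   - aux x1 t1 * ((1 + q) * (k / r) * ((x1 - z) \<bullet> v)) * ((1 + q) * (k / r) * ((x1 - z) \<bullet> v))
   - aux x1 t1 * ((1 + q) * (k / r)) * (v \<bullet> v) <= 0"
proof -
 have t': "t1 \<in> {0..T}" using t by auto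
 have x1: "x1 \<in> \<Omega>" using S by blast
 define X where "X s = x1 + s *\<^sub>R v" for s
 obtain e where e: "e > 0" and inS: "\<And>s. \<bar>s\<bar> < e ==> X s \<in> S"
  unfolding X_def by (rule segment_in_open[OF S(1,3)]) blast
 have line: "((%s. F (X s)) has_vector_derivative F' v) (at s)"
  if "(F has_derivative F') (at (X s))" for F :: "'a => 'b::real_normed_vector" and F' s
  using that unfolding X_def by (rule has_vector_derivative_along_line)
 have liner: "((%s. F (X s)) has_real_derivative F' v) (at s)"
  if "(F has_derivative F') (at (X s))" for F :: "'a => real" and F' s
  using line[OF that] by (simp add: has_real_derivative_iff_has_vector_derivative)
 define g where "g s = - ((1 + q) * (k / r) * ((X s - z) \<bullet> v))" for s
 define B where "B s = aux' (X s) t1 v + aux (X s) t1 * g s" for s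
 define \<psi> where "\<psi> s = aux (X s) t1 * exp (weight k r z (X s))" for s
 have daux: "((%s. aux (X s) t1) has_real_derivative aux' (X s) t1 v) (at s)" if "\<bar>s\<bar> < e" for s
 proof (rule liner)
  have "X s \<in> \<Omega>" using inS[OF that] S by blast
  then show "((%y. aux y t1) has_derivative aux' (X s) t1) (at (X s))"
   using aux_derivative[of "X s" t1] t' at_within_interior_point closure_cases by simp
 qed
 have dexp: "((%s. exp (weight k r z (X s))) has_real_derivative g s * exp (weight k r z (X s))) (at s)" for s
 proof -
  have "((%s. weight k r z (X s)) has_real_derivative g s) (at s)"
   using liner[OF weight_derivative[OF r]] by (simp add: g_def)
  then show ?thesis by (auto intro!: derivative_eq_intros)
 qed
 have d\<psi>: "(\<psi> has_real_derivative B s * exp (weight k r z (X s))) (at s)" if "\<bar>s\<bar> < e" for s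
  using DERIV_mult[OF daux[OF that] dexp[of s]] unfolding \<psi>_def[abs_def] B_def by (simp add: algebra_simps)
 have X0: "X 0 = x1" by (simp add: X_def)
 let ?p = "Du x1 t1" and ?H = "H x1 t1"
 let ?w = "W \<eta> (Du x1 t1)"
 have dp: "((%s. Du (X s) t1) has_vector_derivative ?H v) (at 0)"
  using line[of "%y. Du y t1" "H x1 t1" 0] H_interior[OF x1 t'] by (simp add: X0)
 have dH: "((%s. H (X s) t1 v) has_vector_derivative D3 x1 t1 v v) (at 0)"
  using line[of "%y. H y t1 v" "D3 x1 t1 v" 0] D3[OF x1 t] by (simp add: X0)
 have dV: "((%s. V (X s)) has_vector_derivative DV x1 v) (at 0)"
  using line[of V "DV x1" 0] V[of x1] x1 at_within_interior_point closure_cases by (simp add: X0)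
 have dDV: "((%s. DV (X s) v) has_vector_derivative D2V x1 v v) (at 0)"
  using line[of "%y. DV y v" "D2V x1 v" 0] D2V[OF x1] by (simp add: X0)
 have inn: "((%s. F s \<bullet> G s) has_real_derivative (F 0 \<bullet> G' + F' \<bullet> G 0)) (at 0)"
  if "(F has_vector_derivative F') (at 0)" "(G has_vector_derivative G') (at 0)" for F G :: "real => 'a" and F' G'
 proof -
  have "((%s. F s \<bullet> G s) has_derivative (%h. F 0 \<bullet> (h *\<^sub>R G') + (h *\<^sub>R F') \<bullet> G 0)) (at 0)"
   using that unfolding has_vector_derivative_def by (rule has_derivative_inner)
  moreover have "(%h. F 0 \<bullet> (h *\<^sub>R G') + (h *\<^sub>R F') \<bullet> G 0) = (%h. (F 0 \<bullet> G' + F' \<bullet> G 0) * h)"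
   by (auto simp: algebra_simps)
  ultimately show ?thesis by (simp add: has_field_derivative_def)
 qed
 have dWp: "((%s. W \<eta> (Du (X s) t1) powr (q - 1)) has_real_derivative (q - 1) * ?w powr (q - 3) * (?p \<bullet> ?H v)) (at 0)"
 proof -
  have "((%s. W \<eta> (Du (X s) t1) powr (q - 1)) has_derivative (%h. (q - 1) * ?w powr (q - 1 - 2) * (?p \<bullet> (h *\<^sub>R ?H v)))) (at 0)"
   using W_powr_derivative[OF dp[unfolded has_vector_derivative_def], of "q - 1"] by (simp add: X0)
  moreover have "(%h. (q - 1) * ?w powr (q - 1 - 2) * (?p \<bullet> (h *\<^sub>R ?H v))) = (%h. (q - 1) * ?w powr (q - 3) * (?p \<bullet> ?H v) * h)"
   by (simp add: fun_eq_iff)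
  ultimately show ?thesis unfolding has_field_derivative_def by (simp only:)
 qed
 have daux': "((%s. aux' (X s) t1 v) has_real_derivative
   (1 + q) * (((q - 1) * ?w powr (q - 3) * (?p \<bullet> ?H v)) * (?p \<bullet> ?H v) + (?p \<bullet> D3 x1 t1 v v + ?H v \<bullet> ?H v) * ?w powr (q - 1)
    - ((V x1 \<bullet> D3 x1 t1 v v + DV x1 v \<bullet> ?H v) + (DV x1 v \<bullet> ?H v + D2V x1 v v \<bullet> ?p)))) (at 0)"
  unfolding aux'_def
  using DERIV_cmult[OF DERIV_diff[OF DERIV_mult[OF dWp inn[OF dp dH]] DERIV_add[OF inn[OF dV dH] inn[OF dDV dp]]], of "1 + q"]
  by (simp add: X0)
 have dg: "(g has_real_derivative - ((1 + q) * (k / r) * (v \<bullet> v))) (at 0)"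
 proof -
  have "((%s. (X s - z) \<bullet> v) has_real_derivative v \<bullet> v) (at 0)"
   unfolding X_def by (auto intro!: derivative_eq_intros simp: has_field_derivative_def)
  from DERIV_minus[OF DERIV_cmult[OF this]] show ?thesis unfolding g_def[abs_def] .
 qed
 define B' where "B' = (1 + q) * (((q - 1) * ?w powr (q - 3) * (?p \<bullet> ?H v)) * (?p \<bullet> ?H v) + (?p \<bullet> D3 x1 t1 v v + ?H v \<bullet> ?H v) * ?w powr (q - 1)
    - ((V x1 \<bullet> D3 x1 t1 v v + DV x1 v \<bullet> ?H v) + (DV x1 v \<bullet> ?H v + D2V x1 v v \<bullet> ?p)))
   + (aux' x1 t1 v * g 0 + - ((1 + q) * (k / r) * (v \<bullet> v)) * aux x1 t1)"
 have dB: "(B has_real_derivative B') (at 0)"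
  unfolding B_def[abs_def] B'_def using DERIV_add[OF daux' DERIV_mult[OF daux[of 0] dg]] e by (simp add: X0)
 define ex where "ex = exp (weight k r z x1)"
 have ex: "ex > 0" by (simp add: ex_def)
 have d2: "((%s. B s * exp (weight k r z (X s))) has_real_derivative B' * ex + g 0 * ex * B 0) (at 0)"
  using DERIV_mult[OF dB dexp[of 0]] by (simp add: X0 ex_def)
 have mx': "\<psi> s <= \<psi> 0" if "\<bar>s\<bar> < e" for s using mx[OF inS[OF that]] by (simp add: \<psi>_def X0)
 note sd = second_derivative_test[OF e d\<psi> d2 mx']
 have B0: "B 0 = 0" using sd(1) by simp
 then show first: "aux' x1 t1 v = aux x1 t1 * ((1 + q) * (k / r) * ((x1 - z) \<bullet> v))" by (simp add: B_def g_def X0)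
 have "B' * ex <= 0" using sd(2) B0 by simp
 then have "B' <= 0" using ex by (simp add: mult_le_0_iff)
 then show "(1 + q) * ((q - 1) * ?w powr (q - 3) * (?p \<bullet> ?H v) * (?p \<bullet> ?H v)
    + ?w powr (q - 1) * (?H v \<bullet> ?H v + ?p \<bullet> D3 x1 t1 v v)
    - (V x1 \<bullet> D3 x1 t1 v v + DV x1 v \<bullet> ?H v + DV x1 v \<bullet> ?H v + D2V x1 v v \<bullet> ?p))
   - aux x1 t1 * ((1 + q) * (k / r) * ((x1 - z) \<bullet> v)) * ((1 + q) * (k / r) * ((x1 - z) \<bullet> v))
   - aux x1 t1 * ((1 + q) * (k / r)) * (v \<bullet> v) <= 0"
 proof -
  define E where "E = (1 + q) * (k / r) * ((x1 - z) \<bullet> v)"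
  define S where "S = (1 + q) * (k / r) * (v \<bullet> v)"
  have "g 0 = - E" by (simp add: g_def E_def X0)
  then have "(1 + q) * (((q - 1) * ?w powr (q - 3) * (?p \<bullet> ?H v)) * (?p \<bullet> ?H v) + (?p \<bullet> D3 x1 t1 v v + ?H v \<bullet> ?H v) * ?w powr (q - 1)
    - ((V x1 \<bullet> D3 x1 t1 v v + DV x1 v \<bullet> ?H v) + (DV x1 v \<bullet> ?H v + D2V x1 v v \<bullet> ?p)))
    + (aux x1 t1 * E * (- E) + - S * aux x1 t1) <= 0"
   using \<open>B' <= 0\<close> unfolding B'_def first E_def[symmetric] S_def[symmetric] by simp
  moreover have "aux x1 t1 * ((1 + q) * (k / r)) * (v \<bullet> v) = S * aux x1 t1" by (simp add: S_def)
  ultimately show ?thesis unfolding E_def[symmetric] by (simp add: algebra_simps)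
 qed
qed

text \<open>The mixed derivative of \<open>u\<close> is known as the time derivative of \<open>Du\<close>; equality with the space derivative of \<open>u\<^sub>t\<close> lets the
 right-hand side of the equation be differentiated.\<close>

lemma differentiated_equation:
 assumes x: "x \<in> \<Omega>" and t: "t \<in> {0<..<T}"
 defines "p \<equiv> Du x t" and "w \<equiv> W \<eta> (Du x t)"
 shows "Dut x t \<bullet> v = (\<Sum>b\<in>Basis. D3 x t b v \<bullet> b)
   - ((2 * (H x t p \<bullet> H x t v) + p \<bullet> D3 x t p v) / w\<^sup>2 - (p \<bullet> H x t p) * (2 * (p \<bullet> H x t v)) / (w\<^sup>2)\<^sup>2)
   + ((cx x (u x t) \<bullet> v + cz x (u x t) * (p \<bullet> v)) * w + c x (u x t) * ((p \<bullet> H x t v) / w))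
   - (fx x (u x t) \<bullet> v + fz x (u x t) * (p \<bullet> v))"
proof -
 have t': "t \<in> {0..T}" using t by auto
 have xc: "x \<in> closure \<Omega>" using x closure_cases by blast
 have w: "w > 0" unfolding w_def by (rule W_pos[OF \<eta>(1)])
 have linH: "linear (H x t)" by (rule H_linear[OF xc t'])
 note dDu = H_interior[OF x t']
 note dH = D3[OF x t]
 have tr: "((%y. \<Sum>b\<in>Basis. H y t b \<bullet> b) has_derivative (%v. \<Sum>b\<in>Basis. D3 x t b v \<bullet> b)) (at x)"
  by (intro has_derivative_sum has_derivative_inner_left dH)
 have linD3: "linear (%b. D3 x t b v)" for v
 proof -
  have "(%b. D3 x t b v) = D3 x t v" using D3_symmetric(1)[OF x t] by blast
  then show ?thesis using has_derivative_linear[OF dH[of v]] by simp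
 qed
 have HDu: "((%y. H y t (Du y t)) has_derivative (%v. H x t (H x t v) + D3 x t p v)) (at x)"
 proof -
  have "((%y. \<Sum>b\<in>Basis. (Du y t \<bullet> b) *\<^sub>R H y t b) has_derivative (%v. \<Sum>b\<in>Basis. (p \<bullet> b) *\<^sub>R D3 x t b v + (H x t v \<bullet> b) *\<^sub>R H x t b)) (at x)"
   unfolding p_def by (intro has_derivative_sum has_derivative_scaleR has_derivative_inner_left dDu dH)
  moreover have "(\<Sum>b\<in>Basis. (p \<bullet> b) *\<^sub>R D3 x t b v + (H x t v \<bullet> b) *\<^sub>R H x t b) = H x t (H x t v) + D3 x t p v" for v
  proof -
   have "(\<Sum>b\<in>Basis. (p \<bullet> b) *\<^sub>R D3 x t b v) = D3 x t (\<Sum>b\<in>Basis. (p \<bullet> b) *\<^sub>R b) v"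
    using linear_sum[OF linD3, of "%b. (p \<bullet> b) *\<^sub>R b" Basis v] linear_cmul[OF linD3] by simp
   moreover have "(\<Sum>b\<in>Basis. (H x t v \<bullet> b) *\<^sub>R H x t b) = H x t (\<Sum>b\<in>Basis. (H x t v \<bullet> b) *\<^sub>R b)"
    using linear_sum[OF linH, of "%b. (H x t v \<bullet> b) *\<^sub>R b" Basis] linear_cmul[OF linH] by simp
   ultimately show ?thesis by (simp add: sum.distrib euclidean_representation)
  qed
  ultimately have D: "((%y. \<Sum>b\<in>Basis. (Du y t \<bullet> b) *\<^sub>R H y t b) has_derivative (%v. H x t (H x t v) + D3 x t p v)) (at x)"
   by (simp only:)
  show ?thesis
  proof (rule has_derivative_transform_within_open[OF D open_domain x])
   fix y assume y: "y \<in> \<Omega>"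
   then have linHy: "linear (H y t)" using H_linear[of y t] t' closure_cases by blast
   have "(\<Sum>b\<in>Basis. (Du y t \<bullet> b) *\<^sub>R H y t b) = H y t (\<Sum>b\<in>Basis. (Du y t \<bullet> b) *\<^sub>R b)"
    using linear_sum[OF linHy, of "%b. (Du y t \<bullet> b) *\<^sub>R b" Basis] linear_cmul[OF linHy] by simp
   then show "(\<Sum>b\<in>Basis. (Du y t \<bullet> b) *\<^sub>R H y t b) = H y t (Du y t)" by (simp add: euclidean_representation)
  qed
 qed
 have num: "((%y. Du y t \<bullet> H y t (Du y t)) has_derivative (%v. 2 * (H x t p \<bullet> H x t v) + p \<bullet> D3 x t p v)) (at x)"
 proof -
  have "((%y. Du y t \<bullet> H y t (Du y t)) has_derivative (%v. p \<bullet> (H x t (H x t v) + D3 x t p v) + H x t v \<bullet> H x t p)) (at x)"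
   using has_derivative_inner[OF dDu HDu] by (simp add: p_def)
  moreover have "p \<bullet> (H x t (H x t v) + D3 x t p v) + H x t v \<bullet> H x t p = 2 * (H x t p \<bullet> H x t v) + p \<bullet> D3 x t p v" for v
   using H_symmetric[OF xc t', of p "H x t v"] by (simp add: inner_add_right inner_commute[of p "H x t (H x t v)"] inner_commute[of "H x t v"])
  ultimately show ?thesis by (simp only:)
 qed
 have den: "((%y. (W \<eta> (Du y t))\<^sup>2) has_derivative (%v. 2 * (p \<bullet> H x t v))) (at x)"
 proof -
  have "((%y. \<eta>\<^sup>2 + Du y t \<bullet> Du y t) has_derivative (%v. 0 + (p \<bullet> H x t v + H x t v \<bullet> p))) (at x)"
   unfolding p_def by (rule has_derivative_add[OF has_derivative_const has_derivative_inner[OF dDu dDu]])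
  moreover have "0 + (p \<bullet> H x t v + H x t v \<bullet> p) = 2 * (p \<bullet> H x t v)" for v using inner_commute[of p "H x t v"] by linarith
  ultimately show ?thesis by (simp only: W_sq)
 qed
 have quo: "((%y. Du y t \<bullet> H y t (Du y t) / (W \<eta> (Du y t))\<^sup>2) has_derivative
   (%v. (2 * (H x t p \<bullet> H x t v) + p \<bullet> D3 x t p v) / w\<^sup>2 - (p \<bullet> H x t p) * (2 * (p \<bullet> H x t v)) / (w\<^sup>2)\<^sup>2)) (at x)"
 proof -
  have nz: "(W \<eta> (Du x t))\<^sup>2 \<noteq> 0" using w by (simp add: w_def)
  have "((%y. Du y t \<bullet> H y t (Du y t) / (W \<eta> (Du y t))\<^sup>2) has_derivative
   (%v. ((2 * (H x t p \<bullet> H x t v) + p \<bullet> D3 x t p v) * w\<^sup>2 - (p \<bullet> H x t p) * (2 * (p \<bullet> H x t v))) / (w\<^sup>2 * w\<^sup>2))) (at x)"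
   using has_derivative_divide'[OF num den nz] by (simp only: p_def w_def)
  moreover have "((2 * (H x t p \<bullet> H x t v) + p \<bullet> D3 x t p v) * w\<^sup>2 - (p \<bullet> H x t p) * (2 * (p \<bullet> H x t v))) / (w\<^sup>2 * w\<^sup>2)
    = (2 * (H x t p \<bullet> H x t v) + p \<bullet> D3 x t p v) / w\<^sup>2 - (p \<bullet> H x t p) * (2 * (p \<bullet> H x t v)) / (w\<^sup>2)\<^sup>2" for v
   using w by (simp add: diff_divide_distrib power2_eq_square)
  ultimately show ?thesis by (simp only:)
 qed
 have pair: "((%y. (y, u y t)) has_derivative (%v. (v, p \<bullet> v))) (at x)"
  unfolding p_def by (intro has_derivative_Pair has_derivative_ident Du_interior[OF x t'])
 have dc: "((%y. c y (u y t)) has_derivative (%v. cx x (u x t) \<bullet> v + cz x (u x t) * (p \<bullet> v))) (at x)"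
  using diff_chain_at[OF pair c_deriv[OF x]] by (simp add: o_def)
 have df: "((%y. f y (u y t)) has_derivative (%v. fx x (u x t) \<bullet> v + fz x (u x t) * (p \<bullet> v))) (at x)"
  using diff_chain_at[OF pair f_deriv[OF x]] by (simp add: o_def)
 have dW: "((%y. W \<eta> (Du y t)) has_derivative (%v. (p \<bullet> H x t v) / w)) (at x)"
  unfolding p_def w_def by (rule W_derivative[OF \<eta>(1) dDu])
 have dcW: "((%y. c y (u y t) * W \<eta> (Du y t)) has_derivative (%v. c x (u x t) * ((p \<bullet> H x t v) / w) + (cx x (u x t) \<bullet> v + cz x (u x t) * (p \<bullet> v)) * w)) (at x)"
  unfolding w_def by (rule has_derivative_mult[OF dc dW[unfolded w_def]])
 have "((%y. ((\<Sum>b\<in>Basis. H y t b \<bullet> b) - Du y t \<bullet> H y t (Du y t) / (W \<eta> (Du y t))\<^sup>2) + c y (u y t) * W \<eta> (Du y t) - f y (u y t)) has_derivative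
  (%v. ((\<Sum>b\<in>Basis. D3 x t b v \<bullet> b) - ((2 * (H x t p \<bullet> H x t v) + p \<bullet> D3 x t p v) / w\<^sup>2 - (p \<bullet> H x t p) * (2 * (p \<bullet> H x t v)) / (w\<^sup>2)\<^sup>2))
   + (c x (u x t) * ((p \<bullet> H x t v) / w) + (cx x (u x t) \<bullet> v + cz x (u x t) * (p \<bullet> v)) * w) - (fx x (u x t) \<bullet> v + fz x (u x t) * (p \<bullet> v)))) (at x)"
  by (rule has_derivative_diff[OF has_derivative_add[OF has_derivative_diff[OF tr quo] dcW] df])
 then have "((%y. ut y t) has_derivative
  (%v. ((\<Sum>b\<in>Basis. D3 x t b v \<bullet> b) - ((2 * (H x t p \<bullet> H x t v) + p \<bullet> D3 x t p v) / w\<^sup>2 - (p \<bullet> H x t p) * (2 * (p \<bullet> H x t v)) / (w\<^sup>2)\<^sup>2))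
   + (c x (u x t) * ((p \<bullet> H x t v) / w) + (cx x (u x t) \<bullet> v + cz x (u x t) * (p \<bullet> v)) * w) - (fx x (u x t) \<bullet> v + fz x (u x t) * (p \<bullet> v)))) (at x)"
  by (rule has_derivative_transform_within_open[OF _ open_domain x]) (simp only: pde[OF _ t] curv_def)
 from has_derivative_unique[OF Dut(2)[OF x t] this] have "Dut x t \<bullet> v = ((\<Sum>b\<in>Basis. D3 x t b v \<bullet> b) - ((2 * (H x t p \<bullet> H x t v) + p \<bullet> D3 x t p v) / w\<^sup>2 - (p \<bullet> H x t p) * (2 * (p \<bullet> H x t v)) / (w\<^sup>2)\<^sup>2))
   + (c x (u x t) * ((p \<bullet> H x t v) / w) + (cx x (u x t) \<bullet> v + cz x (u x t) * (p \<bullet> v)) * w) - (fx x (u x t) \<bullet> v + fz x (u x t) * (p \<bullet> v))"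
  by (rule fun_cong)
 then show ?thesis by simp
qed

end

lemma powr_in_inverse_power:
 fixes w q :: real assumes "w > 0"
 shows "w powr (1 + q) = w / w powr (- q)" "w powr (q - 1) = 1 / (w * w powr (- q))"
  "w powr (q - 3) = 1 / (w ^ 3 * w powr (- q))"
proof -
 have 1: "w powr q = 1 / w powr (- q)" using powr_minus_divide[of w "- q"] by simp
 show "w powr (1 + q) = w / w powr (- q)" using assms 1 by (simp add: powr_add)
 show "w powr (q - 1) = 1 / (w * w powr (- q))" using assms 1 by (simp add: powr_diff)
 have "w powr 3 = w ^ 3" using assms powr_realpow[of w 3] by simp
 then show "w powr (q - 3) = 1 / (w ^ 3 * w powr (- q))" using assms 1 by (simp add: powr_diff)
qed

lemma second_order_rescaling:
 fixes w \<omega> :: real assumes "w > 0" "\<omega> > 0"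
 shows "(1 + q) * ((q - 1) * (1 / (w ^ 3 * \<omega>)) * (w * (w * a)) * (w * (w * a)) + 1 / (w * \<omega>) * (w * (w * b) + w * (w * d1))
   - (w * d2 + w * e1 + w * e1 + w * e2))
   - w / \<omega> * \<theta> * (- ((1 + q) * g)) * (- ((1 + q) * g)) - w / \<omega> * \<theta> * ((1 + q) * \<kappa>) * vv
  = (1 + q) * (w / \<omega>) * ((q - 1) * (a * a) + b + (d1 - \<omega> * d2) - 2 * \<omega> * e1 - \<omega> * e2 - \<theta> * (1 + q) * (g * g) - \<theta> * \<kappa> * vv)"
proof -
 have 1: "(q - 1) * (1 / (w ^ 3 * \<omega>)) * (w * (w * a)) * (w * (w * a)) = (w / \<omega>) * ((q - 1) * (a * a))"
  using assms by (simp add: field_simps power3_eq_cube)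
 have 2: "1 / (w * \<omega>) * (w * (w * b) + w * (w * d1)) = (w / \<omega>) * (b + d1)" using assms by (simp add: field_simps)
 have 3: "w * d2 + w * e1 + w * e1 + w * e2 = (w / \<omega>) * (\<omega> * d2 + 2 * \<omega> * e1 + \<omega> * e2)" using assms by (simp add: field_simps)
 define s where "s = w / \<omega>"
 show ?thesis unfolding 1 2 3 s_def[symmetric] by (simp add: algebra_simps)
qed

context capillary_flow begin

text \<open>The second order conditions in all directions are contracted with the coefficients of the operator, and the nonnegative time derivative of the
 auxiliary function turns, by the differentiated equation in direction \<open>P - \<omega> V\<close>, all third derivatives into
 lower order terms. The second derivative of the weight exponent is a multiple of the identity, which gives \<open>G\<close>.\<close>

lemma interior_maximum_yields_data:
 assumes S: "open S" "S \<subseteq> \<Omega>" "x1 \<in> S" and t1: "t1 \<in> {0<..<T}" and r: "r > 0" and k: "k \<ge> 0"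
  and mx: "\<And>x. x \<in> S ==> aux x t1 * exp (weight k r z x) <= aux x1 t1 * exp (weight k r z x1)"
  and mt: "\<And>s. s \<in> {0..t1} ==> aux x1 s <= aux x1 t1"
  and near: "norm (x1 - z) <= r"
  and M': "M <= M'" "k <= M'" "k / r * real DIM('a) <= M'"
  and \<nu>: "W \<eta> (Du x1 t1) powr (- q) <= \<nu>" "1 / W \<eta> (Du x1 t1) <= \<nu>" "\<nu> <= 1"
 shows "\<exists>P X \<omega> \<iota> V1 DV1 D2 g G Df zz \<epsilon>.
   interior_maximum_data M' q \<nu> P X \<omega> \<iota> V1 DV1 D2 g G (c x1 (u x1 t1)) (cx x1 (u x1 t1)) Df zz \<epsilon>
   \<and> norm g <= k \<and> \<bar>G\<bar> <= k / r * (real DIM('a) - 1 + \<nu>)"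
proof -
 let ?N = "real DIM('a)"
 have t': "t1 \<in> {0..T}" using t1 by auto
 have x1: "x1 \<in> \<Omega>" using S by blast
 have xc: "x1 \<in> closure \<Omega>" using x1 closure_cases by blast
 define p where "p = Du x1 t1"
 define w where "w = W \<eta> p"
 have w: "w > 0" unfolding w_def by (rule W_pos[OF \<eta>(1)])
 define \<omega> where "\<omega> = w powr (- q)"
 have \<omega>: "\<omega> > 0" using w by (simp add: \<omega>_def)
 define P where "P = (1 / w) *\<^sub>R p"
 have p: "p = w *\<^sub>R P" using w by (simp add: P_def)
 define X where "X v = (1 / w) *\<^sub>R H x1 t1 v" for v
 have HX: "H x1 t1 v = w *\<^sub>R X v" for v using w by (simp add: X_def)
 define D where "D v v' = (1 / w) *\<^sub>R D3 x1 t1 v v'" for v v'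
 have DD: "D3 x1 t1 v v' = w *\<^sub>R D v v'" for v v' using w by (simp add: D_def)
 note linH = H_linear[OF xc t']
 have linX: "linear X" unfolding X_def[abs_def] by (rule linear_compose_scale_right[OF linH])
 have symX: "X v \<bullet> v' = X v' \<bullet> v" for v v' using H_symmetric[OF xc t', of v v'] by (simp add: X_def)
 define V1 where "V1 = V x1"
 define \<xi> where "\<xi> = P - \<omega> *\<^sub>R V1"
 define \<theta> where "\<theta> = 1 - (1 + q) * \<omega> * (P \<bullet> V1)"
 define \<kappa> where "\<kappa> = k / r"
 define g where "g = - (\<kappa> *\<^sub>R (x1 - z))"
 define G where "G = - (\<kappa> * (?N - P \<bullet> P))"
 define D2 where "D2 = ((\<Sum>b\<in>Basis. D2V x1 b b) - D2V x1 P P) \<bullet> P"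
 have \<kappa>: "\<kappa> \<ge> 0" using k r by (simp add: \<kappa>_def)
 note pw = powr_in_inverse_power[OF w, of q, folded \<omega>_def]
 have auxw: "aux x1 t1 = w / \<omega> * \<theta>"
 proof -
  have "w * \<omega> / \<omega> = w" using \<omega> by simp
  then have "w / \<omega> * ((1 + q) * \<omega> * (P \<bullet> V1)) = (1 + q) * (w * (P \<bullet> V1))" using \<omega> by (simp add: field_simps)
  moreover have "aux x1 t1 = w / \<omega> - (1 + q) * (w * (P \<bullet> V1))"
   unfolding aux_def p_def[symmetric] w_def[symmetric] pw(1) V1_def[symmetric]
   by (subst p) (simp add: inner_commute[of V1])
  ultimately show ?thesis by (simp add: \<theta>_def right_diff_distrib)
 qed
 have E: "(1 + q) * (k / r) * ((x1 - z) \<bullet> v) = - ((1 + q) * (g \<bullet> v))" for v by (simp add: g_def \<kappa>_def)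
 note wm = weighted_maximum_conditions[OF S t1 r mx, folded p_def, folded w_def, unfolded E pw HX DD auxw, folded V1_def \<kappa>_def]
 have first: "\<xi> \<bullet> X v = \<omega> * (DV x1 v \<bullet> P) - \<theta> * (g \<bullet> v)" for v
 proof -
  have "(1 + q) * (1 / (w * \<omega>) * (w * (w * (P \<bullet> X v))) - (w * (V1 \<bullet> X v) + w * (DV x1 v \<bullet> P))) = w / \<omega> * \<theta> * (- ((1 + q) * (g \<bullet> v)))"
   using wm(1)[of v] unfolding aux'_def p_def[symmetric] unfolding w_def[symmetric] V1_def[symmetric] unfolding pw HX
   by (simp only: p inner_scaleR_left inner_scaleR_right)
  moreover have "1 / (w * \<omega>) * (w * (w * (P \<bullet> X v))) - (w * (V1 \<bullet> X v) + w * (DV x1 v \<bullet> P)) = w / \<omega> * (P \<bullet> X v - \<omega> * (V1 \<bullet> X v) - \<omega> * (DV x1 v \<bullet> P))"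
   using w \<omega> by (simp add: field_simps)
  ultimately have "((1 + q) * (w / \<omega>)) * (P \<bullet> X v - \<omega> * (V1 \<bullet> X v) - \<omega> * (DV x1 v \<bullet> P)) = ((1 + q) * (w / \<omega>)) * (- \<theta> * (g \<bullet> v))"
   by (simp add: mult_ac)
  moreover have "(1 + q) * (w / \<omega>) \<noteq> 0" using w \<omega> q by simp
  ultimately have "P \<bullet> X v - \<omega> * (V1 \<bullet> X v) - \<omega> * (DV x1 v \<bullet> P) = - \<theta> * (g \<bullet> v)" by (metis mult_left_cancel)
  then show ?thesis by (simp add: \<xi>_def inner_diff_left)
 qed
 define m where "m v v' = (q - 1) * ((P \<bullet> X v) * (P \<bullet> X v')) + X v \<bullet> X v' + \<xi> \<bullet> D v v'
   - 2 * \<omega> * (DV x1 v \<bullet> X v') - \<omega> * (D2V x1 v v' \<bullet> P) - \<theta> * (1 + q) * ((g \<bullet> v) * (g \<bullet> v')) - \<theta> * \<kappa> * (v \<bullet> v')" for v v'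
 have mneg: "m v v <= 0" for v
 proof -
  have "(1 + q) * ((q - 1) * (1 / (w ^ 3 * \<omega>)) * (w * (w * (P \<bullet> X v))) * (w * (w * (P \<bullet> X v)))
    + 1 / (w * \<omega>) * (w * (w * (X v \<bullet> X v)) + w * (w * (P \<bullet> D v v)))
    - (w * (V1 \<bullet> D v v) + w * (DV x1 v \<bullet> X v) + w * (DV x1 v \<bullet> X v) + w * (D2V x1 v v \<bullet> P)))
   - w / \<omega> * \<theta> * (- ((1 + q) * (g \<bullet> v))) * (- ((1 + q) * (g \<bullet> v))) - w / \<omega> * \<theta> * ((1 + q) * \<kappa>) * (v \<bullet> v) <= 0"
   using wm(2)[of v] unfolding p by (simp only: inner_scaleR_left inner_scaleR_right)
  then have "(1 + q) * (w / \<omega>) * m v v <= 0"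
   unfolding second_order_rescaling[OF w \<omega>] m_def \<xi>_def inner_diff_left inner_scaleR_left .
  moreover have "(1 + q) * (w / \<omega>) > 0" using w \<omega> q by simp
  ultimately show ?thesis by (meson mult_pos_pos not_le)
 qed
 have linD: "linear (%v'. D v v')" for v
  unfolding D_def[abs_def] by (rule linear_compose_scale_right[OF has_derivative_linear[OF D3[OF x1 t1]]])
 have Dsym: "D v v' = D v' v" for v v' using D3_symmetric(1)[OF x1 t1] by (simp add: D_def)
 have Dsym2: "D v v' \<bullet> y = D y v' \<bullet> v" for v v' y using D3_symmetric(2)[OF x1 t1] by (simp add: D_def)
 have linDV: "linear (DV x1)" by (rule has_derivative_linear[OF V[OF xc]])
 have linD2: "linear (%v'. D2V x1 v v')" for v by (rule has_derivative_linear[OF D2V[OF x1]])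
 note lins = linear_add[OF linX] linear_cmul[OF linX] linear_add[OF linD] linear_cmul[OF linD]
  linear_add[OF linDV] linear_cmul[OF linDV] linear_add[OF linD2] linear_cmul[OF linD2]
  linear_add[OF D2V_linear[OF x1]] linear_cmul[OF D2V_linear[OF x1]] inner_add_left inner_add_right
  inner_scaleR_left inner_scaleR_right real_scaleR_def
 have lin2: "linear (%v'. m v v')" for v
  by (rule linearI; simp only: m_def lins; simp add: algebra_simps)
 have lin1: "linear (%v. m v v')" for v'
  by (rule linearI; simp only: m_def Dsym[of _ v'] lins; simp add: algebra_simps)
 have PP: "P \<bullet> P <= 1" "1 - P \<bullet> P <= \<nu>"
 proof -
  have "p \<bullet> p = w\<^sup>2 - \<eta>\<^sup>2" unfolding w_def W_sq by simp
  then have PPe: "P \<bullet> P = 1 - (\<eta> / w)\<^sup>2" using w by (simp add: P_def power2_eq_square field_simps)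
  then show "P \<bullet> P <= 1" by simp
  have "\<eta> / w <= 1 / w" using \<eta> w by (intro divide_right_mono) auto
  then have "\<eta> / w <= \<nu>" "0 <= \<eta> / w" "\<nu> \<ge> 0" using \<nu>(2) \<eta> w unfolding w_def p_def
   by (auto intro: order_trans[of _ "1 / W \<eta> (Du x1 t1)"])
  then have "(\<eta> / w)\<^sup>2 <= \<nu> * 1" unfolding power2_eq_square using \<nu>(3) by (intro mult_mono) auto
  then show "1 - P \<bullet> P <= \<nu>" using PPe by simp
 qed
 have nP: "norm P <= 1" using PP(1) by (simp add: norm_le_square)
 have sumP: "(\<Sum>b\<in>Basis. (y \<bullet> b) * (y \<bullet> b)) = y \<bullet> y" for y :: 'a by (simp only: euclidean_inner[of y y, symmetric])
 define \<tau> where "\<tau> = (\<Sum>b\<in>Basis. \<xi> \<bullet> D b b) - \<xi> \<bullet> D P P"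
 have trm: "(\<Sum>b\<in>Basis. m b b) - m P P <= 0" by (rule coefficient_trace_nonpos[OF lin1 lin2 mneg PP(1)])
 have PX: "P \<bullet> X b = X P \<bullet> b" for b using symX[of b P] by (simp only: inner_commute[of P])
 have "(\<Sum>b\<in>Basis. m b b) = (q - 1) * (X P \<bullet> X P) + frob_sq X + (\<Sum>b\<in>Basis. \<xi> \<bullet> D b b)
   - 2 * \<omega> * (\<Sum>b\<in>Basis. DV x1 b \<bullet> X b) - \<omega> * ((\<Sum>b\<in>Basis. D2V x1 b b) \<bullet> P) - \<theta> * (1 + q) * (g \<bullet> g) - \<theta> * \<kappa> * ?N"
  unfolding m_def sum_subtractf sum.distrib sum_distrib_left[symmetric] PX sumP frob_sq_def inner_sum_left by simp
 then have second: "\<theta> * (G - (1 + q) * aform P g g)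
    <= - (q - 1) * aform P (X P) (X P) - (frob_sq X - X P \<bullet> X P) - \<tau>
     + 2 * \<omega> * ((\<Sum>b\<in>Basis. DV x1 b \<bullet> X b) - DV x1 P \<bullet> X P) + \<omega> * D2"
  using trm inner_commute[of P g] by (simp add: m_def aform_def G_def D2_def \<tau>_def inner_diff_left algebra_simps)
 have time: "Dut x1 t1 \<bullet> \<xi> \<ge> 0"
 proof -
  have dD: "((%s. Du x1 s) has_derivative (%h. h *\<^sub>R Dut x1 t1)) (at t1 within {0..t1})"
   using Dut(1)[OF x1 t1] has_derivative_at_withinI unfolding has_vector_derivative_def by blast
  have "((%s. aux x1 s) has_derivative (%h. (1 + q) * w powr (1 + q - 2) * (p \<bullet> (h *\<^sub>R Dut x1 t1))
    - (1 + q) * (V1 \<bullet> (h *\<^sub>R Dut x1 t1)))) (at t1 within {0..t1})"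
   unfolding aux_def V1_def[symmetric] p_def w_def
   by (rule has_derivative_diff[OF W_powr_derivative[OF dD] has_derivative_mult_right[OF has_derivative_inner_right[OF dD]]])
  moreover have "(%h. (1 + q) * w powr (1 + q - 2) * (p \<bullet> (h *\<^sub>R Dut x1 t1)) - (1 + q) * (V1 \<bullet> (h *\<^sub>R Dut x1 t1)))
    = (%h. (1 + q) * (w powr (q - 1) * (p \<bullet> Dut x1 t1) - V1 \<bullet> Dut x1 t1) * h)"
   by (simp add: fun_eq_iff algebra_simps)
  ultimately have "((%s. aux x1 s) has_real_derivative (1 + q) * (w powr (q - 1) * (p \<bullet> Dut x1 t1) - V1 \<bullet> Dut x1 t1)) (at t1 within {0..t1})"
   unfolding has_field_derivative_def by (simp only:)
  then have "(1 + q) * (w powr (q - 1) * (p \<bullet> Dut x1 t1) - V1 \<bullet> Dut x1 t1) \<ge> 0"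
   by (rule left_maximum_derivative) (use t1 mt in auto)
  then have "w powr (q - 1) * (p \<bullet> Dut x1 t1) - V1 \<bullet> Dut x1 t1 \<ge> 0" using q by (simp add: zero_le_mult_iff)
  moreover have "w powr (q - 1) * (p \<bullet> Dut x1 t1) - V1 \<bullet> Dut x1 t1 = (1 / \<omega>) * (Dut x1 t1 \<bullet> \<xi>)"
   unfolding pw p \<xi>_def inner_diff_right inner_scaleR_left inner_scaleR_right inner_commute[of "Dut x1 t1"]
   using w \<omega> by (simp add: field_simps)
  ultimately show ?thesis using \<omega> by (simp add: zero_le_mult_iff zero_le_divide_iff)
 qed
 let ?c = "c x1 (u x1 t1)" and ?Dc = "cx x1 (u x1 t1)" and ?Df = "fx x1 (u x1 t1)"
 define zz where "zz = cz x1 (u x1 t1) * w - fz x1 (u x1 t1)"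
 have deq: "Dut x1 t1 \<bullet> \<xi> = w * (\<tau> - 2 * aform P (X P) (X \<xi>) + \<xi> \<bullet> ?Dc + zz * (\<xi> \<bullet> P) + ?c * (\<xi> \<bullet> X P) - (1 / w) * (\<xi> \<bullet> ?Df))"
 proof -
  have 1: "(\<Sum>b\<in>Basis. D3 x1 t1 b \<xi> \<bullet> b) = w * (\<Sum>b\<in>Basis. \<xi> \<bullet> D b b)"
  proof -
   have "D3 x1 t1 b \<xi> \<bullet> b = w * (\<xi> \<bullet> D b b)" for b
    using Dsym2[of b b \<xi>] Dsym[of \<xi> b] by (simp add: DD inner_commute[of \<xi>])
   then show ?thesis by (simp add: sum_distrib_left)
  qed
  have 2: "p \<bullet> D3 x1 t1 p \<xi> = w * (w\<^sup>2 * (\<xi> \<bullet> D P P))"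
  proof -
   have "p \<bullet> D3 x1 t1 p \<xi> = w * (D p \<xi> \<bullet> p)" by (simp add: DD inner_commute[of p])
   also have "D p \<xi> \<bullet> p = D p p \<bullet> \<xi>" using Dsym2[of p p \<xi>] Dsym[of \<xi> p] by simp
   also have "D p p = (w\<^sup>2) *\<^sub>R D P P"
    unfolding p by (simp only: linear_cmul[OF linD] Dsym[of "w *\<^sub>R P"] scaleR_scaleR power2_eq_square)
   finally show ?thesis by (simp add: inner_commute[of \<xi>])
  qed
  have 3: "H x1 t1 p = (w\<^sup>2) *\<^sub>R X P" unfolding HX by (subst p) (simp add: linear_cmul[OF linX] power2_eq_square)
  have 4: "p \<bullet> H x1 t1 \<xi> = w\<^sup>2 * (P \<bullet> X \<xi>)" unfolding HX by (subst p) (simp add: power2_eq_square)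
  have 5: "p \<bullet> H x1 t1 p = w ^ 3 * (P \<bullet> X P)" unfolding 3 by (subst p) (simp add: power2_eq_square power3_eq_cube)
  have 6: "H x1 t1 p \<bullet> H x1 t1 \<xi> = w ^ 3 * (X P \<bullet> X \<xi>)" unfolding 3 unfolding HX by (simp add: power2_eq_square power3_eq_cube)
  have PXx: "P \<bullet> X \<xi> = \<xi> \<bullet> X P" using symX[of P \<xi>] inner_commute[of P] inner_commute[of \<xi>] by simp
  have br: "(2 * (w ^ 3 * (X P \<bullet> X \<xi>)) + w * (w\<^sup>2 * (\<xi> \<bullet> D P P))) / w\<^sup>2 - (w ^ 3 * (P \<bullet> X P)) * (2 * (w\<^sup>2 * (\<xi> \<bullet> X P))) / (w\<^sup>2)\<^sup>2
    = w * (2 * aform P (X P) (X \<xi>) + \<xi> \<bullet> D P P)"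
   using w by (simp add: aform_def PXx power2_eq_square power3_eq_cube field_simps)
  have px: "p \<bullet> \<xi> = w * (\<xi> \<bullet> P)" by (subst p) (simp add: inner_commute[of P])
  have "Dut x1 t1 \<bullet> \<xi> = w * (\<Sum>b\<in>Basis. \<xi> \<bullet> D b b) - w * (2 * aform P (X P) (X \<xi>) + \<xi> \<bullet> D P P)
   + ((\<xi> \<bullet> ?Dc + cz x1 (u x1 t1) * (w * (\<xi> \<bullet> P))) * w + ?c * (w\<^sup>2 * (\<xi> \<bullet> X P) / w)) - (\<xi> \<bullet> ?Df + fz x1 (u x1 t1) * (w * (\<xi> \<bullet> P)))"
   using differentiated_equation[OF x1 t1, of \<xi>, folded p_def, folded w_def] unfolding 1 2 4 5 6 px PXx br
    inner_commute[of ?Dc] inner_commute[of ?Df] .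
  moreover have "w\<^sup>2 * (\<xi> \<bullet> X P) / w = w * (\<xi> \<bullet> X P)" using w by (simp add: power2_eq_square)
  moreover define Y where "Y = (1 / w) * (\<xi> \<bullet> ?Df)"
  moreover have "\<xi> \<bullet> ?Df = w * Y" using w by (simp add: Y_def)
  ultimately show ?thesis unfolding Y_def[symmetric] zz_def \<tau>_def by (simp only:) (simp add: algebra_simps)
 qed
 have \<tau>: "- \<tau> <= - 2 * aform P (X P) (X \<xi>) + \<xi> \<bullet> ?Dc + zz * (\<xi> \<bullet> P) + ?c * (\<xi> \<bullet> X P) - (1 / w) * (\<xi> \<bullet> ?Df)"
  using time w unfolding deq by (simp add: zero_le_mult_iff)
 define \<epsilon> where "\<epsilon> = (ut x1 t1 + f x1 (u x1 t1)) / w"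
 have tr: "(\<Sum>b\<in>Basis. X b \<bullet> b) - P \<bullet> X P = - ?c + \<epsilon>"
 proof -
  have "(\<Sum>b\<in>Basis. H x1 t1 b \<bullet> b) = w * (\<Sum>b\<in>Basis. X b \<bullet> b)" by (simp add: HX sum_distrib_left)
  moreover have "p \<bullet> H x1 t1 p / w\<^sup>2 = w * (P \<bullet> X P)"
  proof -
   have "p \<bullet> H x1 t1 p = w\<^sup>2 * (w * (P \<bullet> X P))" unfolding HX by (subst (1 2) p) (simp add: linear_cmul[OF linX] power2_eq_square)
   then show ?thesis using w by simp
  qed
  ultimately have "ut x1 t1 = w * (\<Sum>b\<in>Basis. X b \<bullet> b) - w * (P \<bullet> X P) + ?c * w - f x1 (u x1 t1)"
   using pde[OF x1 t1] by (simp add: curv_def p_def[symmetric] w_def[symmetric])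
  then have "(ut x1 t1 + f x1 (u x1 t1)) / w = (w * ((\<Sum>b\<in>Basis. X b \<bullet> b) - P \<bullet> X P + ?c)) / w" by (simp add: algebra_simps)
  then show ?thesis using w by (simp add: \<epsilon>_def)
 qed
 have w\<nu>: "1 / w <= \<nu>" using \<nu>(2) by (simp add: w_def p_def)
 have \<epsilon>b: "\<bar>\<epsilon>\<bar> <= M' * \<nu>"
 proof -
  have "\<bar>ut x1 t1 + f x1 (u x1 t1)\<bar> <= K + \<bar>C\<bar>"
   using ut_bound[OF xc, of t1] t1 f_bounds(1)[OF x1, of "u x1 t1"] by fastforce
  then have "\<bar>ut x1 t1 + f x1 (u x1 t1)\<bar> <= M'" using M(3) M'(1) by linarith
  then have "\<bar>\<epsilon>\<bar> <= M' * (1 / w)" using w by (simp add: \<epsilon>_def divide_right_mono)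
  also have "... <= M' * \<nu>" using w\<nu> M(1) M'(1) by (intro mult_left_mono) auto
  finally show ?thesis .
 qed
 have \<nu>pos: "\<nu> > 0" using w\<nu> w by (smt (verit) divide_pos_pos)
 have D2b: "\<bar>D2\<bar> <= M'"
 proof -
  have "norm (D2V x1 b b) <= M / (?N + 1)" if "norm b <= 1" for b
  proof -
   have "(?N + 1) * norm (D2V x1 b b) <= M * norm b * norm b" by (rule V_bounds(3)[OF x1])
   also have "... <= M * 1 * 1" using that M by (intro mult_mono) auto
   finally show ?thesis by (simp add: field_simps)
  qed
  note D2b = this
  have "norm (\<Sum>b\<in>Basis. D2V x1 b b) <= ?N * (M / (?N + 1))" by (rule sum_norm_bound) (simp add: D2b)
  moreover have "norm (D2V x1 P P) <= M / (?N + 1)" by (rule D2b[OF nP])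
  ultimately have "norm ((\<Sum>b\<in>Basis. D2V x1 b b) - D2V x1 P P) <= ?N * (M / (?N + 1)) + M / (?N + 1)"
   using norm_triangle_ineq4[of "\<Sum>b\<in>Basis. D2V x1 b b" "D2V x1 P P"] by linarith
  also have "... = (?N + 1) * (M / (?N + 1))" by (simp only: distrib_right mult_1)
  also have "... = M" by simp
  finally have "norm ((\<Sum>b\<in>Basis. D2V x1 b b) - D2V x1 P P) * norm P <= M * 1" using nP M by (intro mult_mono) auto
  then show ?thesis using Cauchy_Schwarz_ineq2[of "(\<Sum>b\<in>Basis. D2V x1 b b) - D2V x1 P P" P] M'(1) by (simp add: D2_def)
 qed
 have gk: "norm g <= k"
 proof -
  have "norm g = (k / r) * norm (x1 - z)" using k r by (simp add: g_def \<kappa>_def)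
  also have "... <= (k / r) * r" using near k r by (intro mult_left_mono) auto
  finally show ?thesis using r by simp
 qed
 have "?N \<ge> 1" using DIM_positive[where 'a='a] by (simp add: Suc_leI)
 then have GN: "\<bar>G\<bar> = \<kappa> * (?N - P \<bullet> P)" using PP(1) \<kappa> by (simp only: G_def abs_minus_cancel abs_mult)
 have Gk: "\<bar>G\<bar> <= k / r * (?N - 1 + \<nu>)" unfolding GN \<kappa>_def[symmetric] using PP(2) \<kappa> by (intro mult_left_mono) auto
 have GM: "\<bar>G\<bar> <= M'"
 proof -
  have "\<bar>G\<bar> <= \<kappa> * ?N" unfolding GN using \<kappa> by (intro mult_left_mono) auto
  then show ?thesis using M'(3) by (simp add: \<kappa>_def)
 qed
 have zz: "zz <= 0"
  using c_bounds(3)[OF x1, of "u x1 t1"] f_bounds(3)[OF x1, of "u x1 t1"] w by (simp add: zz_def mult_nonpos_nonneg order_trans[of _ 0])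
 have CM: "C <= M'" using M(2) M'(1) by linarith
 have DVb: "norm (DV x1 v) <= M' * norm v" for v
  using V_bounds(2)[OF xc, of v] mult_right_mono[OF M'(1) norm_ge_zero[of v]] by linarith
 have "interior_maximum_data M' q \<nu> P X \<omega> (1 / w) V1 (DV x1) D2 g G ?c ?Dc ?Df zz \<epsilon>"
  unfolding interior_maximum_data_def \<xi>_def[symmetric] \<theta>_def[symmetric]
 proof (intro conjI allI)
  show "\<omega> <= \<nu>" using \<nu>(1) by (simp add: \<omega>_def w_def p_def)
  show "norm V1 <= M'" using V_bounds(1)[OF xc] M'(1) by (simp add: V1_def)
  show "\<bar>?c\<bar> <= M'" "norm ?Dc <= M'" using c_bounds(1,2)[OF x1, of "u x1 t1"] CM by auto
  show "norm ?Df <= M'" using f_bounds(2)[OF x1, of "u x1 t1"] CM by auto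
  show "\<xi> \<bullet> X v = \<omega> * (DV x1 v \<bullet> P) - \<theta> * (g \<bullet> v)" for v by (rule first)
  show "norm g <= M'" using gk M'(2) by linarith
  show "\<theta> * (G - (1 + q) * aform P g g)
    <= - 2 * aform P (X P) (X \<xi>) - (frob_sq X - X P \<bullet> X P) - (q - 1) * aform P (X P) (X P)
     + \<xi> \<bullet> ?Dc + zz * (\<xi> \<bullet> P) + ?c * (\<xi> \<bullet> X P) - 1 / w * (\<xi> \<bullet> ?Df)
     + 2 * \<omega> * ((\<Sum>b\<in>Basis. DV x1 b \<bullet> X b) - DV x1 P \<bullet> X P) + \<omega> * D2"
   using second \<tau> by linarith
 qed (use \<omega> w w\<nu> nP PP(2) linX symX DVb D2b GM zz \<epsilon>b tr in auto)
 then show ?thesis using gk Gk by blast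
qed

end

context capillary_flow begin

text \<open>The forcing condition, with \<open>k\<close> bounding \<open>|g|\<close>, contradicts the algebraic estimate as soon as \<open>\<nu>\<close> is small against \<open>\<gamma>\<close>. The case
 \<open>k = 0\<close> is the one of an unweighted maximum.\<close>

lemma interior_maximum_excluded:
 assumes est: "interior_estimate TYPE('a) M' q \<nu>0 Kc"
  and \<nu>0: "0 < \<nu>" "\<nu> <= \<nu>0" and small: "(Kc + k / r) * \<nu> < \<gamma>"
  and forcing: "\<And>x z. x \<in> \<Omega> ==> norm (cx x z) + k * \<bar>c x z\<bar> + k / r * (real DIM('a) - 1) + \<gamma> <= (c x z)\<^sup>2 / (real DIM('a) - 1)"
  and S: "open S" "S \<subseteq> \<Omega>" "x1 \<in> S" and t1: "t1 \<in> {0<..<T}" and r: "r > 0" and k: "k \<ge> 0"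
  and mx: "\<And>x. x \<in> S ==> aux x t1 * exp (weight k r z x) <= aux x1 t1 * exp (weight k r z x1)"
  and mt: "\<And>s. s \<in> {0..t1} ==> aux x1 s <= aux x1 t1"
  and near: "norm (x1 - z) <= r"
  and M': "M <= M'" "k <= M'" "k / r * real DIM('a) <= M'"
  and \<nu>: "W \<eta> (Du x1 t1) powr (- q) <= \<nu>" "1 / W \<eta> (Du x1 t1) <= \<nu>" "\<nu> <= 1"
 shows False
proof -
 let ?c = "c x1 (u x1 t1)" and ?Dc = "cx x1 (u x1 t1)"
 obtain P X \<omega> \<iota> V1 DV1 D2 g G Df zz \<epsilon> where d: "interior_maximum_data M' q \<nu> P X \<omega> \<iota> V1 DV1 D2 g G ?c ?Dc Df zz \<epsilon>"
  and g: "norm g <= k" and G: "\<bar>G\<bar> <= k / r * (real DIM('a) - 1 + \<nu>)"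
  using interior_maximum_yields_data[OF S t1 r k mx mt near M' \<nu>] by metis
 have "?c\<^sup>2 / (real DIM('a) - 1) <= norm ?Dc + \<bar>?c\<bar> * norm g + \<bar>G\<bar> + Kc * \<nu>"
  using est \<nu>0 d unfolding interior_estimate_def by blast
 moreover have "\<bar>?c\<bar> * norm g <= k * \<bar>?c\<bar>" using mult_left_mono[OF g abs_ge_zero[of ?c]] by (simp add: mult.commute)
 moreover have "k / r * (real DIM('a) - 1 + \<nu>) + Kc * \<nu> = k / r * (real DIM('a) - 1) + (Kc + k / r) * \<nu>" by (simp add: ring_distribs)
 moreover have "x1 \<in> \<Omega>" using S by blast
 note forcing[OF this, of "u x1 t1"]
 ultimately show False using G small by linarith
qed

text \<open>At such a point the gradient of the auxiliary function is a multiple of the normal, and the tangential derivative of the boundary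
 condition holds: these are the hypotheses of the boundary algebra.\<close>

lemma boundary_maximum_normal_derivative:
 assumes alg: "boundary_estimate TYPE('a) M q k0 \<delta> R"
  and k0: "\<kappa>0 <= k0"
  and y: "y \<in> frontier \<Omega>" and t: "t \<in> {0..<T}" and large: "W \<eta> (Du y t) \<ge> R"
  and mx: "\<And>x. x \<in> closure \<Omega> ==> aux x t <= aux y t"
 shows "aux' y t (n y) < (1 + q) * (k0 + \<delta>) * aux y t"
proof -
 have t': "t \<in> {0..T}" using t by auto
 have yc: "y \<in> closure \<Omega>" using y closure_cases by blast
 define w where "w = W \<eta> (Du y t)"
 have w: "w > 0" unfolding w_def by (rule W_pos[OF \<eta>(1)])
 note da = aux_derivative[OF yc t']
 have lin: "linear (aux' y t)" by (rule has_derivative_linear[OF da])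
 define G where "G = (\<Sum>b\<in>Basis. aux' y t b *\<^sub>R b)"
 have G: "aux' y t v = G \<bullet> v" for v
 proof -
  have "aux' y t v = aux' y t (\<Sum>b\<in>Basis. (v \<bullet> b) *\<^sub>R b)" by (simp add: euclidean_representation)
  also have "... = (\<Sum>b\<in>Basis. (v \<bullet> b) * aux' y t b)" by (simp add: linear_sum[OF lin] linear_cmul[OF lin])
  also have "... = G \<bullet> v" by (simp add: G_def inner_commute[of _ v] inner_sum_right mult.commute)
  finally show ?thesis .
 qed
 have "aux' y t = (%v. G \<bullet> v)" using G by blast
 with da have "((%y. aux y t) has_derivative (%v. G \<bullet> v)) (at y within closure \<Omega>)" by simp
 from boundary_maximum[OF y this mx] obtain l where l: "G = l *\<^sub>R n y" by blast
 have tang: "aux' y t \<tau> = 0" if "\<tau> \<bullet> n y = 0" for \<tau>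
  using that by (simp add: G l inner_commute[of "n y"])
 have pw: "w powr (1 - q) * w powr (q - 1) = 1" using w by (simp flip: powr_add)
 have a': "aux' y t v = (1 + q) * (w powr (q - 1) * (Du y t \<bullet> H y t v) - (\<phi> y * (n y \<bullet> H y t v) + DV y v \<bullet> Du y t))" for v
  by (simp add: aux'_def w_def V_normal[OF y])
 have data: "boundary_maximum_data M q k0 (Du y t) (H y t) (LN y) (DV y) (n y) (\<phi> y) (\<phi>' y) w"
  unfolding boundary_maximum_data_def
 proof (intro conjI allI impI)
  show "Du y t \<bullet> Du y t <= w\<^sup>2" by (simp add: w_def W_sq)
  have "\<eta>\<^sup>2 <= 1" using \<eta> by (simp add: power_le_one)
  then show "w\<^sup>2 <= 1 + Du y t \<bullet> Du y t" by (simp add: w_def W_sq)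
  show "n y \<bullet> n y = 1" by (rule normal_unit[OF y])
  show "\<bar>\<phi> y\<bar> <= M" "norm (\<phi>' y) <= M" using \<phi>'[OF y] by auto
  show "Du y t \<bullet> n y = \<phi> y * w powr (1 - q)" unfolding w_def by (rule neumann[OF y t])
  show "linear (H y t)" by (rule H_linear[OF yc t'])
  show "H y t v \<bullet> x = H y t x \<bullet> v" for v x by (rule H_symmetric[OF yc t'])
  show "norm (DV y v) <= M * norm v" for v by (rule V_bounds(2)[OF yc])
  fix \<tau> :: 'a assume \<tau>: "\<tau> \<bullet> n y = 0"
  show "- (LN y \<tau> \<bullet> \<tau>) <= k0 * (\<tau> \<bullet> \<tau>)" "LN y \<tau> \<bullet> n y = 0"
   using N_derivative[OF y LN[OF y] \<tau>] mult_right_mono[OF k0 inner_ge_zero[of \<tau>]] by linarith+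
  show "H y t \<tau> \<bullet> n y + Du y t \<bullet> LN y \<tau> = \<phi>' y \<bullet> \<tau> * w powr (1 - q) + \<phi> y * (1 - q) * w powr (- 1 - q) * (Du y t \<bullet> H y t \<tau>)"
   unfolding w_def by (rule neumann_tangential_derivative[OF y t \<tau> LN[OF y] \<phi>'(1)[OF y]])
  have "w powr (q - 1) * (Du y t \<bullet> H y t \<tau>) = \<phi> y * (n y \<bullet> H y t \<tau>) + DV y \<tau> \<bullet> Du y t"
   using tang[OF \<tau>] q unfolding a' by simp
  then have "w powr (1 - q) * (w powr (q - 1) * (Du y t \<bullet> H y t \<tau>)) = w powr (1 - q) * (\<phi> y * (n y \<bullet> H y t \<tau>) + DV y \<tau> \<bullet> Du y t)" by simp
  then show "(Du y t - w powr (1 - q) *\<^sub>R (\<phi> y *\<^sub>R n y)) \<bullet> H y t \<tau> = w powr (1 - q) * (DV y \<tau> \<bullet> Du y t)"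
   unfolding mult.assoc[symmetric] pw by (simp add: inner_diff_left distrib_left)
 qed
 have "R <= w" using large by (simp add: w_def)
 with alg data
 have "(1 + q) * w powr (q - 1) * ((Du y t - w powr (1 - q) *\<^sub>R (\<phi> y *\<^sub>R n y)) \<bullet> H y t (n y)) - (1 + q) * (DV y (n y) \<bullet> Du y t)
      < (1 + q) * (k0 + \<delta>) * (w powr (1 + q) - (1 + q) * (\<phi> y * (n y \<bullet> Du y t)))"
  unfolding boundary_estimate_def by blast
 moreover have "(1 + q) * w powr (q - 1) * ((Du y t - w powr (1 - q) *\<^sub>R (\<phi> y *\<^sub>R n y)) \<bullet> H y t (n y)) - (1 + q) * (DV y (n y) \<bullet> Du y t) = aux' y t (n y)"
 proof -
  have "w powr (q - 1) * ((Du y t - w powr (1 - q) *\<^sub>R (\<phi> y *\<^sub>R n y)) \<bullet> H y t (n y))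
    = w powr (q - 1) * (Du y t \<bullet> H y t (n y)) - (w powr (1 - q) * w powr (q - 1)) * (\<phi> y * (n y \<bullet> H y t (n y)))"
   by (simp add: inner_diff_left right_diff_distrib)
  then have "w powr (q - 1) * ((Du y t - w powr (1 - q) *\<^sub>R (\<phi> y *\<^sub>R n y)) \<bullet> H y t (n y))
    = w powr (q - 1) * (Du y t \<bullet> H y t (n y)) - \<phi> y * (n y \<bullet> H y t (n y))" unfolding pw by simp
  then show ?thesis unfolding a' mult.assoc by (simp only:) (simp add: algebra_simps)
 qed
 moreover have "w powr (1 + q) - (1 + q) * (\<phi> y * (n y \<bullet> Du y t)) = aux y t"
  by (simp add: aux_def w_def V_normal[OF y])
 ultimately show ?thesis by simp
qed

lemma aux_upper: assumes x: "x \<in> closure \<Omega>" and B: "W \<eta> (Du x t) <= B"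
 shows "aux x t <= B powr (1 + q) + (1 + q) * (M * B)"
proof -
 let ?w = "W \<eta> (Du x t)"
 have w: "?w > 0" by (rule W_pos[OF \<eta>(1)])
 have np: "norm (Du x t) <= ?w" using w by (simp add: norm_le_square W_sq)
 have "\<bar>V x \<bullet> Du x t\<bar> <= norm (V x) * norm (Du x t)" by (rule Cauchy_Schwarz_ineq2)
 also have "... <= M * B" using V_bounds(1)[OF x] np B M(1) by (intro mult_mono) auto
 finally have "(1 + q) * - (V x \<bullet> Du x t) <= (1 + q) * (M * B)" using q by (intro mult_left_mono) auto
 moreover have "?w powr (1 + q) <= B powr (1 + q)" using w B q by (intro powr_mono2) auto
 ultimately show ?thesis by (simp add: aux_def)
qed

text \<open>For \<open>W powr q \<ge> 1 + (1 + q) M\<close> the leading term dominates the linear one.\<close>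

lemma aux_lower: assumes x: "x \<in> closure \<Omega>" and large: "W \<eta> (Du x t) \<ge> (1 + (1 + q) * M) powr (1 / q)"
 shows "W \<eta> (Du x t) <= aux x t"
proof -
 let ?w = "W \<eta> (Du x t)"
 have w: "?w > 0" by (rule W_pos[OF \<eta>(1)])
 have np: "norm (Du x t) <= ?w" using w by (simp add: norm_le_square W_sq)
 have "\<bar>V x \<bullet> Du x t\<bar> <= norm (V x) * norm (Du x t)" by (rule Cauchy_Schwarz_ineq2)
 also have "... <= M * ?w" using V_bounds(1)[OF x] np M(1) by (intro mult_mono) auto
 finally have 1: "(1 + q) * (V x \<bullet> Du x t) <= (1 + q) * (M * ?w)" using q by (intro mult_left_mono) auto
 have "((1 + (1 + q) * M) powr (1 / q)) powr q <= ?w powr q" using large q by (intro powr_mono2) auto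
 then have "1 + (1 + q) * M <= ?w powr q" using q M(1) by (simp add: powr_powr)
 then have "?w * (1 + (1 + q) * M) <= ?w * ?w powr q" using w by (intro mult_left_mono) auto
 moreover have "?w powr (1 + q) = ?w * ?w powr q" using w by (simp add: powr_add)
 moreover have "?w * (1 + (1 + q) * M) = ?w + (1 + q) * (M * ?w)" by (simp add: ring_distribs)
 ultimately show ?thesis using 1 unfolding aux_def by linarith
qed

end

text \<open>A maximum of the auxiliary function above the threshold lies at a positive time and at a large gradient. In the interior it
 contradicts the forcing condition directly. At a boundary point \<open>x0\<close> the weight of the interior ball touching there is 0, and it
 grows faster along the inward normal than the auxiliary function decreases; hence the weighted function has a larger value
 inside the ball. Its maximum over the ball is then attained where the weight is positive, so in the open ball, and contradicts the
 forcing condition with the gradient and Hessian of the weight included.\<close>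

theorem uniform_gradient_bound:
 fixes M q k0 \<delta> \<gamma> r W0 :: real
 assumes M: "M \<ge> 1" and q: "q > 0" and k0: "k0 \<ge> 0" and \<delta>: "\<delta> > 0" and \<gamma>: "\<gamma> > 0" and r: "r > 0"
  and dim: "DIM('a::euclidean_space) \<ge> 2"
 obtains R where "R > 1"
  "\<And>(\<Omega>::'a set) n T u Du H ut D3 Dut h h' Lh N \<kappa>0 c f cx fx cz fz \<phi> \<eta> C V DV D2V \<phi>' LN K x t.
   [| capillary_flow \<Omega> n T u Du H ut D3 Dut h h' Lh N \<kappa>0 c f cx fx cz fz \<phi> q \<eta> C V DV D2V \<phi>' LN M K;
    \<kappa>0 <= k0; \<And>y. y \<in> frontier \<Omega> ==> ball (y - r *\<^sub>R n y) r \<subseteq> \<Omega>;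
    \<And>x z. x \<in> \<Omega> ==> norm (cx x z) + (k0 + \<delta>) * \<bar>c x z\<bar> + (k0 + \<delta>) / r * (real DIM('a) - 1) + \<gamma> <= (c x z)\<^sup>2 / (real DIM('a) - 1);
    \<And>x. x \<in> closure \<Omega> ==> W \<eta> (Du x 0) <= W0; x \<in> closure \<Omega>; t \<in> {0..T} |]
   ==> norm (Du x t) <= R"
proof -
 define k where "k = k0 + \<delta>"
 have k: "k > 0" using k0 \<delta> by (simp add: k_def)
 define M' where "M' = max M (max k (k / r * real DIM('a)))"
 have M': "M <= M'" "k <= M'" "k / r * real DIM('a) <= M'" "M' \<ge> 1" using M by (auto simp: M'_def)
 obtain \<nu>0 Kc where \<nu>0: "\<nu>0 > 0" and Kc: "Kc \<ge> 0" and est: "interior_estimate TYPE('a) M' q \<nu>0 Kc"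
  by (rule interior_maximum_algebra[OF M'(4) q dim])
 obtain Rb where Rb: "Rb \<ge> 1" and balg: "boundary_estimate TYPE('a) M q k0 \<delta> Rb"
  by (rule boundary_maximum_algebra[OF M q k0 \<delta>])
 \<comment> \<open>Small enough for the algebraic estimate and for its error to stay below half of \<open>\<gamma>\<close>.\<close>
 define \<nu> where "\<nu> = min (min \<nu>0 1) (\<gamma> / (2 * (Kc + k / r + 1)))"
 have den: "Kc + k / r + 1 > 0" using Kc k r by (simp add: add_nonneg_pos)
 have \<nu>: "0 < \<nu>" "\<nu> <= \<nu>0" "\<nu> <= 1" using \<nu>0 \<gamma> den by (auto simp: \<nu>_def)
 have small: "(Kc + k / r) * \<nu> < \<gamma>"
 proof -
  have "\<nu> * (2 * (Kc + k / r + 1)) <= \<gamma>"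
   using den by (subst pos_le_divide_eq[symmetric]) (auto simp: \<nu>_def)
  moreover have "(Kc + k / r) * \<nu> \<ge> 0" using Kc k r \<nu> by simp
  moreover have "\<nu> * (2 * (Kc + k / r + 1)) = 2 * ((Kc + k / r) * \<nu>) + 2 * \<nu>" by (simp add: algebra_simps)
  ultimately show ?thesis using \<nu>(1) by linarith
 qed
 have small0: "(Kc + 0 / r) * \<nu> < \<gamma>"
 proof -
  have "(Kc + 0 / r) * \<nu> <= (Kc + k / r) * \<nu>" using k r \<nu> by (intro mult_right_mono) auto
  then show ?thesis using small by linarith
 qed
 \<comment> \<open>Above \<open>L\<close> both estimates apply.\<close>
 define L where "L = max Rb (max (1 / \<nu>) ((1 / \<nu>) powr (1 / q)))"
 have Lw: "w powr (- q) <= \<nu>" "1 / w <= \<nu>" "w \<ge> Rb" if "w \<ge> L" for w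
 proof -
  have w: "w \<ge> 1" using that Rb by (simp add: L_def)
  show "w \<ge> Rb" using that by (simp add: L_def)
  have "w \<ge> 1 / \<nu>" using that by (simp add: L_def)
  then show "1 / w <= \<nu>" using \<nu>(1) w by (simp add: field_simps)
  have "((1 / \<nu>) powr (1 / q)) powr q <= w powr q" using that q by (intro powr_mono2) (auto simp: L_def)
  then have "1 / \<nu> <= w powr q" using \<nu>(1) q by (simp add: powr_powr)
  then show "w powr (- q) <= \<nu>" using \<nu>(1) w by (simp add: powr_minus_divide field_simps)
 qed
 define a where "a B = B powr (1 + q) + (1 + q) * (M * B)" for B
 define A0 where "A0 = max (a L) (a (max 0 W0))"
 have L1: "L \<ge> 1" using Rb by (simp add: L_def)
 have aL: "a L \<ge> 0" using L1 q M by (simp add: a_def)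
 have A0: "A0 \<ge> 0" using aL by (simp add: A0_def)
 \<comment> \<open>The exponential is the largest value of the weight: the maximum found inside the ball may have a smaller value of the
  auxiliary function than \<open>x0\<close> by this factor, and must still be above \<open>A0\<close>.\<close>
 define A where "A = A0 * exp ((1 + q) * (k * r / 2))"
 have "exp ((1 + q) * (k * r / 2)) \<ge> 1" using q k r by simp
 then have AA: "A0 <= A" using A0 mult_left_mono[of 1 "exp ((1 + q) * (k * r / 2))" A0] by (simp add: A_def)
 define R where "R = max 2 (max ((1 + (1 + q) * M) powr (1 / q)) A)"
 show ?thesis
 proof (rule that[of R])
  show "R > 1" by (simp add: R_def)
  fix \<Omega> :: "'a set" and n T u Du H ut D3 Dut h h' Lh N \<kappa>0 c f cx fx cz fz \<phi> \<eta> C V DV D2V \<phi>' LN K x t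
  assume flow: "capillary_flow \<Omega> n T u Du H ut D3 Dut h h' Lh N \<kappa>0 c f cx fx cz fz \<phi> q \<eta> C V DV D2V \<phi>' LN M K"
   and \<kappa>0: "\<kappa>0 <= k0" and balls: "\<And>y. y \<in> frontier \<Omega> ==> ball (y - r *\<^sub>R n y) r \<subseteq> \<Omega>"
   and forcing0: "\<And>x z. x \<in> \<Omega> ==> norm (cx x z) + (k0 + \<delta>) * \<bar>c x z\<bar> + (k0 + \<delta>) / r * (real DIM('a) - 1) + \<gamma> <= (c x z)\<^sup>2 / (real DIM('a) - 1)"
   and W0: "\<And>x. x \<in> closure \<Omega> ==> W \<eta> (Du x 0) <= W0" and x: "x \<in> closure \<Omega>" and t: "t \<in> {0..T}"
  interpret capillary_flow \<Omega> n T u Du H ut D3 Dut h h' Lh N \<kappa>0 c f cx fx cz fz \<phi> q \<eta> C V DV D2V \<phi>' LN M K by (rule flow)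
  note forcing = forcing0[folded k_def]
  have forcing0': "norm (cx x z) + 0 * \<bar>c x z\<bar> + 0 / r * (real DIM('a) - 1) + \<gamma> <= (c x z)\<^sup>2 / (real DIM('a) - 1)" if "x \<in> \<Omega>" for x z
  proof -
   have "k * \<bar>c x z\<bar> \<ge> 0" "k / r * (real DIM('a) - 1) \<ge> 0" using k r dim by auto
   then show ?thesis using forcing[OF that, of z] by simp
  qed
  have high: "t > 0 \<and> W \<eta> (Du x t) > L" if "x \<in> closure \<Omega>" "t \<ge> 0" "aux x t > A0" for x t
  proof
   show "t > 0"
   proof (rule ccontr)
    assume "\<not> t > 0"
    then have "t = 0" using that by simp
    then have "W \<eta> (Du x t) <= max 0 W0" using W0[OF that(1)] by simp
    from aux_upper[OF that(1) this] show False using that(3) by (simp add: A0_def a_def)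
   qed
   show "W \<eta> (Du x t) > L"
   proof (rule ccontr)
    assume "\<not> W \<eta> (Du x t) > L"
    then have "W \<eta> (Du x t) <= L" by simp
    from aux_upper[OF that(1) this] show False using that(3) by (simp add: A0_def a_def)
   qed
  qed
  have aux_bound: "aux x t <= A" if x: "x \<in> closure \<Omega>" and t: "t \<in> {0..<T}" for x t
  proof (rule ccontr)
   assume "\<not> aux x t <= A"
   then have big: "aux x t > A" by simp
   have cc: "continuous_on (closure \<Omega> \<times> {0..t}) (%z. aux (fst z) (snd z))"
    by (rule continuous_on_subset[OF aux_continuous]) (use t in auto)
   have "compact (closure \<Omega> \<times> {0..t})" by (intro compact_Times compact_closure_domain compact_Icc)
   moreover have "closure \<Omega> \<times> {0..t} \<noteq> {}" using x t by auto
   ultimately obtain z0 where z0: "z0 \<in> closure \<Omega> \<times> {0..t}" "\<forall>z\<in>closure \<Omega> \<times> {0..t}. aux (fst z) (snd z) <= aux (fst z0) (snd z0)"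
    using continuous_attains_sup[OF _ _ cc] by blast
   define x0 t0 where "x0 = fst z0" and "t0 = snd z0"
   have x0: "x0 \<in> closure \<Omega>" and t0: "0 <= t0" "t0 <= t" using z0(1) by (auto simp: x0_def t0_def)
   have mx0: "aux y s <= aux x0 t0" if "y \<in> closure \<Omega>" "s \<in> {0..t}" for y s
    using z0(2) that unfolding x0_def t0_def by (metis SigmaI fst_conv snd_conv)
   have big0: "aux x0 t0 > A" using mx0[OF x, of t] big t by auto
   have hi0: "t0 > 0" "W \<eta> (Du x0 t0) > L" using high[OF x0 t0(1)] big0 AA by auto
   have t0T: "t0 \<in> {0<..<T}" using hi0 t0 t by auto
   consider "x0 \<in> \<Omega>" | "x0 \<in> frontier \<Omega>" using x0 closure_cases by blast
   then show False
   proof cases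
    case 1
    show False
    proof (rule interior_maximum_excluded[OF est \<nu>(1,2) small0 forcing0' open_domain order_refl 1 t0T r order_refl])
     show "aux y t0 * exp (weight 0 r x0 y) <= aux x0 t0 * exp (weight 0 r x0 x0)" if "y \<in> \<Omega>" for y
      using mx0[of y t0] that t0 closure_cases by (simp add: weight_def)
     show "aux x0 s <= aux x0 t0" if "s \<in> {0..t0}" for s using mx0[OF x0, of s] that t0 by auto
    qed (use r M' Lw[of "W \<eta> (Du x0 t0)"] hi0 \<nu> M in auto)
   next
    case 2
    define z where "z = x0 - r *\<^sub>R n x0"
    have n1: "norm (n x0) = 1" using normal_unit[OF 2] by (simp add: norm_eq_1)
    have sub: "ball z r \<subseteq> \<Omega>" using balls[OF 2] by (simp add: z_def)
    have csub: "cball z r \<subseteq> closure \<Omega>"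
     using closure_mono[OF sub] r by (simp add: closure_ball)
    have x0z: "x0 \<in> cball z r" using n1 r by (simp add: z_def dist_norm)
    have w0: "weight k r z x0 = 0" using n1 by (simp add: weight_def z_def norm_eq_1 power2_eq_square)
    define F where "F y s = aux y s * exp (weight k r z y)" for y s
    have Fc: "continuous_on (cball z r \<times> {0..t}) (%p. F (fst p) (snd p))"
    proof -
     have "continuous_on (cball z r \<times> {0..t}) (%p. aux (fst p) (snd p))"
      by (rule continuous_on_subset[OF cc]) (use csub in auto)
     then show ?thesis unfolding F_def weight_def by (intro continuous_intros)
    qed
    have "compact (cball z r \<times> {0..t})" by (intro compact_Times compact_cball compact_Icc)
    moreover have "(x0, 0) \<in> cball z r \<times> {0..t}" using x0z t by auto
    then have "cball z r \<times> {0..t} \<noteq> {}" by blast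
    ultimately obtain p1 where p1: "p1 \<in> cball z r \<times> {0..t}" "\<forall>p\<in>cball z r \<times> {0..t}. F (fst p) (snd p) <= F (fst p1) (snd p1)"
     using continuous_attains_sup[OF _ _ Fc] by blast
    define x1 t1 where "x1 = fst p1" and "t1 = snd p1"
    have x1: "x1 \<in> cball z r" and t1: "0 <= t1" "t1 <= t" using p1(1) by (auto simp: x1_def t1_def)
    have mx1: "F y s <= F x1 t1" if "y \<in> cball z r" "s \<in> {0..t}" for y s
     using p1(2) that unfolding x1_def t1_def by (metis SigmaI fst_conv snd_conv)
    have t0': "t0 \<in> {0..T}" "t0 \<in> {0..<T}" using t0T by auto
    have nd: "aux' x0 t0 (n x0) < (1 + q) * k * aux x0 t0"
     unfolding k_def
    proof (rule boundary_maximum_normal_derivative[OF balg \<kappa>0 2 t0'(2)])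
     show "Rb <= W \<eta> (Du x0 t0)" using Lw[of "W \<eta> (Du x0 t0)"] hi0 by simp
     show "aux y t0 <= aux x0 t0" if "y \<in> closure \<Omega>" for y using mx0[OF that] t0 by simp
    qed
    have up: "\<exists>y\<in>cball z r. F y t0 > F x0 t0"
    proof -
     define X where "X s = x0 - s *\<^sub>R n x0" for s
     have Xin: "X s \<in> cball z r" if "s \<in> {0..2 * r}" for s
     proof -
      have "X s - z = (r - s) *\<^sub>R n x0" by (simp add: X_def z_def algebra_simps)
      then have "norm (X s - z) = \<bar>r - s\<bar>" using n1 by simp
      then show ?thesis using that by (simp add: dist_norm norm_minus_commute abs_le_iff)
     qed
     have X0: "X 0 = x0" by (simp add: X_def)
     have dX: "(X has_derivative (%h. - (h *\<^sub>R n x0))) (at 0 within {0..2 * r})"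
      unfolding X_def[abs_def] by (auto intro!: derivative_eq_intros)
     have comp: "((%s. G (X s)) has_real_derivative - G' (n x0)) (at 0 within {0..2 * r})"
      if "(G has_derivative G') (at x0 within closure \<Omega>)" for G :: "'a => real" and G'
     proof -
      have "(G has_derivative G') (at (X 0) within X ` {0..2 * r})"
       unfolding X0 by (rule has_derivative_subset[OF that]) (use Xin csub in auto)
      from diff_chain_within[OF dX this] have "((%s. G (X s)) has_derivative (%h. G' (- (h *\<^sub>R n x0)))) (at 0 within {0..2 * r})"
       by (simp add: o_def)
      moreover have "(%h. G' (- (h *\<^sub>R n x0))) = (%h. - G' (n x0) * h)"
       using linear_neg[OF has_derivative_linear[OF that]] linear_cmul[OF has_derivative_linear[OF that]] by (simp add: fun_eq_iff)
      ultimately show ?thesis unfolding has_field_derivative_def by (simp only:)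
     qed
     have d1: "((%s. aux (X s) t0) has_real_derivative - aux' x0 t0 (n x0)) (at 0 within {0..2 * r})"
      by (rule comp[OF aux_derivative[OF x0 t0'(1)]])
     have d2: "((%s. exp (weight k r z (X s))) has_real_derivative (1 + q) * k) (at 0 within {0..2 * r})"
     proof -
      have "(x0 - z) \<bullet> n x0 = r" using normal_unit[OF 2] by (simp add: z_def)
      then have "((%s. weight k r z (X s)) has_real_derivative (1 + q) * k) (at 0 within {0..2 * r})"
       using comp[OF weight_derivative[OF r, of k z]] r by simp
      from DERIV_chain2[OF DERIV_exp this] show ?thesis by (simp add: X0 w0)
     qed
     have "((%s. F (X s) t0) has_real_derivative - aux' x0 t0 (n x0) + (1 + q) * k * aux x0 t0) (at 0 within {0..2 * r})"
      using DERIV_mult[OF d1 d2] unfolding F_def by (simp add: X0 w0)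
     moreover have "- aux' x0 t0 (n x0) + (1 + q) * k * aux x0 t0 > 0" using nd by simp
     ultimately obtain d where d: "d > 0" "\<And>s. 0 < s ==> 0 + s \<in> {0..2 * r} ==> s < d ==> F (X 0) t0 < F (X (0 + s)) t0"
      by (metis has_real_derivative_pos_inc_right)
     define s where "s = min d r / 2"
     have "0 < s" "s < d" "s \<in> {0..2 * r}" using d(1) r by (auto simp: s_def)
     then show ?thesis using d(2)[of s] Xin[of s] X0 by auto
    qed
    then have F1: "F x1 t1 > aux x0 t0" using mx1[of _ t0] t0 by (force simp: F_def w0)
    have F1pos: "F x1 t1 > 0" using F1 big0 AA A0 by linarith
    then have a1pos: "aux x1 t1 > 0" by (simp add: F_def zero_less_mult_iff)
    have x1c: "x1 \<in> closure \<Omega>" using x1 csub by blast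
    have wpos: "weight k r z x1 > 0"
    proof (rule ccontr)
     assume "\<not> weight k r z x1 > 0"
     then have "exp (weight k r z x1) <= 1" by simp
     then have "F x1 t1 <= aux x1 t1" using mult_left_mono[of _ 1 "aux x1 t1"] a1pos by (simp add: F_def)
     also have "... <= aux x0 t0" using mx0[OF x1c] t1 by simp
     finally show False using F1 by simp
    qed
    have x1b: "x1 \<in> ball z r"
    proof -
     have "k / (2 * r) * (r\<^sup>2 - (x1 - z) \<bullet> (x1 - z)) > 0" using zero_less_mult_pos[OF wpos[unfolded weight_def]] q by simp
     then have "(norm (x1 - z))\<^sup>2 < r\<^sup>2" using k r by (simp add: zero_less_mult_iff zero_less_divide_iff power2_norm_eq_inner)
     then have "norm (x1 - z) < r" using r by (simp add: power2_less_imp_less)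
     then show ?thesis by (simp add: dist_norm norm_minus_commute)
    qed
    have wle: "weight k r z x1 <= (1 + q) * (k * r / 2)"
    proof -
     have "k / (2 * r) * (r\<^sup>2 - (x1 - z) \<bullet> (x1 - z)) <= k / (2 * r) * r\<^sup>2" using k r by (intro mult_left_mono) auto
     also have "... = k * r / 2" using r by (simp add: power2_eq_square)
     finally show ?thesis unfolding weight_def using q by (intro mult_left_mono) auto
    qed
    have "A0 * exp ((1 + q) * (k * r / 2)) < F x1 t1" using F1 big0 by (simp add: A_def)
    also have "... <= aux x1 t1 * exp ((1 + q) * (k * r / 2))" unfolding F_def using wle a1pos by (intro mult_left_mono) auto
    finally have "aux x1 t1 > A0" by simp
    then have hi1: "t1 > 0" "W \<eta> (Du x1 t1) > L" using high[OF x1c t1(1)] by auto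
    have t1T: "t1 \<in> {0<..<T}" using hi1 t1 t by auto
    show False
    proof (rule interior_maximum_excluded[OF est \<nu>(1,2) small forcing open_ball sub x1b t1T r less_imp_le[OF k]])
     show "aux y t1 * exp (weight k r z y) <= aux x1 t1 * exp (weight k r z x1)" if "y \<in> ball z r" for y
      using mx1[of y t1] that t1 by (simp add: F_def)
     show "aux x1 s <= aux x1 t1" if "s \<in> {0..t1}" for s
      using mx1[of x1 s] x1 that t1 by (simp add: F_def)
    qed (use x1 M' Lw[of "W \<eta> (Du x1 t1)"] hi1 \<nu> in \<open>auto simp: dist_norm norm_minus_commute\<close>)
   qed
  qed
  have bound: "norm (Du x s) <= R" if s: "s \<in> {0..<T}" for s
  proof -
   let ?w = "W \<eta> (Du x s)"
   have w: "?w > 0" by (rule W_pos[OF \<eta>(1)])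
   have "norm (Du x s) <= ?w" using w by (simp add: norm_le_square W_sq)
   also have "?w <= R"
   proof (cases "?w \<ge> (1 + (1 + q) * M) powr (1 / q)")
    case True
    then show ?thesis using aux_lower[OF x True] aux_bound[OF x s] by (simp add: R_def)
   next
    case False
    then show ?thesis by (simp add: R_def)
   qed
   finally show ?thesis .
  qed
  have cl: "closure {0..<T} = {0..T}" using T by simp
  have "continuous_on (closure {0..<T}) (%s. Du (fst (x, s)) (snd (x, s)))"
   unfolding cl by (rule continuous_on_compose2[OF Du_continuous]) (use x in \<open>auto intro!: continuous_intros\<close>)
  then have "continuous_on (closure {0..<T}) (%s. norm (Du x s))" by (intro continuous_on_norm) simp
  then show "norm (Du x t) <= R" by (rule continuous_le_on_closure) (use cl t bound in auto)
 qed
qed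

section \<open>Bounds for the data\<close>

lemma diff_class_mono:
 assumes "diff_class P k S f" and "\<And>g. P S g ==> Q S g"
 shows "diff_class Q k S f"
 using assms(1)
proof (induction k arbitrary: f)
 case (Suc k)
 then obtain g where g: "\<forall>x\<in>S. (f has_derivative (%h. g x \<bullet> h)) (at x within S)" "\<forall>b\<in>Basis. diff_class P k S (%x. g x \<bullet> b)"
  by auto
 show ?case unfolding diff_class.simps by (rule exI[of _ g]) (use g Suc.IH in blast)
qed (simp add: assms(2))

lemma C_hoelder_on_imp_C_on:
 assumes f: "C_hoelder_on k \<alpha> S f" and \<alpha>: "\<alpha> > 0" and S: "compact S"
 shows "C_on k S f"
 unfolding C_on_def
proof (rule diff_class_mono[OF f[unfolded C_hoelder_on_def]])
 fix g :: "'a => real" assume g: "hoelder_on \<alpha> S g"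
 then obtain L where L: "\<And>x y. x \<in> S ==> y \<in> S ==> \<bar>g x - g y\<bar> <= L * dist x y powr \<alpha>"
  using S unfolding hoelder_on_def by (metis order_refl)
 show "continuous_on S g" unfolding continuous_on
 proof
  fix p assume p: "p \<in> S"
  have "((%z. dist z p) \<longlongrightarrow> dist p p) (at p within S)" by (intro tendsto_intros)
  then have "((%z. dist z p) \<longlongrightarrow> 0) (at p within S)" by simp
  note lim = tendsto_powr_modulus[OF \<alpha> this]
  have "((%z. g z - g p) \<longlongrightarrow> 0) (at p within S)"
  proof (rule lim)
   show "norm (g z - g p) <= L * dist z p powr \<alpha>" if "z \<in> S" for z using L[OF that p] by simp
  qed simp_all
  then show "(g \<longlongrightarrow> g p) (at p within S)" by (rule LIM_zero_cancel)
 qed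
qed

lemma C2_derivatives_bounded:
 fixes f :: "'a::euclidean_space => real"
 assumes f: "C_on (Suc (Suc 0)) S f" and S: "compact S"
 obtains g L B where "B > 0" "\<And>x. x \<in> S ==> (f has_derivative (%h. g x \<bullet> h)) (at x within S)"
  "\<And>x. x \<in> S ==> (g has_derivative L x) (at x within S)"
  "\<And>x. x \<in> S ==> \<bar>f x\<bar> <= B" "\<And>x. x \<in> S ==> norm (g x) <= B" "\<And>x v. x \<in> S ==> norm (L x v) <= B * norm v"
proof -
 obtain g L where g: "\<And>x. x \<in> S ==> (f has_derivative (%h. g x \<bullet> h)) (at x within S)"
  and L: "\<And>x. x \<in> S ==> (g has_derivative L x) (at x within S)" and Lc: "\<And>v w. continuous_on S (%x. L x v \<bullet> w)"
  by (rule C_on_gradient_field[OF f]) blast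
 have "continuous_on S g" unfolding continuous_on_eq_continuous_within using L has_derivative_continuous by blast
 then obtain B1 where B1: "B1 > 0" "\<And>x. x \<in> S ==> norm (g x) <= B1" using compact_continuous_bounded[OF S] by blast
 have lin: "linear (L x)" if "x \<in> S" for x using L[OF that] has_derivative_linear by blast
 obtain B2 where B2: "B2 > 0" "\<And>x v. x \<in> S ==> norm (L x v) <= B2 * norm v"
  by (rule linear_family_bounded[OF S lin Lc]) (assumption, rule that)
 obtain B3 where B3: "B3 > 0" "\<And>x. x \<in> S ==> norm (f x) <= B3"
  by (rule compact_continuous_bounded[OF S C_on_continuous[OF f]]) blast
 show ?thesis
 proof (rule that[of "B1 + B2 + B3" g L])
  show "norm (L x v) <= (B1 + B2 + B3) * norm v" if "x \<in> S" for x v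
  proof -
   have "B2 * norm v <= (B1 + B2 + B3) * norm v" using B1(1) B3(1) by (intro mult_right_mono) auto
   then show ?thesis using B2(2) that by (meson order_trans)
  qed
 qed (use g L B1 B2 B3 in \<open>auto intro: order_trans[OF B1(2)] order_trans[OF B3(2)[unfolded real_norm_def]]\<close>)
qed

lemma C2_vector_field_derivatives:
 fixes F :: "'a::euclidean_space => 'a"
 assumes F: "\<And>b. b \<in> Basis ==> C_on (Suc (Suc 0)) S (%x. F x \<bullet> b)" and S: "compact S"
 obtains D D2 B where "B > 0" "\<And>x. x \<in> S ==> (F has_derivative D x) (at x within S)"
  "\<And>x v. x \<in> S ==> ((%y. D y v) has_derivative D2 x v) (at x within S)"
  "\<And>x w. linear (%v. D2 x v w)"
  "\<And>x. x \<in> S ==> norm (F x) <= B" "\<And>x v. x \<in> S ==> norm (D x v) <= B * norm v"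
  "\<And>x v w. x \<in> S ==> norm (D2 x v w) <= B * norm v * norm w"
proof -
 define good where "good b g L B \<longleftrightarrow> B > 0 \<and> (\<forall>x\<in>S. ((%x. F x \<bullet> b) has_derivative (%h. g x \<bullet> h)) (at x within S)) \<and>
   (\<forall>x\<in>S. (g has_derivative L x) (at x within S)) \<and> (\<forall>x\<in>S. \<bar>F x \<bullet> b\<bar> <= B) \<and> (\<forall>x\<in>S. norm (g x) <= B) \<and>
   (\<forall>x\<in>S. \<forall>v. norm (L x v) <= B * norm v)" for b :: 'a and g :: "'a => 'a" and L and B :: real
 have "\<exists>g L B. good b g L B" if b: "b \<in> Basis" for b
 proof -
  obtain g L B where "B > 0" "\<And>x. x \<in> S ==> ((%x. F x \<bullet> b) has_derivative (%h. g x \<bullet> h)) (at x within S)"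
   "\<And>x. x \<in> S ==> (g has_derivative L x) (at x within S)"
   "\<And>x. x \<in> S ==> \<bar>F x \<bullet> b\<bar> <= B" "\<And>x. x \<in> S ==> norm (g x) <= B" "\<And>x v. x \<in> S ==> norm (L x v) <= B * norm v"
   by (rule C2_derivatives_bounded[OF F[OF b] S]) (rule that)
  then have "good b g L B" unfolding good_def by blast
  then show ?thesis by blast
 qed
 then obtain g L B where good: "\<And>b. b \<in> Basis ==> good b (g b) (L b) (B b)" by metis
 have d1: "((%x. F x \<bullet> b) has_derivative (%h. g b x \<bullet> h)) (at x within S)" if "b \<in> Basis" "x \<in> S" for b x
  using good[OF that(1)] that(2) unfolding good_def by blast
 have d2: "(g b has_derivative L b x) (at x within S)" if "b \<in> Basis" "x \<in> S" for b x
  using good[OF that(1)] that(2) unfolding good_def by blast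
 have bd: "B b > 0" if "b \<in> Basis" for b using good[OF that] unfolding good_def by blast
 have bd': "\<bar>F x \<bullet> b\<bar> <= B b" "norm (g b x) <= B b" "norm (L b x v) <= B b * norm v" if "b \<in> Basis" "x \<in> S" for b x v
  using good[OF that(1)] that(2) unfolding good_def by blast+
 define D where "D x v = (\<Sum>b\<in>Basis. (g b x \<bullet> v) *\<^sub>R b)" for x v
 define D2 where "D2 x v w = (\<Sum>b\<in>Basis. (L b x w \<bullet> v) *\<^sub>R b)" for x v w
 have norm_le: "norm (\<Sum>b\<in>(Basis::'a set). r b *\<^sub>R b) <= (\<Sum>b\<in>Basis. B b) * s" if "\<And>b. b \<in> Basis ==> \<bar>r b\<bar> <= B b * s" for r s
 proof -
  have "norm (\<Sum>b\<in>(Basis::'a set). r b *\<^sub>R b) <= (\<Sum>b\<in>(Basis::'a set). \<bar>r b\<bar>)" by (rule order_trans[OF norm_sum]) simp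
  also have "... <= (\<Sum>b\<in>Basis. B b * s)" by (rule sum_mono[OF that])
  finally show ?thesis by (simp add: sum_distrib_right)
 qed
 have "(\<Sum>b\<in>Basis. B b) > 0" using bd nonempty_Basis by (intro sum_pos) auto
 then show ?thesis
 proof (rule that[of "\<Sum>b\<in>Basis. B b" D D2])
  fix x assume x: "x \<in> S"
  show "(F has_derivative D x) (at x within S)"
   unfolding D_def by (rule has_derivative_from_components) (rule d1[OF _ x])
  have "norm (F x) = norm (\<Sum>b\<in>Basis. (F x \<bullet> b) *\<^sub>R b)" by (simp add: euclidean_representation)
  also have "... <= (\<Sum>b\<in>Basis. B b) * 1" by (rule norm_le) (use bd'(1)[OF _ x] in simp)
  finally show "norm (F x) <= (\<Sum>b\<in>Basis. B b)" by simp
  fix v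
  show "((%y. D y v) has_derivative D2 x v) (at x within S)"
   unfolding D_def D2_def by (intro has_derivative_sum has_derivative_scaleR_left has_derivative_inner_left d2[OF _ x])
  show "norm (D x v) <= (\<Sum>b\<in>Basis. B b) * norm v" unfolding D_def
  proof (rule norm_le)
   fix b :: 'a assume b: "b \<in> Basis"
   have "\<bar>g b x \<bullet> v\<bar> <= norm (g b x) * norm v" by (rule Cauchy_Schwarz_ineq2)
   also have "... <= B b * norm v" using bd'(2)[OF b x] by (intro mult_right_mono) auto
   finally show "\<bar>g b x \<bullet> v\<bar> <= B b * norm v" .
  qed
  fix w
  have "norm (D2 x v w) <= (\<Sum>b\<in>Basis. B b) * (norm v * norm w)" unfolding D2_def
  proof (rule norm_le)
   fix b :: 'a assume b: "b \<in> Basis"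
   have "\<bar>L b x w \<bullet> v\<bar> <= norm (L b x w) * norm v" by (rule Cauchy_Schwarz_ineq2)
   also have "... <= (B b * norm w) * norm v" using bd'(3)[OF b x] by (intro mult_right_mono) auto
   finally show "\<bar>L b x w \<bullet> v\<bar> <= B b * (norm v * norm w)" by (simp add: mult_ac)
  qed
  then show "norm (D2 x v w) <= (\<Sum>b\<in>Basis. B b) * norm v * norm w" by (simp add: mult.assoc)
 next
  show "linear (%v. D2 x v w)" for x w unfolding D2_def
   by (rule linearI) (simp_all add: inner_add_right scaleR_add_left sum.distrib scaleR_sum_right)
 qed
qed

context curved_domain begin

text \<open>The bounds hold for one constant by compactness, hence for all larger ones; the constant is fixed only after the speed bound.\<close>

lemma boundary_field_exists:
 assumes \<phi>: "C_on 3 (closure \<Omega>) \<phi>"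
 obtains V DV D2V \<phi>' LN M0 where "\<And>M. M0 <= M ==> boundary_field \<Omega> n \<phi> N V DV D2V \<phi>' LN M"
proof -
 let ?S = "closure \<Omega>"
 have cpt: "compact ?S" by (rule compact_closure_domain)
 have fr: "y \<in> ?S" if "y \<in> frontier \<Omega>" for y using that closure_cases by blast
 have \<phi>2: "C_on (Suc (Suc 0)) ?S \<phi>" using C_on_le[OF \<phi>, of 2] by (simp add: numeral_2_eq_2)
 have N2: "C_on (Suc (Suc 0)) ?S (%x. N x \<bullet> b)" if "b \<in> Basis" for b using N_smooth[OF that] by (simp add: numeral_2_eq_2)
 define V where "V x = \<phi> x *\<^sub>R N x" for x
 have V2: "C_on (Suc (Suc 0)) ?S (%x. V x \<bullet> b)" if "b \<in> Basis" for b
  using C_on_mult[OF \<phi>2 N2[OF that]] by (simp add: V_def)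
 obtain \<phi>' L B1 where B1: "B1 > 0" and p: "\<And>x. x \<in> ?S ==> (\<phi> has_derivative (%h. \<phi>' x \<bullet> h)) (at x within ?S)"
  "\<And>x. x \<in> ?S ==> \<bar>\<phi> x\<bar> <= B1" "\<And>x. x \<in> ?S ==> norm (\<phi>' x) <= B1"
  by (rule C2_derivatives_bounded[OF \<phi>2 cpt]) blast
 have "\<exists>LN. \<forall>x\<in>?S. (N has_derivative LN x) (at x within ?S)"
 proof (rule C2_vector_field_derivatives[OF N2 cpt])
  fix D assume "\<And>x. x \<in> ?S ==> (N has_derivative D x) (at x within ?S)"
  then show ?thesis by blast
 qed
 then obtain LN where LN: "\<And>x. x \<in> ?S ==> (N has_derivative LN x) (at x within ?S)" by blast
 obtain DV D2V B2 where B2: "B2 > 0" and d: "\<And>x. x \<in> ?S ==> (V has_derivative DV x) (at x within ?S)"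
  "\<And>x v. x \<in> ?S ==> ((%y. DV y v) has_derivative D2V x v) (at x within ?S)"
  "\<And>x w. linear (%v. D2V x v w)"
  "\<And>x. x \<in> ?S ==> norm (V x) <= B2" "\<And>x v. x \<in> ?S ==> norm (DV x v) <= B2 * norm v"
  "\<And>x v w. x \<in> ?S ==> norm (D2V x v w) <= B2 * norm v * norm w"
  by (rule C2_vector_field_derivatives[OF V2 cpt]) blast+
 have "1 * B2 <= (real DIM('a) + 1) * B2" using B2 by (intro mult_right_mono) auto
 have "boundary_field \<Omega> n \<phi> N V DV D2V \<phi>' LN M" if "max B1 ((real DIM('a) + 1) * B2) <= M" for M
 proof (rule boundary_field.intro[OF flow_domain_axioms], rule boundary_field_axioms.intro)
  have M: "B1 <= M" "B2 <= M" "(real DIM('a) + 1) * B2 <= M" using that \<open>1 * B2 <= _\<close> by auto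
  show "V y = \<phi> y *\<^sub>R n y" if "y \<in> frontier \<Omega>" for y by (simp add: V_def N_normal[OF that])
  show "((%y. DV y v) has_derivative D2V x v) (at x)" if "x \<in> \<Omega>" for x v
   using d(2)[of x v] at_within_interior_point[OF that] that closure_cases by simp
  show "norm (DV x v) <= M * norm v" if "x \<in> ?S" for x v
   using d(5)[OF that, of v] mult_right_mono[OF M(2) norm_ge_zero[of v]] by linarith
  show "(real DIM('a) + 1) * norm (D2V x v w) <= M * norm v * norm w" if "x \<in> \<Omega>" for x v w
  proof -
   have "x \<in> ?S" using that closure_cases by blast
   then have "(real DIM('a) + 1) * norm (D2V x v w) <= (real DIM('a) + 1) * (B2 * norm v * norm w)"
    using d(6) by (intro mult_left_mono) auto
   also have "... = ((real DIM('a) + 1) * B2) * (norm v * norm w)" by (simp add: mult.assoc)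
   also have "... <= M * (norm v * norm w)" using M(3) by (intro mult_right_mono) auto
   finally show ?thesis by (simp add: mult.assoc)
  qed
  show "norm (V x) <= M" if "x \<in> ?S" for x using d(4)[OF that] M by linarith
  show "\<bar>\<phi> y\<bar> <= M" "norm (\<phi>' y) <= M" if "y \<in> frontier \<Omega>" for y using p(2,3)[OF fr[OF that]] M by auto
  show "linear (%v. D2V x v w)" if "x \<in> \<Omega>" for x w by (rule d(3))
 qed (use d p LN fr in auto)
 then show ?thesis by (rule that)
qed

end

context forced_flow begin

text \<open>The equation holds at positive times only; continuity of all its terms carries the bound to time zero and to the
 boundary.\<close>

lemma initial_speed_bound:
 assumes B: "\<And>x. x \<in> \<Omega> ==> norm (Du x 0) <= B" "\<And>x v. x \<in> \<Omega> ==> norm (H x 0 v) <= B * norm v"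
  and x: "x \<in> closure \<Omega>"
 shows "\<bar>ut x 0\<bar> <= (real DIM('a) + 1) * (real DIM('a) * B) + \<bar>C\<bar> * (1 + B) + \<bar>C\<bar>"
proof -
 have zero: "(0::real) \<in> {0..T}" using T by simp
 let ?S = "%x t. \<Sum>b\<in>Basis. norm (H x t b)"
 define F where "F x t = (real DIM('a) + 1) * ?S x t + \<bar>C\<bar> * (1 + norm (Du x t)) + \<bar>C\<bar>" for x t
 have interior: "\<bar>ut x 0\<bar> <= F x 0" if x: "x \<in> \<Omega>" for x
 proof -
  have xc: "x \<in> closure \<Omega>" using x closure_cases by blast
  have pos: "\<bar>ut x t\<bar> <= F x t" if t: "t \<in> {0<..<T}" for t
  proof -
   have t': "t \<in> {0..T}" using t by simp
   have "norm (H x t v) <= ?S x t * norm v" for v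
   proof -
    have "norm (H x t v) = norm (\<Sum>b\<in>Basis. (v \<bullet> b) *\<^sub>R H x t b)"
     by (subst euclidean_representation[of v, symmetric])
       (simp add: linear_sum[OF H_linear[OF xc t']] linear_cmul[OF H_linear[OF xc t']] del: euclidean_representation)
    also have "... <= (\<Sum>b\<in>Basis. \<bar>v \<bullet> b\<bar> * norm (H x t b))" by (rule order_trans[OF norm_sum]) simp
    also have "... <= (\<Sum>b\<in>Basis. norm v * norm (H x t b))" by (intro sum_mono mult_right_mono) (auto simp: Basis_le_norm)
    finally show ?thesis by (simp add: sum_distrib_left mult.commute)
   qed
   then have 1: "\<bar>curv \<eta> (Du x t) (H x t)\<bar> <= (real DIM('a) + 1) * ?S x t"
    by (rule curv_bound[OF \<eta>(1) H_linear[OF xc t']])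
   have "\<bar>c x (u x t) * W \<eta> (Du x t)\<bar> <= \<bar>C\<bar> * (1 + norm (Du x t))"
    unfolding abs_mult using c_bounds(1)[OF x, of "u x t"] W_le[of \<eta> "Du x t"] W_pos[OF \<eta>(1), of "Du x t"] \<eta>
    by (intro mult_mono) auto
   moreover have "\<bar>f x (u x t)\<bar> <= \<bar>C\<bar>" using f_bounds(1)[OF x, of "u x t"] by linarith
   ultimately show ?thesis using 1 pde[OF x t] unfolding F_def by linarith
  qed
  have seg: "continuous_on {0..T} (%t. G (fst (x, t)) (snd (x, t)))"
   if "continuous_on (closure \<Omega> \<times> {0..T}) (%z. G (fst z) (snd z))" for G :: "'a => real => 'b::real_normed_vector"
   by (rule continuous_on_compose2[OF that]) (use xc in \<open>auto intro!: continuous_intros\<close>)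
  have c1: "continuous_on {0..T} (%t. ut x t)" using seg[OF ut_continuous] by simp
  have c2: "continuous_on {0..T} (%t. Du x t)" using seg[OF Du_continuous] by simp
  have c3: "continuous_on {0..T} (%t. H x t b)" for b using seg[of "%x t. H x t b", OF H_continuous] by simp
  have cc: "continuous_on (closure {0<..<T}) (%t. \<bar>ut x t\<bar> - F x t)"
   unfolding closure_greaterThanLessThan[OF T] F_def by (intro continuous_intros c1 c2 c3)
  have "\<bar>ut x 0\<bar> - F x 0 <= 0"
   by (rule continuous_le_on_closure[OF cc]) (use T pos in auto)
  then show ?thesis by simp
 qed
 have bound: "\<bar>ut x 0\<bar> <= (real DIM('a) + 1) * (real DIM('a) * B) + \<bar>C\<bar> * (1 + B) + \<bar>C\<bar>" if x: "x \<in> \<Omega>" for x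
 proof -
  have "?S x 0 <= (\<Sum>b\<in>(Basis::'a set). B)" using B(2)[OF x] by (intro sum_mono) (metis norm_Basis mult.right_neutral)
  then have "?S x 0 <= real DIM('a) * B" by simp
  then have "(real DIM('a) + 1) * ?S x 0 <= (real DIM('a) + 1) * (real DIM('a) * B)" by (intro mult_left_mono) auto
  moreover have "\<bar>C\<bar> * (1 + norm (Du x 0)) <= \<bar>C\<bar> * (1 + B)" using B(1)[OF x] by (intro mult_left_mono) auto
  ultimately show ?thesis using interior[OF x] unfolding F_def by linarith
 qed
 have "continuous_on (closure \<Omega>) (%x. ut (fst (x, 0::real)) (snd (x, 0::real)))"
  by (rule continuous_on_compose2[OF ut_continuous]) (use zero in \<open>auto intro!: continuous_intros\<close>)
 then have "continuous_on (closure \<Omega>) (%x. \<bar>ut x 0\<bar>)" by (intro continuous_on_rabs) simp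
 then show ?thesis by (rule continuous_le_on_closure[OF _ x]) (rule bound)
qed

end

text \<open>The joint derivative of a \<open>C\<^sup>1\<close> function of space and value splits into its partial derivatives. At interior points the derivative
 within the closed cylinder is the ordinary one.\<close>

lemma coefficient_derivatives:
 fixes c :: "'a::euclidean_space => real => real"
 assumes \<Omega>: "open \<Omega>" "\<And>y. y \<in> frontier \<Omega> ==> is_outer_normal \<Omega> y (n y)"
  and c: "C_hoelder_on 1 \<alpha> (closure \<Omega> \<times> UNIV) (%(x, z). c x z)" and x: "x \<in> \<Omega>"
 shows "((%p. c (fst p) (snd p)) has_derivative
   (%v. grad (closure \<Omega>) (%y. c y z) x \<bullet> fst v + deriv (%w. c x w) z * snd v)) (at (x, z))"
proof -
 have xc: "x \<in> closure \<Omega>" using x closure_subset by blast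
 obtain g where g: "\<forall>p\<in>closure \<Omega> \<times> UNIV. ((%(x, z). c x z) has_derivative (%h. g p \<bullet> h)) (at p within closure \<Omega> \<times> UNIV)"
  using c unfolding C_hoelder_on_def One_nat_def diff_class.simps by blast
 have at: "at (x, z) within closure \<Omega> \<times> UNIV = at (x, z)"
 proof (rule at_within_open_subset[of _ "\<Omega> \<times> UNIV"])
  show "open (\<Omega> \<times> (UNIV :: real set))" using \<Omega>(1) by (intro open_Times) auto
  show "\<Omega> \<times> UNIV \<subseteq> closure \<Omega> \<times> (UNIV :: real set)" using closure_subset[of \<Omega>] by (intro Sigma_mono) auto
 qed (use x in auto)
 obtain a b where ab: "g (x, z) = (a, b)" by (cases "g (x, z)")
 have "((%(x, z). c x z) has_derivative (%h. g (x, z) \<bullet> h)) (at (x, z))" using g xc at by (metis UNIV_I SigmaI)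
 moreover have "(%(x, z). c x z) = (%p. c (fst p) (snd p))" by (simp add: fun_eq_iff)
 moreover have "(%h. g (x, z) \<bullet> h) = (%h. a \<bullet> fst h + b * snd h)" by (simp only: ab inner_prod_def fst_conv snd_conv inner_real_def)
 ultimately have d: "((%p. c (fst p) (snd p)) has_derivative (%h. a \<bullet> fst h + b * snd h)) (at (x, z))" by (simp only:)
 have "((%y. (y, z)) has_derivative (%h. (h, 0))) (at x)" by (auto intro!: derivative_eq_intros)
 from diff_chain_at[OF this d] have "((%y. c y z) has_derivative (%h. a \<bullet> h)) (at x)" by (simp add: o_def)
 then have "((%y. c y z) has_derivative (%h. a \<bullet> h)) (at x within closure \<Omega>)" by (rule has_derivative_at_withinI)
 from grad_closure_eqI[where n = n, OF \<Omega>(1) _ xc this] have ga: "grad (closure \<Omega>) (%y. c y z) x = a" using \<Omega>(2) by blast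
 have "((%w. (x, w)) has_derivative (%h. (0, h))) (at z)" by (auto intro!: derivative_eq_intros)
 from diff_chain_at[OF this d] have "((%w. c x w) has_real_derivative b) (at z)" by (simp add: o_def has_field_derivative_def)
 then have "deriv (%w. c x w) z = b" by (rule DERIV_imp_deriv)
 then show ?thesis using d ga by simp
qed

text \<open>The margin \<open>\<delta>\<close> leaves room to replace \<open>C0\<close> by \<open>max C0 0 + e\<close> and \<open>K0\<close> by a smaller radius \<open>r\<close>: the first makes the estimate at
 the boundary strict, the second makes the interior balls exist.\<close>

lemma forcing_condition_robust:
 fixes C0 K0 C \<delta> N q :: real
 assumes K0: "K0 > 0" and \<delta>: "\<delta> > 0" and N: "N > 0" and q: "q > 0"
 obtains e r where "e > 0" "0 < r" "r < K0"
  "\<And>a d. [| \<bar>a\<bar> <= C; 1 / N * a\<^sup>2 - d - \<delta> > max 0 (C0 * \<bar>a\<bar> + N * C0 / K0 + (1 + q) * sgn C0 * C0\<^sup>2) |]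
   ==> d + (max C0 0 + e) * \<bar>a\<bar> + (max C0 0 + e) / r * N + \<delta> / 2 <= a\<^sup>2 / N"
proof -
 define k where "k = max C0 0"
 define B where "B = \<bar>C\<bar> + N * (2 + k) / K0 + 1"
 have k: "k \<ge> 0" by (simp add: k_def)
 have B: "B > 0" using K0 N k by (simp add: B_def add_nonneg_pos)
 \<comment> \<open>The total increase of the left-hand side is at most \<open>e * B\<close>; the bound 1 makes \<open>e\<^sup>2 <= e\<close>.\<close>
 define e where "e = min 1 (\<delta> / (2 * B))"
 have e: "0 < e" "e <= 1" using \<delta> B by (auto simp: e_def)
 have eB: "e * B <= \<delta> / 2"
 proof -
  have "e * B <= \<delta> / (2 * B) * B" using B by (intro mult_right_mono) (auto simp: e_def)
  then show ?thesis using B by simp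
 qed
 define r where "r = K0 / (1 + e)"
 have r: "0 < r" "r < K0" using K0 e by (auto simp: r_def field_simps)
 show ?thesis
 proof (rule that[OF e(1) r])
  fix a d :: real
  assume a: "\<bar>a\<bar> <= C" and m: "1 / N * a\<^sup>2 - d - \<delta> > max 0 (C0 * \<bar>a\<bar> + N * C0 / K0 + (1 + q) * sgn C0 * C0\<^sup>2)"
  have main: "a\<^sup>2 / N - d - \<delta> > k * \<bar>a\<bar> + N * k / K0"
  proof (cases "C0 > 0")
   case True
   then have "(1 + q) * sgn C0 * C0\<^sup>2 \<ge> 0" using q by simp
   then show ?thesis using m True by (simp add: k_def)
  next
   case False
   then show ?thesis using m by (simp add: k_def)
  qed
  have 1: "(k + e) * \<bar>a\<bar> <= k * \<bar>a\<bar> + e * \<bar>C\<bar>"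
  proof -
   have "e * \<bar>a\<bar> <= e * \<bar>C\<bar>" using a e by (intro mult_left_mono) auto
   then show ?thesis by (simp add: distrib_right)
  qed
  have 2: "(k + e) / r * N <= N * k / K0 + e * (N * (2 + k) / K0)"
  proof -
   have "(k + e) / r * N = N * ((k + e) * (1 + e)) / K0" by (simp add: r_def)
   also have "... <= N * (k + e * (2 + k)) / K0"
   proof -
    have "e * e <= e * 1" using e by (intro mult_left_mono) auto
    then have "(k + e) * (1 + e) <= k + e * (2 + k)" by (simp add: algebra_simps)
    then show ?thesis using N K0 by (intro divide_right_mono mult_left_mono) auto
   qed
   also have "... = N * k / K0 + e * (N * (2 + k) / K0)" by (simp add: distrib_left add_divide_distrib mult.left_commute)
   finally show ?thesis .
  qed
  have "e * \<bar>C\<bar> + e * (N * (2 + k) / K0) <= e * B" using e by (simp add: B_def distrib_left)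
  then show "d + (max C0 0 + e) * \<bar>a\<bar> + (max C0 0 + e) / r * N + \<delta> / 2 <= a\<^sup>2 / N"
   using 1 2 main eB unfolding k_def[symmetric] by linarith
 qed
qed

section \<open>From solutions to the gradient bound\<close>

lemma divergence_cong_open:
 assumes "open S" "x \<in> S" "\<And>y. y \<in> S ==> F y = G y"
 shows "divergence F x = divergence G x"
proof -
 have "(F has_derivative D) (at x) \<longleftrightarrow> (G has_derivative D) (at x)" for D
  using has_derivative_transform_within_open[OF _ assms(1,2), of F D UNIV G]
   has_derivative_transform_within_open[OF _ assms(1,2), of G D UNIV F] assms(3) by auto
 then show ?thesis by (simp add: divergence_def frechet_derivative_def)
qed

text \<open>Derivatives within the closure are unique, also on the boundary, so that \<open>Du\<close> of the evolution is the gradient in the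
 formulation of the problem; the divergence form is expanded by the quotient rule.\<close>

lemma solution_is_forced_flow:
 fixes \<Omega> :: "'m::finite space set"
 assumes curved: "curved_domain \<Omega> (outward_normal \<Omega>) h h' Lh N \<kappa>0"
  and ev: "smooth_evolution \<Omega> (outward_normal \<Omega>) T u Du H ut D3 Dut"
  and c_regular: "C_hoelder_on 1 \<alpha> (closure \<Omega> \<times> UNIV) (%(x, z). c x z)"
  and f_regular: "C_hoelder_on 1 \<alpha> (closure \<Omega> \<times> UNIV) (%(x, z). f x z)"
  and c_bounds: "\<And>x z. x \<in> closure \<Omega> ==>
   \<bar>c x z\<bar> <= C \<and> norm (grad (closure \<Omega>) (%y. c y z) x) <= C \<and> deriv (%w. c x w) z <= 0"
  and f_bounds: "\<And>x z. x \<in> closure \<Omega> ==>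
   \<bar>f x z\<bar> <= C \<and> norm (grad (closure \<Omega>) (%y. f y z) x) <= C \<and> deriv (%w. f x w) z \<ge> 0"
  and \<eta>: "0 < \<eta>" "\<eta> <= 1" and q: "q > 0" and sol: "mcf_solution \<Omega> c f \<phi> q \<eta> u0 T u"
 shows "forced_flow \<Omega> (outward_normal \<Omega>) T u Du H ut D3 Dut h h' Lh N \<kappa>0 c f
   (%x z. grad (closure \<Omega>) (%y. c y z) x) (%x z. grad (closure \<Omega>) (%y. f y z) x)
   (%x z. deriv (%w. c x w) z) (%x z. deriv (%w. f x w) z) \<phi> q \<eta> C"
  and "\<And>x t. x \<in> closure \<Omega> ==> t \<in> {0..T} ==> grad (closure \<Omega>) (%y. u y t) x = Du x t"
proof -
 interpret smooth_evolution \<Omega> "outward_normal \<Omega>" T u Du H ut D3 Dut by (rule ev)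
 have sub: "x \<in> closure \<Omega>" if "x \<in> \<Omega>" for x using that closure_subset by blast
 have gradu: "grad (closure \<Omega>) (%y. u y t) x = Du x t" if "x \<in> closure \<Omega>" "t \<in> {0..T}" for x t
  using grad_closure_eqI[OF open_domain normal that(1) Du[OF that]] by blast
 then show "\<And>x t. x \<in> closure \<Omega> ==> t \<in> {0..T} ==> grad (closure \<Omega>) (%y. u y t) x = Du x t" .
 show "forced_flow \<Omega> (outward_normal \<Omega>) T u Du H ut D3 Dut h h' Lh N \<kappa>0 c f
   (%x z. grad (closure \<Omega>) (%y. c y z) x) (%x z. grad (closure \<Omega>) (%y. f y z) x)
   (%x z. deriv (%w. c x w) z) (%x z. deriv (%w. f x w) z) \<phi> q \<eta> C"
 proof (intro forced_flow.intro forced_flow_axioms.intro ev curved \<eta> q)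
  fix x t assume x: "x \<in> \<Omega>" and t: "t \<in> {0<..<T}"
  have t': "t \<in> {0..T}" using t by simp
  have "((%s. u x s) has_real_derivative ut x t) (at t)"
   using ut[OF sub[OF x] t'] t by (simp add: at_within_Icc_at)
  then have "ut x t = deriv (%s. u x s) t" by (rule DERIV_imp_deriv[symmetric])
  also have "... = W \<eta> (grad (closure \<Omega>) (%z. u z t) x) * divergence (%y. (1 / W \<eta> (grad (closure \<Omega>) (%z. u z t) y)) *\<^sub>R grad (closure \<Omega>) (%z. u z t) y) x
      + c x (u x t) * W \<eta> (grad (closure \<Omega>) (%z. u z t) x) - f x (u x t)"
   using sol x t unfolding mcf_solution_def Let_def by blast
  also have "grad (closure \<Omega>) (%z. u z t) x = Du x t" by (rule gradu[OF sub[OF x] t'])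
  also have "divergence (%y. (1 / W \<eta> (grad (closure \<Omega>) (%z. u z t) y)) *\<^sub>R grad (closure \<Omega>) (%z. u z t) y) x
    = divergence (%y. (1 / W \<eta> (Du y t)) *\<^sub>R Du y t) x"
   by (rule divergence_cong_open[OF open_domain x]) (simp only: gradu[OF sub t'])
  also have "W \<eta> (Du x t) * divergence (%y. (1 / W \<eta> (Du y t)) *\<^sub>R Du y t) x = curv \<eta> (Du x t) (H x t)"
   unfolding curv_def
   using divergence_normalised_gradient[OF \<eta>(1), of "%y. Du y t" "H x t" x] H[OF sub[OF x] t'] at_within_interior_point[OF x] by simp
  finally show "ut x t = curv \<eta> (Du x t) (H x t) + c x (u x t) * W \<eta> (Du x t) - f x (u x t)" .
 next
  fix y t assume y: "y \<in> frontier \<Omega>" and t: "t \<in> {0..<T}"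
  have t': "t \<in> {0..T}" using t by simp
  have yc: "y \<in> closure \<Omega>" using y closure_cases by blast
  have "neumann_condition \<Omega> \<phi> q \<eta> (%x. u x t)" using sol t unfolding mcf_solution_def by blast
  then show "Du y t \<bullet> outward_normal \<Omega> y = \<phi> y * W \<eta> (Du y t) powr (1 - q)"
   using y unfolding neumann_condition_def gradu[OF yc t', symmetric] by blast
 next
  fix x z assume x: "x \<in> \<Omega>"
  show "((%p. c (fst p) (snd p)) has_derivative (%v. grad (closure \<Omega>) (%y. c y z) x \<bullet> fst v + deriv (%w. c x w) z * snd v)) (at (x, z))"
   by (rule coefficient_derivatives[OF open_domain normal c_regular x])
  show "((%p. f (fst p) (snd p)) has_derivative (%v. grad (closure \<Omega>) (%y. f y z) x \<bullet> fst v + deriv (%w. f x w) z * snd v)) (at (x, z))"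
   by (rule coefficient_derivatives[OF open_domain normal f_regular x])
 qed (use c_bounds f_bounds sub in blast)+
qed

theorem proposition2p2:
  fixes \<Omega> :: "'m::finite space set"
    and n :: nat
    and c f :: "'m space \<Rightarrow> real \<Rightarrow> real"
    and \<phi> u0 :: "'m space \<Rightarrow> real"
    and \<alpha> C \<delta> q :: real
  assumes n: "n = DIM('m space)"
    and domain: "open \<Omega>" "connected \<Omega>" "\<Omega> \<noteq> {}" "bounded \<Omega>"
    and boundary: "C_boundary 3 \<Omega>"
    and \<alpha>: "0 < \<alpha>" "\<alpha> < 1"
    and c_regular: "C_hoelder_on 1 \<alpha> (closure \<Omega> \<times> UNIV) (\<lambda>(x, z). c x z)"
    and f_regular: "C_hoelder_on 1 \<alpha> (closure \<Omega> \<times> UNIV) (\<lambda>(x, z). f x z)"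
    and c_bounds: "\<And>x z. x \<in> closure \<Omega> \<Longrightarrow>
      \<bar>c x z\<bar> \<le> C \<and> norm (grad (closure \<Omega>) (\<lambda>y. c y z) x) \<le> C \<and> deriv (\<lambda>w. c x w) z \<le> 0"
    and f_bounds: "\<And>x z. x \<in> closure \<Omega> \<Longrightarrow>
      \<bar>f x z\<bar> \<le> C \<and> norm (grad (closure \<Omega>) (\<lambda>y. f y z) x) \<le> C \<and> deriv (\<lambda>w. f x w) z \<ge> 0"
    and \<phi>_regular: "C_on 3 (closure \<Omega>) \<phi>"
    and u0_regular: "C_hoelder_on 2 \<alpha> (closure \<Omega>) u0"
    and \<delta>: "\<delta> > 0"
    and forcing: "\<And>x z. x \<in> closure \<Omega> \<Longrightarrow>
      1 / (real n - 1) * (c x z)\<^sup>2 - norm (grad (closure \<Omega>) (\<lambda>y. c y z) x) - \<delta>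
        > max 0 (C0 \<Omega> * \<bar>c x z\<bar> + (real n - 1) * C0 \<Omega> / K0 \<Omega>
                  + (1 + q) * sgn (C0 \<Omega>) * (C0 \<Omega>)\<^sup>2)"
  shows "\<exists>R>1. \<forall>T \<eta> \<sigma> u.
     T > 0 \<and>
     (\<eta> = 1 \<and> q > 0 \<or> 0 < \<eta> \<and> \<eta> \<le> 1 \<and> q = 1) \<and>
     neumann_condition \<Omega> \<phi> q \<eta> u0 \<and>
     0 < \<sigma> \<and> \<sigma> < 1 \<and>
     C_parabolic_on 2 \<sigma> (closure \<Omega>) {0..T} u \<and>
     C_parabolic_on 3 \<sigma> \<Omega> {0<..T} u \<and>
     mcf_solution \<Omega> c f \<phi> q \<eta> u0 T u
     \<longrightarrow> (\<forall>x\<in>closure \<Omega>. \<forall>t\<in>{0..T}. norm (grad (closure \<Omega>) (\<lambda>y. u y t) x) \<le> R)"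
proof (cases "q > 0")
 case False
 then show ?thesis by (intro exI[of _ 2]) auto
next
 case q: True
 let ?n = "outward_normal \<Omega>"
 have dim: "DIM('m space) \<ge> 2" by (simp add: Suc_leI)
 then have N: "real n - 1 > 0" unfolding n by linarith
 have nrm: "is_outer_normal \<Omega> y (?n y)" if "y \<in> frontier \<Omega>" for y
  by (rule outward_normal[OF boundary _ that]) simp
 obtain h h' Lh N where curved: "curved_domain \<Omega> ?n h h' Lh N (C0 \<Omega>)"
  by (rule curved_domain_exists[OF boundary domain(1,4)])
 interpret curved_domain \<Omega> ?n h h' Lh N "C0 \<Omega>" by (rule curved)
 have dom: "flow_domain \<Omega> ?n" by unfold_locales
 obtain V DV D2V \<phi>' LN M0 where field: "\<And>M. M0 <= M ==> boundary_field \<Omega> ?n \<phi> N V DV D2V \<phi>' LN M"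
  by (rule boundary_field_exists[OF \<phi>_regular]) blast
 have u02: "C_on (Suc (Suc 0)) (closure \<Omega>) u0"
  using C_hoelder_on_imp_C_on[OF u0_regular \<alpha>(1) compact_closure_domain] by (simp add: numeral_2_eq_2)
 obtain g0 L0 B where B: "B > 0"
  and g0: "\<And>x. x \<in> closure \<Omega> ==> (u0 has_derivative (%h. g0 x \<bullet> h)) (at x within closure \<Omega>)"
  and L0: "\<And>x. x \<in> closure \<Omega> ==> (g0 has_derivative L0 x) (at x within closure \<Omega>)"
  and g0B: "\<And>x. x \<in> closure \<Omega> ==> norm (g0 x) <= B" and L0B: "\<And>x v. x \<in> closure \<Omega> ==> norm (L0 x v) <= B * norm v"
  by (rule C2_derivatives_bounded[OF u02 compact_closure_domain]) blast
 define K where "K = (real DIM('m space) + 1) * (real DIM('m space) * B) + \<bar>C\<bar> * (1 + B) + \<bar>C\<bar>"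
 define M where "M = max 1 (max M0 (K + \<bar>C\<bar>))"
 have K: "K \<ge> 0" using B by (simp add: K_def)
 have M: "M \<ge> 1" "M0 <= M" "\<bar>C\<bar> <= M" "K + \<bar>C\<bar> <= M" using K by (auto simp: M_def)
 have K0: "K0 \<Omega> > 0" by (rule K0_properties(1)[OF boundary domain(1,4,3)])
 obtain e r where e: "e > 0" and r: "0 < r" "r < K0 \<Omega>" and robust:
  "\<And>a d. [| \<bar>a\<bar> <= C; 1 / (real n - 1) * a\<^sup>2 - d - \<delta> > max 0 (C0 \<Omega> * \<bar>a\<bar> + (real n - 1) * C0 \<Omega> / K0 \<Omega> + (1 + q) * sgn (C0 \<Omega>) * (C0 \<Omega>)\<^sup>2) |]
   ==> d + (max (C0 \<Omega>) 0 + e) * \<bar>a\<bar> + (max (C0 \<Omega>) 0 + e) / r * (real n - 1) + \<delta> / 2 <= a\<^sup>2 / (real n - 1)"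
  by (rule forcing_condition_robust[OF K0 \<delta> N q, where C = C and ?C0.0 = "C0 \<Omega>"]) blast
 have \<delta>2: "\<delta> / 2 > 0" using \<delta> by simp
 define k0 where "k0 = max (C0 \<Omega>) 0"
 have k0: "k0 \<ge> 0" by (simp add: k0_def)
 show ?thesis
 proof (rule uniform_gradient_bound[OF M(1) q k0 e \<delta>2 r(1) dim, of "1 + B"])
  fix R assume R: "R > 1" and bound:
  "\<And>(\<Omega>::'m space set) n T u Du H ut D3 Dut h h' Lh N \<kappa>0 c f cx fx cz fz \<phi> \<eta> C' V DV D2V \<phi>' LN K x t.
   [| capillary_flow \<Omega> n T u Du H ut D3 Dut h h' Lh N \<kappa>0 c f cx fx cz fz \<phi> q \<eta> C' V DV D2V \<phi>' LN M K;
    \<kappa>0 <= k0; \<And>y. y \<in> frontier \<Omega> ==> ball (y - r *\<^sub>R n y) r \<subseteq> \<Omega>;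
    \<And>x z. x \<in> \<Omega> ==> norm (cx x z) + (k0 + e) * \<bar>c x z\<bar> + (k0 + e) / r * (real DIM('m space) - 1) + \<delta> / 2 <= (c x z)\<^sup>2 / (real DIM('m space) - 1);
    \<And>x. x \<in> closure \<Omega> ==> W \<eta> (Du x 0) <= 1 + B; x \<in> closure \<Omega>; t \<in> {0..T} |]
   ==> norm (Du x t) <= R"
 show ?thesis
 proof (intro exI[of _ R] conjI R allI impI ballI)
  fix T \<eta> \<sigma> u x t
  assume A: "T > 0 \<and> (\<eta> = 1 \<and> q > 0 \<or> 0 < \<eta> \<and> \<eta> <= 1 \<and> q = 1) \<and> neumann_condition \<Omega> \<phi> q \<eta> u0 \<and> 0 < \<sigma> \<and> \<sigma> < 1 \<and>
   C_parabolic_on 2 \<sigma> (closure \<Omega>) {0..T} u \<and> C_parabolic_on 3 \<sigma> \<Omega> {0<..T} u \<and> mcf_solution \<Omega> c f \<phi> q \<eta> u0 T u"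
   and x: "x \<in> closure \<Omega>" and t: "t \<in> {0..T}"
  have T: "T > 0" and \<eta>: "0 < \<eta>" "\<eta> <= 1" and \<sigma>: "0 < \<sigma>" and u2: "C_parabolic_on 2 \<sigma> (closure \<Omega>) {0..T} u"
   and u3: "C_parabolic_on 3 \<sigma> \<Omega> {0<..T} u" and sol: "mcf_solution \<Omega> c f \<phi> q \<eta> u0 T u" using A by auto
  obtain Du H ut D3 Dut where ev: "smooth_evolution \<Omega> ?n T u Du H ut D3 Dut"
   by (rule smooth_evolution_exists[OF dom T \<sigma> u2 u3])
  note ff = solution_is_forced_flow(1)[OF curved ev c_regular f_regular c_bounds f_bounds \<eta> q sol]
  interpret F: forced_flow \<Omega> ?n T u Du H ut D3 Dut h h' Lh N "C0 \<Omega>" c f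
   "%x z. grad (closure \<Omega>) (%y. c y z) x" "%x z. grad (closure \<Omega>) (%y. f y z) x"
   "%x z. deriv (%w. c x w) z" "%x z. deriv (%w. f x w) z" \<phi> q \<eta> C by (rule ff)
  have zero: "0 \<in> {0..T}" using T by simp
  have init: "u0 y = u y 0" if "y \<in> closure \<Omega>" for y using sol that unfolding mcf_solution_def by metis
  have Du0: "Du y 0 = g0 y" if y: "y \<in> closure \<Omega>" for y
  proof -
   have "(u0 has_derivative (%h. Du y 0 \<bullet> h)) (at y within closure \<Omega>)"
    by (rule has_derivative_transform[OF y init F.Du[OF y zero]])
   from grad_closure_eqI[OF open_domain normal y this] grad_closure_eqI[OF open_domain normal y g0[OF y]]
   show ?thesis by simp
  qed
  have H0: "H y 0 = L0 y" if y: "y \<in> \<Omega>" for y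
  proof -
   have yc: "y \<in> closure \<Omega>" using y closure_cases by blast
   have "(g0 has_derivative H y 0) (at y within closure \<Omega>)"
    by (rule has_derivative_transform[OF yc Du0[symmetric] F.H[OF yc zero]])
   with L0[OF yc] show ?thesis unfolding at_within_interior_point[OF y] by (rule has_derivative_unique[symmetric])
  qed
  have "\<bar>ut y 0\<bar> <= K" if "y \<in> closure \<Omega>" for y
   unfolding K_def using closure_subset[of \<Omega>]
   by (intro F.initial_speed_bound that) (auto simp: Du0 H0 subset_iff intro!: g0B L0B)
  then have speed: "\<bar>ut y s\<bar> <= K" if "y \<in> closure \<Omega>" "s \<in> {0..<T}" for y s
   using F.speed_bound that by blast
  have "norm (Du x t) <= R"
  proof (rule bound[OF _ _ _ _ _ x t])
   show "capillary_flow \<Omega> ?n T u Du H ut D3 Dut h h' Lh N (C0 \<Omega>) c f (%x z. grad (closure \<Omega>) (%y. c y z) x)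
    (%x z. grad (closure \<Omega>) (%y. f y z) x) (%x z. deriv (%w. c x w) z) (%x z. deriv (%w. f x w) z) \<phi> q \<eta> C
    V DV D2V \<phi>' LN M K"
    by (intro capillary_flow.intro capillary_flow_axioms.intro ff field M speed)
   show "C0 \<Omega> <= k0" by (simp add: k0_def)
   show "ball (y - r *\<^sub>R ?n y) r \<subseteq> \<Omega>" if "y \<in> frontier \<Omega>" for y
    by (rule K0_properties(2)[OF boundary domain(1,4,3) that r])
   show "W \<eta> (Du y 0) <= 1 + B" if "y \<in> closure \<Omega>" for y
    using W_le[of \<eta> "Du y 0"] \<eta> g0B[OF that] Du0[OF that] by simp
   show "norm (grad (closure \<Omega>) (%y. c y z) y) + (k0 + e) * \<bar>c y z\<bar> + (k0 + e) / r * (real DIM('m space) - 1) + \<delta> / 2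
     <= (c y z)\<^sup>2 / (real DIM('m space) - 1)" if y: "y \<in> \<Omega>" for y z
   proof -
    have yc: "y \<in> closure \<Omega>" using y closure_cases by blast
    have "\<bar>c y z\<bar> <= C" using c_bounds[OF yc, of z] by blast
    from robust[OF this forcing[OF yc, of z]] show ?thesis unfolding n k0_def .
   qed
  qed
  moreover have "grad (closure \<Omega>) (%y. u y t) x = Du x t"
   by (rule solution_is_forced_flow(2)[OF curved ev c_regular f_regular c_bounds f_bounds \<eta> q sol x t])
  ultimately show "norm (grad (closure \<Omega>) (%y. u y t) x) <= R" by (simp only:)
 qed
 qed
qed

end
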